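(* Let $(X,\Sigma,\nu)$ be a plain triple and $\lambda,\mu>0$. Let $(\rho,r)$ be an admissible solution of the Twisted Traffic Equations associated with $(X,\Sigma,\nu,\lambda,\mu)$, and let $M_r$ be the queue-content process of the 0-automatic queue of type $(X,\Sigma,\nu,r,\lambda,\mu)$. Let $\widehat\gamma$ be the drift of the random walk $(X,\nu)$. Then $$[\rho<1]\iff[\lambda\widehat\gamma<\mu]\iff[M_r\text{ is ergodic}],$$ $$[\rho=1]\iff[\lambda\widehat\gamma=\mu]\iff[M_r\text{ is null recurrent}],$$ $$[\rho>1]\iff[\lambda\widehat\gamma>\mu]\iff[M_r\text{ is transient}].$$ Moreover, if $\lambda\widehat\gamma<\mu$, the stationary distribution $\pi_{\rho,r}$ of $M_r$ is given by $\pi_{\rho,r}(1_{\Sigma^*})=1-\rho$ and, for all $a_n\cdots a_1\in L(X,\Sigma)$ with $n\ge1$, $$\pi_{\rho,r}(a_n\cdots a_1)=(1-\rho)\rho^n\,q(a_n)\cdots q(a_2)\,r(a_1),\qquad q(a)=\frac{r(a)}{r(\mathrm{Next}(a))}\ (a\in\Sigma).$$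
   Context: Let $X$ be a monoid with product $\ast$ and unit $1_X$. $\Sigma^*$ denotes the free monoid of words over a finite set $\Sigma$, with empty word $1_{\Sigma^*}$. For a generating set $\Sigma$ of $X$, $|x|_\Sigma$ is the least $k$ with $x=a_1\ast\cdots\ast a_k$, $a_i\in\Sigma$. A plain monoid is a free product $X=S^*\star\mathbb F(T)\star X_1\star\cdots\star X_k$, where $S,T$ are finite sets, $S^*$ is the free monoid on $S$, $\mathbb F(T)$ is the free group on $T$ and $X_1,\dots,X_k$ are finite monoids; its natural generating set is $\Sigma=S\sqcup T\sqcup T^{-1}\sqcup(X_1\setminus\{1_{X_1}\})\sqcup\cdots\sqcup(X_k\setminus\{1_{X_k}\})$. Put $L(X,\Sigma)=\{u_1\cdots u_k\in\Sigma^*:\ u_i\ast u_{i+1}\notin\Sigma\cup\{1_X\}\text{ for all }i<k\}$ (evaluation gives a bijection $L(X,\Sigma)\to X$). For $a\in\Sigma$ let $\mathrm{Next}(a)=\{b\in\Sigma: a\ast b\notin\Sigma\cup\{1_X\}\}$ (which equals $\{b: b\ast a\notin\Sigma\cup\{1_X\}\}$). For $x\in\mathbb R^\Sigma$ and $E\subset\Sigma$, $x(E)=\sum_{a\in E}x(a)$. Let $\mathcal B=\{x\in\mathbb R^\Sigma: x(a)>0\ \forall a,\ \sum_a x(a)=1\}$ and $\bar{\mathcal B}$ the analogous set with $x(a)\ge 0$. A plain triple $(X,\Sigma,\nu)$ consists of an infinite plain monoid $X$ not isomorphic to $\mathbb Z$ nor to $\mathbb Z/2\mathbb Z\star\mathbb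 Z/2\mathbb Z$, its natural generating set $\Sigma$, and a probability measure $\nu$ on $\Sigma$ whose support generates $X$. Random walk and drift: with $x_0,x_1,\dots$ i.i.d. of law $\nu$ and $X_n=x_0\ast\cdots\ast x_{n-1}$, the drift is the deterministic a.s. limit $\widehat\gamma=\lim_n |X_n|_\Sigma/n$. The 0-automatic queue of type $(X,\Sigma,\nu,r,\lambda,\mu)$ ($r\in\bar{\mathcal B}$, $\lambda,\mu>0$) is the continuous-time Markov jump process (queue-content process) on $L(X,\Sigma)$ with generator $Q_r$ defined as follows. A word $u=u_n\cdots u_1$ represents the buffer, $u_1$ being the front customer (in service) and $u_n$ the back customer. For $n\ge 1$ and $v\ne u$, $Q_r(u,v)$ is the sum of the following contributions to the target $v$: for each $b\in\mathrm{Next}(u_n)$, $\lambda\nu(b)$ to $v=bu_n\cdots u_1$; for each $b\in\Sigma$ with $b\ast u_n=c\in\Sigma$, $c\ne u_n$, $\lambda\nu(b)$ to $v=cu_{n-1}\cdots u_1$; for each $b\in\Sigma$ with $b\ast u_n=1_X$, $\lambda\nu(b)$ to $v=u_{n-1}\cdots u_1$; and $\mu$ (service) to $v=u_n\cdots u_2$ (which is $1_{\Sigma^*}$ if $n=1$). From the empty word, $Q_r(1_{\Sigma^*},a)=\lambda\nu(a)\,r(\mathrm{Next}(a))$ for $a\in\Sigma$. All other off-diagonal entries are $0$, and diagonal entries make row sums zero. Twisted Traffic Equations associated with $(X,\Sigma,\nu,\lambda,\mu)$ (in $\eta\in\mathbb R_+^*$, $x\in\mathbb R_+^\Sigma$):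 for all $a\in\Sigma$, $\eta(\lambda+\mu)x(a)=\eta^2\mu x(a)+\lambda\nu(a)x(\mathrm{Next}(a))+\eta\lambda\sum_{(b,d)\in\Sigma^2:\ b\ast d=a}\nu(b)x(d)+\eta^2\lambda\sum_{(b,d)\in\Sigma^2:\ d\in\mathrm{Next}(a),\ b\ast d=1_X}\nu(b)\frac{x(d)}{x(\mathrm{Next}(d))}x(a)$. With $A(x)=\sum_{a\in\Sigma}\nu(a)x(\mathrm{Next}(a))$ and $C(x)=\sum_{(a,b)\in\Sigma^2:\ a\ast b=1_X}\nu(a)x(b)$, an admissible solution of the Twisted Traffic Equations is a solution $(\eta,x)=(\rho,r)$ with $\rho\in\mathbb R_+^*$, $r\in\mathcal B$ and $\rho=\lambda A(r)/(\mu+\lambda C(r))$. *)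

theory Defs
  imports "HOL-Probability.Probability" "HOL-Algebra.Elementary_Groups"
begin

section \<open>Free products and plain monoids\<close>

definition free_monoid :: "'s set \<Rightarrow> 's list monoid" where
  "free_monoid S = \<lparr>carrier = lists S, monoid.mult = (@), one = []\<rparr>"

text \<open>Elements of the free group are the reduced words over \<open>T \<times> UNIV\<close>, where
  \<open>(t, True)\<close> stands for \<open>t\<close> and \<open>(t, False)\<close> for its inverse.\<close>

definition mutually_inverse :: "'t \<times> bool \<Rightarrow> 't \<times> bool \<Rightarrow> bool" where
  "mutually_inverse x y \<longleftrightarrow> fst x = fst y \<and> snd x \<noteq> snd y"

fun free_group_push :: "'t \<times> bool \<Rightarrow> ('t \<times> bool) list \<Rightarrow> ('t \<times> bool) list" where
  "free_group_push x [] = [x]"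
| "free_group_push x (y # w) = (if mutually_inverse x y then w else x # y # w)"

definition free_group :: "'t set \<Rightarrow> ('t \<times> bool) list monoid" where
  "free_group T =
     \<lparr>carrier = {w \<in> lists (T \<times> UNIV). successively (\<lambda>x y. \<not> mutually_inverse x y) w},
      monoid.mult = (\<lambda>u v. foldr free_group_push u v), one = []\<rparr>"

text \<open>The free product consists of the alternating words of non-unit elements of the factors;
  the product is concatenation followed by simplification.\<close>

fun free_product_push ::
  "('i \<Rightarrow> ('b, 'm) monoid_scheme) \<Rightarrow> 'i \<times> 'b \<Rightarrow> ('i \<times> 'b) list \<Rightarrow> ('i \<times> 'b) list" where
  "free_product_push F (i, x) [] = [(i, x)]"
| "free_product_push F (i, x) ((j, y) # w) =
     (if i \<noteq> j then (i, x) # (j, y) # w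
      else if x \<otimes>\<^bsub>F i\<^esub> y = \<one>\<^bsub>F i\<^esub> then w
      else (i, x \<otimes>\<^bsub>F i\<^esub> y) # w)"

definition free_product ::
  "'i set \<Rightarrow> ('i \<Rightarrow> ('b, 'm) monoid_scheme) \<Rightarrow> ('i \<times> 'b) list monoid" where
  "free_product I F =
     \<lparr>carrier = {w \<in> lists (SIGMA i:I. carrier (F i) - {\<one>\<^bsub>F i\<^esub>}).
                  successively (\<lambda>x y. fst x \<noteq> fst y) w},
      monoid.mult = (\<lambda>u v. foldr (free_product_push F) u v), one = []\<rparr>"

lemma mult_fp [simp]: "monoid.mult (free_product I F) u v = foldr (free_product_push F) u v"
  and one_fp [simp]: "one (free_product I F) = []"
  by (simp_all add: free_product_def)

lemma push_closed:
  assumes "\<And>i. i \<in> I \<Longrightarrow> monoid (F i)" "i \<in> I" "x \<in> carrier (F i) - {\<one>\<^bsub>F i\<^esub>}"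
    "w \<in> carrier (free_product I F)"
  shows "free_product_push F (i,x) w \<in> carrier (free_product I F)"
proof -
  interpret monoid "F i" using assms by auto
  show ?thesis
  proof (cases w)
    case Nil then show ?thesis using assms by (auto simp: free_product_def)
  next
    case (Cons a w')
    obtain j y where a: "a = (j,y)" by force
    show ?thesis
      using assms unfolding Cons a
      by (cases w') (auto simp: free_product_def intro: monoid.m_closed)
  qed
qed

lemma foldr_closed:
  assumes "\<And>i. i \<in> I \<Longrightarrow> monoid (F i)" "set v \<subseteq> (SIGMA i:I. carrier (F i) - {\<one>\<^bsub>F i\<^esub>})"
    "w \<in> carrier (free_product I F)"
  shows "foldr (free_product_push F) v w \<in> carrier (free_product I F)"
  using assms(2) by (induction v) (auto simp: assms intro!: push_closed)

lemma push_push: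
  assumes "\<And>i. i \<in> I \<Longrightarrow> monoid (F i)" "i \<in> I" "x \<in> carrier (F i) - {\<one>\<^bsub>F i\<^esub>}"
    "y \<in> carrier (F i) - {\<one>\<^bsub>F i\<^esub>}"
    "w \<in> carrier (free_product I F)"
  shows "free_product_push F (i,x) (free_product_push F (i,y) w) =
    (if x \<otimes>\<^bsub>F i\<^esub> y = \<one>\<^bsub>F i\<^esub> then w else free_product_push F (i,x \<otimes>\<^bsub>F i\<^esub> y) w)"
proof -
  interpret monoid "F i" using assms by auto
  show ?thesis
  proof (cases w)
    case Nil then show ?thesis by auto
  next
    case (Cons a w')
    obtain j z where a: "a = (j,z)" by force
    show ?thesis
    proof (cases "j = i")
      case False then show ?thesis unfolding Cons a by auto
    next
      case True
      have z: "z \<in> carrier (F i)" "z \<noteq> \<one>\<^bsub>F i\<^esub>" using assms(5) unfolding Cons a True by (auto simp: free_product_def)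
      have xyz: "x \<otimes>\<^bsub>F i\<^esub> (y \<otimes>\<^bsub>F i\<^esub> z) = (x \<otimes>\<^bsub>F i\<^esub> y) \<otimes>\<^bsub>F i\<^esub> z"
        using assms z by (auto simp: m_assoc)
      have hd: "w' = [] \<or> (\<exists>k t w''. w' = (k,t)#w'' \<and> k \<noteq> i)"
        using assms(5) unfolding Cons a True by (cases w') (auto simp: free_product_def)
      show ?thesis using hd z assms xyz unfolding Cons a True
        apply (cases "y \<otimes>\<^bsub>F i\<^esub> z = \<one>\<^bsub>F i\<^esub>"; cases "x \<otimes>\<^bsub>F i\<^esub> y = \<one>\<^bsub>F i\<^esub>")
        by (auto simp: )
    qed
  qed
qed

lemma foldr_push:
  assumes M: "\<And>i. i \<in> I \<Longrightarrow> monoid (F i)" and "i \<in> I" "x \<in> carrier (F i) - {\<one>\<^bsub>F i\<^esub>}"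
    and v: "v \<in> carrier (free_product I F)" and w: "w \<in> carrier (free_product I F)"
  shows "foldr (free_product_push F) (free_product_push F (i,x) v) w =
     free_product_push F (i,x) (foldr (free_product_push F) v w)"
proof (cases v)
  case Nil then show ?thesis by simp
next
  case (Cons a v')
  obtain j y where a: "a = (j,y)" by force
  have v': "set v' \<subseteq> (SIGMA i:I. carrier (F i) - {\<one>\<^bsub>F i\<^esub>})" using v unfolding Cons by (auto simp: free_product_def)
  have y: "j\<in>I" "y \<in> carrier (F j) - {\<one>\<^bsub>F j\<^esub>}" using v unfolding Cons a by (auto simp: free_product_def)
  show ?thesis
    using push_push[OF M \<open>i\<in>I\<close> assms(3) _ foldr_closed[OF M v' w], of y] y unfolding Cons a by auto
qed

lemma monoid_free_product:
  assumes M: "\<And>i. i \<in> I \<Longrightarrow> monoid (F i)"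
  shows "monoid (free_product I F)"
proof
  fix u v assume u: "u \<in> carrier (free_product I F)" and v: "v \<in> carrier (free_product I F)"
  have "set u \<subseteq> (SIGMA i:I. carrier (F i) - {\<one>\<^bsub>F i\<^esub>})"
    using u by (auto simp: free_product_def)
  from foldr_closed[OF M this v]
  show "u \<otimes>\<^bsub>free_product I F\<^esub> v \<in> carrier (free_product I F)"
    by simp
next
  fix u v w assume u: "u \<in> carrier (free_product I F)" and v: "v \<in> carrier (free_product I F)"
    and w: "w \<in> carrier (free_product I F)"
  have "set u \<subseteq> (SIGMA i:I. carrier (F i) - {\<one>\<^bsub>F i\<^esub>})" using u by (auto simp: free_product_def)
  then have "foldr (free_product_push F) (foldr (free_product_push F) u v) w =
    foldr (free_product_push F) u (foldr (free_product_push F) v w)"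
  proof (induction u)
    case (Cons a u)
    obtain i x where a: "a = (i, x)" by force
    have u: "set u \<subseteq> (SIGMA i:I. carrier (F i) - {\<one>\<^bsub>F i\<^esub>})"
      and i: "i \<in> I" and x: "x \<in> carrier (F i) - {\<one>\<^bsub>F i\<^esub>}"
      using Cons.prems by (auto simp: a)
    show ?case
      using foldr_push[where F = F, OF M i x foldr_closed[where F = F, OF M u v] w] Cons.IH[OF u]
      by (simp add: a)
  qed simp
  then show "u \<otimes>\<^bsub>free_product I F\<^esub> v \<otimes>\<^bsub>free_product I F\<^esub> w = u \<otimes>\<^bsub>free_product I F\<^esub> (v \<otimes>\<^bsub>free_product I F\<^esub> w)"
    by simp
next
  show "\<one>\<^bsub>free_product I F\<^esub> \<in> carrier (free_product I F)" by (simp add: free_product_def)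
  fix u assume u: "u \<in> carrier (free_product I F)"
  show "\<one>\<^bsub>free_product I F\<^esub> \<otimes>\<^bsub>free_product I F\<^esub> u = u" by simp
  have "foldr (free_product_push F) u [] = u" if "successively (\<lambda>x y. fst x \<noteq> fst y) u" for u
    using that
  proof (induction u)
    case (Cons a u) then show ?case by (cases u; cases a) auto
  qed simp
  then show "u \<otimes>\<^bsub>free_product I F\<^esub> \<one>\<^bsub>free_product I F\<^esub> = u"
    using u by (simp add: free_product_def)
qed

lemma fg_push_closed: "w \<in> carrier (free_group T) \<Longrightarrow> fst x \<in> T \<Longrightarrow> free_group_push x w \<in> carrier (free_group T)"
  by (cases w; cases "tl w"; cases x) (auto simp: free_group_def)
lemma fg_foldr_closed: "w \<in> carrier (free_group T) \<Longrightarrow> fst ` set v \<subseteq> T \<Longrightarrow> foldr free_group_push v w \<in> carrier (free_group T)"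
  by (induction v) (auto intro!: fg_push_closed)
lemma fg_push_push: "w \<in> carrier (free_group T) \<Longrightarrow> mutually_inverse x y \<Longrightarrow> free_group_push x (free_group_push y w) = w"
  by (cases w; cases "tl w"; cases x; cases y) (auto simp: free_group_def mutually_inverse_def)
lemma fg_foldr_push: "v \<in> carrier (free_group T) \<Longrightarrow> w \<in> carrier (free_group T) \<Longrightarrow> fst x \<in> T \<Longrightarrow>
   foldr free_group_push (free_group_push x v) w = free_group_push x (foldr free_group_push v w)"
proof (cases v)
  case (Cons y v')
  assume v: "v \<in> carrier (free_group T)" and w: "w \<in> carrier (free_group T)"
  have "fst ` set v' \<subseteq> T" using v Cons by (auto simp: free_group_def)
  then show ?thesis using fg_push_push[OF fg_foldr_closed[OF w], of v' x y] Cons by simp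
qed simp

lemma monoid_free_group: "monoid (free_group (T :: 'a set))"
proof
  fix u v assume u: "u \<in> carrier (free_group T)" and v: "v \<in> carrier (free_group T)"
  have "fst ` set u \<subseteq> T"
    using u by (auto simp: free_group_def)
  from fg_foldr_closed[OF v this]
  show "u \<otimes>\<^bsub>free_group T\<^esub> v \<in> carrier (free_group T)"
    by (simp add: free_group_def)
next
  fix u v w assume u: "u \<in> carrier (free_group T)" and v: "v \<in> carrier (free_group T)"
    and w: "w \<in> carrier (free_group T)"
  have "fst ` set u \<subseteq> T" using u by (auto simp: free_group_def)
  then have "foldr free_group_push (foldr free_group_push u v) w =
    foldr free_group_push u (foldr free_group_push v w)"
    by (induction u) (auto simp: fg_foldr_push[OF fg_foldr_closed[OF v] w])
  then show "u \<otimes>\<^bsub>free_group T\<^esub> v \<otimes>\<^bsub>free_group T\<^esub> w = u \<otimes>\<^bsub>free_group T\<^esub> (v \<otimes>\<^bsub>free_group T\<^esub> w)"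
    by (simp add: free_group_def)
next
  show "\<one>\<^bsub>free_group T\<^esub> \<in> carrier (free_group T)" by (simp add: free_group_def)
  fix u assume u: "u \<in> carrier (free_group T)"
  show "\<one>\<^bsub>free_group T\<^esub> \<otimes>\<^bsub>free_group T\<^esub> u = u" by (simp add: free_group_def)
  have "foldr free_group_push u [] = u" if "successively (\<lambda>x y. \<not> mutually_inverse x y) u" for u :: "('a \<times> bool) list"
    using that
  proof (induction u)
    case (Cons a u) then show ?case by (cases u; cases a) auto
  qed simp
  then show "u \<otimes>\<^bsub>free_group T\<^esub> \<one>\<^bsub>free_group T\<^esub> = u"
    using u by (simp add: free_group_def)
qed

text \<open>\<open>X\<close> is, up to isomorphism, a free product of the free monoid on \<open>S\<close> (factor \<open>0\<close>), the free
  group on \<open>T\<close> (factor \<open>1\<close>) and \<open>k\<close> finite monoids (factors \<open>2, \<dots>, k + 1\<close>), and \<open>Sig\<close> is the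
  corresponding natural generating set. The factors are countable, so taking them (and \<open>S\<close>, \<open>T\<close>)
  on the type of natural numbers is no restriction.\<close>

definition plain_monoid :: "('a, 'm) monoid_scheme \<Rightarrow> 'a set \<Rightarrow> bool" where
  "plain_monoid X Sig \<longleftrightarrow> monoid X \<and>
     (\<exists>(S :: nat set) (T :: nat set) (k :: nat) (F :: nat \<Rightarrow> nat monoid) f g h.
        finite S \<and> finite T \<and>
        (\<forall>i<k + 2. monoid (F i)) \<and> (\<forall>i\<in>{2..<k + 2}. finite (carrier (F i))) \<and>
        f \<in> iso (free_monoid S) (F 0) \<and> g \<in> iso (free_group T) (F 1) \<and>
        h \<in> iso (free_product {..<k + 2} F) X \<and>
        Sig = {h [(0, f [s])] |s. s \<in> S} \<union> {h [(1, g [(t, e)])] |t e. t \<in> T} \<union>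
              {h [(i, x)] |i x. i \<in> {2..<k + 2} \<and> x \<in> carrier (F i) - {\<one>\<^bsub>F i\<^esub>}})"

definition word_eval :: "('a, 'm) monoid_scheme \<Rightarrow> 'a list \<Rightarrow> 'a" where
  "word_eval X w = foldr (\<lambda>a x. a \<otimes>\<^bsub>X\<^esub> x) w \<one>\<^bsub>X\<^esub>"

definition generates_monoid :: "('a, 'm) monoid_scheme \<Rightarrow> 'a set \<Rightarrow> bool" where
  "generates_monoid X A \<longleftrightarrow> carrier X = word_eval X ` lists A"

definition plain_triple :: "('a, 'm) monoid_scheme \<Rightarrow> 'a set \<Rightarrow> 'a pmf \<Rightarrow> bool" where
  "plain_triple X Sig \<nu> \<longleftrightarrow>
     plain_monoid X Sig \<and> infinite (carrier X) \<and>
     \<not> X \<cong> integer_group \<and>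
     \<not> X \<cong> free_product {0, 1 :: nat} (\<lambda>_. integer_mod_group 2) \<and>
     set_pmf \<nu> \<subseteq> Sig \<and> generates_monoid X (set_pmf \<nu>)"

definition Next :: "('a, 'm) monoid_scheme \<Rightarrow> 'a set \<Rightarrow> 'a \<Rightarrow> 'a set" where
  "Next X Sig a = {b \<in> Sig. a \<otimes>\<^bsub>X\<^esub> b \<notin> Sig \<union> {\<one>\<^bsub>X\<^esub>}}"

definition normal_forms :: "('a, 'm) monoid_scheme \<Rightarrow> 'a set \<Rightarrow> 'a list set" where
  "normal_forms X Sig =
     {w \<in> lists Sig. successively (\<lambda>a b. a \<otimes>\<^bsub>X\<^esub> b \<notin> Sig \<union> {\<one>\<^bsub>X\<^esub>}) w}"

section \<open>Random walk and drift\<close>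

definition word_length :: "('a, 'm) monoid_scheme \<Rightarrow> 'a set \<Rightarrow> 'a \<Rightarrow> nat" where
  "word_length X Sig x = (LEAST k. \<exists>w \<in> lists Sig. length w = k \<and> word_eval X w = x)"

text \<open>Under \<open>stream_space (measure_pmf \<nu>)\<close> the entries of the stream are i.i.d. of law \<open>\<nu>\<close>.\<close>

definition is_drift :: "('a, 'm) monoid_scheme \<Rightarrow> 'a set \<Rightarrow> 'a pmf \<Rightarrow> real \<Rightarrow> bool" where
  "is_drift X Sig \<nu> \<gamma> \<longleftrightarrow>
     (AE \<omega> in stream_space (measure_pmf \<nu>).
        (\<lambda>n. real (word_length X Sig (word_eval X (stake n \<omega>))) / real n) \<longlonglongrightarrow> \<gamma>)"

section \<open>Continuous-time Markov chains\<close>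

text \<open>Jump chain / holding time construction of the Markov jump process with generator \<open>Q\<close>, and
  classification of states, as in Norris, Markov Chains, Chapters 2 and 3. A sample point is a pair
  \<open>(y, e)\<close> of a trajectory \<open>y\<close> of the jump chain and an independent sequence \<open>e\<close> of i.i.d. exponential
  variables of parameter 1.\<close>

definition exit_rate :: "('s \<Rightarrow> 's \<Rightarrow> real) \<Rightarrow> 's \<Rightarrow> real" where
  "exit_rate Q u = - Q u u"

definition jump_kernel :: "('s \<Rightarrow> 's \<Rightarrow> real) \<Rightarrow> 's \<Rightarrow> 's pmf" where
  "jump_kernel Q u =
     (if exit_rate Q u = 0 then return_pmf u
      else embed_pmf (\<lambda>v. if v = u then 0 else Q u v / exit_rate Q u))"

definition jump_chain_step :: "('s \<Rightarrow> 's \<Rightarrow> real) \<Rightarrow> 's \<Rightarrow> nat \<Rightarrow> (nat \<Rightarrow> 's) \<Rightarrow> 's measure" where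
  "jump_chain_step Q u n y =
     measure_pmf (if n = 0 then return_pmf u else jump_kernel Q (y (n - 1)))"

definition jump_chain_law :: "('s \<Rightarrow> 's \<Rightarrow> real) \<Rightarrow> 's \<Rightarrow> (nat \<Rightarrow> 's) measure" where
  "jump_chain_law Q u =
     projective_family.lim UNIV
       (Ionescu_Tulcea.CI (jump_chain_step Q u) (\<lambda>_. count_space UNIV)) (\<lambda>_. count_space UNIV)"

lemma Ionescu_Tulcea_jump_chain: "Ionescu_Tulcea (jump_chain_step Q u) (\<lambda>_. count_space UNIV)"
proof (rule Ionescu_Tulcea.intro)
  fix n
  have eq: "jump_chain_step Q u (Suc m) = (\<lambda>y. measure_pmf (jump_kernel Q y)) \<circ> (\<lambda>y. y m)" for m
    by (auto simp: jump_chain_step_def fun_eq_iff)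
  show "jump_chain_step Q u n \<in> Pi\<^sub>M {0..<n} (\<lambda>_. count_space UNIV) \<rightarrow>\<^sub>M subprob_algebra (count_space UNIV)"
  proof (cases n)
    case 0
    have "(\<lambda>y. measure_pmf (return_pmf u)) \<in> Pi\<^sub>M {0..<n} (\<lambda>_. count_space UNIV) \<rightarrow>\<^sub>M subprob_algebra (count_space UNIV)"
      by (rule measurable_const) (simp add: space_subprob_algebra prob_space_imp_subprob_space prob_space_measure_pmf)
    with 0 show ?thesis by (simp add: jump_chain_step_def[abs_def])
  next
    case (Suc m)
    show ?thesis unfolding Suc eq
      by (rule measurable_comp[where N="count_space UNIV"])
         (auto intro!: measurable_component_singleton simp: space_subprob_algebra prob_space_imp_subprob_space prob_space_measure_pmf)
  qed
qed (simp add: jump_chain_step_def prob_space_measure_pmf)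

definition path_law :: "('s \<Rightarrow> 's \<Rightarrow> real) \<Rightarrow> 's \<Rightarrow> ((nat \<Rightarrow> 's) \<times> (nat \<Rightarrow> real)) measure" where
  "path_law Q u =
     jump_chain_law Q u \<Otimes>\<^sub>M (\<Pi>\<^sub>M n\<in>UNIV. density lborel (exponential_density 1))"

text \<open>In an absorbing state the holding time \<open>e n / 0\<close> is infinite, by the conventions of
  \<open>ennreal\<close>.\<close>

definition jump_time ::
  "('s \<Rightarrow> 's \<Rightarrow> real) \<Rightarrow> nat \<Rightarrow> (nat \<Rightarrow> 's) \<times> (nat \<Rightarrow> real) \<Rightarrow> ennreal" where
  "jump_time Q n = (\<lambda>(y, e). \<Sum>i<n. ennreal (e i) / ennreal (exit_rate Q (y i)))"

text \<open>The value \<open>None\<close> is only used after an explosion.\<close>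

definition jump_process ::
  "('s \<Rightarrow> 's \<Rightarrow> real) \<Rightarrow> real \<Rightarrow> (nat \<Rightarrow> 's) \<times> (nat \<Rightarrow> real) \<Rightarrow> 's option" where
  "jump_process Q t \<omega> =
     (if \<exists>n. ennreal t < jump_time Q (Suc n) \<omega>
      then Some (fst \<omega> (LEAST n. ennreal t < jump_time Q (Suc n) \<omega>))
      else None)"

definition return_time ::
  "('s \<Rightarrow> 's \<Rightarrow> real) \<Rightarrow> 's \<Rightarrow> (nat \<Rightarrow> 's) \<times> (nat \<Rightarrow> real) \<Rightarrow> ennreal" where
  "return_time Q u \<omega> =
     Inf {ennreal t |t. 0 \<le> t \<and> jump_time Q 1 \<omega> \<le> ennreal t \<and> jump_process Q t \<omega> = Some u}"

definition recurrent_state :: "('s \<Rightarrow> 's \<Rightarrow> real) \<Rightarrow> 's \<Rightarrow> bool" where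
  "recurrent_state Q u \<longleftrightarrow>
     (AE \<omega> in path_law Q u. \<not> bdd_above {t. 0 \<le> t \<and> jump_process Q t \<omega> = Some u})"

definition transient_state :: "('s \<Rightarrow> 's \<Rightarrow> real) \<Rightarrow> 's \<Rightarrow> bool" where
  "transient_state Q u \<longleftrightarrow>
     (AE \<omega> in path_law Q u. bdd_above {t. 0 \<le> t \<and> jump_process Q t \<omega> = Some u})"

definition positive_recurrent_state :: "('s \<Rightarrow> 's \<Rightarrow> real) \<Rightarrow> 's \<Rightarrow> bool" where
  "positive_recurrent_state Q u \<longleftrightarrow>
     recurrent_state Q u \<and> (exit_rate Q u = 0 \<or> (\<integral>\<^sup>+\<omega>. return_time Q u \<omega> \<partial>path_law Q u) < \<infinity>)"

definition null_recurrent_state :: "('s \<Rightarrow> 's \<Rightarrow> real) \<Rightarrow> 's \<Rightarrow> bool" where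
  "null_recurrent_state Q u \<longleftrightarrow> recurrent_state Q u \<and> \<not> positive_recurrent_state Q u"

definition irreducible_on :: "'s set \<Rightarrow> ('s \<Rightarrow> 's \<Rightarrow> real) \<Rightarrow> bool" where
  "irreducible_on L Q \<longleftrightarrow>
     (\<forall>u\<in>L. \<forall>v\<in>L. (u, v) \<in> {(x, y). x \<in> L \<and> y \<in> L \<and> x \<noteq> y \<and> Q x y > 0}\<^sup>*)"

definition ergodic :: "'s set \<Rightarrow> ('s \<Rightarrow> 's \<Rightarrow> real) \<Rightarrow> bool" where
  "ergodic L Q \<longleftrightarrow> irreducible_on L Q \<and> (\<forall>u\<in>L. positive_recurrent_state Q u)"

definition null_recurrent :: "'s set \<Rightarrow> ('s \<Rightarrow> 's \<Rightarrow> real) \<Rightarrow> bool" where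
  "null_recurrent L Q \<longleftrightarrow> irreducible_on L Q \<and> (\<forall>u\<in>L. null_recurrent_state Q u)"

definition transient :: "'s set \<Rightarrow> ('s \<Rightarrow> 's \<Rightarrow> real) \<Rightarrow> bool" where
  "transient L Q \<longleftrightarrow> irreducible_on L Q \<and> (\<forall>u\<in>L. transient_state Q u)"

definition transition_prob :: "('s \<Rightarrow> 's \<Rightarrow> real) \<Rightarrow> real \<Rightarrow> 's \<Rightarrow> 's \<Rightarrow> real" where
  "transition_prob Q t u v =
     measure (path_law Q u) {\<omega> \<in> space (path_law Q u). jump_process Q t \<omega> = Some v}"

definition stationary_distribution :: "'s set \<Rightarrow> ('s \<Rightarrow> 's \<Rightarrow> real) \<Rightarrow> 's pmf \<Rightarrow> bool" where
  "stationary_distribution L Q p \<longleftrightarrow> set_pmf p \<subseteq> L \<and>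
     (\<forall>t\<ge>0. \<forall>v\<in>L. measure_pmf.expectation p (\<lambda>u. transition_prob Q t u v) = pmf p v)"

section \<open>The 0-automatic queue\<close>

text \<open>A buffer content \<open>u\<^sub>n \<cdots> u\<^sub>1\<close> is the list \<open>[u\<^sub>n, \<dots>, u\<^sub>1]\<close>: arrivals act on its head,
  services remove its last element.\<close>

definition queue_rate ::
  "('a, 'm) monoid_scheme \<Rightarrow> 'a set \<Rightarrow> 'a pmf \<Rightarrow> ('a \<Rightarrow> real) \<Rightarrow> real \<Rightarrow> real \<Rightarrow> 'a list \<Rightarrow> 'a list \<Rightarrow> real"
  where
  "queue_rate X Sig \<nu> r lam mu u v =
     (if u = [] then
        (\<Sum>a\<in>Sig. if v = [a] then lam * pmf \<nu> a * sum r (Next X Sig a) else 0)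
      else
        (\<Sum>b\<in>Next X Sig (hd u). if v = b # u then lam * pmf \<nu> b else 0) +
        (\<Sum>b\<in>{b \<in> Sig. b \<otimes>\<^bsub>X\<^esub> hd u \<in> Sig \<and> b \<otimes>\<^bsub>X\<^esub> hd u \<noteq> hd u}.
           if v = (b \<otimes>\<^bsub>X\<^esub> hd u) # tl u then lam * pmf \<nu> b else 0) +
        (\<Sum>b\<in>{b \<in> Sig. b \<otimes>\<^bsub>X\<^esub> hd u = \<one>\<^bsub>X\<^esub>}. if v = tl u then lam * pmf \<nu> b else 0) +
        (if v = butlast u then mu else 0))"

definition queue_generator ::
  "('a, 'm) monoid_scheme \<Rightarrow> 'a set \<Rightarrow> 'a pmf \<Rightarrow> ('a \<Rightarrow> real) \<Rightarrow> real \<Rightarrow> real \<Rightarrow> 'a list \<Rightarrow> 'a list \<Rightarrow> real"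
  where
  "queue_generator X Sig \<nu> r lam mu u v =
     (if v = u then - (\<Sum>\<^sub>\<infinity>w\<in>normal_forms X Sig - {u}. queue_rate X Sig \<nu> r lam mu u w)
      else queue_rate X Sig \<nu> r lam mu u v)"

definition twisted_traffic_equations ::
  "('a, 'm) monoid_scheme \<Rightarrow> 'a set \<Rightarrow> 'a pmf \<Rightarrow> real \<Rightarrow> real \<Rightarrow> real \<Rightarrow> ('a \<Rightarrow> real) \<Rightarrow> bool" where
  "twisted_traffic_equations X Sig \<nu> lam mu \<eta> x \<longleftrightarrow>
     (\<forall>a\<in>Sig.
        \<eta> * (lam + mu) * x a =
          \<eta>\<^sup>2 * mu * x a
        + lam * pmf \<nu> a * sum x (Next X Sig a)
        + \<eta> * lam * (\<Sum>(b, d)\<in>{(b, d). b \<in> Sig \<and> d \<in> Sig \<and> b \<otimes>\<^bsub>X\<^esub> d = a}. pmf \<nu> b * x d)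
        + \<eta>\<^sup>2 * lam * (\<Sum>(b, d)\<in>{(b, d). b \<in> Sig \<and> d \<in> Next X Sig a \<and> b \<otimes>\<^bsub>X\<^esub> d = \<one>\<^bsub>X\<^esub>}.
                       pmf \<nu> b * (x d / sum x (Next X Sig d)) * x a))"

definition admissible_solution ::
  "('a, 'm) monoid_scheme \<Rightarrow> 'a set \<Rightarrow> 'a pmf \<Rightarrow> real \<Rightarrow> real \<Rightarrow> real \<Rightarrow> ('a \<Rightarrow> real) \<Rightarrow> bool" where
  "admissible_solution X Sig \<nu> lam mu \<rho> r \<longleftrightarrow>
     0 < \<rho> \<and> (\<forall>a\<in>Sig. 0 < r a) \<and> sum r Sig = 1 \<and>
     twisted_traffic_equations X Sig \<nu> lam mu \<rho> r \<and>
     \<rho> = lam * (\<Sum>a\<in>Sig. pmf \<nu> a * sum r (Next X Sig a)) /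
         (mu + lam * (\<Sum>(a, b)\<in>{(a, b). a \<in> Sig \<and> b \<in> Sig \<and> a \<otimes>\<^bsub>X\<^esub> b = \<one>\<^bsub>X\<^esub>}.
                        pmf \<nu> a * r b))"

end

theory Submission
  imports Defs
begin

text \<open>
  The measure \<open>m(w) = \<rho>\<^sup>n q(a\<^sub>n) \<cdots> q(a\<^sub>2) r(a\<^sub>1)\<close> is invariant for every admissible solution: the Twisted Traffic
  Equations are its local balance relation between three consecutive word lengths, and admissibility of \<open>\<rho>\<close>
  is the balance at the empty word.

  The sign of \<open>\<rho> - 1\<close> is compared with the drift by iterating the same balance relation on the test function
  \<open>\<rho>\<^bsup>-|w|\<^esup>\<close>. Under the Markovian weights of \<open>m\<close> a word of length \<open>n\<close> hardly cancels with the random walk, so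
  that Jensen's inequality yields \<open>ln (1 + (\<mu>/\<lambda>) (1 - \<rho>)) \<ge> - \<gamma> ln \<rho>\<close>; since both logarithms lie below their
  tangents, this excludes \<open>\<lambda> \<gamma> \<ge> \<mu>\<close> for \<open>\<rho> < 1\<close> and \<open>\<lambda> \<gamma> \<le> \<mu>\<close> for \<open>\<rho> > 1\<close>. For \<open>\<rho> = 1\<close> the length itself is the
  test function.

  If \<open>\<rho> < 1\<close>, then \<open>m\<close> is finite and the queue is positive recurrent. If \<open>\<rho> = 1\<close>, then every level has mass 1, and
  cut-off length functions averaged over the random walk are Lyapunov functions whose total defect under \<open>m\<close>
  is arbitrarily small; this gives recurrence, which is null because \<open>m\<close> is infinite. If the queue hits the
  empty word almost surely, a sum of hitting probabilities over prefixes bounds \<open>\<lambda> \<gamma>\<close> by \<open>\<mu>\<close>, so for \<open>\<rho> > 1\<close> it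
  is transient.
\<close>

section \<open>Recurrence of discrete-time chains\<close>

text \<open>The drift is known only as an almost sure limit, without a formula in \<open>r\<close>,
  so it enters through the mean lengths \<open>a j\<close> of the walk, which are compared with
  \<open>\<rho>\<close> by inequalities. Three implications suffice, since the cases for
  \<open>\<rho>\<close> and for \<open>lam * \<gamma>\<close> each exhaust all possibilities.

  The test function for \<open>\<rho> \<noteq> 1\<close> is the one under which every word length
  has mass 1; one step of the walk then multiplies the mass by at most
  \<open>1 + (mu / lam) * (1 - \<rho>)\<close>, up to boundary terms. The total is infinite, so sums
  run over \<open>M\<close> lengths, and the boundary terms vanish on division by \<open>M\<close>.

  The obstacle is cancellation. A run of \<open>k\<close> cancellations follows a single word of
  invertible letters, whose weight decays with \<open>k\<close> unless two successive letters are
  forced. In the integers the letter after \<open>a\<close> is always \<open>a\<close>, and in the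
  infinite dihedral group the two letters alternate; excluding these two groups is what makes the
  weight decay.

  Recurrence is decided for the jump chain and carried to continuous time by rates that lie between
  two positive constants.\<close>

definition kop :: "('s \<Rightarrow> 's pmf) \<Rightarrow> ('s \<Rightarrow> ennreal) \<Rightarrow> 's \<Rightarrow> ennreal" where
  "kop K f u = (\<integral>\<^sup>+v. f v \<partial>measure_pmf (K u))"

text \<open>The expectation of \<open>g 0 (y 0) * ... * g n (y n)\<close> for the chain
  \<open>y\<close> started at \<open>u\<close>. Products of functions of one coordinate determine
  all finite-dimensional laws.\<close>

fun path_weight :: "('s \<Rightarrow> 's pmf) \<Rightarrow> nat \<Rightarrow> (nat \<Rightarrow> 's \<Rightarrow> ennreal) \<Rightarrow> 's \<Rightarrow> ennreal" where
  "path_weight K 0 g u = g 0 u"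
| "path_weight K (Suc n) g u = g 0 u * kop K (path_weight K n (\<lambda>i. g (Suc i))) u"

lemma kop_mono: "(\<And>v. v \<in> set_pmf (K u) \<Longrightarrow> f v \<le> g v) \<Longrightarrow> kop K f u \<le> kop K g u"
  unfolding kop_def by (intro nn_integral_mono_AE) (auto simp: AE_measure_pmf_iff)

lemma kop_cong: "(\<And>v. v \<in> set_pmf (K u) \<Longrightarrow> f v = g v) \<Longrightarrow> kop K f u = kop K g u"
  by (intro antisym kop_mono) auto

lemma kop_add: "kop K (\<lambda>v. f v + g v) u = kop K f u + kop K g u"
  unfolding kop_def by (simp add: nn_integral_add)

lemma kop_cmult: "kop K (\<lambda>v. c * f v) u = c * kop K f u"
  unfolding kop_def by (simp add: nn_integral_cmult)

lemma kop_const [simp]: "kop K (\<lambda>v. c) u = c"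
  unfolding kop_def by simp

lemma kop_sum: "kop K (\<lambda>v. \<Sum>i\<in>I. f i v) u = (\<Sum>i\<in>I. kop K (f i) u)"
  unfolding kop_def by (simp add: nn_integral_sum)

lemma path_weight_cong:
  "(\<And>i v. i \<le> n \<Longrightarrow> g i v = h i v) \<Longrightarrow> path_weight K n g u = path_weight K n h u"
proof (induction n arbitrary: g h u)
  case (Suc n)
  have "path_weight K n (\<lambda>i. g (Suc i)) = path_weight K n (\<lambda>i. h (Suc i))"
    by (rule ext, rule Suc.IH) (use Suc.prems in auto)
  then show ?case using Suc.prems[of 0] by simp
qed auto

text \<open>The recursion of \<open>path_weight\<close> peels off the first factor, whereas the
  Ionescu-Tulcea construction appends coordinates at the end. Integrating out the last coordinate
  links the two.\<close>

lemma path_weight_last: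
  "path_weight K (Suc n) g u = path_weight K n (g(n := \<lambda>v. g n v * kop K (g (Suc n)) v)) u"
proof (induction n arbitrary: g u)
  case (Suc n)
  have "path_weight K (Suc n) (\<lambda>i. g (Suc i)) =
     path_weight K n (\<lambda>i. (g(Suc n := \<lambda>v. g (Suc n) v * kop K (g (Suc (Suc n))) v)) (Suc i))"
    unfolding Suc.IH[abs_def] by (intro ext path_weight_cong) auto
  then show ?case by (subst path_weight.simps) simp
qed (auto simp: cong: kop_cong)

section \<open>Finite-dimensional laws of the jump chain\<close>

context
  fixes Q :: "'s \<Rightarrow> 's \<Rightarrow> real" and u :: 's
begin

interpretation IT: Ionescu_Tulcea "jump_chain_step Q u" "\<lambda>_. count_space UNIV"
  by (rule Ionescu_Tulcea_jump_chain)

lemma sets_jump_chain_law [measurable_cong]: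
  "sets (jump_chain_law Q u) = sets (Pi\<^sub>M UNIV (\<lambda>_. count_space UNIV))"
  by (simp add: jump_chain_law_def)

lemma space_jump_chain_law [simp]: "space (jump_chain_law Q u) = UNIV"
  using sets_eq_imp_space_eq[OF sets_jump_chain_law] by (simp add: space_PiM)

lemma prob_space_jump_chain_law: "prob_space (jump_chain_law Q u)"
proof -
  have m: "(\<lambda>x. restrict x {}) \<in> IT.PF.lim \<rightarrow>\<^sub>M Pi\<^sub>M {} (\<lambda>_. count_space UNIV)"
    by (subst measurable_cong_sets[OF IT.PF.sets_lim refl]) (auto intro!: measurable_restrict_subset)
  show ?thesis
    unfolding jump_chain_law_def
    by (rule prob_space_distrD[OF m]) (auto simp: IT.distr_lim intro!: IT.PF.prob_space_P)
qed

lemma CI_Ico: "IT.CI {0..<n} = IT.C 0 n (\<lambda>_. undefined)"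
proof (rule measure_eqI)
  have s: "sets (IT.CI {0..<n}) = sets (Pi\<^sub>M {0..<n} (\<lambda>_. count_space UNIV))"
    by (simp add: IT.CI_def)
  then show "sets (IT.CI {0..<n}) = sets (IT.C 0 n (\<lambda>_. undefined))"
    using IT.sets_C[of "\<lambda>_. undefined" 0 n] by (simp add: space_PiM)
  fix A assume "A \<in> sets (IT.CI {0..<n})"
  then have A: "A \<in> sets (Pi\<^sub>M {0..<n} (\<lambda>_. count_space UNIV))" by (simp add: s)
  show "emeasure (IT.CI {0..<n}) A = emeasure (IT.C 0 n (\<lambda>_. undefined)) A"
    using IT.emeasure_CI[OF order_refl A] sets.sets_into_space[OF A] by (simp add: prod_emb_id space_PiM)
qed

lemma nn_integral_jump_chain_restrict:
  assumes [measurable]: "f \<in> borel_measurable (Pi\<^sub>M {0..<n} (\<lambda>_. count_space UNIV))"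
  shows "(\<integral>\<^sup>+y. f (restrict y {0..<n}) \<partial>jump_chain_law Q u) = (\<integral>\<^sup>+y. f y \<partial>IT.C 0 n (\<lambda>_. undefined))"
proof -
  have m: "(\<lambda>x. restrict x {0..<n}) \<in> IT.PF.lim \<rightarrow>\<^sub>M Pi\<^sub>M {0..<n} (\<lambda>_. count_space UNIV)"
    by (subst measurable_cong_sets[OF IT.PF.sets_lim refl]) (auto intro!: measurable_restrict_subset)
  show ?thesis
    unfolding CI_Ico[symmetric] IT.distr_lim[symmetric, OF finite_atLeastLessThan] jump_chain_law_def
    by (subst nn_integral_distr[OF m]) auto
qed

lemma nn_integral_C_prod:
  "(\<integral>\<^sup>+y. (\<Prod>i\<le>n. g i (y i)) \<partial>IT.C 0 (Suc n) (\<lambda>_. undefined)) = path_weight (jump_kernel Q) n g u"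
proof (induction n arbitrary: g)
  case 0
  show ?case
  proof -
    have "IT.C 0 (Suc 0) (\<lambda>_. undefined) = IT.eP 0 (\<lambda>_. undefined)"
      using bind_return[OF IT.measurable_eP[of 0], of "\<lambda>_. undefined"] by (simp add: space_PiM)
    moreover have "(\<integral>\<^sup>+y. g 0 (y 0) \<partial>IT.eP 0 (\<lambda>_. undefined)) = g 0 u"
      by (subst IT.nn_integral_eP)
         (auto simp: space_PiM jump_chain_step_def intro!: measurable_compose[OF measurable_component_singleton])
    ultimately show ?thesis by simp
  qed
next
  case (Suc n)
  have m: "(\<lambda>y. \<Prod>i\<le>k. h i (y i)) \<in> borel_measurable (Pi\<^sub>M {0..<Suc k} (\<lambda>_. count_space UNIV))" for k and h :: "nat \<Rightarrow> 's \<Rightarrow> ennreal"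
    by (intro borel_measurable_prod_ennreal measurable_compose[OF measurable_component_singleton]) auto
  have mP: "IT.eP (0 + Suc n) \<in> IT.C 0 (Suc n) (\<lambda>_. undefined) \<rightarrow>\<^sub>M subprob_algebra (Pi\<^sub>M {0..<Suc (Suc n)} (\<lambda>_. count_space UNIV))"
    by (subst measurable_cong_sets[OF IT.sets_C refl]) (use IT.measurable_eP[of "Suc n"] in \<open>simp_all add: space_PiM\<close>)
  have "(\<integral>\<^sup>+y. (\<Prod>i\<le>Suc n. g i (y i)) \<partial>IT.C 0 (Suc (Suc n)) (\<lambda>_. undefined)) =
    (\<integral>\<^sup>+\<omega>. \<integral>\<^sup>+y. (\<Prod>i\<le>Suc n. g i (y i)) \<partial>IT.eP (Suc n) \<omega> \<partial>IT.C 0 (Suc n) (\<lambda>_. undefined))"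
    by (subst IT.C.simps(2), subst nn_integral_bind[OF m mP]) simp
  also have "\<dots> = (\<integral>\<^sup>+\<omega>. (\<Prod>i\<le>n. (g(n := \<lambda>v. g n v * kop (jump_kernel Q) (g (Suc n)) v)) i (\<omega> i)) \<partial>IT.C 0 (Suc n) (\<lambda>_. undefined))"
  proof (rule nn_integral_cong)
    fix \<omega> assume "\<omega> \<in> space (IT.C 0 (Suc n) (\<lambda>_. undefined))"
    then have \<omega>: "\<omega> \<in> space (Pi\<^sub>M {0..<Suc n} (\<lambda>_. count_space UNIV))"
      using IT.space_C[of "\<lambda>_. undefined" 0 "Suc n"] by (simp add: space_PiM del: IT.C.simps)
    have "(\<integral>\<^sup>+y. (\<Prod>i\<le>Suc n. g i (y i)) \<partial>IT.eP (Suc n) \<omega>) =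
      (\<integral>\<^sup>+x. (\<Prod>i\<le>n. g i (\<omega> i)) * g (Suc n) x \<partial>jump_kernel Q (\<omega> n))"
      by (subst IT.nn_integral_eP[OF \<omega> m]) (auto simp: jump_chain_step_def intro!: nn_integral_cong prod.cong arg_cong2[where f="(*)"])
    also have "\<dots> = (\<Prod>i\<le>n. g i (\<omega> i)) * kop (jump_kernel Q) (g (Suc n)) (\<omega> n)"
      unfolding kop_def by (simp add: nn_integral_cmult)
    also have "\<dots> = (\<Prod>i\<le>n. (g(n := \<lambda>v. g n v * kop (jump_kernel Q) (g (Suc n)) v)) i (\<omega> i))"
      by (cases n) (auto simp: mult.assoc intro!: arg_cong2[where f="(*)"] prod.cong)
    finally show "(\<integral>\<^sup>+y. (\<Prod>i\<le>Suc n. g i (y i)) \<partial>IT.eP (Suc n) \<omega>) = \<dots>" .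
  qed
  also have "\<dots> = path_weight (jump_kernel Q) (Suc n) g u"
    unfolding path_weight_last by (rule Suc.IH)
  finally show ?case .
qed

lemma nn_integral_jump_chain_prod:
  "(\<integral>\<^sup>+y. (\<Prod>i\<le>n. g i (y i)) \<partial>jump_chain_law Q u) = path_weight (jump_kernel Q) n g u"
proof -
  have m: "(\<lambda>y. \<Prod>i\<le>n. g i (y i)) \<in> borel_measurable (Pi\<^sub>M {0..<Suc n} (\<lambda>_. count_space UNIV))"
    by (intro borel_measurable_prod_ennreal measurable_compose[OF measurable_component_singleton]) auto
  show ?thesis
    using nn_integral_jump_chain_restrict[OF m] nn_integral_C_prod[of n g] by simp
qed

end

text \<open>Markov property at time 1. The right-hand side integrates against the mixture, over the
  first jump \<open>w\<close>, of the laws from \<open>w\<close> with \<open>u\<close> put in front.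
  The product formula shows that this mixture agrees with the law from \<open>u\<close> on
  cylinders, hence everywhere.\<close>

lemma nn_integral_jump_chain_first_step:
  assumes G [measurable]: "G \<in> borel_measurable (Pi\<^sub>M UNIV (\<lambda>_. count_space UNIV))"
  shows "(\<integral>\<^sup>+y. G y \<partial>jump_chain_law Q u) =
    kop (jump_kernel Q) (\<lambda>w. \<integral>\<^sup>+y. G (case_nat u y) \<partial>jump_chain_law Q w) u"
proof -
  let ?S = "Pi\<^sub>M UNIV (\<lambda>_. count_space UNIV) :: (nat \<Rightarrow> 'a) measure"
  have cn [measurable]: "case_nat u \<in> ?S \<rightarrow>\<^sub>M ?S"
    by (rule measurable_PiM_single') (auto split: nat.split simp: space_PiM intro!: measurable_component_singleton)
  let ?D = "\<lambda>w. distr (jump_chain_law Q w) ?S (case_nat u)"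
  have ps: "prob_space (?D w)" for w
    by (rule prob_space.prob_space_distr[OF prob_space_jump_chain_law])
       (simp cong: measurable_cong_sets)
  have mD: "?D \<in> measure_pmf (jump_kernel Q u) \<rightarrow>\<^sub>M subprob_algebra ?S"
    by (auto simp: space_subprob_algebra intro!: prob_space_imp_subprob_space ps)
  let ?N = "measure_pmf (jump_kernel Q u) \<bind> ?D"
  have sN: "sets ?N = sets ?S" by (subst sets_bind[OF _ ]) auto
  have nnN: "(\<integral>\<^sup>+y. H y \<partial>?N) = kop (jump_kernel Q) (\<lambda>w. \<integral>\<^sup>+y. H (case_nat u y) \<partial>jump_chain_law Q w) u"
    if [measurable]: "H \<in> borel_measurable ?S" for H
    unfolding kop_def
    by (subst nn_integral_bind[OF _ mD]) (auto intro!: nn_integral_cong simp: nn_integral_distr cong: measurable_cong_sets)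
  have "jump_chain_law Q u = ?N"
  proof (rule measure_eqI_PiM_infinite[where I=UNIV and M="\<lambda>_. count_space UNIV"])
    fix A :: "nat \<Rightarrow> 'a set" and J :: "nat set" assume J: "finite J"
    \<comment> \<open>The product below runs to \<open>Suc n\<close> even when \<open>J\<close> is
      empty, so that \<open>path_weight\<close> always unfolds by its second equation.\<close>
    define n where "n = (if J = {} then 0 else Max J)"
    have Jn: "i \<le> n" if "i \<in> J" for i using that J by (auto simp: n_def)
    define g where "g i = (if i \<in> J then indicator (A i) else (\<lambda>_. 1 :: ennreal))" for i
    let ?X = "prod_emb UNIV (\<lambda>_. count_space UNIV) J (Pi\<^sub>E J A) :: (nat \<Rightarrow> 'a) set"
    have X: "indicator ?X y = (\<Prod>i\<le>Suc n. g i (y i))" for y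
    proof (cases "y \<in> ?X")
      case True then have "g i (y i) = 1" for i by (auto simp: prod_emb_def g_def PiE_iff)
      then show ?thesis using True by simp
    next
      case False
      then obtain i where "i \<in> J" "y i \<notin> A i" by (auto simp: prod_emb_def PiE_iff)
      then have "\<exists>i\<in>{..Suc n}. g i (y i) = 0" by (intro bexI[of _ i]) (use Jn[of i] in \<open>auto simp: g_def\<close>)
      then show ?thesis using False by (simp add: prod_zero del: prod.atMost_Suc)
    qed
    have Xs [measurable]: "?X \<in> sets ?S" using J by (intro sets_PiM_I) auto
    have "emeasure (jump_chain_law Q u) ?X = (\<integral>\<^sup>+y. (\<Prod>i\<le>Suc n. g i (y i)) \<partial>jump_chain_law Q u)"
      unfolding X[symmetric] using Xs by (simp add: sets_jump_chain_law)
    also have "\<dots> = g 0 u * kop (jump_kernel Q) (path_weight (jump_kernel Q) n (\<lambda>i. g (Suc i))) u"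
      by (subst nn_integral_jump_chain_prod) simp
    also have "\<dots> = kop (jump_kernel Q) (\<lambda>w. \<integral>\<^sup>+y. indicator ?X (case_nat u y) \<partial>jump_chain_law Q w) u"
    proof -
      have "(\<lambda>y. \<Prod>i\<le>n. g (Suc i) (y i)) \<in> borel_measurable (jump_chain_law Q w)" for w
        by (subst measurable_cong_sets[OF sets_jump_chain_law refl])
           (intro borel_measurable_prod_ennreal measurable_compose[OF measurable_component_singleton]; simp)
      then show ?thesis
        unfolding X prod.atMost_Suc_shift
        by (simp add: nn_integral_cmult nn_integral_jump_chain_prod[where g="\<lambda>i. g (Suc i)"] kop_cmult)
    qed
    also have "\<dots> = emeasure ?N ?X"
      using Xs by (subst nnN[symmetric]) (auto simp: sN nn_integral_indicator)
    finally show "emeasure (jump_chain_law Q u) ?X = emeasure ?N ?X" .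
  next
    show "finite_measure (jump_chain_law Q u)"
      using prob_space_jump_chain_law[of Q u] by (simp add: prob_space.finite_measure)
  qed (simp_all add: sN sets_jump_chain_law)
  then show ?thesis using nnN[OF G] by simp
qed

section \<open>Killed kernels and first returns\<close>

lemma kop_pow_mono_on:
  assumes "\<And>v. v \<in> L \<Longrightarrow> f v \<le> g v" "\<And>u. u \<in> L \<Longrightarrow> set_pmf (K u) \<subseteq> L" "u \<in> L"
  shows "((kop K) ^^ n) f u \<le> ((kop K) ^^ n) g u"
  using assms(3)
proof (induction n arbitrary: u)
  case (Suc n)
  then show ?case using assms(2)[of u] by (auto intro!: kop_mono)
qed (use assms in auto)

lemma kop_pow_cmult: "((kop K) ^^ n) (\<lambda>v. c * f v) u = c * ((kop K) ^^ n) f u"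
proof (induction n arbitrary: u)
  case (Suc n)
  have "((kop K) ^^ n) (\<lambda>v. c * f v) = (\<lambda>v. c * ((kop K) ^^ n) f v)" using Suc by blast
  then show ?case by (simp add: kop_cmult)
qed simp

text \<open>The chain killed on entering \<open>x\<close>: the \<open>n\<close>th power integrates
  \<open>f\<close> at time \<open>n\<close> over the event that \<open>x\<close> is avoided at times
  1 to \<open>n\<close>. Time 0 is exempt, so that excursions from \<open>x\<close> itself are
  covered.\<close>

definition taboo :: "('s \<Rightarrow> 's pmf) \<Rightarrow> 's \<Rightarrow> ('s \<Rightarrow> ennreal) \<Rightarrow> 's \<Rightarrow> ennreal" where
  "taboo K x f = kop K (\<lambda>v. if v = x then 0 else f v)"

definition avoid :: "('s \<Rightarrow> 's pmf) \<Rightarrow> 's \<Rightarrow> nat \<Rightarrow> 's \<Rightarrow> ennreal" where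
  "avoid K x n = ((taboo K x) ^^ n) (\<lambda>_. 1)"

lemma avoid_0 [simp]: "avoid K x 0 u = 1"
  and avoid_Suc: "avoid K x (Suc n) = taboo K x (avoid K x n)"
  by (simp_all add: avoid_def)

lemma taboo_add: "taboo K x (\<lambda>v. f v + g v) u = taboo K x f u + taboo K x g u"
  unfolding taboo_def kop_add[symmetric] by (rule kop_cong) auto

lemma taboo_cmult: "taboo K x (\<lambda>v. c * f v) u = c * taboo K x f u"
  unfolding taboo_def kop_cmult[symmetric] by (rule kop_cong) auto

lemma taboo_pow_add:
  "((taboo K x) ^^ n) (\<lambda>v. f v + g v) u = ((taboo K x) ^^ n) f u + ((taboo K x) ^^ n) g u"
proof (induction n arbitrary: u)
  case (Suc n)
  have "((taboo K x) ^^ n) (\<lambda>v. f v + g v) = (\<lambda>v. ((taboo K x) ^^ n) f v + ((taboo K x) ^^ n) g v)"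
    using Suc by blast
  then show ?case by (simp add: taboo_add)
qed simp

lemma taboo_pow_cmult:
  "((taboo K x) ^^ n) (\<lambda>v. c * f v) u = c * ((taboo K x) ^^ n) f u"
proof (induction n arbitrary: u)
  case (Suc n)
  have "((taboo K x) ^^ n) (\<lambda>v. c * f v) = (\<lambda>v. c * ((taboo K x) ^^ n) f v)" using Suc by blast
  then show ?case by (simp add: taboo_cmult)
qed simp

lemma taboo_pow_zero: "((taboo K x) ^^ n) (\<lambda>v. 0) u = 0"
  using taboo_pow_cmult[of n K x 0 "\<lambda>_. 0" u] by simp

lemma taboo_pow_sum:
  "finite I \<Longrightarrow> ((taboo K x) ^^ n) (\<lambda>v. \<Sum>i\<in>I. f i v) u = (\<Sum>i\<in>I. ((taboo K x) ^^ n) (f i) u)"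
  by (induction I rule: finite_induct) (simp_all add: taboo_pow_zero taboo_pow_add)

lemma kop_split: "kop K f u = taboo K x f u + f x * kop K (indicator {x}) u"
  unfolding taboo_def kop_cmult[symmetric] kop_add[symmetric] by (rule kop_cong) auto

lemma kop_indicator: "kop K (indicator {x}) u = ennreal (pmf (K u) x)"
  unfolding kop_def by (simp add: emeasure_pmf_single)

lemma taboo_mono:
  "(\<And>v. v \<in> set_pmf (K u) \<Longrightarrow> f v \<le> g v) \<Longrightarrow> taboo K x f u \<le> taboo K x g u"
  unfolding taboo_def by (rule kop_mono) auto

lemma taboo_pow_mono: "(\<And>v. f v \<le> g v) \<Longrightarrow> ((taboo K x) ^^ n) f u \<le> ((taboo K x) ^^ n) g u"
  by (induction n arbitrary: u) (auto intro: taboo_mono)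

lemma avoid_le_1: "avoid K x n u \<le> 1"
proof (induction n arbitrary: u)
  case (Suc n)
  have "avoid K x (Suc n) u \<le> kop K (\<lambda>_. 1) u"
    unfolding avoid_Suc taboo_def by (rule kop_mono) (use Suc in auto)
  then show ?case by simp
qed simp

lemma avoid_decseq: "avoid K x (Suc n) u \<le> avoid K x n u"
proof (induction n arbitrary: u)
  case (Suc n)
  then show ?case unfolding avoid_Suc[of K x n] avoid_Suc[of K x "Suc n"] by (intro taboo_mono)
qed (simp add: avoid_le_1)

lemma avoid_return_split:
  "avoid K x (Suc n) u + ((taboo K x) ^^ n) (kop K (indicator {x})) u = avoid K x n u"
proof -
  have "avoid K x n u = ((taboo K x) ^^ n) (\<lambda>v. taboo K x (\<lambda>_. 1) v + kop K (indicator {x}) v) u"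
    unfolding avoid_def using kop_split[of K "\<lambda>_. 1" _ x] by simp
  then show ?thesis
    by (simp add: taboo_pow_add avoid_def funpow_Suc_right del: funpow.simps)
qed

text \<open>The \<open>i\<close>th term is the probability that the first visit to \<open>x\<close>
  after time 0 takes place at time \<open>i + 1\<close>.\<close>

lemma return_by_sum:
  "(\<Sum>i<n. ((taboo K x) ^^ i) (kop K (indicator {x})) u) + avoid K x n u = 1"
proof (induction n)
  case (Suc n)
  then show ?case using avoid_return_split[of K x n u] by (simp add: add.assoc add.commute[of "avoid K x (Suc n) u"])
qed simp

definition recurrent_at :: "('s \<Rightarrow> 's pmf) \<Rightarrow> 's \<Rightarrow> bool" where
  "recurrent_at K x \<longleftrightarrow> (\<lambda>n. avoid K x n x) \<longlonglongrightarrow> 0"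

section \<open>Invariant measures and excursions\<close>

definition occupation :: "('s \<Rightarrow> ennreal) \<Rightarrow> ('s \<Rightarrow> ennreal) \<Rightarrow> ennreal" where
  "occupation m f = (\<integral>\<^sup>+u. m u * f u \<partial>count_space UNIV)"

lemma occupation_add: "occupation m (\<lambda>v. f v + g v) = occupation m f + occupation m g"
  unfolding occupation_def by (simp add: distrib_left nn_integral_add)

lemma occupation_cmult: "occupation m (\<lambda>v. c * f v) = c * occupation m f"
  unfolding occupation_def by (simp add: mult.left_commute nn_integral_cmult)

lemma occupation_mono: "(\<And>v. m v \<noteq> 0 \<Longrightarrow> f v \<le> g v) \<Longrightarrow> occupation m f \<le> occupation m g"
  unfolding occupation_def by (intro nn_integral_mono) (metis mult_eq_0_iff mult_left_mono order_refl zero_le)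

lemma occupation_indicator: "occupation m (indicator {x}) = m x"
  unfolding occupation_def by simp

lemma occupation_ge: "m x * f x \<le> occupation m f"
proof -
  have "m x * f x = occupation m (\<lambda>v. f x * indicator {x} v)"
    by (simp add: occupation_cmult occupation_indicator mult.commute)
  also have "\<dots> \<le> occupation m f" by (rule occupation_mono) (auto simp: indicator_def)
  finally show ?thesis .
qed

locale invariant_chain =
  fixes K :: "'s \<Rightarrow> 's pmf" and L :: "'s set" and m :: "'s \<Rightarrow> ennreal"
  assumes closed: "u \<in> L \<Longrightarrow> set_pmf (K u) \<subseteq> L"
    and irred: "u \<in> L \<Longrightarrow> v \<in> L \<Longrightarrow> (u, v) \<in> {(x, y). x \<in> L \<and> y \<in> L \<and> 0 < pmf (K x) y}\<^sup>*"
    and inv: "occupation m (kop K f) = occupation m f"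
    and m_finite: "m u < \<infinity>"
    and m_pos: "u \<in> L \<Longrightarrow> 0 < m u"
    and m_zero: "u \<notin> L \<Longrightarrow> m u = 0"
begin

definition occ_off :: "'s \<Rightarrow> ('s \<Rightarrow> ennreal) \<Rightarrow> ennreal" where
  "occ_off x f = occupation m (\<lambda>v. if v = x then 0 else f v)"

lemma occ_off_cmult: "occ_off x (\<lambda>v. c * f v) = c * occ_off x f"
  unfolding occ_off_def occupation_cmult[symmetric] by (rule arg_cong[where f="occupation m"]) auto

lemma occ_off_mono: "(\<And>v. f v \<le> g v) \<Longrightarrow> occ_off x f \<le> occ_off x g"
  unfolding occ_off_def by (rule occupation_mono) auto

lemma occ_off_le: "occ_off x f \<le> occupation m f"
  unfolding occ_off_def by (rule occupation_mono) auto

lemma occ_off_split: "occupation m f = m x * f x + occ_off x f"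
proof -
  have "m x * f x = occupation m (\<lambda>v. f x * indicator {x} v)"
    by (simp add: occupation_cmult occupation_indicator mult.commute)
  then show ?thesis
    unfolding occ_off_def occupation_add[symmetric]
    by (simp add: occupation_add[symmetric]) (rule arg_cong[where f="occupation m"], auto)
qed

lemma occ_off_step: "occ_off x f = m x * taboo K x f x + occ_off x (taboo K x f)"
proof -
  have "occ_off x f = occupation m (taboo K x f)"
    unfolding occ_off_def taboo_def by (rule inv[symmetric])
  then show ?thesis by (simp add: occ_off_split[of _ x])
qed

text \<open>Iterating \<open>occ_off_step\<close> sorts the mass of \<open>f\<close> off
  \<open>x\<close> by the time since the last visit to \<open>x\<close>; the remainder belongs to
  paths that have not met \<open>x\<close> during \<open>n\<close> steps.\<close>

lemma occ_off_telescope: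
  "occ_off x f = m x * (\<Sum>i<n. ((taboo K x) ^^ Suc i) f x) + occ_off x (((taboo K x) ^^ n) f)"
proof (induction n)
  case (Suc n)
  then show ?case using occ_off_step[of x "((taboo K x) ^^ n) f"] by (simp add: distrib_left add.assoc)
qed simp

text \<open>Dropping the remainder of the telescoped identity leaves one half of Kac's formula. It
  holds without recurrence and is therefore a means of proving recurrence.\<close>

lemma excursion_le: "m x * (\<Sum>i. ((taboo K x) ^^ Suc i) f x) \<le> occupation m f"
proof -
  have "(\<Sum>i. m x * ((taboo K x) ^^ Suc i) f x) \<le> occupation m f"
  proof (rule suminf_le_const[OF summableI])
    fix n
    have "(\<Sum>i<n. m x * ((taboo K x) ^^ Suc i) f x) \<le> occ_off x f"
      by (subst occ_off_telescope[of x f n]) (simp add: sum_distrib_left)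
    then show "(\<Sum>i<n. m x * ((taboo K x) ^^ Suc i) f x) \<le> occupation m f"
      using occ_off_le[of x f] by (rule order_trans)
  qed
  then show ?thesis by (simp only: ennreal_suminf_cmult)
qed

lemma excursion_finite:
  assumes "x \<in> L" "occupation m f < \<infinity>"
  shows "(\<Sum>i. ((taboo K x) ^^ Suc i) f x) < \<infinity>"
  using excursion_le[of x f] assms m_pos[of x]
  by (metis ennreal_mult_eq_top_iff infinity_ennreal_def leD neq_iff top.not_eq_extremum)

lemma summable_tendsto_0:
  fixes f :: "nat \<Rightarrow> ennreal"
  assumes "(\<Sum>i. f i) < \<infinity>"
  shows "f \<longlonglongrightarrow> 0"
proof -
  have fin: "f i < \<infinity>" for i
    using assms sum_le_suminf[of f "{i}"] by (auto simp: less_top[symmetric] top_unique)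
  have "summable (\<lambda>i. enn2real (f i))"
    using assms fin by (intro summable_suminf_not_top) (auto simp: less_top)
  then have "(\<lambda>i. enn2real (f i)) \<longlonglongrightarrow> 0" by (rule summable_LIMSEQ_zero)
  then have "(\<lambda>i. ennreal (enn2real (f i))) \<longlonglongrightarrow> ennreal 0" by (rule tendsto_ennrealI)
  then show ?thesis using fin by (simp add: less_top)
qed

text \<open>For \<open>f = 1\<close> the excursion sum is the expected return time without its term
  at time 0, which equals 1.\<close>

lemma finite_mass_imp_finite_return:
  assumes "x \<in> L" "occupation m (\<lambda>_. 1) < \<infinity>"
  shows "(\<Sum>n. avoid K x n x) < \<infinity>"
proof -
  have s: "(\<Sum>n. avoid K x (Suc n) x) < \<infinity>"
    using excursion_finite[OF assms] by (simp add: avoid_def)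
  have "(\<Sum>n. avoid K x n x) = avoid K x 0 x + (\<Sum>n. avoid K x (Suc n) x)"
    by (subst suminf_offset[where i=1]) (auto intro: summableI)
  with s show ?thesis by simp
qed

lemma finite_mass_imp_recurrent:
  assumes "x \<in> L" "occupation m (\<lambda>_. 1) < \<infinity>"
  shows "recurrent_at K x"
  unfolding recurrent_at_def using finite_mass_imp_finite_return[OF assms] by (rule summable_tendsto_0)

lemma taboo_pow_mono_on:
  assumes "\<And>v. v \<in> L \<Longrightarrow> f v \<le> g v" "u \<in> L"
  shows "((taboo K x) ^^ n) f u \<le> ((taboo K x) ^^ n) g u"
  using assms(2)
proof (induction n arbitrary: u)
  case (Suc n) then show ?case using closed[of u] by (auto intro!: taboo_mono)
qed (use assms in auto)

text \<open>The inequality for \<open>f\<close> is iterated along the killed chain. Each return to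
  \<open>x\<close> is paid with \<open>f x\<close>; by \<open>return_by_sum\<close> these payments
  add up to \<open>f x\<close> times the probability of having returned, and they are subtracted
  from both sides, which is possible because \<open>f x\<close> is finite.\<close>

lemma lyapunov_step:
  assumes x: "x \<in> L" and f: "\<And>u. u \<in> L \<Longrightarrow> f u \<le> kop K f u + \<psi> u" and fin: "f x < \<infinity>"
  shows "f x * avoid K x n x \<le> ((taboo K x) ^^ n) f x + (\<Sum>i<n. ((taboo K x) ^^ i) \<psi> x)"
proof -
  let ?T = "taboo K x"
  have "f x \<le> (?T ^^ n) f x + (\<Sum>i<n. (?T ^^ i) (\<lambda>v. f x * kop K (indicator {x}) v + \<psi> v) x)"
  proof (induction n)
    case (Suc n)
    have "(?T ^^ n) f x \<le> (?T ^^ n) (\<lambda>v. ?T f v + (f x * kop K (indicator {x}) v + \<psi> v)) x"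
    proof (rule taboo_pow_mono_on[OF _ x])
      fix v assume "v \<in> L"
      then show "f v \<le> ?T f v + (f x * kop K (indicator {x}) v + \<psi> v)"
        using f[of v] kop_split[of K f v x] by (simp add: add.assoc)
    qed
    also have "\<dots> = (?T ^^ Suc n) f x + (?T ^^ n) (\<lambda>v. f x * kop K (indicator {x}) v + \<psi> v) x"
      by (subst taboo_pow_add) (simp add: funpow_Suc_right del: funpow.simps)
    finally have "(?T ^^ n) f x + (\<Sum>i<n. (?T ^^ i) (\<lambda>v. f x * kop K (indicator {x}) v + \<psi> v) x) \<le>
       (?T ^^ Suc n) f x + (?T ^^ n) (\<lambda>v. f x * kop K (indicator {x}) v + \<psi> v) x + (\<Sum>i<n. (?T ^^ i) (\<lambda>v. f x * kop K (indicator {x}) v + \<psi> v) x)"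
      by (rule add_right_mono)
    from order_trans[OF Suc this] show ?case by (simp add: ac_simps del: funpow.simps)
  qed simp
  also have "\<dots> = ((?T ^^ n) f x + (\<Sum>i<n. (?T ^^ i) \<psi> x)) + f x * (\<Sum>i<n. (?T ^^ i) (kop K (indicator {x})) x)"
    by (simp add: taboo_pow_add taboo_pow_cmult sum.distrib sum_distrib_left ac_simps)
  finally have le: "f x \<le> \<dots>" .
  define c where "c = f x * (\<Sum>i<n. (?T ^^ i) (kop K (indicator {x})) x)"
  have eq: "c + f x * avoid K x n x = f x"
    unfolding c_def distrib_left[symmetric] return_by_sum by simp
  have "c \<le> f x" by (subst eq[symmetric]) simp
  then have "c \<noteq> \<infinity>" using fin by (auto simp: top_unique)
  moreover have "c + f x * avoid K x n x \<le> c + ((?T ^^ n) f x + (\<Sum>i<n. (?T ^^ i) \<psi> x))"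
    unfolding eq using le unfolding c_def by (simp only: add.commute)
  ultimately show ?thesis by (simp add: ennreal_add_left_cancel_le)
qed

text \<open>A finite-mass \<open>f\<close> dies out along the killed chain, and the defect
  \<open>\<psi>\<close> collected during an excursion is controlled by its mass. Hence the
  probability of no return, weighted by \<open>m x\<close>, is at most a multiple of
  \<open>\<epsilon>\<close>. The functions may change with \<open>\<epsilon>\<close>; they need not
  grow at infinity as in the usual criterion.\<close>

lemma lyapunov_recurrent:
  assumes x: "x \<in> L"
    and ex: "\<And>\<epsilon>. 0 < \<epsilon> \<Longrightarrow> \<exists>f \<psi>. (\<forall>u\<in>L. f u \<le> kop K f u + \<psi> u) \<and> 1 / 2 \<le> f x \<and> f x < \<infinity> \<and>
      occupation m f < \<infinity> \<and> occupation m \<psi> \<le> ennreal \<epsilon>"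
  shows "recurrent_at K x"
proof -
  have lim: "(\<lambda>n. avoid K x n x) \<longlonglongrightarrow> (INF n. avoid K x n x)"
    by (rule LIMSEQ_INF) (simp add: decseq_Suc_iff avoid_decseq)
  define \<sigma> where "\<sigma> = (INF n. avoid K x n x)"
  have \<sigma>: "\<sigma> \<le> avoid K x n x" for n unfolding \<sigma>_def by (rule INF_lower) simp
  have \<sigma>1: "\<sigma> \<le> 1" using \<sigma>[of 0] by simp
  have le: "m x * (\<sigma> / 2) \<le> ennreal (2 * \<epsilon>)" if "0 < \<epsilon>" for \<epsilon>
  proof -
    obtain f \<psi> where f: "\<And>u. u \<in> L \<Longrightarrow> f u \<le> kop K f u + \<psi> u" "1 / 2 \<le> f x" "f x < \<infinity>"
      and mf: "occupation m f < \<infinity>" and mp: "occupation m \<psi> \<le> ennreal \<epsilon>"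
      using ex[OF \<open>0 < \<epsilon>\<close>] by blast
    have t0: "(\<lambda>n. ((taboo K x) ^^ Suc n) f x) \<longlonglongrightarrow> 0"
      by (rule summable_tendsto_0[OF excursion_finite[OF x mf]])
    have b: "m x * (\<sigma> / 2) \<le> m x * ((taboo K x) ^^ Suc n) f x + ennreal (2 * \<epsilon>)" for n
    proof -
      have "\<sigma> / 2 = 1 / 2 * \<sigma>" by (simp add: divide_ennreal_def mult.commute)
      also have "\<dots> \<le> f x * avoid K x (Suc n) x" by (intro mult_mono f \<sigma>) auto
      also have "\<dots> \<le> ((taboo K x) ^^ Suc n) f x + (\<Sum>i<Suc n. ((taboo K x) ^^ i) \<psi> x)"
        by (rule lyapunov_step[OF x f(1,3)])
      also have "(\<Sum>i<Suc n. ((taboo K x) ^^ i) \<psi> x) = \<psi> x + (\<Sum>i<n. ((taboo K x) ^^ Suc i) \<psi> x)"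
        by (subst sum.lessThan_Suc_shift) simp
      also have "(\<Sum>i<n. ((taboo K x) ^^ Suc i) \<psi> x) \<le> (\<Sum>i. ((taboo K x) ^^ Suc i) \<psi> x)"
        by (intro sum_le_suminf summableI) auto
      finally have "m x * (\<sigma> / 2) \<le> m x * (((taboo K x) ^^ Suc n) f x + (\<psi> x + (\<Sum>i. ((taboo K x) ^^ Suc i) \<psi> x)))"
        by (simp add: mult_left_mono add_left_mono)
      also have "\<dots> = m x * ((taboo K x) ^^ Suc n) f x + (m x * \<psi> x + m x * (\<Sum>i. ((taboo K x) ^^ Suc i) \<psi> x))"
        by (simp only: distrib_left)
      \<comment> \<open>One \<open>\<epsilon>\<close> for the defect at the starting point, one for
        the rest of the excursion.\<close>
      also have "m x * \<psi> x + m x * (\<Sum>i. ((taboo K x) ^^ Suc i) \<psi> x) \<le> ennreal \<epsilon> + ennreal \<epsilon>"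
        by (intro add_mono order_trans[OF excursion_le mp] order_trans[OF occupation_ge mp])
      also have "ennreal \<epsilon> + ennreal \<epsilon> = ennreal (2 * \<epsilon>)" using that by (simp flip: ennreal_plus)
      finally show ?thesis by (simp add: add_left_mono)
    qed
    have l: "(\<lambda>n. m x * ((taboo K x) ^^ Suc n) f x + ennreal (2 * \<epsilon>)) \<longlonglongrightarrow> m x * 0 + ennreal (2 * \<epsilon>)"
      using m_finite[of x] by (intro tendsto_add tendsto_const ennreal_tendsto_cmult t0) auto
    show ?thesis
      using LIMSEQ_le_const[OF l] b by simp
  qed
  then have "m x * (\<sigma> / 2) \<le> 0 + ennreal e" if "0 < e" for e
    using that le[of "e / 2"] by simp
  then have "m x * (\<sigma> / 2) \<le> 0" by (rule ennreal_le_epsilon)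
  then have "\<sigma> = 0" using m_pos[OF x] \<sigma>1 by (auto simp: ennreal_divide_eq_0_iff)
  with lim show ?thesis unfolding recurrent_at_def \<sigma>_def by simp
qed

end

section \<open>Infinite mass and infinite expected return time\<close>

lemma ennreal_tendsto_0_of_cmult:
  fixes c :: ennreal
  assumes "0 < c" "\<And>n. c * d n \<le> g n" "g \<longlonglongrightarrow> 0"
  shows "d \<longlonglongrightarrow> 0"
proof -
  \<comment> \<open>\<open>c\<close> may be infinite; the minimum with 1 can be inverted in
    \<open>ennreal\<close>.\<close>
  define c' where "c' = min c 1"
  have c': "0 < c'" "c' \<le> c" "c' \<le> 1" using assms(1) by (auto simp: c'_def)
  then have top: "c' \<noteq> \<top>" by (auto simp: top_unique)
  then have inv: "inverse c' * c' = 1"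
    using c' by (simp add: ennreal_divide_self divide_ennreal_def[symmetric] mult.commute less_top)
  have "d n \<le> inverse c' * g n" for n
  proof -
    have "d n = inverse c' * (c' * d n)" by (simp add: mult.assoc[symmetric] inv)
    also have "\<dots> \<le> inverse c' * g n"
      by (intro mult_left_mono order_trans[OF mult_right_mono[OF c'(2)] assms(2)]) auto
    finally show ?thesis .
  qed
  then have le: "\<forall>\<^sub>F n in sequentially. d n \<le> inverse c' * g n" by simp
  have "inverse c' \<noteq> \<top>" using c' by simp
  then have "inverse c' < \<top>" by (simp only: less_top)
  then have "(\<lambda>n. inverse c' * g n) \<longlonglongrightarrow> inverse c' * 0"
    by (intro ennreal_tendsto_cmult assms)
  then have "(\<lambda>n. inverse c' * g n) \<longlonglongrightarrow> 0" by simp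
  from tendsto_sandwich[OF _ le tendsto_const this] show ?thesis by simp
qed

lemma ennreal_finite_of_cmult:
  fixes c :: ennreal
  assumes "c \<noteq> 0" "c * x \<le> y" "y < \<infinity>"
  shows "x < \<infinity>"
proof (rule ccontr)
  assume "\<not> x < \<infinity>"
  then have "c * x = \<infinity>" using assms(1) by (simp add: less_top[symmetric] ennreal_mult_top)
  then show False using assms by (simp add: top_unique)
qed

context invariant_chain
begin

lemma occ_off_sum: "finite B \<Longrightarrow> occ_off x (\<lambda>v. \<Sum>i\<in>B. f i v) = (\<Sum>i\<in>B. occ_off x (f i))"
proof (induction B rule: finite_induct)
  case empty
  show ?case using occ_off_cmult[of x 0 "\<lambda>_. 0"] by simp
next
  case (insert i B)
  have "occ_off x (\<lambda>v. f i v + (\<Sum>i\<in>B. f i v)) = occ_off x (f i) + occ_off x (\<lambda>v. \<Sum>i\<in>B. f i v)"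
    unfolding occ_off_def occupation_add[symmetric] by (rule arg_cong[where f="occupation m"]) auto
  with insert show ?case by simp
qed

text \<open>The mass of \<open>x\<close> is decomposed twice: by the time since the last visit for
  the paths that arrive, and by the time until the next visit for the paths that leave. The common
  part is finite and cancels.\<close>

lemma occ_off_tail_return: "occ_off x (((taboo K x) ^^ n) (kop K (indicator {x}))) = m x * avoid K x (Suc n) x"
proof -
  let ?r = "kop K (indicator {x})" and ?T = "taboo K x"
  have "m x * ?r x + occ_off x ?r = m x"
    using occ_off_split[of ?r x] inv[of "indicator {x}"] by (simp add: occupation_indicator)
  then have "m x = m x * ?r x + m x * (\<Sum>i<n. (?T ^^ Suc i) ?r x) + occ_off x ((?T ^^ n) ?r)"
    using occ_off_telescope[of x ?r n] by (simp add: add.assoc)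
  also have "m x * ?r x + m x * (\<Sum>i<n. (?T ^^ Suc i) ?r x) = m x * (\<Sum>i<Suc n. (?T ^^ i) ?r x)"
    by (subst sum.lessThan_Suc_shift) (simp add: distrib_left)
  finally have 1: "m x = m x * (\<Sum>i<Suc n. (?T ^^ i) ?r x) + occ_off x ((?T ^^ n) ?r)" .
  have 2: "m x * (\<Sum>i<Suc n. (?T ^^ i) ?r x) + m x * avoid K x (Suc n) x = m x"
    using return_by_sum[where K=K and x=x and n="Suc n" and u=x] unfolding distrib_left[symmetric] by simp
  define c where "c = m x * (\<Sum>i<Suc n. (?T ^^ i) ?r x)"
  have "c \<le> m x" by (subst 1) (simp add: c_def)
  then have "c \<noteq> \<infinity>" using m_finite[of x] by (auto simp: top_unique)
  moreover have "c + occ_off x ((?T ^^ n) ?r) = c + m x * avoid K x (Suc n) x"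
    using 1 2 unfolding c_def by (rule trans[OF sym sym])
  ultimately show ?thesis by (simp add: ennreal_add_left_cancel)
qed

text \<open>Induction along a path from \<open>w\<close> to \<open>x\<close>. Mass that stays away
  from \<open>x\<close> for \<open>n\<close> steps and sits at \<open>u\<close> moves on to a
  successor \<open>v\<close> with a fixed positive probability, so the tail at \<open>u\<close> is
  bounded by a multiple of the tail at \<open>v\<close>; if \<open>v\<close> is \<open>x\<close>
  itself, \<open>occ_off_tail_return\<close> and recurrence apply.\<close>

lemma occ_off_tail_tendsto_0:
  assumes rec: "recurrent_at K x" and x: "x \<in> L" and w: "w \<in> L" "w \<noteq> x"
  shows "(\<lambda>n. occ_off x (((taboo K x) ^^ n) (indicator {w}))) \<longlonglongrightarrow> 0"
proof -
  let ?T = "taboo K x"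
  let ?d = "\<lambda>w n. occ_off x ((?T ^^ n) (indicator {w}))"
  have base: "(\<lambda>n. m x * avoid K x (Suc n) x) \<longlonglongrightarrow> 0"
    using ennreal_tendsto_cmult[OF _ LIMSEQ_Suc[OF rec[unfolded recurrent_at_def]], of "m x"] m_finite[of x] by simp
  have "w = x \<or> ?d w \<longlonglongrightarrow> 0"
    using irred[OF w(1) x]
  proof (induction rule: converse_rtrancl_induct)
    case (step u v)
    then have p: "0 < pmf (K u) v" by auto
    show ?case
    proof (cases "v = x")
      case True
      have "?d u \<longlonglongrightarrow> 0"
      proof (rule ennreal_tendsto_0_of_cmult[OF _ _ base])
        fix n
        have "ennreal (pmf (K u) x) * ?d u n = occ_off x ((?T ^^ n) (\<lambda>v. ennreal (pmf (K u) x) * indicator {u} v))"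
          unfolding taboo_pow_cmult[abs_def] by (subst occ_off_cmult) simp
        also have "\<dots> \<le> occ_off x ((?T ^^ n) (kop K (indicator {x})))"
          by (intro occ_off_mono taboo_pow_mono) (auto simp: kop_indicator split: split_indicator)
        finally show "ennreal (pmf (K u) x) * ?d u n \<le> m x * avoid K x (Suc n) x"
          by (simp add: occ_off_tail_return)
      qed (use p True in simp)
      then show ?thesis by simp
    next
      case False
      then have dv: "?d v \<longlonglongrightarrow> 0" using step.IH by simp
      have "?d u \<longlonglongrightarrow> 0"
      proof (rule ennreal_tendsto_0_of_cmult[OF _ _ LIMSEQ_Suc[OF dv]])
        fix n
        have "ennreal (pmf (K u) v) * ?d u n = occ_off x ((?T ^^ n) (\<lambda>y. ennreal (pmf (K u) v) * indicator {u} y))"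
          unfolding taboo_pow_cmult[abs_def] by (subst occ_off_cmult) simp
        also have "\<dots> \<le> occ_off x ((?T ^^ n) (?T (indicator {v})))"
        proof (intro occ_off_mono taboo_pow_mono)
          fix y
          have "?T (indicator {v}) y = kop K (indicator {v}) y"
            unfolding taboo_def by (rule kop_cong) (use False in \<open>auto simp: indicator_def\<close>)
          then show "ennreal (pmf (K u) v) * indicator {u} y \<le> ?T (indicator {v}) y"
            by (auto simp: kop_indicator indicator_def split: if_splits)
        qed
        finally show "ennreal (pmf (K u) v) * ?d u n \<le> ?d v (Suc n)"
          by (simp add: funpow_Suc_right del: funpow.simps)
      qed (use p in simp)
      then show ?thesis by simp
    qed
  qed simp
  with w show ?thesis by simp
qed

text \<open>Under recurrence the remainder in \<open>occ_off_telescope\<close> vanishes for a finite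
  set \<open>B\<close>, so the mass of \<open>B\<close> is at most \<open>m x\<close> times the
  expected return time. Finite sets are used because the remainder is known to vanish only
  pointwise.\<close>

lemma infinite_mass_imp_infinite_return:
  assumes rec: "recurrent_at K x" and x: "x \<in> L"
    and inf: "\<And>C :: real. \<exists>B. finite B \<and> B \<subseteq> L - {x} \<and> ennreal C \<le> (\<Sum>w\<in>B. m w)"
  shows "(\<Sum>n. avoid K x n x) = \<infinity>"
proof (rule ccontr)
  let ?T = "taboo K x" and ?S = "\<Sum>n. avoid K x n x"
  assume "?S \<noteq> \<infinity>"
  then have "m x * ?S < \<infinity>" using m_finite[of x] by (simp add: ennreal_mult_less_top less_top)
  then obtain C where C: "m x * ?S = ennreal C" "0 \<le> C" by (cases "m x * ?S") auto
  obtain B where B: "finite B" "B \<subseteq> L - {x}" "ennreal (C + 1) \<le> (\<Sum>w\<in>B. m w)" using inf[of "C + 1"] by blast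
  let ?f = "\<lambda>v. \<Sum>w\<in>B. indicator {w} v :: ennreal"
  have f1: "?f v \<le> 1" for v using B(1) card_mono[of "{v}" "B \<inter> {v}"] by (auto simp: indicator_def sum.If_cases)
  have "occ_off x ?f = (\<Sum>w\<in>B. m w)"
    using B by (subst occ_off_sum)
      (auto intro!: sum.cong arg_cong[where f="occupation m"]
         simp: occupation_indicator[of m, symmetric] occ_off_def fun_eq_iff indicator_def)
  have le: "(\<Sum>w\<in>B. m w) \<le> m x * ?S + (\<Sum>w\<in>B. occ_off x ((?T ^^ n) (indicator {w})))" for n
  proof -
    have "(\<Sum>i<n. (?T ^^ Suc i) ?f x) \<le> (\<Sum>i<n. avoid K x (Suc i) x)"
      unfolding avoid_def by (intro sum_mono taboo_pow_mono f1)
    also have "\<dots> \<le> (\<Sum>i<Suc n. avoid K x i x)"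
      unfolding sum.lessThan_Suc_shift[of "\<lambda>i. avoid K x i x"] by simp
    also have "\<dots> \<le> ?S" by (intro sum_le_suminf summableI) auto
    finally have "occ_off x ?f \<le> m x * ?S + occ_off x ((?T ^^ n) ?f)"
      by (subst occ_off_telescope[of x ?f n]) (intro add_right_mono mult_left_mono, auto)
    also have "(?T ^^ n) ?f = (\<lambda>v. \<Sum>w\<in>B. (?T ^^ n) (indicator {w}) v)"
      using B(1) by (simp add: taboo_pow_sum fun_eq_iff)
    finally show ?thesis using B(1) \<open>occ_off x ?f = _\<close> by (simp add: occ_off_sum)
  qed
  have "(\<lambda>n. m x * ?S + (\<Sum>w\<in>B. occ_off x ((?T ^^ n) (indicator {w})))) \<longlonglongrightarrow> m x * ?S + (\<Sum>w\<in>B. 0)"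
    by (intro tendsto_add tendsto_const tendsto_sum occ_off_tail_tendsto_0[OF rec x]) (use B in auto)
  from LIMSEQ_le_const[OF this] le have "(\<Sum>w\<in>B. m w) \<le> m x * ?S" by simp
  then have "ennreal (C + 1) \<le> ennreal C" using B(3) C(1) by (metis order_trans)
  then show False using C(2) by simp
qed

end

section \<open>Green function and hitting probabilities\<close>

lemma kop_pow_mono: "(\<And>v. f v \<le> g v) \<Longrightarrow> ((kop K) ^^ n) f u \<le> ((kop K) ^^ n) g u"
  by (rule kop_pow_mono_on[where L=UNIV]) auto

text \<open>Decompose according to the time of the last visit to \<open>x\<close> before \<open>n\<close>.\<close>

lemma last_visit_sum:
  "(\<Sum>i\<le>n. ((kop K) ^^ i) (\<lambda>v. indicator {x} v * avoid K x (n - i) v) u) +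
    (if u = x then 0 else avoid K x n u) = 1"
proof (induction n arbitrary: u)
  case (Suc n)
  let ?L = "\<lambda>n v. \<Sum>i\<le>n. ((kop K) ^^ i) (\<lambda>v. indicator {x} v * avoid K x (n - i) v) v"
  have "kop K (\<lambda>v. ?L n v + (if v = x then 0 else avoid K x n v)) u = 1"
    using Suc by simp
  then have 1: "kop K (?L n) u + avoid K x (Suc n) u = 1"
    by (simp add: kop_add avoid_Suc taboo_def)
  have "?L (Suc n) u = indicator {x} u * avoid K x (Suc n) u + kop K (?L n) u"
    by (subst sum.atMost_Suc_shift) (simp add: kop_sum)
  then show ?case using 1 by (auto simp: add.commute split: if_splits)
qed auto

definition green :: "('s \<Rightarrow> 's pmf) \<Rightarrow> 's \<Rightarrow> 's \<Rightarrow> ennreal" where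
  "green K u x = (\<Sum>i. ((kop K) ^^ i) (indicator {x}) u)"

text \<open>Each visit to \<open>x\<close> is the last one before time \<open>n\<close> with
  probability at least \<open>\<sigma> > 0\<close>, and the events of being the last visit are
  disjoint. The resulting bound on the number of visits is the same for all starting points.\<close>

lemma green_finite_of_not_recurrent:
  assumes "\<not> recurrent_at K x"
  shows "green K u x < \<infinity>"
proof -
  have lim: "(\<lambda>n. avoid K x n x) \<longlonglongrightarrow> (INF n. avoid K x n x)"
    by (rule LIMSEQ_INF) (simp add: decseq_Suc_iff avoid_decseq)
  define \<sigma> where "\<sigma> = (INF n. avoid K x n x)"
  have \<sigma>: "\<sigma> \<le> avoid K x n x" for n unfolding \<sigma>_def by (rule INF_lower) simp
  have \<sigma>0: "\<sigma> \<noteq> 0" using lim assms unfolding recurrent_at_def \<sigma>_def by auto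
  have "\<sigma> * green K u x \<le> 1"
    unfolding green_def ennreal_suminf_cmult[symmetric]
  proof (rule suminf_le_const[OF summableI])
    fix n
    have "(\<Sum>i<n. \<sigma> * ((kop K) ^^ i) (indicator {x}) u) \<le> (\<Sum>i\<le>n. \<sigma> * ((kop K) ^^ i) (indicator {x}) u)"
      by (intro sum_mono2) auto
    also have "\<dots> \<le> (\<Sum>i\<le>n. ((kop K) ^^ i) (\<lambda>v. indicator {x} v * avoid K x (n - i) v) u)"
      unfolding kop_pow_cmult[symmetric]
      by (intro sum_mono kop_pow_mono) (auto simp: indicator_def \<sigma>)
    also have "\<dots> \<le> \<dots> + (if u = x then 0 else avoid K x n u)" by simp
    also have "\<dots> = 1" by (rule last_visit_sum)
    finally show "(\<Sum>i<n. \<sigma> * ((kop K) ^^ i) (indicator {x}) u) \<le> 1" .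
  qed
  then show ?thesis by (rule ennreal_finite_of_cmult[OF \<sigma>0]) simp
qed

text \<open>A loop at \<open>v\<close>, preceded by a path from \<open>x\<close> to \<open>v\<close>
  and followed by a path back, is a loop at \<open>x\<close>.\<close>

lemma green_finite_transfer:
  assumes fin: "green K x x < \<infinity>"
    and pos: "((kop K) ^^ i) (indicator {v}) x \<noteq> 0" "((kop K) ^^ j) (indicator {x}) v \<noteq> 0"
  shows "green K v v < \<infinity>"
proof -
  let ?a = "((kop K) ^^ i) (indicator {v}) x" and ?b = "((kop K) ^^ j) (indicator {x}) v"
  have ge: "((kop K) ^^ n) g u \<ge> g w * ((kop K) ^^ n) (indicator {w}) u" for n g u w
    unfolding kop_pow_cmult[symmetric] by (rule kop_pow_mono) (auto simp: indicator_def)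
  have "?a * ?b * green K v v \<le> green K x x"
    unfolding green_def ennreal_suminf_cmult[symmetric]
  proof (rule suminf_le_const[OF summableI])
    fix N
    have "?a * ?b * ((kop K) ^^ n) (indicator {v}) v \<le> ((kop K) ^^ (i + n + j)) (indicator {x}) x" for n
    proof -
      have "?a * ?b * ((kop K) ^^ n) (indicator {v}) v \<le> ?a * ((kop K) ^^ n) (((kop K) ^^ j) (indicator {x})) v"
        using ge[of "((kop K) ^^ j) (indicator {x})" v n v] by (simp add: mult.assoc mult_left_mono)
      also have "\<dots> \<le> ((kop K) ^^ i) (((kop K) ^^ n) (((kop K) ^^ j) (indicator {x}))) x"
        using ge[of "((kop K) ^^ n) (((kop K) ^^ j) (indicator {x}))" v i x] by (simp add: mult.commute)
      also have "\<dots> = ((kop K) ^^ (i + n + j)) (indicator {x}) x"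
        by (simp add: funpow_add)
      finally show ?thesis .
    qed
    then have "(\<Sum>n<N. ?a * ?b * ((kop K) ^^ n) (indicator {v}) v) \<le> (\<Sum>n<N. ((kop K) ^^ (n + (i + j))) (indicator {x}) x)"
      by (intro sum_mono) (simp add: add.commute add.left_commute)
    also have "\<dots> = (\<Sum>n\<in>(\<lambda>n. n + (i + j)) ` {..<N}. ((kop K) ^^ n) (indicator {x}) x)"
      by (subst sum.reindex) auto
    also have "\<dots> \<le> (\<Sum>n. ((kop K) ^^ n) (indicator {x}) x)"
      by (intro sum_le_suminf summableI) auto
    finally show "(\<Sum>n<N. ?a * ?b * ((kop K) ^^ n) (indicator {v}) v) \<le> (\<Sum>n. ((kop K) ^^ n) (indicator {x}) x)" .
  qed
  moreover have "?a * ?b \<noteq> 0" using pos by simp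
  ultimately show ?thesis using fin by (metis ennreal_finite_of_cmult)
qed

lemma kop_pow_pos_of_path:
  assumes "(u, v) \<in> {(x, y). x \<in> L \<and> y \<in> L \<and> 0 < pmf (K x) y}\<^sup>*"
  shows "\<exists>n. ((kop K) ^^ n) (indicator {v}) u \<noteq> 0"
  using assms
proof (induction rule: converse_rtrancl_induct)
  case base
  show ?case by (rule exI[of _ 0]) simp
next
  case (step u w)
  then obtain n where n: "((kop K) ^^ n) (indicator {v}) w \<noteq> 0" and p: "0 < pmf (K u) w" by auto
  let ?g = "((kop K) ^^ n) (indicator {v})"
  have "?g w * ennreal (pmf (K u) w) \<le> kop K ?g u"
    unfolding kop_indicator[symmetric] kop_cmult[symmetric] by (rule kop_mono) (auto simp: indicator_def)
  then have "kop K ?g u \<noteq> 0" using n p by auto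
  then show ?case by (intro exI[of _ "Suc n"]) simp
qed

context
  fixes K :: "'s \<Rightarrow> 's pmf" and L :: "'s set"
  assumes closed: "\<And>u. u \<in> L \<Longrightarrow> set_pmf (K u) \<subseteq> L"
    and irred: "\<And>u v. u \<in> L \<Longrightarrow> v \<in> L \<Longrightarrow> (u, v) \<in> {(x, y). x \<in> L \<and> y \<in> L \<and> 0 < pmf (K x) y}\<^sup>*"
begin

lemma irreducible_green_finite:
  assumes "x \<in> L" "\<not> recurrent_at K x" "v \<in> L"
  shows "green K v v < \<infinity>"
  using green_finite_transfer[OF green_finite_of_not_recurrent[OF assms(2)]]
    kop_pow_pos_of_path[OF irred] assms by metis

lemma avoid_tendsto_0_from_successor:
  assumes lim: "(\<lambda>n. avoid K x n u) \<longlonglongrightarrow> 0" and p: "0 < pmf (K u) v" and v: "v \<noteq> x"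
  shows "(\<lambda>n. avoid K x n v) \<longlonglongrightarrow> 0"
proof -
  let ?c = "ennreal (pmf (K u) v)"
  have "?c * avoid K x n v \<le> avoid K x (Suc n) u" for n
  proof -
    have "avoid K x n v * ?c \<le> avoid K x (Suc n) u"
      unfolding kop_indicator[symmetric] kop_cmult[symmetric] avoid_Suc taboo_def
      by (rule kop_mono) (use v in \<open>auto simp: indicator_def\<close>)
    then show ?thesis by (simp add: mult.commute)
  qed
  then show ?thesis using p by (intro ennreal_tendsto_0_of_cmult[OF _ _ LIMSEQ_Suc[OF lim]]) auto
qed

text \<open>A chain that is sure to visit \<open>x\<close> from \<open>y\<close> is also sure to do
  so from every successor of \<open>y\<close>; this propagates the return to \<open>x\<close> along
  a path from \<open>x\<close> to \<open>u\<close>.\<close>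

lemma recurrent_hits_everywhere:
  assumes rec: "recurrent_at K x" and x: "x \<in> L" and u: "u \<in> L"
  shows "(\<lambda>n. avoid K x n u) \<longlonglongrightarrow> 0"
  using irred[OF x u]
proof (induction rule: rtrancl_induct)
  case base
  then show ?case using rec by (simp add: recurrent_at_def)
next
  case (step y z)
  then show ?case
    using avoid_tendsto_0_from_successor[of x y z] rec by (cases "z = x") (auto simp: recurrent_at_def)
qed

end

section \<open>Almost sure behaviour of trajectories\<close>

abbreviation traj_space :: "(nat \<Rightarrow> 's) measure" where
  "traj_space \<equiv> Pi\<^sub>M UNIV (\<lambda>_. count_space UNIV)"

lemma measurable_traj_component [measurable]: "(\<lambda>y. f (y n)) \<in> traj_space \<rightarrow>\<^sub>M count_space UNIV"
  by (rule measurable_compose[OF measurable_component_singleton]) auto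

lemma borel_measurable_traj_component: "(\<lambda>y. f (y n) :: 'b :: topological_space) \<in> borel_measurable traj_space"
  by (rule measurable_compose[OF measurable_component_singleton]) auto

lemma AE_jump_chain_first_step:
  assumes P [measurable]: "Measurable.pred traj_space P"
    and w: "\<And>w. w \<in> set_pmf (jump_kernel Q u) \<Longrightarrow> AE y in jump_chain_law Q w. P (case_nat u y)"
  shows "AE y in jump_chain_law Q u. P y"
proof -
  have cn [measurable]: "case_nat u \<in> traj_space \<rightarrow>\<^sub>M traj_space"
    by (rule measurable_PiM_single') (auto split: nat.split simp: space_PiM intro!: measurable_component_singleton)
  have P' [measurable]: "Measurable.pred (jump_chain_law Q w) P" "Measurable.pred (jump_chain_law Q w) (\<lambda>y. P (case_nat u y))" for w
    by (auto cong: measurable_cong_sets)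
  have "(\<integral>\<^sup>+y. indicator {y. \<not> P y} y \<partial>jump_chain_law Q u) =
    kop (jump_kernel Q) (\<lambda>w. \<integral>\<^sup>+y. indicator {y. \<not> P y} (case_nat u y) \<partial>jump_chain_law Q w) u"
    by (rule nn_integral_jump_chain_first_step) measurable
  also have "\<dots> = kop (jump_kernel Q) (\<lambda>w. 0) u"
  proof (rule kop_cong)
    fix w assume "w \<in> set_pmf (jump_kernel Q u)"
    from w[OF this] show "(\<integral>\<^sup>+y. indicator {y. \<not> P y} (case_nat u y) \<partial>jump_chain_law Q w) = 0"
      by (subst nn_integral_0_iff_AE) (auto simp: indicator_def)
  qed
  finally have "(\<integral>\<^sup>+y. indicator {y. \<not> P y} y \<partial>jump_chain_law Q u) = 0" by simp
  moreover have "(\<lambda>y. indicator {y. \<not> P y} y :: ennreal) \<in> borel_measurable (jump_chain_law Q u)" by measurable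
  ultimately show ?thesis
    using nn_integral_0_iff_AE[of "\<lambda>y. indicator {y. \<not> P y} y" "jump_chain_law Q u"] by (auto simp: indicator_def)
qed

lemma AE_jump_chain_start: "AE y in jump_chain_law Q u. y 0 = u"
  by (rule AE_jump_chain_first_step) auto

lemma AE_jump_chain_closed:
  assumes "\<And>u. u \<in> L \<Longrightarrow> set_pmf (jump_kernel Q u) \<subseteq> L" "u \<in> L"
  shows "AE y in jump_chain_law Q u. \<forall>n. y n \<in> L"
proof -
  have "AE y in jump_chain_law Q u. y n \<in> L" if "u \<in> L" for n u
    using that
  proof (induction n arbitrary: u)
    case 0
    then show ?case using AE_jump_chain_start[where Q=Q and u=u] by auto
  next
    case (Suc n)
    show ?case
      by (rule AE_jump_chain_first_step) (use Suc assms(1)[of u] in auto)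
  qed
  then show ?thesis using assms(2) by (simp add: AE_all_countable)
qed

lemma nn_integral_visit:
  "(\<integral>\<^sup>+y. indicator {x} (y n) \<partial>jump_chain_law Q u) = ((kop (jump_kernel Q)) ^^ n) (indicator {x}) u"
proof (induction n arbitrary: u)
  case 0
  interpret prob_space "jump_chain_law Q u" by (rule prob_space_jump_chain_law)
  have "(\<integral>\<^sup>+y. indicator {x} (y 0) \<partial>jump_chain_law Q u) = (\<integral>\<^sup>+y. indicator {x} u \<partial>jump_chain_law Q u)"
    by (rule nn_integral_cong_AE) (use AE_jump_chain_start[where Q=Q and u=u] in auto)
  then show ?case using emeasure_space_1 by simp
next
  case (Suc n)
  show ?case
    by (subst nn_integral_jump_chain_first_step) (auto simp: Suc intro: borel_measurable_traj_component)
qed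

lemma nn_integral_avoid:
  "(\<integral>\<^sup>+y. indicator {y. \<forall>j\<in>{1..n}. y j \<noteq> x} y \<partial>jump_chain_law Q u) = avoid (jump_kernel Q) x n u"
proof -
  let ?K = "jump_kernel Q" and ?ne = "\<lambda>v. if v = x then 0 else 1 :: ennreal"
  \<comment> \<open>Time 0 has factor 1, because a chain started at \<open>x\<close> has not yet
    returned.\<close>
  define g where "g j = (if j = 0 then (\<lambda>_. 1) else ?ne)" for j :: nat
  have 1: "path_weight ?K n (\<lambda>_. ?ne) v = ?ne v * avoid ?K x n v" for n v
  proof (induction n arbitrary: v)
    case (Suc n)
    have "path_weight ?K n (\<lambda>_. ?ne) = (\<lambda>v. ?ne v * avoid ?K x n v)" using Suc by blast
    then show ?case by (auto simp: avoid_Suc taboo_def intro!: kop_cong)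
  qed simp
  have 2: "path_weight ?K n g u = avoid ?K x n u"
  proof (cases n)
    case (Suc k)
    then show ?thesis
      by (simp add: g_def avoid_Suc taboo_def 1[abs_def]) (auto intro!: kop_cong)
  qed (simp add: g_def)
  have "indicator {y. \<forall>j\<in>{1..n}. y j \<noteq> x} y = (\<Prod>i\<le>n. g i (y i))" for y
  proof (cases "\<forall>j\<in>{1..n}. y j \<noteq> x")
    case True
    then have "\<And>i. i \<le> n \<Longrightarrow> g i (y i) = 1" by (auto simp: g_def)
    with True show ?thesis by simp
  next
    case False
    then obtain j where "1 \<le> j" "j \<le> n" "y j = x" by auto
    then have "\<exists>i\<in>{..n}. g i (y i) = 0" by (intro bexI[of _ j]) (auto simp: g_def)
    with False show ?thesis by (simp add: prod_zero)
  qed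
  then show ?thesis by (simp add: nn_integral_jump_chain_prod 2)
qed

lemma measurable_avoid [measurable]:
  "Measurable.pred traj_space (\<lambda>y. \<forall>j\<in>{1..n::nat}. y j \<noteq> x)"
  by (intro pred_intros_countable_bounded) auto

lemma AE_finite_visits:
  assumes "green (jump_kernel Q) u x < \<infinity>"
  shows "AE y in jump_chain_law Q u. finite {n. y n = x}"
proof -
  have m [measurable]: "(\<lambda>y. indicator {x} (y n) :: ennreal) \<in> borel_measurable (jump_chain_law Q u)" for n
    by (subst measurable_cong_sets[OF sets_jump_chain_law refl]) (rule borel_measurable_traj_component)
  have "(\<integral>\<^sup>+y. (\<Sum>n. indicator {x} (y n)) \<partial>jump_chain_law Q u) = green (jump_kernel Q) u x"
    unfolding green_def by (subst nn_integral_suminf) (auto simp: nn_integral_visit)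
  then have "AE y in jump_chain_law Q u. (\<Sum>n. indicator {x} (y n) :: ennreal) \<noteq> \<infinity>"
    using assms by (intro nn_integral_PInf_AE) auto
  then show ?thesis
  proof eventually_elim
    case (elim y)
    show ?case
    proof (rule ccontr)
      assume inf: "infinite {n. y n = x}"
      have "of_nat k \<le> (\<Sum>n. indicator {x} (y n) :: ennreal)" for k
      proof -
        obtain B where B: "finite B" "card B = k" "B \<subseteq> {n. y n = x}" using inf by (meson infinite_arbitrarily_large)
        have "of_nat k = (\<Sum>n\<in>B. indicator {x} (y n) :: ennreal)"
          using B by (subst sum.cong[of B B _ "\<lambda>_. 1"]) auto
        also have "\<dots> \<le> (\<Sum>n. indicator {x} (y n))" by (intro sum_le_suminf summableI B) auto
        finally show ?thesis .
      qed
      then have "(\<Sum>n. indicator {x} (y n) :: ennreal) = \<infinity>"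
        by (metis ennreal_Ex_less_of_nat infinity_ennreal_def leD top.not_eq_extremum)
      with elim show False by simp
    qed
  qed
qed

text \<open>Induction on \<open>m\<close>: a visit after time \<open>Suc m\<close> is a visit after
  time \<open>m\<close> of the chain started at the first jump. For this reason hitting is required
  from every starting point in \<open>L\<close>.\<close>

lemma AE_infinitely_many_visits:
  assumes closed: "\<And>u. u \<in> L \<Longrightarrow> set_pmf (jump_kernel Q u) \<subseteq> L"
    and hit: "\<And>u. u \<in> L \<Longrightarrow> (\<lambda>n. avoid (jump_kernel Q) x n u) \<longlonglongrightarrow> 0"
    and u: "u \<in> L"
  shows "AE y in jump_chain_law Q u. \<forall>m. \<exists>n>m. y n = x"
proof -
  have m [measurable]: "Measurable.pred traj_space (\<lambda>y. \<exists>n>m::nat. y n = x)" for m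
    by (intro pred_intros_countable pred_intros_logic) auto
  have "AE y in jump_chain_law Q u. \<exists>n>m. y n = x" if "u \<in> L" for m u
    using that
  proof (induction m arbitrary: u)
    case 0
    have "(\<integral>\<^sup>+y. indicator {y. \<not> (\<exists>n>0. y n = x)} y \<partial>jump_chain_law Q u) \<le> avoid (jump_kernel Q) x n u" for n
      unfolding nn_integral_avoid[symmetric]
    proof (intro nn_integral_mono indicator_leI)
      fix y :: "nat \<Rightarrow> 'a" assume "y \<in> {y. \<not> (\<exists>n>0. y n = x)}"
      then have "y j \<noteq> x" if "0 < j" for j using that by blast
      then show "y \<in> {y. \<forall>j\<in>{1..n}. y j \<noteq> x}" by simp
    qed
    then have "(\<integral>\<^sup>+y. indicator {y. \<not> (\<exists>n>0. y n = x)} y \<partial>jump_chain_law Q u) = 0"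
      using LIMSEQ_le_const[OF hit[OF 0]] by fastforce
    moreover have "Measurable.pred (jump_chain_law Q u) (\<lambda>y. \<exists>n>0. y n = x)"
      using m[of 0] by (subst measurable_cong_sets[OF sets_jump_chain_law refl])
    ultimately show ?case
      by (subst (asm) nn_integral_0_iff_AE) (auto simp: indicator_def)
  next
    case (Suc m)
    show ?case
    proof (rule AE_jump_chain_first_step[OF m])
      fix w assume "w \<in> set_pmf (jump_kernel Q u)"
      then have "w \<in> L" using closed[OF Suc.prems] by auto
      from Suc.IH[OF this] show "AE y in jump_chain_law Q w. \<exists>n>Suc m. (case n of 0 \<Rightarrow> u | Suc k \<Rightarrow> y k) = x"
      proof eventually_elim
        case (elim y)
        then obtain n where "n > m" "y n = x" by auto
        then show ?case by (intro exI[of _ "Suc n"]) auto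
      qed
    qed
  qed
  then show ?thesis using u by (simp add: AE_all_countable)
qed

section \<open>Holding times\<close>

abbreviation exp1 :: "real measure" where "exp1 \<equiv> density lborel (exponential_density 1)"
abbreviation hold_law :: "(nat \<Rightarrow> real) measure" where "hold_law \<equiv> \<Pi>\<^sub>M n\<in>UNIV. exp1"

interpretation exp1: prob_space exp1
  by (rule prob_space_exponential_density) simp

interpretation hold: sequence_space exp1 ..

lemma nn_integral_hold_component: "(\<integral>\<^sup>+e. f (e i) \<partial>hold_law) = (\<integral>\<^sup>+s. f s \<partial>exp1)"
  if [measurable]: "f \<in> borel_measurable borel"
proof -
  have "(\<integral>\<^sup>+e. f (e i) \<partial>hold_law) = (\<integral>\<^sup>+s. f s \<partial>distr hold_law exp1 (\<lambda>e. e i))"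
    by (subst nn_integral_distr) auto
  also have "distr hold_law exp1 (\<lambda>e. e i) = exp1"
    by (rule hold.PiM_component) simp
  finally show ?thesis .
qed

lemma nn_integral_exp1_id: "(\<integral>\<^sup>+s. ennreal s \<partial>exp1) = 1"
proof -
  have "(\<integral>\<^sup>+s. ennreal s \<partial>exp1) = (\<integral>\<^sup>+s. ennreal (exponential_density 1 s * s ^ 1) \<partial>lborel)"
    by (subst nn_integral_density) (auto intro!: nn_integral_cong simp: exponential_density_def ennreal_mult)
  then show ?thesis using nn_integral_erlang_ith_moment[of 1 0 1] by simp
qed

lemma AE_exp1_pos: "AE s in exp1. 0 < s"
proof -
  have "AE s in lborel. s \<noteq> (0::real)" by (rule AE_lborel_singleton)
  then show ?thesis by (subst AE_density) (auto simp: exponential_density_def)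
qed

lemma AE_hold_pos: "AE e in hold_law. \<forall>n. 0 < e n"
  using hold.AE_component[OF UNIV_I AE_exp1_pos] by (simp add: AE_all_countable)

text \<open>Together with an upper bound on the rates this excludes explosion.\<close>

lemma AE_hold_io: "AE e in hold_law. \<forall>m. \<exists>i\<ge>m. 1 < e i"
proof -
  have "AE e in hold_law. \<exists>i\<ge>m. 1 < e i" for m
  proof -
    \<comment> \<open>The first \<open>m\<close> coordinates are free, so the event for the first
      \<open>n + m + 1\<close> coordinates has probability \<open>p ^ Suc n\<close>.\<close>
    define E where "E i = (if i < m then UNIV else {..1::real})" for i
    have s [measurable]: "E i \<in> sets exp1" for i by (simp add: E_def)
    define p where "p = measure exp1 {..1}"
    have p: "p = 1 - exp (-1)"
      using emeasure_erlang_density[of 1 0 1] by (simp add: p_def measure_def erlang_CDF_def)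
    have "measure exp1 UNIV = 1" using exp1.prob_space by simp
    then have m1: "measure exp1 (E i) = (if i < m then 1 else p)" for i
      by (simp add: E_def p_def)
    have prod: "(\<Prod>i\<le>n + m. measure exp1 (E i)) = p ^ Suc n" for n
    proof (induction n)
      case 0
      have "(\<Prod>i\<le>m. measure exp1 (E i)) = (\<Prod>i<m. measure exp1 (E i)) * p"
        by (simp add: lessThan_Suc_atMost[symmetric] m1)
      then show ?case by (simp add: m1)
    qed (simp add: m1)
    have "(\<lambda>n. p ^ Suc n) \<longlonglongrightarrow> 0" by (intro LIMSEQ_Suc LIMSEQ_realpow_zero) (auto simp: p)
    moreover have "(\<lambda>n. p ^ Suc n) \<longlonglongrightarrow> measure hold_law (Pi UNIV E)"
      using LIMSEQ_ignore_initial_segment[OF hold.measure_PiM_countable[of E], of m] s by (simp add: prod)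
    ultimately have "measure hold_law (Pi UNIV E) = 0" by (rule LIMSEQ_unique[rotated])
    then have "Pi UNIV E \<in> null_sets hold_law"
      using s by (auto simp: null_sets_def hold.P.emeasure_eq_measure)
    then have "AE e in hold_law. e \<notin> Pi UNIV E" by (rule AE_not_in)
    then show ?thesis by eventually_elim (auto simp: E_def Pi_def not_le not_less split: if_splits)
  qed
  then show ?thesis by (simp add: AE_all_countable)
qed

lemma AE_path_law:
  assumes "AE y in jump_chain_law Q u. P y" "AE e in hold_law. R e"
  shows "AE \<omega> in path_law Q u. P (fst \<omega>) \<and> R (snd \<omega>)"
proof -
  interpret Y: prob_space "jump_chain_law Q u" by (rule prob_space_jump_chain_law)
  interpret P: pair_prob_space "jump_chain_law Q u" hold_law ..
  have "AE \<omega> in path_law Q u. P (fst \<omega>)"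
    unfolding path_law_def
    by (rule AE_distrD[OF measurable_fst]) (subst hold.P.distr_pair_fst, rule assms)
  moreover have "AE \<omega> in path_law Q u. R (snd \<omega>)"
  proof -
    obtain N where N: "N \<in> null_sets hold_law" "{e \<in> space hold_law. \<not> R e} \<subseteq> N"
      using assms(2) by (auto elim!: AE_E3 simp: eventually_ae_filter)
    have "space (jump_chain_law Q u) \<times> N \<in> null_sets (path_law Q u)"
      unfolding path_law_def using N(1)
      by (intro null_setsI) (auto simp: hold.P.emeasure_pair_measure_Times null_sets_def simp del: space_jump_chain_law)
    then show ?thesis
      by (rule AE_I') (use N(2) in \<open>auto simp: path_law_def space_pair_measure\<close>)
  qed
  ultimately show ?thesis by eventually_elim auto
qed

lemma prob_space_path_law: "prob_space (path_law Q u)"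
proof -
  interpret Y: prob_space "jump_chain_law Q u" by (rule prob_space_jump_chain_law)
  interpret P: pair_prob_space "jump_chain_law Q u" hold_law ..
  show ?thesis
    unfolding path_law_def using Y.emeasure_space_1 hold.P.emeasure_space_1
    by (intro prob_spaceI) (simp add: space_pair_measure hold.P.emeasure_pair_measure_Times del: space_jump_chain_law)
qed

section \<open>Return times under bounded rates\<close>

locale bounded_rates =
  fixes Q :: "'s \<Rightarrow> 's \<Rightarrow> real" and L :: "'s set" and c0 c :: real
  assumes closed: "u \<in> L \<Longrightarrow> set_pmf (jump_kernel Q u) \<subseteq> L"
    and rate_ge: "u \<in> L \<Longrightarrow> c0 \<le> exit_rate Q u"
    and rate_le: "u \<in> L \<Longrightarrow> exit_rate Q u \<le> c"
    and c0_pos: "0 < c0"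
begin

lemma rate_pos: "u \<in> L \<Longrightarrow> 0 < exit_rate Q u"
  using rate_ge c0_pos by fastforce

definition J :: "(nat \<Rightarrow> 's) \<Rightarrow> (nat \<Rightarrow> real) \<Rightarrow> nat \<Rightarrow> real" where
  "J y e n = (\<Sum>i<n. e i / exit_rate Q (y i))"

text \<open>The almost sure properties of a sample point from which the facts on its path follow
  without further probability.\<close>

definition good :: "(nat \<Rightarrow> 's) \<Rightarrow> (nat \<Rightarrow> real) \<Rightarrow> bool" where
  "good y e \<longleftrightarrow> (\<forall>n. y n \<in> L) \<and> (\<forall>n. 0 < e n) \<and> (\<forall>m. \<exists>i\<ge>m. 1 < e i)"

lemma AE_good:
  assumes "u \<in> L" "AE y in jump_chain_law Q u. P y"
  shows "AE \<omega> in path_law Q u. good (fst \<omega>) (snd \<omega>) \<and> fst \<omega> 0 = u \<and> P (fst \<omega>)"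
proof -
  have "AE y in jump_chain_law Q u. (\<forall>n. y n \<in> L) \<and> y 0 = u \<and> P y"
    using AE_jump_chain_closed[of L Q u, OF _ assms(1)] closed AE_jump_chain_start[where Q=Q and u=u] assms(2)
    by (auto elim: AE_mp)
  moreover have "AE e in hold_law. (\<forall>n. 0 < e n) \<and> (\<forall>m. \<exists>i\<ge>m. 1 < e i)"
    using AE_hold_pos AE_hold_io by eventually_elim auto
  ultimately have "AE \<omega> in path_law Q u. ((\<forall>n. fst \<omega> n \<in> L) \<and> fst \<omega> 0 = u \<and> P (fst \<omega>)) \<and>
      ((\<forall>n. 0 < snd \<omega> n) \<and> (\<forall>m. \<exists>i\<ge>m. 1 < snd \<omega> i))"
    by (rule AE_path_law)
  then show ?thesis by eventually_elim (auto simp: good_def)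
qed

context
  fixes y e assumes good: "good y e"
begin

lemma J_step: "J y e (Suc n) = J y e n + e n / exit_rate Q (y n)" "0 < e n / exit_rate Q (y n)"
  using good rate_pos by (auto simp: J_def good_def)

lemma J_strict_mono: "strict_mono (J y e)"
  by (rule strict_monoI_Suc) (use J_step in simp)

lemma J_mono: "i \<le> j \<Longrightarrow> J y e i \<le> J y e j"
  using J_strict_mono by (simp add: strict_mono_less_eq)

lemma J_nonneg: "0 \<le> J y e n"
  using J_mono[of 0 n] by (simp add: J_def)

lemma jump_time_J: "jump_time Q n (y, e) = ennreal (J y e n)"
proof -
  have "jump_time Q n (y, e) = (\<Sum>i<n. ennreal (e i / exit_rate Q (y i)))"
    unfolding jump_time_def prod.case using good rate_pos
    by (intro sum.cong refl divide_ennreal) (auto simp: good_def less_imp_le)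
  also have "\<dots> = ennreal (J y e n)"
    unfolding J_def using J_step(2) by (intro sum_ennreal) (simp add: less_imp_le)
  finally show ?thesis .
qed

lemma J_unbounded: "\<exists>n. t < J y e n"
proof -
  have c: "0 < c" using good rate_pos rate_le[of "y 0"] by (auto simp: good_def intro: less_le_trans)
  have "\<exists>n. real k / c \<le> J y e n" for k
  proof (induction k)
    case 0 then show ?case by (auto intro: exI[of _ 0] simp: J_def)
  next
    case (Suc k)
    then obtain n where n: "real k / c \<le> J y e n" by auto
    obtain i where i: "i \<ge> n" "1 < e i" using good unfolding good_def by blast
    have "1 / c \<le> e i / exit_rate Q (y i)"
      using i good rate_pos[of "y i"] rate_le[of "y i"] by (intro frac_le) (auto simp: good_def)
    with n J_mono[OF i(1)] have "real (Suc k) / c \<le> J y e (Suc i)"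
      by (simp add: J_step add_divide_distrib)
    then show ?case by blast
  qed
  moreover obtain k where "t * c < real k" using reals_Archimedean2 by blast
  ultimately show ?thesis using c by (metis less_le_trans pos_less_divide_eq)
qed

lemma J_interval:
  assumes "0 \<le> t" shows "\<exists>n. J y e n \<le> t \<and> t < J y e (Suc n)"
proof -
  define k where "k = (LEAST n. t < J y e n)"
  have k: "t < J y e k" unfolding k_def using J_unbounded by (rule LeastI_ex)
  then have "k \<noteq> 0" using assms by (auto simp: J_def intro: ccontr)
  then obtain n where n: "k = Suc n" by (cases k) auto
  then have "\<not> t < J y e n" unfolding k_def using not_less_Least[of n] by (metis lessI k_def)
  with k n show ?thesis by (auto simp: not_less)
qed

lemma jump_process_J:
  assumes "J y e n \<le> t" "t < J y e (Suc n)"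
  shows "jump_process Q t (y, e) = Some (y n)"
proof -
  have t: "0 \<le> t" using J_nonneg[of n] assms by linarith
  have iff: "ennreal t < jump_time Q k (y, e) \<longleftrightarrow> t < J y e k" for k
    using t by (simp add: jump_time_J ennreal_less_iff)
  have "(LEAST n. t < J y e (Suc n)) = n"
  proof (rule Least_equality)
    fix k assume "t < J y e (Suc k)"
    then have "J y e n < J y e (Suc k)" using assms by simp
    then show "n \<le> k" using J_strict_mono by (simp add: strict_mono_less)
  qed fact
  then show ?thesis using assms by (auto simp: jump_process_def iff)
qed

lemma jump_process_iff:
  assumes "0 \<le> t"
  shows "jump_process Q t (y, e) = Some u \<longleftrightarrow> (\<exists>n. y n = u \<and> J y e n \<le> t \<and> t < J y e (Suc n))"
  using J_interval[OF assms] jump_process_J by (metis option.inject)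

lemma bdd_above_visits: "finite {n. y n = u} \<Longrightarrow> bdd_above {t. 0 \<le> t \<and> jump_process Q t (y, e) = Some u}"
proof -
  assume f: "finite {n. y n = u}"
  define N where "N = Max (insert 0 {n. y n = u})"
  show ?thesis
  proof (rule bdd_aboveI)
    fix t assume "t \<in> {t. 0 \<le> t \<and> jump_process Q t (y, e) = Some u}"
    then obtain n where n: "y n = u" "t < J y e (Suc n)" using jump_process_iff by auto
    then have "n \<le> N" using f by (auto simp: N_def)
    with n J_mono[of "Suc n" "Suc N"] show "t \<le> J y e (Suc N)" by simp
  qed
qed

lemma not_bdd_above_visits:
  assumes "\<forall>m. \<exists>n>m. y n = u"
  shows "\<not> bdd_above {t. 0 \<le> t \<and> jump_process Q t (y, e) = Some u}"
proof
  assume "bdd_above {t. 0 \<le> t \<and> jump_process Q t (y, e) = Some u}"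
  then obtain B where B: "\<And>t. 0 \<le> t \<Longrightarrow> jump_process Q t (y, e) = Some u \<Longrightarrow> t \<le> B"
    by (auto simp: bdd_above_def)
  obtain m where m: "B < J y e m" using J_unbounded by blast
  obtain n where n: "n > m" "y n = u" using assms by blast
  have "J y e n \<le> B" using B[of "J y e n"] J_nonneg jump_process_J[of n "J y e n"] J_strict_mono n by (simp add: strict_mono_less)
  with m n J_mono[of m n] show False by simp
qed

text \<open>The return happens at the first \<open>k > 0\<close> with \<open>y k = u\<close>, and
  the \<open>i\<close>th holding time belongs to the sum iff \<open>i < k\<close>, that is, iff
  \<open>u\<close> is avoided at times 1 to \<open>i\<close>. The indicator depends on the
  trajectory only, so it can be integrated separately from the holding times.\<close>

lemma return_time_eq:
  assumes "\<exists>n>0. y n = u"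
  shows "return_time Q u (y, e) =
    (\<Sum>i. ennreal (e i / exit_rate Q (y i)) * indicator {y. \<forall>j\<in>{1..i}. y j \<noteq> u} y)"
proof -
  define k where "k = (LEAST n. 0 < n \<and> y n = u)"
  have k: "0 < k" "y k = u" using LeastI_ex[of "\<lambda>n. 0 < n \<and> y n = u"] assms by (auto simp: k_def)
  have least: "k \<le> n" if "0 < n" "y n = u" for n unfolding k_def using that by (intro Least_le) auto
  have "return_time Q u (y, e) = ennreal (J y e k)"
    unfolding return_time_def
  proof (rule antisym)
    show "Inf {ennreal t |t. 0 \<le> t \<and> jump_time Q 1 (y, e) \<le> ennreal t \<and> jump_process Q t (y, e) = Some u} \<le> ennreal (J y e k)"
      using k J_nonneg J_mono[of 1 k] J_strict_mono jump_process_J[of k "J y e k"]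
      by (intro Inf_lower) (auto simp: jump_time_J ennreal_leI strict_mono_less intro!: exI[of _ "J y e k"])
    show "ennreal (J y e k) \<le> Inf {ennreal t |t. 0 \<le> t \<and> jump_time Q 1 (y, e) \<le> ennreal t \<and> jump_process Q t (y, e) = Some u}"
    proof (rule Inf_greatest, clarify)
      fix t assume t: "0 \<le> t" "jump_time Q 1 (y, e) \<le> ennreal t" "jump_process Q t (y, e) = Some u"
      then obtain n where n: "y n = u" "J y e n \<le> t" "t < J y e (Suc n)" using jump_process_iff by blast
      have "J y e 1 \<le> t" using t by (simp add: jump_time_J)
      then have "J y e 1 < J y e (Suc n)" using n by linarith
      then have "0 < n" using J_strict_mono by (auto simp: strict_mono_less)
      then have "k \<le> n" using n least by simp
      then show "ennreal (J y e k) \<le> ennreal t" using J_mono[of k n] n by (intro ennreal_leI) linarith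
    qed
  qed
  also have "\<dots> = (\<Sum>i<k. ennreal (e i / exit_rate Q (y i)))"
    unfolding J_def using J_step(2) by (intro sum_ennreal[symmetric]) (simp add: less_imp_le)
  also have "\<dots> = (\<Sum>i<k. ennreal (e i / exit_rate Q (y i)) * indicator {y. \<forall>j\<in>{1..i}. y j \<noteq> u} y)"
  proof (intro sum.cong refl)
    fix i assume "i \<in> {..<k}"
    then have "y j \<noteq> u" if "1 \<le> j" "j \<le> i" for j using least[of j] that by auto
    then have "y \<in> {y. \<forall>j\<in>{1..i}. y j \<noteq> u}" by simp
    then show "ennreal (e i / exit_rate Q (y i)) =
        ennreal (e i / exit_rate Q (y i)) * indicator {y. \<forall>j\<in>{1..i}. y j \<noteq> u} y"
      by (simp only: indicator_simps mult_1_right)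
  qed
  also have "\<dots> = (\<Sum>i. ennreal (e i / exit_rate Q (y i)) * indicator {y. \<forall>j\<in>{1..i}. y j \<noteq> u} y)"
  proof (intro suminf_finite[symmetric] finite_lessThan)
    fix i assume "i \<notin> {..<k}"
    then have "y \<notin> {y. \<forall>j\<in>{1..i}. y j \<noteq> u}" using k by (auto intro!: bexI[of _ k])
    then show "ennreal (e i / exit_rate Q (y i)) * indicator {y. \<forall>j\<in>{1..i}. y j \<noteq> u} y = 0"
      by (subst indicator_simps(2)) simp_all
  qed
  finally show ?thesis .
qed

end

text \<open>The two bounds on the rates compare the expected return time with the expected number of
  jumps until the return, which is the sum of the avoidance probabilities.\<close>

lemma nn_integral_return_time:
  assumes u: "u \<in> L" and hit: "\<And>u'. u' \<in> L \<Longrightarrow> (\<lambda>n. avoid (jump_kernel Q) u n u') \<longlonglongrightarrow> 0"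
  shows "(\<integral>\<^sup>+\<omega>. return_time Q u \<omega> \<partial>path_law Q u) \<le> ennreal (1 / c0) * (\<Sum>i. avoid (jump_kernel Q) u i u)"
    and "ennreal (1 / c) * (\<Sum>i. avoid (jump_kernel Q) u i u) \<le> (\<integral>\<^sup>+\<omega>. return_time Q u \<omega> \<partial>path_law Q u)"
proof -
  let ?a = "\<lambda>i y. indicator {y. \<forall>j\<in>{1..i}. y j \<noteq> u} y :: ennreal"
  have c: "0 < c" using rate_pos[OF u] rate_le[OF u] by simp
  interpret Y: prob_space "jump_chain_law Q u" by (rule prob_space_jump_chain_law)
  have m1 [measurable]: "?a i \<in> borel_measurable (jump_chain_law Q u)" for i
    by (subst measurable_cong_sets[OF sets_jump_chain_law refl]) measurable
  \<comment> \<open>Holding times have mean 1 and are independent of the trajectory.\<close>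
  have calc: "(\<integral>\<^sup>+\<omega>. (\<Sum>i. ennreal (b * snd \<omega> i) * ?a i (fst \<omega>)) \<partial>path_law Q u) = ennreal b * (\<Sum>i. avoid (jump_kernel Q) u i u)"
    if b: "0 \<le> b" for b
  proof -
    have [measurable]: "(\<lambda>e. e i) \<in> borel_measurable hold_law" for i
      using measurable_component_singleton[of i UNIV "\<lambda>_. exp1"] by (simp cong: measurable_cong_sets)
    have "(\<integral>\<^sup>+\<omega>. (\<Sum>i. ennreal (b * snd \<omega> i) * ?a i (fst \<omega>)) \<partial>path_law Q u) =
      (\<Sum>i. \<integral>\<^sup>+\<omega>. ennreal (b * snd \<omega> i) * ?a i (fst \<omega>) \<partial>path_law Q u)"
      unfolding path_law_def by (rule nn_integral_suminf) measurable
    also have "\<dots> = (\<Sum>i. ennreal b * avoid (jump_kernel Q) u i u)"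
    proof (rule suminf_cong)
      fix i
      have "(\<integral>\<^sup>+\<omega>. ennreal (b * snd \<omega> i) * ?a i (fst \<omega>) \<partial>path_law Q u) =
        (\<integral>\<^sup>+y. \<integral>\<^sup>+e. ennreal (b * e i) * ?a i y \<partial>hold_law \<partial>jump_chain_law Q u)"
        unfolding path_law_def by (subst hold.P.nn_integral_fst[symmetric]) (simp_all, measurable)
      also have "\<dots> = (\<integral>\<^sup>+y. ennreal b * ?a i y \<partial>jump_chain_law Q u)"
      proof (rule nn_integral_cong)
        fix y
        have "(\<integral>\<^sup>+e. ennreal (b * e i) * ?a i y \<partial>hold_law) = (\<integral>\<^sup>+e. ennreal (e i) * (ennreal b * ?a i y) \<partial>hold_law)"
          using b by (intro nn_integral_cong) (simp add: ennreal_mult' mult_ac)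
        also have "\<dots> = ennreal b * ?a i y"
          using nn_integral_hold_component[of ennreal i] by (subst nn_integral_multc) (auto simp: nn_integral_exp1_id)
        finally show "(\<integral>\<^sup>+e. ennreal (b * e i) * ?a i y \<partial>hold_law) = ennreal b * ?a i y" .
      qed
      also have "\<dots> = ennreal b * avoid (jump_kernel Q) u i u"
        unfolding nn_integral_avoid[symmetric] by (rule nn_integral_cmult) (rule m1)
      finally show "(\<integral>\<^sup>+\<omega>. ennreal (b * snd \<omega> i) * ?a i (fst \<omega>) \<partial>path_law Q u) = \<dots>" .
    qed
    finally show ?thesis by simp
  qed
  have io: "AE y in jump_chain_law Q u. \<forall>m. \<exists>n>m. y n = u"
    by (rule AE_infinitely_many_visits[OF _ hit u]) (use closed in auto)
  have AE: "AE \<omega> in path_law Q u. good (fst \<omega>) (snd \<omega>) \<and> fst \<omega> 0 = u \<and> (\<forall>m. \<exists>n>m. fst \<omega> n = u)"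
    by (rule AE_good[OF u io])
  have ret: "return_time Q u \<omega> = (\<Sum>i. ennreal (snd \<omega> i / exit_rate Q (fst \<omega> i)) * ?a i (fst \<omega>))"
    if "good (fst \<omega>) (snd \<omega>)" "\<forall>m. \<exists>n>m. fst \<omega> n = u" for \<omega>
    using return_time_eq[OF that(1), of u] that(2) by simp
  show "(\<integral>\<^sup>+\<omega>. return_time Q u \<omega> \<partial>path_law Q u) \<le> ennreal (1 / c0) * (\<Sum>i. avoid (jump_kernel Q) u i u)"
    unfolding calc[OF less_imp_le[OF divide_pos_pos[OF zero_less_one c0_pos]], symmetric]
  proof (rule nn_integral_mono_AE, use AE in eventually_elim)
    case (elim \<omega>)
    then have "snd \<omega> i / exit_rate Q (fst \<omega> i) \<le> 1 / c0 * snd \<omega> i" for i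
      using rate_ge[of "fst \<omega> i"] c0_pos by (auto simp: good_def field_simps mult_left_mono less_imp_le intro!: divide_left_mono mult_pos_pos)
    then show ?case
      using elim by (subst ret) (auto intro!: suminf_le summableI mult_right_mono ennreal_leI)
  qed
  show "ennreal (1 / c) * (\<Sum>i. avoid (jump_kernel Q) u i u) \<le> (\<integral>\<^sup>+\<omega>. return_time Q u \<omega> \<partial>path_law Q u)"
    unfolding calc[OF less_imp_le[OF divide_pos_pos[OF zero_less_one c]], symmetric]
  proof (rule nn_integral_mono_AE, use AE in eventually_elim)
    case (elim \<omega>)
    have "1 / c * snd \<omega> i \<le> snd \<omega> i / exit_rate Q (fst \<omega> i)" for i
      using rate_le[of "fst \<omega> i"] rate_pos[of "fst \<omega> i"] c elim by (auto simp: good_def field_simps mult_left_mono less_imp_le)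
    then show ?case
      using elim by (subst ret) (auto intro!: suminf_le summableI mult_right_mono ennreal_leI)
  qed
qed

lemma recurrent_stateI:
  assumes "u \<in> L" "\<And>u'. u' \<in> L \<Longrightarrow> (\<lambda>n. avoid (jump_kernel Q) u n u') \<longlonglongrightarrow> 0"
  shows "recurrent_state Q u"
  unfolding recurrent_state_def
proof -
  have io: "AE y in jump_chain_law Q u. \<forall>m. \<exists>n>m. y n = u"
    by (rule AE_infinitely_many_visits[OF _ assms(2) assms(1)]) (use closed in auto)
  show "AE \<omega> in path_law Q u. \<not> bdd_above {t. 0 \<le> t \<and> jump_process Q t \<omega> = Some u}"
    using AE_good[OF assms(1) io]
  proof eventually_elim
    case (elim \<omega>)
    then show ?case using not_bdd_above_visits[of "fst \<omega>" "snd \<omega>" u] by simp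
  qed
qed

lemma positive_recurrent_stateI:
  assumes "u \<in> L" "\<And>u'. u' \<in> L \<Longrightarrow> (\<lambda>n. avoid (jump_kernel Q) u n u') \<longlonglongrightarrow> 0"
    and fin: "(\<Sum>i. avoid (jump_kernel Q) u i u) < \<infinity>"
  shows "positive_recurrent_state Q u"
proof -
  have "ennreal (1 / c0) * (\<Sum>i. avoid (jump_kernel Q) u i u) < \<infinity>"
    using fin by (simp add: ennreal_mult_less_top)
  then show ?thesis
    unfolding positive_recurrent_state_def
    using recurrent_stateI[OF assms(1,2)] nn_integral_return_time(1)[OF assms(1,2)] by (auto intro: le_less_trans)
qed

lemma null_recurrent_stateI:
  assumes "u \<in> L" "\<And>u'. u' \<in> L \<Longrightarrow> (\<lambda>n. avoid (jump_kernel Q) u n u') \<longlonglongrightarrow> 0"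
    and inf: "(\<Sum>i. avoid (jump_kernel Q) u i u) = \<infinity>"
  shows "null_recurrent_state Q u"
proof -
  have c: "0 < c" using rate_pos[OF assms(1)] rate_le[OF assms(1)] by simp
  then have "ennreal (1 / c) * (\<Sum>i. avoid (jump_kernel Q) u i u) = \<infinity>"
    using inf by (simp add: ennreal_mult_top)
  then show ?thesis
    unfolding null_recurrent_state_def positive_recurrent_state_def
    using recurrent_stateI[OF assms(1,2)] nn_integral_return_time(2)[OF assms(1,2)] rate_pos[OF assms(1)] by (simp add: top_unique)
qed

lemma transient_stateI:
  assumes "u \<in> L" "green (jump_kernel Q) u u < \<infinity>"
  shows "transient_state Q u"
  unfolding transient_state_def
  using AE_good[OF assms(1) AE_finite_visits[OF assms(2)]]
proof eventually_elim
  case (elim \<omega>)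
  then show ?case using bdd_above_visits[of "fst \<omega>" "snd \<omega>" u] by simp
qed

end

lemma not_recurrent_and_transient: "\<not> (recurrent_state Q u \<and> transient_state Q u)"
proof
  assume "recurrent_state Q u \<and> transient_state Q u"
  then have "AE \<omega> in path_law Q u. False"
    unfolding recurrent_state_def transient_state_def by (auto elim: AE_mp)
  interpret prob_space "path_law Q u" by (rule prob_space_path_law)
  show False using \<open>AE \<omega> in path_law Q u. False\<close> by simp
qed

section \<open>Measurability and the first jump in continuous time\<close>

lemma jump_time_mono: "m \<le> n \<Longrightarrow> jump_time Q m \<omega> \<le> jump_time Q n \<omega>"
  unfolding jump_time_def by (cases \<omega>) (auto intro!: sum_mono2)

text \<open>As a countable disjunction instead of a minimum, the event can be handled by the
  measurability rules.\<close>

lemma jump_process_eq_Some_iff: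
  "jump_process Q t \<omega> = Some v \<longleftrightarrow>
     (\<exists>n. fst \<omega> n = v \<and> \<not> ennreal t < jump_time Q n \<omega> \<and> ennreal t < jump_time Q (Suc n) \<omega>)" (is "?l \<longleftrightarrow> ?r")
proof
  assume ?l
  then have ex: "\<exists>n. ennreal t < jump_time Q (Suc n) \<omega>"
    and v: "fst \<omega> (LEAST n. ennreal t < jump_time Q (Suc n) \<omega>) = v"
    by (auto simp: jump_process_def split: if_splits)
  let ?n = "LEAST n. ennreal t < jump_time Q (Suc n) \<omega>"
  have "\<not> ennreal t < jump_time Q ?n \<omega>"
  proof (cases ?n)
    case 0
    show ?thesis unfolding 0 by (simp add: jump_time_def case_prod_beta)
  next
    case (Suc k)
    then have "\<not> ennreal t < jump_time Q (Suc k) \<omega>" using not_less_Least[of k "\<lambda>n. ennreal t < jump_time Q (Suc n) \<omega>"] by simp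
    then show ?thesis unfolding Suc .
  qed
  then show ?r using v LeastI_ex[OF ex] by blast
next
  assume ?r
  then obtain n where n: "fst \<omega> n = v" "\<not> ennreal t < jump_time Q n \<omega>" "ennreal t < jump_time Q (Suc n) \<omega>" by blast
  have "(LEAST n. ennreal t < jump_time Q (Suc n) \<omega>) = n"
  proof (rule Least_equality)
    fix k assume "ennreal t < jump_time Q (Suc k) \<omega>"
    then show "n \<le> k" using n(2) jump_time_mono[of "Suc k" n Q \<omega>] by (metis not_less_eq_eq leI less_le_trans)
  qed (rule n)
  then show ?l using n by (auto simp: jump_process_def)
qed

abbreviation path_space :: "((nat \<Rightarrow> 's) \<times> (nat \<Rightarrow> real)) measure" where
  "path_space \<equiv> traj_space \<Otimes>\<^sub>M hold_law"

lemma sets_path_law [measurable_cong]: "sets (path_law Q u) = sets path_space"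
  unfolding path_law_def by (intro sets_pair_measure_cong sets_jump_chain_law refl)

lemma space_path_law [simp]: "space (path_law Q u) = UNIV"
  by (simp add: path_law_def space_pair_measure space_PiM)

lemma measurable_hold_component [measurable]: "(\<lambda>e. e i) \<in> borel_measurable hold_law"
  using measurable_component_singleton[of i UNIV "\<lambda>_. exp1"] by (simp cong: measurable_cong_sets)

lemma measurable_jump_time [measurable]: "(\<lambda>\<omega>. jump_time Q n \<omega>) \<in> borel_measurable path_space"
proof -
  have [measurable]: "(\<lambda>y. ennreal (exit_rate Q (y i))) \<in> borel_measurable traj_space" for i
    by (rule borel_measurable_traj_component)
  show ?thesis unfolding jump_time_def case_prod_beta by measurable
qed

lemma measurable_jump_process [measurable]:
  "Measurable.pred (borel \<Otimes>\<^sub>M path_space) (\<lambda>x. jump_process Q (fst x) (snd x) = Some v)"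
proof -
  have [measurable]: "Measurable.pred traj_space (\<lambda>y. y n = v)" for n :: nat by measurable
  show ?thesis unfolding jump_process_eq_Some_iff by measurable
qed

lemma measurable_jump_process_path [measurable]: "Measurable.pred path_space (\<lambda>\<omega>. jump_process Q t \<omega> = Some v)"
  using measurable_compose[OF measurable_Pair1'[of t borel path_space] measurable_jump_process[of Q v]] by simp

lemma case_nat_traj_measurable [measurable]: "case_nat u \<in> traj_space \<rightarrow>\<^sub>M traj_space"
  by (rule measurable_PiM_single') (auto split: nat.split simp: space_PiM intro!: measurable_component_singleton)

lemma nn_integral_hold_first_step:
  assumes [measurable]: "H \<in> borel_measurable hold_law"
  shows "(\<integral>\<^sup>+e. H e \<partial>hold_law) = (\<integral>\<^sup>+s. \<integral>\<^sup>+e. H (case_nat s e) \<partial>hold_law \<partial>exp1)"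
proof -
  have "(\<integral>\<^sup>+e. H e \<partial>hold_law) = (\<integral>\<^sup>+e. H e \<partial>distr (exp1 \<Otimes>\<^sub>M hold_law) hold_law (\<lambda>(s, \<omega>). case_nat s \<omega>))"
    by (simp only: hold.PiM_iter)
  also have "\<dots> = (\<integral>\<^sup>+x. H (case x of (s, \<omega>) \<Rightarrow> case_nat s \<omega>) \<partial>(exp1 \<Otimes>\<^sub>M hold_law))"
    by (rule nn_integral_distr) measurable
  also have "\<dots> = (\<integral>\<^sup>+s. \<integral>\<^sup>+e. H (case_nat s e) \<partial>hold_law \<partial>exp1)"
    by (subst hold.P.nn_integral_fst[symmetric]) auto
  finally show ?thesis .
qed

text \<open>Markov property at the first jump, with the holding time \<open>s\<close> split off.
  Finitely many successors let the integral over \<open>s\<close> pass through the sum over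
  \<open>w\<close>.\<close>

lemma nn_integral_path_law_first_step:
  assumes fin: "finite (set_pmf (jump_kernel Q u))"
    and G [measurable]: "G \<in> borel_measurable path_space"
  shows "(\<integral>\<^sup>+\<omega>. G \<omega> \<partial>path_law Q u) =
    (\<integral>\<^sup>+s. kop (jump_kernel Q) (\<lambda>w. \<integral>\<^sup>+\<omega>. G (case_nat u (fst \<omega>), case_nat s (snd \<omega>)) \<partial>path_law Q w) u \<partial>exp1)"
proof -
  let ?K = "jump_kernel Q"
  have kf: "kop ?K f u = (\<Sum>w\<in>set_pmf (?K u). f w * ennreal (pmf (?K u) w))" for f
    unfolding kop_def by (rule nn_integral_measure_pmf_finite[OF fin]) simp
  have m1 [measurable]: "(\<lambda>x. G (case_nat u (fst (snd x)), case_nat (fst x) (snd (snd x)))) \<in> borel_measurable (exp1 \<Otimes>\<^sub>M path_law Q w)" for w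
    by measurable
  interpret P: prob_space "path_law Q w" for w by (rule prob_space_path_law)
  interpret Y: prob_space "jump_chain_law Q w" for w by (rule prob_space_jump_chain_law)
  have [measurable]: "(\<lambda>y. \<integral>\<^sup>+e. G (y, e) \<partial>hold_law) \<in> borel_measurable traj_space"
    by measurable
  have "(\<integral>\<^sup>+\<omega>. G \<omega> \<partial>path_law Q u) = (\<integral>\<^sup>+y. \<integral>\<^sup>+e. G (y, e) \<partial>hold_law \<partial>jump_chain_law Q u)"
    unfolding path_law_def by (subst hold.P.nn_integral_fst) (auto cong: measurable_cong_sets)
  also have "\<dots> = kop ?K (\<lambda>w. \<integral>\<^sup>+y. \<integral>\<^sup>+e. G (case_nat u y, e) \<partial>hold_law \<partial>jump_chain_law Q w) u"
    by (rule nn_integral_jump_chain_first_step) measurable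
  also have "\<dots> = kop ?K (\<lambda>w. \<integral>\<^sup>+s. \<integral>\<^sup>+\<omega>. G (case_nat u (fst \<omega>), case_nat s (snd \<omega>)) \<partial>path_law Q w \<partial>exp1) u"
  proof (rule kop_cong)
    fix w
    interpret YE: pair_sigma_finite "jump_chain_law Q w" exp1 ..
    have "(\<integral>\<^sup>+y. \<integral>\<^sup>+e. G (case_nat u y, e) \<partial>hold_law \<partial>jump_chain_law Q w) =
      (\<integral>\<^sup>+y. \<integral>\<^sup>+s. \<integral>\<^sup>+e. G (case_nat u y, case_nat s e) \<partial>hold_law \<partial>exp1 \<partial>jump_chain_law Q w)"
    proof (rule nn_integral_cong)
      fix y
      have "(\<lambda>e. G (case_nat u y, e)) \<in> borel_measurable hold_law"
        by (rule measurable_compose[OF measurable_Pair1' G]) (simp add: space_PiM)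
      then show "(\<integral>\<^sup>+e. G (case_nat u y, e) \<partial>hold_law) = (\<integral>\<^sup>+s. \<integral>\<^sup>+e. G (case_nat u y, case_nat s e) \<partial>hold_law \<partial>exp1)"
        by (rule nn_integral_hold_first_step)
    qed
    also have "\<dots> = (\<integral>\<^sup>+s. \<integral>\<^sup>+y. \<integral>\<^sup>+e. G (case_nat u y, case_nat s e) \<partial>hold_law \<partial>jump_chain_law Q w \<partial>exp1)"
      by (rule YE.Fubini'[symmetric]) measurable
    also have "\<dots> = (\<integral>\<^sup>+s. \<integral>\<^sup>+\<omega>. G (case_nat u (fst \<omega>), case_nat s (snd \<omega>)) \<partial>path_law Q w \<partial>exp1)"
    proof (rule nn_integral_cong)
      fix s
      have "(\<lambda>\<omega>. G (case_nat u (fst \<omega>), case_nat s (snd \<omega>))) \<in> borel_measurable (jump_chain_law Q w \<Otimes>\<^sub>M hold_law)"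
        by measurable
      from hold.P.nn_integral_fst[OF this]
      show "(\<integral>\<^sup>+y. \<integral>\<^sup>+e. G (case_nat u y, case_nat s e) \<partial>hold_law \<partial>jump_chain_law Q w) =
        (\<integral>\<^sup>+\<omega>. G (case_nat u (fst \<omega>), case_nat s (snd \<omega>)) \<partial>path_law Q w)"
        unfolding path_law_def by simp
    qed
    finally show "(\<integral>\<^sup>+y. \<integral>\<^sup>+e. G (case_nat u y, e) \<partial>hold_law \<partial>jump_chain_law Q w) = \<dots>" .
  qed
  also have "\<dots> = (\<integral>\<^sup>+s. kop ?K (\<lambda>w. \<integral>\<^sup>+\<omega>. G (case_nat u (fst \<omega>), case_nat s (snd \<omega>)) \<partial>path_law Q w) u \<partial>exp1)"
    unfolding kf by (subst nn_integral_sum) (auto simp: nn_integral_multc)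
  finally show ?thesis .
qed

lemma jump_process_first_step:
  assumes "0 \<le> t" "0 \<le> s" "0 < exit_rate Q u"
  shows "jump_process Q t (case_nat u y, case_nat s e) = Some v \<longleftrightarrow>
    (if t < s / exit_rate Q u then u = v else jump_process Q (t - s / exit_rate Q u) (y, e) = Some v)"
proof -
  let ?h = "s / exit_rate Q u"
  have h: "0 \<le> ?h" using assms by simp
  have jt: "jump_time Q (Suc n) (case_nat u y, case_nat s e) = ennreal ?h + jump_time Q n (y, e)" for n
    using assms unfolding jump_time_def prod.case
    by (subst sum.lessThan_Suc_shift) (simp add: divide_ennreal)
  have j0: "jump_time Q 0 \<omega> = 0" for \<omega> :: "(nat \<Rightarrow> _) \<times> _" by (simp add: jump_time_def case_prod_beta)
  show ?thesis
  proof (cases "t < ?h")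
    case True
    have lt0: "ennreal t < ennreal ?h" using True assms(1) by (intro ennreal_lessI) linarith+
    have lt: "ennreal t < ennreal ?h + x" for x
      by (rule order_less_le_trans[OF lt0]) simp
    have "jump_process Q t (case_nat u y, case_nat s e) = Some v \<longleftrightarrow> u = v"
    proof
      assume "jump_process Q t (case_nat u y, case_nat s e) = Some v"
      then obtain n where n: "case_nat u y n = v" "\<not> ennreal t < jump_time Q n (case_nat u y, case_nat s e)"
        unfolding jump_process_eq_Some_iff by auto
      then show "u = v" by (cases n) (auto simp: jt lt)
    next
      assume "u = v"
      then show "jump_process Q t (case_nat u y, case_nat s e) = Some v"
        unfolding jump_process_eq_Some_iff
      proof (intro exI[of _ 0] conjI)
        show "ennreal t < jump_time Q (Suc 0) (case_nat u y, case_nat s e)" unfolding jt by (rule lt)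
      qed (simp_all add: j0)
    qed
    with True show ?thesis by simp
  next
    case False
    then have "ennreal t = ennreal ?h + ennreal (t - ?h)" using h by (simp flip: ennreal_plus)
    then have lt: "ennreal t < ennreal ?h + x \<longleftrightarrow> ennreal (t - ?h) < x" for x
      by (simp add: ennreal_add_left_cancel_less)
    have "jump_process Q t (case_nat u y, case_nat s e) = Some v \<longleftrightarrow> jump_process Q (t - ?h) (y, e) = Some v"
    proof
      assume "jump_process Q t (case_nat u y, case_nat s e) = Some v"
      then obtain n where n: "case_nat u y n = v" "\<not> ennreal t < jump_time Q n (case_nat u y, case_nat s e)"
         "ennreal t < jump_time Q (Suc n) (case_nat u y, case_nat s e)"
        unfolding jump_process_eq_Some_iff by auto
      have a: "ennreal (t - ?h) < jump_time Q n (y, e)" using n(3) unfolding jt lt .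
      then obtain k where k: "n = Suc k" by (cases n) (auto simp: j0)
      have b: "\<not> ennreal (t - ?h) < jump_time Q k (y, e)" using n(2) unfolding k jt lt .
      show "jump_process Q (t - ?h) (y, e) = Some v"
        unfolding jump_process_eq_Some_iff using a b n(1) k by auto
    next
      assume "jump_process Q (t - ?h) (y, e) = Some v"
      then obtain n where "y n = v" "\<not> ennreal (t - ?h) < jump_time Q n (y, e)" "ennreal (t - ?h) < jump_time Q (Suc n) (y, e)"
        unfolding jump_process_eq_Some_iff by auto
      then show "jump_process Q t (case_nat u y, case_nat s e) = Some v"
        unfolding jump_process_eq_Some_iff by (intro exI[of _ "Suc n"]) (simp add: jt lt)
    qed
    with False show ?thesis by simp
  qed
qed

lemma emeasure_transition:
  "emeasure (path_law Q u) {\<omega>. jump_process Q t \<omega> = Some v} = ennreal (transition_prob Q t u v)"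
proof -
  interpret prob_space "path_law Q u" by (rule prob_space_path_law)
  show ?thesis by (simp add: transition_prob_def emeasure_eq_measure)
qed

lemma transition_prob_bounds: "0 \<le> transition_prob Q t u v" "transition_prob Q t u v \<le> 1"
proof -
  interpret prob_space "path_law Q u" by (rule prob_space_path_law)
  show "0 \<le> transition_prob Q t u v" "transition_prob Q t u v \<le> 1" by (simp_all add: transition_prob_def)
qed

lemma measurable_transition_prob [measurable]: "(\<lambda>t. transition_prob Q t u v) \<in> borel_measurable borel"
proof -
  interpret prob_space "path_law Q u" by (rule prob_space_path_law)
  have "(\<lambda>t. \<integral>\<^sup>+\<omega>. indicator {x. jump_process Q (fst x) (snd x) = Some v} (t, \<omega>) \<partial>path_law Q u) \<in> borel_measurable borel"
  proof -
    have [measurable]: "Measurable.pred (borel \<Otimes>\<^sub>M path_law Q u) (\<lambda>x. jump_process Q (fst x) (snd x) = Some v)"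
      using measurable_jump_process[of Q v] by (simp cong: measurable_cong_sets add: sets_pair_measure_cong[OF refl sets_path_law])
    show ?thesis by measurable
  qed
  also have "(\<lambda>t. \<integral>\<^sup>+\<omega>. indicator {x. jump_process Q (fst x) (snd x) = Some v} (t, \<omega>) \<partial>path_law Q u) = (\<lambda>t. ennreal (transition_prob Q t u v))"
  proof
    fix t
    have "(\<integral>\<^sup>+\<omega>. indicator {x. jump_process Q (fst x) (snd x) = Some v} (t, \<omega>) \<partial>path_law Q u) =
      (\<integral>\<^sup>+\<omega>. indicator {\<omega>. jump_process Q t \<omega> = Some v} \<omega> \<partial>path_law Q u)"
      by (intro nn_integral_cong) (simp add: indicator_def)
    also have "\<dots> = ennreal (transition_prob Q t u v)"
    proof -
      have "{\<omega>. jump_process Q t \<omega> = Some v} \<in> sets (path_law Q u)"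
        using measurable_jump_process_path[of Q t v] unfolding sets_path_law pred_def by (simp add: space_pair_measure space_PiM)
      then show ?thesis by (simp add: emeasure_transition)
    qed
    finally show "(\<integral>\<^sup>+\<omega>. indicator {x. jump_process Q (fst x) (snd x) = Some v} (t, \<omega>) \<partial>path_law Q u) = ennreal (transition_prob Q t u v)" .
  qed
  finally have "(\<lambda>t. enn2real (ennreal (transition_prob Q t u v))) \<in> borel_measurable borel" by measurable
  then show ?thesis by (simp add: transition_prob_bounds)
qed

lemma sum_transition_prob_le_1:
  assumes "finite V" shows "(\<Sum>v\<in>V. transition_prob Q t u v) \<le> 1"
proof -
  interpret prob_space "path_law Q u" by (rule prob_space_path_law)
  have s: "{\<omega>. jump_process Q t \<omega> = Some v} \<in> sets (path_law Q u)" for v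
    using measurable_jump_process_path[of Q t v] unfolding sets_path_law pred_def by (simp add: space_pair_measure space_PiM)
  have "(\<Sum>v\<in>V. transition_prob Q t u v) = prob (\<Union>v\<in>V. {\<omega>. jump_process Q t \<omega> = Some v})"
    unfolding transition_prob_def
    by (subst finite_measure_finite_Union) (use assms s in \<open>auto simp: disjoint_family_on_def\<close>)
  then show ?thesis by simp
qed

section \<open>Transition probabilities\<close>

declare measurable_traj_component [measurable del] measurable_hold_component [measurable del]

locale finite_bounded_rates = bounded_rates +
  assumes finite_succ: "u \<in> L \<Longrightarrow> finite (set_pmf (jump_kernel Q u))"
begin

definition jump_mean :: "('a \<Rightarrow> real) \<Rightarrow> 'a \<Rightarrow> real" where
  "jump_mean f u = (\<Sum>w\<in>set_pmf (jump_kernel Q u). pmf (jump_kernel Q u) w * f w)"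

lemma kop_ennreal:
  assumes "u \<in> L" "\<And>w. 0 \<le> f w"
  shows "kop (jump_kernel Q) (\<lambda>w. ennreal (f w)) u = ennreal (jump_mean f u)"
proof -
  have "kop (jump_kernel Q) (\<lambda>w. ennreal (f w)) u = (\<Sum>w\<in>set_pmf (jump_kernel Q u). ennreal (f w) * ennreal (pmf (jump_kernel Q u) w))"
    unfolding kop_def by (rule nn_integral_measure_pmf_finite[OF finite_succ[OF assms(1)]]) simp
  also have "\<dots> = (\<Sum>w\<in>set_pmf (jump_kernel Q u). ennreal (pmf (jump_kernel Q u) w * f w))"
    using assms(2) by (intro sum.cong) (simp_all add: ennreal_mult mult.commute)
  also have "\<dots> = ennreal (jump_mean f u)"
    unfolding jump_mean_def using assms(2) by (intro sum_ennreal) simp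
  finally show ?thesis .
qed

lemma jump_mean_bounds:
  assumes "u \<in> L" "\<And>w. 0 \<le> f w" "\<And>w. f w \<le> 1"
  shows "0 \<le> jump_mean f u" "jump_mean f u \<le> 1"
proof -
  show "0 \<le> jump_mean f u" unfolding jump_mean_def using assms by (intro sum_nonneg) auto
  have "jump_mean f u \<le> (\<Sum>w\<in>set_pmf (jump_kernel Q u). pmf (jump_kernel Q u) w * 1)"
    unfolding jump_mean_def using assms by (intro sum_mono mult_left_mono) auto
  also have "\<dots> = 1" using sum_pmf_eq_1[OF finite_succ[OF assms(1)] order_refl] by simp
  finally show "jump_mean f u \<le> 1" .
qed

lemma transition_backward_nn:
  assumes u: "u \<in> L" and t: "0 \<le> t"
  shows "ennreal (transition_prob Q t u v) =
    (\<integral>\<^sup>+s. ennreal (if t < s / exit_rate Q u then of_bool (u = v)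
       else jump_mean (\<lambda>w. transition_prob Q (t - s / exit_rate Q u) w v) u) \<partial>exp1)"
proof -
  let ?q = "exit_rate Q u"
  have s: "{\<omega>. jump_process Q t \<omega> = Some v} \<in> sets (path_law Q w)" for t w
    using measurable_jump_process_path[of Q t v] unfolding sets_path_law pred_def by (simp add: space_pair_measure space_PiM)
  have em: "(\<integral>\<^sup>+\<omega>. indicator {\<omega>. jump_process Q t \<omega> = Some v} \<omega> \<partial>path_law Q w) = ennreal (transition_prob Q t w v)" for t w
    using s by (simp add: emeasure_transition)
  have "ennreal (transition_prob Q t u v) = (\<integral>\<^sup>+\<omega>. indicator {\<omega>. jump_process Q t \<omega> = Some v} \<omega> \<partial>path_law Q u)"
    by (rule em[symmetric])
  also have "\<dots> = (\<integral>\<^sup>+s. kop (jump_kernel Q) (\<lambda>w. \<integral>\<^sup>+\<omega>. indicator {\<omega>. jump_process Q t \<omega> = Some v} (case_nat u (fst \<omega>), case_nat s (snd \<omega>)) \<partial>path_law Q w) u \<partial>exp1)"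
    by (rule nn_integral_path_law_first_step[OF finite_succ[OF u]]) measurable
  also have "\<dots> = (\<integral>\<^sup>+s. ennreal (if t < s / ?q then of_bool (u = v)
       else jump_mean (\<lambda>w. transition_prob Q (t - s / ?q) w v) u) \<partial>exp1)"
  proof (rule nn_integral_cong_AE, use AE_exp1_pos in eventually_elim)
    case (elim s)
    show ?case
    proof (cases "t < s / ?q")
      case True
      have "(\<integral>\<^sup>+\<omega>. indicator {\<omega>. jump_process Q t \<omega> = Some v} (case_nat u (fst \<omega>), case_nat s (snd \<omega>)) \<partial>path_law Q w) = ennreal (of_bool (u = v))" for w
      proof -
        interpret prob_space "path_law Q w" by (rule prob_space_path_law)
        have "(\<integral>\<^sup>+\<omega>. indicator {\<omega>. jump_process Q t \<omega> = Some v} (case_nat u (fst \<omega>), case_nat s (snd \<omega>)) \<partial>path_law Q w) = (\<integral>\<^sup>+\<omega>. ennreal (of_bool (u = v)) \<partial>path_law Q w)"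
          using True elim t rate_pos[OF u] by (intro nn_integral_cong) (simp add: indicator_def jump_process_first_step)
        also have "\<dots> = ennreal (of_bool (u = v))" using emeasure_space_1 by simp
        finally show ?thesis .
      qed
      with True show ?thesis by simp
    next
      case False
      have "(\<integral>\<^sup>+\<omega>. indicator {\<omega>. jump_process Q t \<omega> = Some v} (case_nat u (fst \<omega>), case_nat s (snd \<omega>)) \<partial>path_law Q w) = ennreal (transition_prob Q (t - s / ?q) w v)" for w
        unfolding em[symmetric]
        using False elim t rate_pos[OF u] by (intro nn_integral_cong) (simp add: indicator_def jump_process_first_step)
      with False show ?thesis by (simp add: kop_ennreal[OF u transition_prob_bounds(1)])
    qed
  qed
  finally show ?thesis .
qed

lemma nn_integral_exp1_tail:
  assumes "0 \<le> a" shows "(\<integral>\<^sup>+s. indicator {a<..} s \<partial>exp1) = ennreal (exp (- a))"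
proof -
  have "emeasure exp1 {a<..} = emeasure exp1 (space exp1 - {..a})" by (rule arg_cong[where f="emeasure exp1"]) auto
  also have "\<dots> = emeasure exp1 (space exp1) - emeasure exp1 {..a}"
    by (rule emeasure_compl) (auto simp: exp1.emeasure_eq_measure)
  also have "\<dots> = ennreal 1 - ennreal (1 - exp (- a))"
    using emeasure_erlang_density[of 1 0 a] assms exp1.emeasure_space_1 by (simp add: erlang_CDF_0)
  also have "\<dots> = ennreal (exp (- a))" using assms by (subst ennreal_minus) auto
  finally show ?thesis by simp
qed

definition K_trans :: "'a \<Rightarrow> 'a \<Rightarrow> real \<Rightarrow> real" where
  "K_trans v u s = jump_mean (\<lambda>w. transition_prob Q s w v) u"

lemma K_trans_measurable [measurable]: "K_trans v u \<in> borel_measurable borel"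
  unfolding K_trans_def jump_mean_def by measurable

lemma K_trans_bounds: "u \<in> L \<Longrightarrow> 0 \<le> K_trans v u s" "u \<in> L \<Longrightarrow> K_trans v u s \<le> 1"
  by (auto simp: K_trans_def transition_prob_bounds intro!: jump_mean_bounds)

lemma integrable_K:
  assumes u: "u \<in> L"
  shows "set_integrable lborel {0..t} (\<lambda>s. exit_rate Q u * exp (exit_rate Q u * s) * K_trans v u s)"
proof -
  let ?q = "exit_rate Q u"
  have q: "0 < ?q" by (rule rate_pos[OF u])
  show ?thesis
    unfolding set_integrable_def
  proof (rule Bochner_Integration.integrable_bound)
    show "integrable lborel (\<lambda>s. indicator {0..t} s *\<^sub>R (?q * exp (?q * t)))"
      by (auto intro!: integrable_real_indicator integrable_scaleR_left simp: emeasure_lborel_Icc_eq)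
    show "AE x in lborel. norm (indicator {0..t} x *\<^sub>R (?q * exp (?q * x) * K_trans v u x)) \<le> norm (indicator {0..t} x *\<^sub>R (?q * exp (?q * t)))"
    proof (rule AE_I2)
      fix x
      have "?q * exp (?q * x) * K_trans v u x \<le> ?q * exp (?q * t) * 1" if "0 \<le> x" "x \<le> t"
        using q that K_trans_bounds[OF u, of v x] by (intro mult_mono) auto
      then show "norm (indicator {0..t} x *\<^sub>R (?q * exp (?q * x) * K_trans v u x)) \<le> norm (indicator {0..t} x *\<^sub>R (?q * exp (?q * t)))"
        using q K_trans_bounds[OF u, of v x] by (auto simp: indicator_def abs_mult)
    qed
  qed measurable
qed

text \<open>Kolmogorov's backward equation in integrated form. The integrand does not involve
  \<open>t\<close>, which yields first continuity and then differentiability in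
  \<open>t\<close>.\<close>

lemma transition_backward:
  assumes u: "u \<in> L" and t: "0 \<le> t"
  shows "transition_prob Q t u v = exp (- exit_rate Q u * t) * (of_bool (u = v) +
    integral {0..t} (\<lambda>s. exit_rate Q u * exp (exit_rate Q u * s) * K_trans v u s))"
proof -
  let ?q = "exit_rate Q u" and ?k = "K_trans v u"
  have q: "0 < ?q" by (rule rate_pos[OF u])
  note k = K_trans_bounds[OF u, of v]
  let ?g = "\<lambda>s. ?q * exp (?q * s) * ?k s"
  have g0: "0 \<le> ?g s" for s using q k by simp
  have split_if: "ennreal (if P then a else b) = ennreal a * indicator {z<..} s + ennreal b * indicator {..z} s"
    if "P \<longleftrightarrow> z < s" for P a b and z s :: real
    using that by (cases P) (simp_all add: not_less)
  have "ennreal (transition_prob Q t u v) = (\<integral>\<^sup>+s. ennreal (of_bool (u = v)) * indicator {t * ?q<..} s + ennreal (?k (t - s / ?q)) * indicator {..t * ?q} s \<partial>exp1)"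
    unfolding transition_backward_nn[OF u t] K_trans_def
  proof (rule nn_integral_cong)
    fix s
    show "ennreal (if t < s / ?q then of_bool (u = v) else jump_mean (\<lambda>w. transition_prob Q (t - s / ?q) w v) u) =
      ennreal (of_bool (u = v)) * indicator {t * ?q<..} s +
      ennreal (jump_mean (\<lambda>w. transition_prob Q (t - s / ?q) w v) u) * indicator {..t * ?q} s"
      by (rule split_if) (rule pos_less_divide_eq[OF q])
  qed
  also have "\<dots> = (\<integral>\<^sup>+s. ennreal (of_bool (u = v)) * indicator {t * ?q<..} s \<partial>exp1) + (\<integral>\<^sup>+s. ennreal (?k (t - s / ?q)) * indicator {..t * ?q} s \<partial>exp1)"
    by (rule nn_integral_add) measurable
  also have "(\<integral>\<^sup>+s. ennreal (of_bool (u = v)) * indicator {t * ?q<..} s \<partial>exp1) = ennreal (of_bool (u = v)) * ennreal (exp (- (t * ?q)))"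
    using nn_integral_exp1_tail[of "t * ?q"] t q by (subst nn_integral_cmult) auto
  also have "(\<integral>\<^sup>+s. ennreal (?k (t - s / ?q)) * indicator {..t * ?q} s \<partial>exp1) =
     (\<integral>\<^sup>+s. ennreal (exponential_density 1 s) * (ennreal (?k (t - s / ?q)) * indicator {..t * ?q} s) \<partial>lborel)"
    by (rule nn_integral_density) (auto simp: exponential_density_nonneg)
  \<comment> \<open>Substitution \<open>s = t * q - q * x\<close>, where \<open>x\<close> is the
    time left after the first jump.\<close>
  also have "\<dots> = ennreal \<bar>- ?q\<bar> * (\<integral>\<^sup>+x. ennreal (exponential_density 1 (t * ?q + (- ?q) * x)) * (ennreal (?k (t - (t * ?q + (- ?q) * x) / ?q)) * indicator {..t * ?q} (t * ?q + (- ?q) * x)) \<partial>lborel)"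
    by (rule nn_integral_real_affine) (use q in auto)
  also have "(\<integral>\<^sup>+x. ennreal (exponential_density 1 (t * ?q + (- ?q) * x)) * (ennreal (?k (t - (t * ?q + (- ?q) * x) / ?q)) * indicator {..t * ?q} (t * ?q + (- ?q) * x)) \<partial>lborel) =
     (\<integral>\<^sup>+x. ennreal (exp (- ?q * t) / ?q) * ennreal (indicator {0..t} x *\<^sub>R ?g x) \<partial>lborel)"
  proof (rule nn_integral_cong)
    fix x :: real
    have e1: "t * ?q + - ?q * x < 0 \<longleftrightarrow> t < x" using q by (auto simp: algebra_simps)
    have e2: "t * ?q + - ?q * x \<le> t * ?q \<longleftrightarrow> 0 \<le> x" using q by (simp add: zero_le_mult_iff)
    have e3: "t - (t * ?q + - ?q * x) / ?q = x" using q by (simp add: field_simps)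
    have e4: "exp (- (t * ?q + - ?q * x)) = exp (- ?q * t) / ?q * (?q * exp (?q * x))"
      using q by (simp add: exp_add[symmetric] algebra_simps)
    show "ennreal (exponential_density 1 (t * ?q + - ?q * x)) * (ennreal (?k (t - (t * ?q + - ?q * x) / ?q)) * indicator {..t * ?q} (t * ?q + - ?q * x)) =
      ennreal (exp (- ?q * t) / ?q) * ennreal (indicator {0..t} x *\<^sub>R ?g x)"
    proof (cases "0 \<le> x \<and> x \<le> t")
      case True
      then have "exponential_density 1 (t * ?q + - ?q * x) * ?k (t - (t * ?q + - ?q * x) / ?q) = exp (- ?q * t) / ?q * ?g x"
        unfolding exponential_density_def e1 e3 using e4 by simp
      moreover have "indicator {..t * ?q} (t * ?q + - ?q * x) = (1 :: ennreal)" using True e2 by simp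
      moreover have "ennreal (exponential_density 1 (t * ?q + - ?q * x)) * ennreal (?k (t - (t * ?q + - ?q * x) / ?q)) =
          ennreal (exponential_density 1 (t * ?q + - ?q * x) * ?k (t - (t * ?q + - ?q * x) / ?q))"
        using k by (intro ennreal_mult[symmetric] exponential_density_nonneg) simp_all
      moreover have "ennreal (exp (- ?q * t) / ?q) * ennreal (indicator {0..t} x *\<^sub>R ?g x) = ennreal (exp (- ?q * t) / ?q * ?g x)"
        using True q g0[of x] by (subst ennreal_mult) simp_all
      ultimately show ?thesis by (simp only: mult_1_right)
    next
      case False
      then show ?thesis
      proof (cases "t < x")
        case True
        then have "exponential_density 1 (t * ?q + - ?q * x) = 0" unfolding exponential_density_def e1 by simp
        with True show ?thesis by simp
      next
        case f: False
        then have "x < 0" using False by simp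
        then have "indicator {..t * ?q} (t * ?q + - ?q * x) = (0 :: ennreal)" using e2 by (simp add: indicator_def)
        with \<open>x < 0\<close> show ?thesis by simp
      qed
    qed
  qed
  also have "\<dots> = ennreal (exp (- ?q * t) / ?q) * (\<integral>\<^sup>+x. ennreal (indicator {0..t} x *\<^sub>R ?g x) \<partial>lborel)"
    by (rule nn_integral_cmult) measurable
  also have "(\<integral>\<^sup>+x. ennreal (indicator {0..t} x *\<^sub>R ?g x) \<partial>lborel) = ennreal (\<integral>x. indicator {0..t} x *\<^sub>R ?g x \<partial>lborel)"
    using integrable_K[OF u, of t v] g0 unfolding set_integrable_def by (intro nn_integral_eq_integral) auto
  also have "(\<integral>x. indicator {0..t} x *\<^sub>R ?g x \<partial>lborel) = integral {0..t} ?g"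
    using set_borel_integral_eq_integral(2)[OF integrable_K[OF u, of t v]] unfolding set_lebesgue_integral_def .
  finally have "ennreal (transition_prob Q t u v) = ennreal (of_bool (u = v)) * ennreal (exp (- (t * ?q))) +
    ennreal \<bar>- ?q\<bar> * (ennreal (exp (- ?q * t) / ?q) * ennreal (integral {0..t} ?g))" .
  also have "\<dots> = ennreal (of_bool (u = v) * exp (- (t * ?q)) + ?q * (exp (- ?q * t) / ?q * integral {0..t} ?g))"
  proof -
    have "0 \<le> integral {0..t} ?g"
      using g0 by (intro integral_nonneg set_borel_integral_eq_integral(1)[OF integrable_K[OF u]]) auto
    then show ?thesis using q by (simp add: ennreal_mult'[symmetric] ennreal_mult''[symmetric] flip: ennreal_plus)
  qed
  also have "of_bool (u = v) * exp (- (t * ?q)) + ?q * (exp (- ?q * t) / ?q * integral {0..t} ?g) =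
     exp (- ?q * t) * (of_bool (u = v) + integral {0..t} ?g)"
    using q by (simp add: field_simps)
  finally show ?thesis
  proof (rule ennreal_inj[THEN iffD1, rotated 2])
    have "0 \<le> integral {0..t} ?g"
      using g0 by (intro integral_nonneg set_borel_integral_eq_integral(1)[OF integrable_K[OF u]]) auto
    then show "0 \<le> exp (- ?q * t) * (of_bool (u = v) + integral {0..t} ?g)" by simp
  qed (rule transition_prob_bounds)
qed

lemma transition_prob_0: "u \<in> L \<Longrightarrow> transition_prob Q 0 u v = of_bool (u = v)"
  by (simp add: transition_backward)

lemma transition_continuous:
  assumes "u \<in> L" shows "continuous_on {0..b} (\<lambda>t. transition_prob Q t u v)"
proof -
  have "continuous_on {0..b} (\<lambda>t. exp (- exit_rate Q u * t) * (of_bool (u = v) +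
    integral {0..t} (\<lambda>s. exit_rate Q u * exp (exit_rate Q u * s) * K_trans v u s)))"
    by (intro continuous_intros indefinite_integral_continuous_1 set_borel_integral_eq_integral(1)[OF integrable_K[OF assms]])
  then show ?thesis
    by (rule continuous_on_eq) (simp add: transition_backward[OF assms])
qed

lemma K_trans_continuous: "u \<in> L \<Longrightarrow> continuous_on {0..b} (K_trans v u)"
  unfolding K_trans_def jump_mean_def
  using closed[of u] by (intro continuous_intros transition_continuous) auto

lemma transition_derivative:
  assumes u: "u \<in> L" and t: "0 \<le> t" "t \<le> b"
  shows "((\<lambda>t. transition_prob Q t u v) has_real_derivative
    exit_rate Q u * (K_trans v u t - transition_prob Q t u v)) (at t within {0..b})"
proof -
  let ?q = "exit_rate Q u"
  let ?g = "\<lambda>s. ?q * exp (?q * s) * K_trans v u s"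
  have "((\<lambda>t. integral {0..t} ?g) has_vector_derivative ?g t) (at t within {0..b})"
    by (rule integral_has_vector_derivative) (use t K_trans_continuous[OF u] in \<open>auto intro!: continuous_intros\<close>)
  then have I: "((\<lambda>t. integral {0..t} ?g) has_real_derivative ?g t) (at t within {0..b})"
    by (simp add: has_real_derivative_iff_has_vector_derivative)
  have "((\<lambda>t. exp (- ?q * t) * (d + integral {0..t} ?g)) has_real_derivative
     exp (- ?q * t) * (- ?q) * (d + integral {0..t} ?g) + exp (- ?q * t) * ?g t) (at t within {0..b})" for d
    by (auto intro!: derivative_eq_intros I)
  from this[of "of_bool (u = v)"]
  have "((\<lambda>t. exp (- ?q * t) * (of_bool (u = v) + integral {0..t} ?g)) has_real_derivative
     exp (- ?q * t) * (- ?q) * (of_bool (u = v) + integral {0..t} ?g) + exp (- ?q * t) * ?g t) (at t within {0..b})" .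
  also have "exp (- ?q * t) * (- ?q) * (of_bool (u = v) + integral {0..t} ?g) + exp (- ?q * t) * ?g t =
     ?q * (K_trans v u t - transition_prob Q t u v)"
    unfolding transition_backward[OF u t(1)] by (simp add: algebra_simps exp_minus)
  finally show ?thesis
    by (rule has_field_derivative_transform_within[where d=1]) (use t in \<open>auto simp: transition_backward[OF u]\<close>)
qed

text \<open>Multiplication by \<open>exp (q * t)\<close> removes the loss term: the derivative
  becomes \<open>exp (q * s) * q * K_trans v u s\<close>, which is positive because the successor
  \<open>w\<close> contributes to the mean.\<close>

lemma transition_pos_step:
  assumes u: "u \<in> L" and w: "0 < pmf (jump_kernel Q u) w" and pos: "\<And>s. 0 < s \<Longrightarrow> 0 < transition_prob Q s w v"
    and t: "0 < t"
  shows "0 < transition_prob Q t u v"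
proof -
  let ?q = "exit_rate Q u" and ?f = "\<lambda>t. transition_prob Q t u v"
  let ?D = "\<lambda>s. exp (?q * s) * ?q * ?f s + exp (?q * s) * (?q * (K_trans v u s - ?f s))"
  have d: "((\<lambda>t. exp (?q * t) * ?f t) has_real_derivative ?D s) (at s within {0..t})" if "0 \<le> s" "s \<le> t" for s
    by (auto intro!: derivative_eq_intros transition_derivative[OF u that])
  then have "\<exists>s\<in>{0<..<t}. exp (?q * t) * ?f t - exp (?q * 0) * ?f 0 = ?D s * (t - 0)"
    using mvt_simple[OF t, of "\<lambda>t. exp (?q * t) * ?f t" "\<lambda>s x. ?D s * x"]
    by (auto simp: has_field_derivative_def)
  then obtain s where s: "0 < s" "exp (?q * t) * ?f t - ?f 0 = ?D s * t" by auto
  have "?D s = exp (?q * s) * ?q * K_trans v u s" by (simp add: algebra_simps)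
  moreover have "0 < K_trans v u s"
  proof -
    have "w \<in> set_pmf (jump_kernel Q u)" using w by (simp add: set_pmf_iff)
    then have "pmf (jump_kernel Q u) w * transition_prob Q s w v \<le> K_trans v u s"
      unfolding K_trans_def jump_mean_def
      by (intro member_le_sum finite_succ[OF u]) (auto simp: transition_prob_bounds)
    moreover have "0 < pmf (jump_kernel Q u) w * transition_prob Q s w v" using w pos[OF s(1)] by simp
    ultimately show ?thesis by linarith
  qed
  ultimately have "0 < ?D s * t" using rate_pos[OF u] t by simp
  then have "0 < exp (?q * t) * ?f t" using s(2) transition_prob_bounds(1)[of Q 0 u v] by linarith
  then show ?thesis by (simp add: zero_less_mult_iff)
qed

lemma transition_pos_self:
  assumes u: "u \<in> L" and t: "0 \<le> t"
  shows "0 < transition_prob Q t u u"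
proof -
  have "0 \<le> integral {0..t} (\<lambda>s. exit_rate Q u * exp (exit_rate Q u * s) * K_trans u u s)"
    using rate_pos[OF u] K_trans_bounds[OF u, of u]
    by (intro integral_nonneg set_borel_integral_eq_integral(1)[OF integrable_K[OF u]]) auto
  then show ?thesis unfolding transition_backward[OF u t] by simp
qed

lemma transition_pos:
  assumes "(u, v) \<in> {(x, y). x \<in> L \<and> y \<in> L \<and> 0 < pmf (jump_kernel Q x) y}\<^sup>*" "v \<in> L" "0 < t"
  shows "0 < transition_prob Q t u v"
  using assms(1,3)
proof (induction arbitrary: t rule: converse_rtrancl_induct)
  case base
  then show ?case using transition_pos_self assms(2) by simp
next
  case (step x y)
  then show ?case using transition_pos_step[of x y v t] by auto
qed

text \<open>On a finite set the weighted transition probabilities may be differentiated term by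
  term, and by the backward equation the derivative is the generator sum for the test function
  \<open>transition_prob Q s\<close> into \<open>v\<close>. A bound uniform in the test function,
  with the mean value theorem, avoids differentiating an infinite sum.\<close>

lemma transition_almost_invariant:
  assumes B: "finite B" "B \<subseteq> L" and t: "0 \<le> t"
    and bd: "\<And>f. (\<And>w. 0 \<le> f w \<and> f w \<le> 1) \<Longrightarrow> \<bar>\<Sum>u\<in>B. m u * (exit_rate Q u * (jump_mean f u - f u))\<bar> \<le> \<epsilon>"
  shows "\<bar>(\<Sum>u\<in>B. m u * transition_prob Q t u v) - (\<Sum>u\<in>B. m u * of_bool (u = v))\<bar> \<le> \<epsilon> * t"
proof -
  let ?\<phi> = "\<lambda>t. \<Sum>u\<in>B. m u * transition_prob Q t u v"
  let ?D = "\<lambda>s. \<Sum>u\<in>B. m u * (exit_rate Q u * (jump_mean (\<lambda>w. transition_prob Q s w v) u - transition_prob Q s u v))"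
  have "(?\<phi> has_real_derivative ?D s) (at s within {0..t})" if "0 \<le> s" "s \<le> t" for s
    using B that by (intro DERIV_sum DERIV_cmult transition_derivative[unfolded K_trans_def]) auto
  then have "\<exists>s\<in>{0..t}. ?\<phi> t - ?\<phi> 0 = ?D s * (t - 0)"
    using t by (intro mvt_very_simple) (auto simp: has_field_derivative_def)
  then obtain s where s: "?\<phi> t - ?\<phi> 0 = ?D s * t" by auto
  have "\<bar>?D s\<bar> \<le> \<epsilon>" by (rule bd) (simp add: transition_prob_bounds)
  then have "\<bar>?\<phi> t - ?\<phi> 0\<bar> \<le> \<epsilon> * t" unfolding s abs_mult using t by (simp add: mult_right_mono)
  moreover have "?\<phi> 0 = (\<Sum>u\<in>B. m u * of_bool (u = v))"
    using B by (intro sum.cong) (auto simp: transition_prob_0)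
  ultimately show ?thesis by simp
qed

end

text \<open>The positive part \<open>d\<close> of the difference satisfies
  \<open>d \<le> d P\<close>, where \<open>P\<close> is the kernel at time 1. If \<open>d\<close> is
  nonzero but vanishes at some \<open>v0\<close>, then \<open>P\<close> carries an extra mass
  \<open>\<delta>\<close> to \<open>v0\<close>, although it cannot increase the total mass of
  \<open>d\<close>. So one law would exceed the other on all of \<open>L\<close>, against equal
  total mass.\<close>

lemma stationary_unique:
  assumes p1: "stationary_distribution L Q p1" and p2: "stationary_distribution L Q p2"
    and L: "countable L" "infinite L"
    and pos: "\<And>u v. u \<in> L \<Longrightarrow> v \<in> L \<Longrightarrow> 0 < transition_prob Q 1 u v"
  shows "p1 = p2"
proof -
  let ?P = "\<lambda>u v. ennreal (transition_prob Q 1 u v) * indicator L v"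
  note cL = L
  have L: "pmf p u = 0" if "stationary_distribution L Q p" "u \<notin> L" for p u
    using that by (auto simp: stationary_distribution_def set_pmf_iff)
  have st: "(\<integral>\<^sup>+u. ennreal (pmf p u) * ?P u v \<partial>count_space UNIV) = ennreal (pmf p v)"
    if p: "stationary_distribution L Q p" and v: "v \<in> L" for p v
  proof -
    have "(\<integral>\<^sup>+u. ennreal (pmf p u) * ?P u v \<partial>count_space UNIV) = (\<integral>\<^sup>+u. ?P u v \<partial>measure_pmf p)"
      by (simp add: nn_integral_measure_pmf)
    also have "\<dots> = ennreal (measure_pmf.expectation p (\<lambda>u. transition_prob Q 1 u v))"
      using v by (simp, intro nn_integral_eq_integral measure_pmf.integrable_const_bound[where B=1])
         (auto simp: transition_prob_bounds)
    finally show ?thesis using p v by (simp add: stationary_distribution_def)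
  qed
  have total: "(\<integral>\<^sup>+u. ennreal (pmf p u) \<partial>count_space UNIV) = 1" for p :: "'a pmf"
    using nn_integral_measure_pmf[of p "\<lambda>_. 1"] by simp
  have mass: "(\<integral>\<^sup>+v. ?P u v \<partial>count_space UNIV) \<le> 1" for u
  proof -
    let ?f = "\<lambda>v. ennreal (transition_prob Q 1 u v)"
    have fin: "(\<Sum>v\<in>V. ?f v) \<le> 1" if "finite V" for V
      using sum_transition_prob_le_1[OF that, of Q 1 u] by (simp add: sum_ennreal transition_prob_bounds)
    have bij: "bij_betw (from_nat_into L) UNIV L" using cL by (rule bij_betw_from_nat_into)
    have "(\<integral>\<^sup>+v. ?P u v \<partial>count_space UNIV) = (\<integral>\<^sup>+v. ?f v \<partial>count_space L)"
      by (rule nn_integral_count_space_indicator[symmetric]) simp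
    also have "\<dots> = (\<Sum>n. ?f (from_nat_into L n))"
      using nn_integral_bij_count_space[OF bij, of ?f] by (simp add: nn_integral_count_space_nat)
    also have "\<dots> \<le> 1"
    proof (rule suminf_le_const[OF summableI])
      fix n
      have "(\<Sum>i<n. ?f (from_nat_into L i)) = (\<Sum>v\<in>from_nat_into L ` {..<n}. ?f v)"
        using bij by (subst sum.reindex) (auto simp: bij_betw_def inj_on_def)
      also have "\<dots> \<le> 1" by (rule fin) simp
      finally show "(\<Sum>i<n. ?f (from_nat_into L i)) \<le> 1" .
    qed
    finally show ?thesis .
  qed
  \<comment> \<open>Subtraction in \<open>ennreal\<close> is cut off at 0, so this is the positive
    part of the difference.\<close>
  define d where "d p p' u = ennreal (pmf p u) - ennreal (pmf p' u)" for p p' :: "'a pmf" and u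
  have dpos: "d p p' u \<noteq> 0 \<longleftrightarrow> pmf p' u < pmf p u" for p p' u
    by (auto simp: d_def ennreal_minus ennreal_eq_0_iff)
  have full: "\<forall>v\<in>L. pmf p' v < pmf p v"
    if p: "stationary_distribution L Q p" and p': "stationary_distribution L Q p'" and u: "pmf p' u < pmf p u" for p p' u
  proof (rule ccontr)
    assume "\<not> ?thesis"
    then obtain v0 where v0: "v0 \<in> L" "d p p' v0 = 0" using dpos by blast
    have uL: "u \<in> L" using L[OF p, of u] u pmf_nonneg[of p' u] by (cases "u \<in> L") auto
    have dP: "d p p' v \<le> (\<integral>\<^sup>+u. d p p' u * ?P u v \<partial>count_space UNIV)" if v: "v \<in> L" for v
    proof -
      have "ennreal (pmf p v) = (\<integral>\<^sup>+u. ennreal (pmf p u) * ?P u v \<partial>count_space UNIV)" by (rule st[OF p v, symmetric])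
      also have "\<dots> \<le> (\<integral>\<^sup>+u. d p p' u * ?P u v + ennreal (pmf p' u) * ?P u v \<partial>count_space UNIV)"
      proof (rule nn_integral_mono)
        fix u
        have "ennreal (pmf p u) \<le> d p p' u + ennreal (pmf p' u)"
          by (cases "pmf p' u \<le> pmf p u") (auto simp: d_def ennreal_minus ennreal_neg simp flip: ennreal_plus intro!: ennreal_leI)
        then show "ennreal (pmf p u) * ?P u v \<le> d p p' u * ?P u v + ennreal (pmf p' u) * ?P u v"
          unfolding distrib_right[symmetric] by (rule mult_right_mono) simp
      qed
      also have "\<dots> = (\<integral>\<^sup>+u. d p p' u * ?P u v \<partial>count_space UNIV) + ennreal (pmf p' v)"
        by (subst nn_integral_add) (auto simp: st[OF p' v])
      finally show ?thesis unfolding d_def[of p p' v] by (simp add: ennreal_minus_le_iff add.commute)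
    qed
    define \<delta> where "\<delta> = d p p' u * ?P u v0"
    have \<delta>: "\<delta> \<noteq> 0" unfolding \<delta>_def using dpos[of p p' u] u pos[OF uL v0(1)] v0(1) by auto
    have "d p p' v + \<delta> * indicator {v0} v \<le> (\<integral>\<^sup>+u. d p p' u * ?P u v \<partial>count_space UNIV)" for v
    proof (cases "v = v0")
      case True
      then show ?thesis
        using v0(2) nn_integral_ge_point[of u UNIV "\<lambda>u. d p p' u * ?P u v0"] by (simp add: \<delta>_def)
    next
      case False
      then show ?thesis using dP[of v] L[OF p, of v] by (cases "v \<in> L") (auto simp: d_def)
    qed
    then have "(\<integral>\<^sup>+v. d p p' v + \<delta> * indicator {v0} v \<partial>count_space UNIV) \<le>
        (\<integral>\<^sup>+v. \<integral>\<^sup>+u. d p p' u * ?P u v \<partial>count_space UNIV \<partial>count_space UNIV)"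
      by (intro nn_integral_mono)
    also have "\<dots> = (\<integral>\<^sup>+u. \<integral>\<^sup>+v. d p p' u * ?P u v \<partial>count_space UNIV \<partial>count_space UNIV)"
      using nn_integral_fst_count_space[of "\<lambda>(v, u). d p p' u * ?P u v"] nn_integral_snd_count_space[of "\<lambda>(v, u). d p p' u * ?P u v"] by simp
    also have "\<dots> = (\<integral>\<^sup>+u. d p p' u * (\<integral>\<^sup>+v. ?P u v \<partial>count_space UNIV) \<partial>count_space UNIV)"
      by (simp add: nn_integral_cmult)
    also have "\<dots> \<le> (\<integral>\<^sup>+u. d p p' u * 1 \<partial>count_space UNIV)"
      by (intro nn_integral_mono mult_left_mono mass) auto
    also have "(\<integral>\<^sup>+v. d p p' v + \<delta> * indicator {v0} v \<partial>count_space UNIV) = (\<integral>\<^sup>+v. d p p' v \<partial>count_space UNIV) + \<delta>"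
      by (subst nn_integral_add) (auto simp: nn_integral_cmult)
    finally have "(\<integral>\<^sup>+v. d p p' v \<partial>count_space UNIV) + \<delta> \<le> (\<integral>\<^sup>+v. d p p' v \<partial>count_space UNIV) + 0" by simp
    moreover have "(\<integral>\<^sup>+v. d p p' v \<partial>count_space UNIV) \<noteq> \<infinity>"
    proof -
      have "(\<integral>\<^sup>+v. d p p' v \<partial>count_space UNIV) \<le> (\<integral>\<^sup>+u. ennreal (pmf p u) \<partial>count_space UNIV)"
        by (intro nn_integral_mono) (simp add: d_def)
      then show ?thesis unfolding total by (auto simp: top_unique)
    qed
    ultimately have "\<delta> \<le> 0" by (simp only: ennreal_add_left_cancel_le) simp
    with \<delta> show False by simp
  qed
  show ?thesis
  proof (rule ccontr)
    assume "p1 \<noteq> p2"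
    then obtain u where "pmf p1 u \<noteq> pmf p2 u" by (metis pmf_eqI)
    then have "(\<forall>v\<in>L. pmf p2 v < pmf p1 v) \<or> (\<forall>v\<in>L. pmf p1 v < pmf p2 v)"
      using full[OF p1 p2, of u] full[OF p2 p1, of u] by linarith
    moreover have no: "\<not> (\<forall>v\<in>L. pmf p' v < pmf p v)" if p: "stationary_distribution L Q p" and p': "stationary_distribution L Q p'" for p p'
    proof
      assume less: "\<forall>v\<in>L. pmf p' v < pmf p v"
      then have le: "pmf p' v \<le> pmf p v" for v using L[OF p, of v] L[OF p', of v] by (cases "v \<in> L") auto
      have "set_pmf p \<subseteq> L" "set_pmf p \<noteq> {}" using p by (auto simp: stationary_distribution_def set_pmf_not_empty)
      then obtain v where v: "v \<in> L" by blast
      have "(\<integral>\<^sup>+u. ennreal (pmf p' u) + ennreal (pmf p v - pmf p' v) * indicator {v} u \<partial>count_space UNIV) \<le> (\<integral>\<^sup>+u. ennreal (pmf p u) \<partial>count_space UNIV)"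
        using le by (intro nn_integral_mono) (auto simp: indicator_def simp flip: ennreal_plus intro!: ennreal_leI)
      then have "1 + ennreal (pmf p v - pmf p' v) \<le> 1 + 0"
        by (subst (asm) nn_integral_add) (auto simp: total nn_integral_cmult)
      then have "ennreal (pmf p v - pmf p' v) \<le> 0" by (subst (asm) ennreal_add_left_cancel_le) simp
      then show False using less v by (auto simp: ennreal_eq_0_iff)
    qed
    ultimately show False using p1 p2 by blast
  qed
qed

section \<open>Normal forms in plain monoids\<close>

lemma mult_free_monoid [simp]: "monoid.mult (free_monoid S) = (@)"
  and one_free_monoid [simp]: "one (free_monoid S) = []"
  and carrier_free_monoid [simp]: "carrier (free_monoid S) = lists S"
  by (simp_all add: free_monoid_def)

lemma mult_free_group [simp]: "monoid.mult (free_group T) u v = foldr free_group_push u v"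
  and one_free_group [simp]: "one (free_group T) = []"
  by (simp_all add: free_group_def)

section \<open>Letters of the factors and their products\<close>

locale plain_factors =
  fixes S T :: "nat set" and k :: nat and F :: "nat \<Rightarrow> nat monoid"
    and f :: "nat list \<Rightarrow> nat" and g :: "(nat \<times> bool) list \<Rightarrow> nat"
  assumes S_fin: "finite S" and T_fin: "finite T"
    and F_monoid: "\<And>i. i < k + 2 \<Longrightarrow> monoid (F i)"
    and F_fin: "\<And>i. i \<in> {2..<k + 2} \<Longrightarrow> finite (carrier (F i))"
    and f_iso: "f \<in> iso (free_monoid S) (F 0)" and g_iso: "g \<in> iso (free_group T) (F 1)"
begin

inductive letter :: "nat \<times> nat \<Rightarrow> bool" where
  letter_S: "s \<in> S \<Longrightarrow> letter (0, f [s])"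
| letter_T: "t \<in> T \<Longrightarrow> letter (1, g [(t, e)])"
| letter_M: "i \<in> {2..<k + 2} \<Longrightarrow> x \<in> carrier (F i) - {\<one>\<^bsub>F i\<^esub>} \<Longrightarrow> letter (i, x)"

lemma f_hom: "u \<in> lists S \<Longrightarrow> v \<in> lists S \<Longrightarrow> f u \<otimes>\<^bsub>F 0\<^esub> f v = f (u @ v)"
  using f_iso hom_mult[of f "free_monoid S" "F 0" u v] by (auto simp: iso_def)

lemma f_inj: "u \<in> lists S \<Longrightarrow> v \<in> lists S \<Longrightarrow> f u = f v \<longleftrightarrow> u = v"
  using f_iso by (auto simp: iso_def bij_betw_def inj_on_def)

lemma f_carrier: "u \<in> lists S \<Longrightarrow> f u \<in> carrier (F 0)"
  using f_iso by (auto simp: iso_def bij_betw_def)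

lemma f_surj: "x \<in> carrier (F 0) \<Longrightarrow> \<exists>u \<in> lists S. x = f u"
  using f_iso by (auto simp: iso_def bij_betw_def)

lemma f_one: "f [] = \<one>\<^bsub>F 0\<^esub>"
proof -
  interpret F0: monoid "F 0" by (rule F_monoid) simp
  obtain u where u: "u \<in> lists S" "\<one>\<^bsub>F 0\<^esub> = f u" using f_surj by blast
  then have "f u = f (u @ u)" using f_hom[OF u(1) u(1)] F0.one_closed F0.l_one by metis
  then have "u = u @ u" using u(1) by (subst (asm) f_inj) auto
  with u show ?thesis by simp
qed

lemma g_hom: "u \<in> carrier (free_group T) \<Longrightarrow> v \<in> carrier (free_group T) \<Longrightarrow>
    g u \<otimes>\<^bsub>F 1\<^esub> g v = g (foldr free_group_push u v)"
  using g_iso hom_mult[of g "free_group T" "F 1" u v] by (auto simp: iso_def)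

lemma g_inj: "u \<in> carrier (free_group T) \<Longrightarrow> v \<in> carrier (free_group T) \<Longrightarrow> g u = g v \<longleftrightarrow> u = v"
  using g_iso by (auto simp: iso_def bij_betw_def inj_on_def)

lemma g_carrier: "u \<in> carrier (free_group T) \<Longrightarrow> g u \<in> carrier (F 1)"
  using g_iso by (auto simp: iso_def bij_betw_def)

lemma g_surj: "x \<in> carrier (F 1) \<Longrightarrow> \<exists>u \<in> carrier (free_group T). x = g u"
  using g_iso by (auto simp: iso_def bij_betw_def)

lemma free_group_one: "[] \<in> carrier (free_group T)"
  and free_group_letter: "t \<in> T \<Longrightarrow> [(t, e)] \<in> carrier (free_group T)"
  and free_group_pair: "t \<in> T \<Longrightarrow> t' \<in> T \<Longrightarrow> \<not> mutually_inverse (t, e) (t', e') \<Longrightarrow> [(t, e), (t', e')] \<in> carrier (free_group T)"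
  by (auto simp: free_group_def)

lemma g_one: "g [] = \<one>\<^bsub>F 1\<^esub>"
proof -
  interpret F1: monoid "F 1" by (rule F_monoid) simp
  obtain u where u: "u \<in> carrier (free_group T)" "\<one>\<^bsub>F 1\<^esub> = g u" using g_surj by blast
  have "g [] = g u \<otimes>\<^bsub>F 1\<^esub> g []" using u g_carrier[OF free_group_one] F1.l_one by metis
  also have "\<dots> = g u" using g_hom[OF u(1) free_group_one] monoid.r_one[OF monoid_free_group u(1)] by simp
  finally show ?thesis using u by simp
qed

lemma letter_ex: "letter (i, x) \<Longrightarrow> i < k + 2 \<and> x \<in> carrier (F i) \<and> x \<noteq> \<one>\<^bsub>F i\<^esub>"
proof (cases rule: letter.cases)
  assume "letter (i, x)" then show "letter (i, x)" .
next
  fix s assume "(i, x) = (0, f [s])" "s \<in> S"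
  then show ?thesis using f_carrier[of "[s]"] f_inj[of "[s]" "[]"] by (auto simp: f_one)
next
  fix t e assume "(i, x) = (1, g [(t, e)])" "t \<in> T"
  then show ?thesis
    using g_carrier[OF free_group_letter, of t e] g_inj[OF free_group_letter free_group_one, of t e] by (auto simp: g_one)
qed auto

text \<open>For a product of two letters of one factor this means that the two cannot be neighbours
  in a normal form.\<close>

definition good :: "nat \<Rightarrow> nat \<Rightarrow> bool" where
  "good i z \<longleftrightarrow> letter (i, z) \<or> z = \<one>\<^bsub>F i\<^esub>"

lemma good_S: "s \<in> S \<Longrightarrow> s' \<in> S \<Longrightarrow> \<not> good 0 (f [s] \<otimes>\<^bsub>F 0\<^esub> f [s'])"
proof
  assume s: "s \<in> S" "s' \<in> S" and "good 0 (f [s] \<otimes>\<^bsub>F 0\<^esub> f [s'])"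
  then have "letter (0, f [s, s']) \<or> f [s, s'] = f []" by (simp add: good_def f_one f_hom)
  then show False
    using s f_inj[of "[s,s']" "[]"] by (auto elim!: letter.cases simp: f_inj)
qed

lemma good_T:
  assumes "t \<in> T" "t' \<in> T"
  shows "good 1 (g [(t, e)] \<otimes>\<^bsub>F 1\<^esub> g [(t', e')]) \<longleftrightarrow> mutually_inverse (t, e) (t', e')"
    and "mutually_inverse (t, e) (t', e') \<Longrightarrow> g [(t, e)] \<otimes>\<^bsub>F 1\<^esub> g [(t', e')] = \<one>\<^bsub>F 1\<^esub>"
proof -
  have eq: "g [(t, e)] \<otimes>\<^bsub>F 1\<^esub> g [(t', e')] = (if mutually_inverse (t, e) (t', e') then \<one>\<^bsub>F 1\<^esub> else g [(t, e), (t', e')])"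
    using g_hom[OF free_group_letter free_group_letter] assms by (simp add: g_one)
  show "mutually_inverse (t, e) (t', e') \<Longrightarrow> g [(t, e)] \<otimes>\<^bsub>F 1\<^esub> g [(t', e')] = \<one>\<^bsub>F 1\<^esub>"
    using eq by simp
  have "\<not> good 1 (g [(t, e), (t', e')])" if "\<not> mutually_inverse (t, e) (t', e')"
  proof
    note p = free_group_pair[OF assms that]
    assume "good 1 (g [(t, e), (t', e')])"
    then have "letter (1, g [(t, e), (t', e')]) \<or> g [(t, e), (t', e')] = g []" by (simp add: good_def g_one)
    then show False
      using g_inj[OF p free_group_one] by (auto elim!: letter.cases simp: g_inj[OF p free_group_letter])
  qed
  then show "good 1 (g [(t, e)] \<otimes>\<^bsub>F 1\<^esub> g [(t', e')]) \<longleftrightarrow> mutually_inverse (t, e) (t', e')"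
    unfolding eq by (auto simp: good_def)
qed

lemma good_M:
  assumes "i \<in> {2..<k + 2}" "x \<in> carrier (F i)" "y \<in> carrier (F i)"
  shows "good i (x \<otimes>\<^bsub>F i\<^esub> y)"
proof -
  interpret monoid "F i" using assms by (intro F_monoid) auto
  show ?thesis using assms letter_M[of i "x \<otimes>\<^bsub>F i\<^esub> y"] by (auto simp: good_def)
qed

lemma letter_kinds:
  assumes "letter a"
  obtains (S) s where "s \<in> S" "a = (0, f [s])"
    | (T) t e where "t \<in> T" "a = (1, g [(t, e)])"
    | (M) "fst a \<in> {2..<k + 2}" "snd a \<in> carrier (F (fst a)) - {\<one>\<^bsub>F (fst a)\<^esub>}"
  using assms by cases auto

definition clash :: "nat \<times> nat \<Rightarrow> nat \<times> nat \<Rightarrow> bool" where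
  "clash a b \<longleftrightarrow> fst a = fst b \<and> good (fst a) (snd a \<otimes>\<^bsub>F (fst a)\<^esub> snd b)"

lemma clash_sym: assumes "letter a" "letter b" shows "clash a b \<longleftrightarrow> clash b a"
  using assms(1)
proof (cases rule: letter_kinds)
  case (S s)
  show ?thesis using assms(2) by (cases rule: letter_kinds) (auto simp: S clash_def good_S)
next
  case (T t e)
  show ?thesis using assms(2)
    by (cases rule: letter_kinds) (auto simp: T clash_def good_T[simplified] mutually_inverse_def)
next
  case M
  show ?thesis using assms(2) by (cases rule: letter_kinds) (use M in \<open>auto simp: clash_def good_M\<close>)
qed

text \<open>In the free monoid two letters never clash, and in the free group a clash gives the
  unit. Hence a product of two letters that is a letter again lives in a finite factor.\<close>

lemma clash_letter:
  assumes "letter a" "letter b" "clash a b" "letter (fst a, snd a \<otimes>\<^bsub>F (fst a)\<^esub> snd b)"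
  shows "fst a \<in> {2..<k + 2} \<and> fst b = fst a"
  using assms(1)
proof (cases rule: letter_kinds)
  case (S s)
  show ?thesis using assms(2) by (cases rule: letter_kinds) (use assms(3) in \<open>auto simp: S clash_def good_S\<close>)
next
  case (T t e)
  show ?thesis using assms(2)
  proof (cases rule: letter_kinds)
    case (T t' e')
    then have "snd a \<otimes>\<^bsub>F (fst a)\<^esub> snd b = \<one>\<^bsub>F 1\<^esub>"
      using assms(3) \<open>t \<in> T\<close> \<open>a = _\<close> good_T[of t t' e e'] by (auto simp: clash_def)
    then show ?thesis using assms(4) letter_ex[of 1] \<open>a = _\<close> by auto
  qed (use assms(3) T in \<open>auto simp: clash_def\<close>)
next
  case M
  then show ?thesis using assms(3) by (auto simp: clash_def)
qed

lemma clash_M: "letter a \<Longrightarrow> letter b \<Longrightarrow> fst a \<in> {2..<k + 2} \<Longrightarrow> clash a b \<longleftrightarrow> fst b = fst a"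
  using letter_ex[of "fst a" "snd a"] letter_ex[of "fst b" "snd b"] by (auto simp: clash_def good_M)

lemma clash_self: assumes "letter a" "clash a a" shows "fst a \<in> {2..<k + 2}"
  using assms(1)
  by (cases rule: letter_kinds) (use assms(2) in \<open>auto simp: clash_def good_S good_T[simplified] mutually_inverse_def\<close>)

text \<open>The finite factors are the point: \<open>a b = 1\<close> makes left multiplication by
  \<open>b\<close> injective, hence surjective by finiteness, so \<open>b\<close> has a right
  inverse, and this is \<open>a\<close>.\<close>

lemma prod_one_sym:
  assumes a: "letter a" and b: "letter b" and eq: "fst a = fst b" "snd a \<otimes>\<^bsub>F (fst a)\<^esub> snd b = \<one>\<^bsub>F (fst a)\<^esub>"
  shows "snd b \<otimes>\<^bsub>F (fst a)\<^esub> snd a = \<one>\<^bsub>F (fst a)\<^esub>"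
  using a
proof (cases rule: letter_kinds)
  case (S s)
  have gd: "good 0 (snd a \<otimes>\<^bsub>F (fst a)\<^esub> snd b)" using eq S by (simp add: good_def)
  show ?thesis using b by (cases rule: letter_kinds) (use gd eq in \<open>auto simp: S good_S\<close>)
next
  case (T t e)
  have gd: "good 1 (snd a \<otimes>\<^bsub>F (fst a)\<^esub> snd b)" using eq T by (simp add: good_def)
  show ?thesis using b
  proof (cases rule: letter_kinds)
    case (T t' e')
    then have "mutually_inverse (t', e') (t, e)"
      using gd \<open>t \<in> T\<close> \<open>a = _\<close> good_T(1)[of t t' e e'] by (auto simp: mutually_inverse_def)
    then show ?thesis using good_T(2)[of t' t e' e] T \<open>t \<in> T\<close> \<open>a = _\<close> by simp
  qed (use eq T in auto)
next
  case M
  define i where "i = fst a"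
  interpret monoid "F i" using M by (intro F_monoid) (auto simp: i_def)
  let ?C = "carrier (F i)" and ?a = "snd a" and ?b = "snd b"
  have c: "?a \<in> ?C" "?b \<in> ?C" "?a \<otimes>\<^bsub>F i\<^esub> ?b = \<one>\<^bsub>F i\<^esub>" using M b eq letter_ex[of "fst b" "snd b"] by (auto simp: i_def)
  have fin: "finite ?C" using M by (auto simp: i_def intro: F_fin)
  have "inj_on (\<lambda>x. ?b \<otimes>\<^bsub>F i\<^esub> x) ?C"
  proof (rule inj_onI)
    fix x y assume xy: "x \<in> ?C" "y \<in> ?C" "?b \<otimes>\<^bsub>F i\<^esub> x = ?b \<otimes>\<^bsub>F i\<^esub> y"
    then show "x = y" using c m_assoc[of ?a ?b x] m_assoc[of ?a ?b y] by simp
  qed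
  then have "(\<lambda>x. ?b \<otimes>\<^bsub>F i\<^esub> x) ` ?C = ?C"
    using c by (intro endo_inj_surj fin) auto
  then obtain x where x: "x \<in> ?C" "?b \<otimes>\<^bsub>F i\<^esub> x = \<one>\<^bsub>F i\<^esub>" using one_closed by (metis imageE)
  have "x = ?a" using x c m_assoc[of ?a ?b x] by simp
  then show ?thesis using x by (simp add: i_def)
qed

text \<open>Left inverse of \<open>ev\<close> on words without clashes: each syllable of the free
  product is spelled out in the letters of its factor.\<close>

fun decode :: "(nat \<times> nat) list \<Rightarrow> (nat \<times> nat) list" where
  "decode [] = []"
| "decode ((i, x) # w) =
    (if i = 0 then map (\<lambda>s. (0, f [s])) (inv_into (lists S) f x)
     else if i = 1 then map (\<lambda>p. (1, g [p])) (inv_into (carrier (free_group T)) g x)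
     else [(i, x)]) @ decode w"

lemma f_inv: "u \<in> lists S \<Longrightarrow> inv_into (lists S) f (f u) = u"
  using f_iso by (intro inv_into_f_f) (auto simp: iso_def bij_betw_def)

lemma g_inv: "u \<in> carrier (free_group T) \<Longrightarrow> inv_into (carrier (free_group T)) g (g u) = u"
  using g_iso by (intro inv_into_f_f) (auto simp: iso_def bij_betw_def)

definition ev :: "(nat \<times> nat) list \<Rightarrow> (nat \<times> nat) list" where
  "ev w = foldr (free_product_push F) w []"

lemma ev_carrier: "\<forall>a\<in>set w. letter a \<Longrightarrow> ev w \<in> carrier (free_product {..<k + 2} F)"
  unfolding ev_def
proof (rule foldr_closed)
  assume "\<forall>a\<in>set w. letter a"
  then show "set w \<subseteq> (SIGMA i:{..<k + 2}. carrier (F i) - {\<one>\<^bsub>F i\<^esub>})"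
    using letter_ex by fastforce
qed (auto simp: F_monoid free_product_def)

text \<open>The second conjunct carries the induction: the first syllable of \<open>ev w\<close>
  lies in the factor of the first letter of \<open>w\<close>, which decides whether pushing
  \<open>a\<close> opens a new syllable or extends the first one. An extension in the free monoid or
  the free group does not cancel, as neighbouring letters do not clash; in a finite factor no
  extension occurs, as two of its letters always clash.\<close>

lemma ev_decode:
  "\<forall>a\<in>set w. letter a \<Longrightarrow> successively (\<lambda>a b. \<not> clash a b) w \<Longrightarrow>
    decode (ev w) = w \<and> (w \<noteq> [] \<longrightarrow> ev w \<noteq> [] \<and> fst (hd (ev w)) = fst (hd w))"
proof (induction w)
  case (Cons a w)
  obtain i x where a: "a = (i, x)" by force
  have la: "letter (i, x)" using Cons.prems a by simp
  have sing: "decode ((i, x) # z) = (i, x) # decode z" for z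
    using la
  proof cases
    case (letter_S s) then show ?thesis by (simp add: f_inv)
  next
    case (letter_T t e) then show ?thesis by (simp add: g_inv[OF free_group_letter])
  qed auto
  have IH: "decode (ev w) = w" "w \<noteq> [] \<Longrightarrow> ev w \<noteq> [] \<and> fst (hd (ev w)) = fst (hd w)"
    using Cons by (auto simp: successively_Cons)
  show ?case
  proof (cases w)
    case Nil
    then show ?thesis using sing[of "[]"] by (simp add: ev_def a)
  next
    case (Cons b w')
    obtain j y0 where b: "b = (j, y0)" by force
    have lb: "letter (j, y0)" and nc: "\<not> clash (i, x) (j, y0)" using Cons.prems unfolding Cons a b by auto
    obtain y z where z: "ev w = (j, y) # z" using IH(2) Cons b by (cases "ev w") auto
    have eva: "ev (a # w) = free_product_push F (i, x) ((j, y) # z)" by (simp add: ev_def a z[unfolded ev_def])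
    have zc: "(j, y) # z \<in> carrier (free_product {..<k + 2} F)" using ev_carrier[of w] Cons.prems z by simp
    then have y: "y \<in> carrier (F j)" by (simp add: free_product_def)
    show ?thesis
    proof (cases "i = j")
      case False
      then have "ev (a # w) = (i, x) # ev w" unfolding eva z by simp
      then show ?thesis using sing[of "ev w"] IH by (simp add: a)
    next
      case True
      show ?thesis using la
      proof cases
        case (letter_S s)
        then have j0: "j = 0" using True by simp
        obtain u where u: "u \<in> lists S" "y = f u" using y f_surj unfolding j0 by blast
        have xy: "x \<otimes>\<^bsub>F i\<^esub> y = f (s # u)" using letter_S u f_hom[of "[s]" u] by simp
        have "f (s # u) \<noteq> \<one>\<^bsub>F i\<^esub>" using letter_S u f_inj[of "s # u" "[]"] by (auto simp: f_one)
        then have "ev (a # w) = (0, f (s # u)) # z" unfolding eva using True j0 xy letter_S by simp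
        moreover have "decode ((0, f (s # u)) # z) = (0, f [s]) # decode ((0, f u) # z)"
          using letter_S u by (simp add: f_inv)
        ultimately show ?thesis using IH(1) z j0 u letter_S a by simp
      next
        case (letter_T t e)
        then have j1: "j = 1" using True by simp
        obtain u where u: "u \<in> carrier (free_group T)" "y = g u" using y g_surj unfolding j1 by blast
        have dz: "map (\<lambda>p. (1, g [p])) u @ decode z = b # w'"
          using IH(1)[unfolded z] unfolding Cons j1 u(2) by (simp add: g_inv[OF u(1)])
        have "y \<noteq> \<one>\<^bsub>F j\<^esub>" using zc by (simp add: free_product_def)
        then have "u \<noteq> []" using u(2) g_one j1 by auto
        then obtain p u' where u': "u = p # u'" by (cases u) auto
        obtain t' e' where p: "p = (t', e')" by force
        have t': "t' \<in> T" using u(1) by (auto simp: free_group_def u' p)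
        have y0: "y0 = g [(t', e')]" using dz u' p b by simp
        have nm: "\<not> mutually_inverse (t, e) (t', e')"
          using nc letter_T j1 y0 good_T(1)[of t t' e e'] t' by (auto simp: clash_def)
        have c: "(t, e) # u \<in> carrier (free_group T)" using u(1) nm letter_T by (auto simp: free_group_def u' p)
        have xy: "x \<otimes>\<^bsub>F i\<^esub> y = g ((t, e) # u)"
          using letter_T g_hom[OF free_group_letter u(1), of t e] u nm by (simp add: u' p)
        have "g ((t, e) # u) \<noteq> \<one>\<^bsub>F i\<^esub>" using letter_T g_inj[OF c free_group_one] by (auto simp: g_one)
        then have "ev (a # w) = (1, g ((t, e) # u)) # z" unfolding eva using True j1 xy letter_T by simp
        moreover have "decode ((1, g ((t, e) # u)) # z) = (1, g [(t, e)]) # decode ((1, g u) # z)"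
          by (simp add: g_inv[OF c] g_inv[OF u(1)])
        ultimately show ?thesis using IH(1) z j1 u letter_T a by simp
      next
        case letter_M
        then have "clash (i, x) (j, y0)" using la lb True clash_M[of "(i,x)" "(j,y0)"] by simp
        with nc show ?thesis by simp
      qed
    qed
  qed
qed (simp add: ev_def)

lemma finite_letters: "finite {a. letter a}"
proof -
  have "{a. letter a} \<subseteq> (\<lambda>s. (0, f [s])) ` S \<union> (\<lambda>p. (1, g [p])) ` (T \<times> UNIV) \<union> (SIGMA i:{2..<k+2}. carrier (F i))"
    by (auto elim!: letter.cases)
  moreover have "finite \<dots>" using S_fin T_fin F_fin by auto
  ultimately show ?thesis by (rule finite_subset)
qed

end

text \<open>The later combinatorics rests on these consequences of the decomposition. Mergers take
  place inside a finite factor, all of whose letters have the same neighbours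
  (\<open>next_prod\<close>). A letter that clashes with itself lies in such a factor, together with
  all letters that clash with it (\<open>next_class\<close>).\<close>

locale plain_structure = monoid X for X (structure) +
  fixes Sig :: "'a set"
  assumes Sig_fin: "finite Sig" and Sig_sub: "Sig \<subseteq> carrier X" and one_notin: "\<one> \<notin> Sig"
    and next_sym: "a \<in> Sig \<Longrightarrow> b \<in> Sig \<Longrightarrow> a \<otimes> b \<in> Sig \<union> {\<one>} \<longleftrightarrow> b \<otimes> a \<in> Sig \<union> {\<one>}"
    and next_prod: "a \<in> Sig \<Longrightarrow> b \<in> Sig \<Longrightarrow> a \<otimes> b \<in> Sig \<Longrightarrow>
      Next X Sig a = Next X Sig b \<and> Next X Sig (a \<otimes> b) = Next X Sig b"
    and inv_sym: "a \<in> Sig \<Longrightarrow> b \<in> Sig \<Longrightarrow> a \<otimes> b = \<one> \<Longrightarrow> b \<otimes> a = \<one>"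
    and next_class: "a \<in> Sig \<Longrightarrow> d \<in> Sig \<Longrightarrow> a \<notin> Next X Sig a \<Longrightarrow> d \<notin> Next X Sig a \<Longrightarrow>
      Next X Sig d = Next X Sig a"
    and eval_inj: "inj_on (word_eval X) (normal_forms X Sig)"

lemma (in plain_factors) letter_prod_carrier:
  assumes a: "letter a" and b: "letter b" and f: "fst a = fst b"
    and ne: "snd a \<otimes>\<^bsub>F (fst a)\<^esub> snd b \<noteq> \<one>\<^bsub>F (fst a)\<^esub>"
  shows "[(fst a, snd a \<otimes>\<^bsub>F (fst a)\<^esub> snd b)] \<in> carrier (free_product {..<k + 2} F)"
proof -
  have l: "fst a < k + 2" using letter_ex[of "fst a" "snd a"] a by simp
  interpret Fi: monoid "F (fst a)" using l by (rule F_monoid)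
  have "snd a \<otimes>\<^bsub>F (fst a)\<^esub> snd b \<in> carrier (F (fst a))"
  proof (rule Fi.m_closed)
    show "snd a \<in> carrier (F (fst a))" using letter_ex[of "fst a" "snd a"] a by simp
    show "snd b \<in> carrier (F (fst a))" using letter_ex[of "fst b" "snd b"] b unfolding f by simp
  qed
  then show ?thesis using l ne by (simp add: free_product_def)
qed

lemma (in plain_factors) plain_structure_of_iso:
  fixes X :: "('a, 'm) monoid_scheme"
  assumes X: "monoid X" and h: "h \<in> iso (free_product {..<k + 2} F) X"
    and Sig: "Sig = {h [a] |a. letter a}"
  shows "plain_structure X Sig"
proof -
  interpret X: monoid X by fact
  let ?FP = "free_product {..<k + 2} F"
  interpret FP: monoid ?FP by (rule monoid_free_product) (auto intro: F_monoid)
  have h_hom: "h u \<otimes>\<^bsub>X\<^esub> h v = h (foldr (free_product_push F) u v)" if "u \<in> carrier ?FP" "v \<in> carrier ?FP" for u v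
    using h that hom_mult[of h ?FP X u v] by (simp add: iso_def)
  have h_inj: "h u = h v \<longleftrightarrow> u = v" if "u \<in> carrier ?FP" "v \<in> carrier ?FP" for u v
    using h that by (auto simp: iso_def bij_betw_def inj_on_def)
  have h_car: "h u \<in> carrier X" if "u \<in> carrier ?FP" for u
    using h that by (auto simp: iso_def bij_betw_def)
  have nil: "[] \<in> carrier ?FP" using FP.one_closed by simp
  have one: "h [] = \<one>\<^bsub>X\<^esub>"
  proof -
    have "h ` carrier ?FP = carrier X" using h by (simp add: iso_def bij_betw_def)
    then have "\<one>\<^bsub>X\<^esub> \<in> h ` carrier ?FP" by simp
    then obtain u where u: "u \<in> carrier ?FP" "h u = \<one>\<^bsub>X\<^esub>" by (elim imageE) simp
    have "h [] = h u \<otimes>\<^bsub>X\<^esub> h []" using u h_car[OF nil] by simp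
    also have "\<dots> = h (u \<otimes>\<^bsub>?FP\<^esub> [])" using h_hom[OF u(1) nil] by simp
    also have "u \<otimes>\<^bsub>?FP\<^esub> [] = u" using FP.r_one[OF u(1)] by simp
    finally show ?thesis using u by simp
  qed
  have sing: "[a] \<in> carrier ?FP" if "letter a" for a
    using letter_ex[of "fst a" "snd a"] that by (cases a) (auto simp: free_product_def)
  have pair: "[a, b] \<in> carrier ?FP" if "letter a" "letter b" "fst a \<noteq> fst b" for a b
    using letter_ex[of "fst a" "snd a"] letter_ex[of "fst b" "snd b"] that by (cases a; cases b) (auto simp: free_product_def)
  have hh_inj: "h [a] = h [b] \<longleftrightarrow> a = b" if "letter a" "letter b" for a b
    using h_inj[OF sing sing] that by simp
  have mem: "h [a] \<in> Sig \<longleftrightarrow> letter a" if "[a] \<in> carrier ?FP" for a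
  proof
    assume "h [a] \<in> Sig"
    then obtain b where "h [a] = h [b]" "letter b" unfolding Sig by blast
    then show "letter a" using h_inj[OF that sing, of b] by simp
  qed (unfold Sig, blast)
  have mult: "h [a] \<otimes>\<^bsub>X\<^esub> h [b] = (if fst a \<noteq> fst b then h [a, b]
      else if snd a \<otimes>\<^bsub>F (fst a)\<^esub> snd b = \<one>\<^bsub>F (fst a)\<^esub> then \<one>\<^bsub>X\<^esub>
      else h [(fst a, snd a \<otimes>\<^bsub>F (fst a)\<^esub> snd b)])" if "letter a" "letter b" for a b
    using h_hom[OF sing sing, OF that] by (cases a; cases b) (simp add: one)
  have clash: "h [a] \<otimes>\<^bsub>X\<^esub> h [b] \<in> Sig \<union> {\<one>\<^bsub>X\<^esub>} \<longleftrightarrow> clash a b" if ab: "letter a" "letter b" for a b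
  proof (cases "fst a = fst b")
    case False
    have "h [a, b] \<notin> Sig \<union> {\<one>\<^bsub>X\<^esub>}"
      using h_inj[OF pair[OF ab False] sing] h_inj[OF pair[OF ab False] nil] by (auto simp: Sig one[symmetric])
    then show ?thesis using False by (simp add: mult[OF ab] clash_def)
  next
    case True
    show ?thesis
    proof (cases "snd a \<otimes>\<^bsub>F (fst a)\<^esub> snd b = \<one>\<^bsub>F (fst a)\<^esub>")
      case False
      then have s: "[(fst a, snd a \<otimes>\<^bsub>F (fst a)\<^esub> snd b)] \<in> carrier ?FP"
        using letter_prod_carrier[OF ab True] by simp
      have "h [(fst a, snd a \<otimes>\<^bsub>F (fst a)\<^esub> snd b)] \<noteq> \<one>\<^bsub>X\<^esub>" using h_inj[OF s nil] by (simp add: one)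
      then show ?thesis using False True mem[OF s] by (simp add: mult[OF ab] clash_def good_def)
    qed (use True in \<open>simp add: mult[OF ab] clash_def good_def\<close>)
  qed
  have Next: "Next X Sig (h [a]) = {h [b] |b. letter b \<and> \<not> clash a b}" if "letter a" for a
  proof -
    have S: "x \<in> Sig \<longleftrightarrow> (\<exists>b. x = h [b] \<and> letter b)" for x unfolding Sig by blast
    show ?thesis unfolding Next_def set_eq_iff mem_Collect_eq
      using S clash[OF that] by metis
  qed
  have Next_eq: "Next X Sig (h [a]) = Next X Sig (h [b])" if "letter a" "letter b" "fst a \<in> {2..<k + 2}" "fst b = fst a" for a b
  proof -
    have "clash a c \<longleftrightarrow> clash b c" if "letter c" for c
      using clash_M[of a c] clash_M[of b c] that \<open>letter a\<close> \<open>letter b\<close> \<open>fst a \<in> _\<close> \<open>fst b = _\<close> by simp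
    then show ?thesis unfolding Next[OF that(1)] Next[OF that(2)] by blast
  qed
  have in_Next: "h [b] \<in> Next X Sig (h [a]) \<longleftrightarrow> \<not> clash a b" if "letter a" "letter b" for a b
    unfolding Next[OF that(1)] mem_Collect_eq using that(2) hh_inj by metis
  have eval: "word_eval X (map (\<lambda>a. h [a]) w) = h (ev w)" if "\<forall>a\<in>set w. letter a" for w
    using that
  proof (induction w)
    case (Cons a w)
    have "ev w \<in> carrier ?FP" by (rule ev_carrier) (use Cons in auto)
    from h_hom[OF sing this, of a] show ?case using Cons by (simp add: word_eval_def ev_def)
  qed (simp add: word_eval_def ev_def one)
  have nf: "\<exists>w'. w = map (\<lambda>a. h [a]) w' \<and> (\<forall>a\<in>set w'. letter a) \<and> successively (\<lambda>a b. \<not> clash a b) w'"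
    if wnf: "w \<in> normal_forms X Sig" for w
  proof -
    have "\<exists>w'. w = map (\<lambda>a. h [a]) w' \<and> (\<forall>a\<in>set w'. letter a)" if "w \<in> lists Sig" for w
      using that
    proof (induction w)
      case (Cons a w)
      then obtain w' b where "w = map (\<lambda>a. h [a]) w'" "\<forall>a\<in>set w'. letter a" "a = h [b]" "letter b"
        by (auto simp: Sig)
      then show ?case by (intro exI[of _ "b # w'"]) auto
    qed simp
    then obtain w' where w': "w = map (\<lambda>a. h [a]) w'" "\<forall>a\<in>set w'. letter a"
      using wnf unfolding normal_forms_def by blast
    have "successively (\<lambda>a b. h [a] \<otimes>\<^bsub>X\<^esub> h [b] \<notin> Sig \<union> {\<one>\<^bsub>X\<^esub>}) w'"
      using wnf unfolding normal_forms_def w'(1) by (simp add: successively_map)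
    then have "successively (\<lambda>a b. \<not> clash a b) w'"
      by (rule successively_mono) (use w'(2) clash in metis)
    with w' show ?thesis by blast
  qed
  show ?thesis
  proof
    have "Sig = (\<lambda>a. h [a]) ` {a. letter a}" unfolding Sig by blast
    then show "finite Sig" using finite_letters by simp
    show "Sig \<subseteq> carrier X" unfolding Sig using sing h_car by blast
    show "\<one>\<^bsub>X\<^esub> \<notin> Sig" unfolding Sig one[symmetric] using h_inj[OF nil sing] by blast
  next
    fix a b assume "a \<in> Sig" "b \<in> Sig"
    then obtain a' b' where ab: "a = h [a']" "b = h [b']" "letter a'" "letter b'" unfolding Sig by blast
    show "a \<otimes>\<^bsub>X\<^esub> b \<in> Sig \<union> {\<one>\<^bsub>X\<^esub>} \<longleftrightarrow> b \<otimes>\<^bsub>X\<^esub> a \<in> Sig \<union> {\<one>\<^bsub>X\<^esub>}"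
      using clash[OF ab(3,4)] clash[OF ab(4,3)] clash_sym[OF ab(3,4)] by (simp add: ab)
    show "b \<otimes>\<^bsub>X\<^esub> a = \<one>\<^bsub>X\<^esub>" if one': "a \<otimes>\<^bsub>X\<^esub> b = \<one>\<^bsub>X\<^esub>"
    proof -
      have f: "fst a' = fst b'"
        using one' h_inj[OF pair nil, of a' b'] ab by (auto simp: mult one split: if_splits)
      have "snd a' \<otimes>\<^bsub>F (fst a')\<^esub> snd b' = \<one>\<^bsub>F (fst a')\<^esub>"
      proof (rule ccontr)
        assume n: "\<not> ?thesis"
        then have s: "[(fst a', snd a' \<otimes>\<^bsub>F (fst a')\<^esub> snd b')] \<in> carrier ?FP"
          by (rule letter_prod_carrier[OF ab(3,4) f])
        show False using one' n f h_inj[OF s nil] ab by (simp add: mult one)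
      qed
      from prod_one_sym[OF ab(3,4) f this] show ?thesis using ab f mult[OF ab(4,3)] by simp
    qed
    show "Next X Sig a = Next X Sig b \<and> Next X Sig (a \<otimes>\<^bsub>X\<^esub> b) = Next X Sig b" if S: "a \<otimes>\<^bsub>X\<^esub> b \<in> Sig"
    proof -
      have cl: "clash a' b'" using S clash[OF ab(3,4)] ab by simp
      then have f: "fst a' = fst b'" by (simp add: clash_def)
      have ne: "snd a' \<otimes>\<^bsub>F (fst a')\<^esub> snd b' \<noteq> \<one>\<^bsub>F (fst a')\<^esub>"
        using S f ab mult[OF ab(3,4)] h_inj[OF nil sing] unfolding Sig one[symmetric] by (auto simp: one)
      then have eq: "a \<otimes>\<^bsub>X\<^esub> b = h [(fst a', snd a' \<otimes>\<^bsub>F (fst a')\<^esub> snd b')]" using mult[OF ab(3,4)] ab f by simp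
      have l: "letter (fst a', snd a' \<otimes>\<^bsub>F (fst a')\<^esub> snd b')"
        using cl ne unfolding clash_def good_def by blast
      note M = clash_letter[OF ab(3,4) cl l]
      have "Next X Sig (h [a']) = Next X Sig (h [b'])" using M by (intro Next_eq ab) simp_all
      moreover have "Next X Sig (h [b']) = Next X Sig (h [(fst a', snd a' \<otimes>\<^bsub>F (fst a')\<^esub> snd b')])"
        using M by (intro Next_eq ab l) simp_all
      ultimately show ?thesis unfolding eq unfolding ab(1,2) by metis
    qed
    show "Next X Sig b = Next X Sig a" if "a \<notin> Next X Sig a" "b \<notin> Next X Sig a"
    proof -
      have c: "clash a' a'" "clash a' b'" using that in_Next[OF ab(3) ab(3)] in_Next[OF ab(3,4)] unfolding ab(1,2) by blast+
      have "fst b' = fst a'" using c(2) unfolding clash_def by simp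
      with Next_eq[OF ab(3,4) clash_self[OF ab(3) c(1)]] show ?thesis unfolding ab(1,2) by simp
    qed
  next
    show "inj_on (word_eval X) (normal_forms X Sig)"
    proof (rule inj_onI)
      fix w v assume w: "w \<in> normal_forms X Sig" and v: "v \<in> normal_forms X Sig" and eq: "word_eval X w = word_eval X v"
      obtain w' where w': "w = map (\<lambda>a. h [a]) w'" "\<forall>a\<in>set w'. letter a" "successively (\<lambda>a b. \<not> clash a b) w'" using nf[OF w] by blast
      obtain v' where v': "v = map (\<lambda>a. h [a]) v'" "\<forall>a\<in>set v'. letter a" "successively (\<lambda>a b. \<not> clash a b) v'" using nf[OF v] by blast
      have "h (ev w') = h (ev v')" using eq eval w'(1,2) v'(1,2) by simp
      then have "ev w' = ev v'" using h_inj[OF ev_carrier ev_carrier] w'(2) v'(2) by simp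
      then have "w' = v'" using ev_decode[OF w'(2,3)] ev_decode[OF v'(2,3)] by metis
      then show "w = v" using w' v' by simp
    qed
  qed
qed

lemma plain_monoid_structure:
  assumes "plain_monoid X Sig"
  shows "plain_structure X Sig"
proof -
  obtain S T :: "nat set" and k :: nat and F :: "nat \<Rightarrow> nat monoid" and f g h where M: "monoid X" "finite S" "finite T" "\<forall>i<k + 2. monoid (F i)"
    "\<forall>i\<in>{2..<k + 2}. finite (carrier (F i))" "f \<in> iso (free_monoid S) (F 0)" "g \<in> iso (free_group T) (F 1)"
    and h: "h \<in> iso (free_product {..<k + 2} F) X" and
    Sig: "Sig = {h [(0, f [s])] |s. s \<in> S} \<union> {h [(1, g [(t, e)])] |t e. t \<in> T} \<union>
              {h [(i, x)] |i x. i \<in> {2..<k + 2} \<and> x \<in> carrier (F i) - {\<one>\<^bsub>F i\<^esub>}}"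
    using assms unfolding plain_monoid_def by (elim conjE exE) (rule that; assumption)
  interpret plain_factors S T k F f g using M by (intro plain_factors.intro) auto
  have "Sig = {h [a] |a. letter a}"
  proof (intro equalityI subsetI)
    fix x assume "x \<in> Sig"
    then consider s where "x = h [(0, f [s])]" "s \<in> S" | t e where "x = h [(1, g [(t, e)])]" "t \<in> T"
      | i y where "x = h [(i, y)]" "i \<in> {2..<k + 2}" "y \<in> carrier (F i) - {\<one>\<^bsub>F i\<^esub>}"
      unfolding Sig by blast
    then show "x \<in> {h [a] |a. letter a}"
      using letter_S letter_T letter_M by cases blast+
  next
    fix x assume "x \<in> {h [a] |a. letter a}"
    then obtain a where a: "x = h [a]" "letter a" by blast
    from a(2) show "x \<in> Sig" by cases (unfold a(1) Sig, blast+)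
  qed
  then show ?thesis by (rule plain_structure_of_iso[OF M(1) h])
qed

section \<open>Left multiplication on normal forms\<close>

context plain_structure
begin

abbreviation "L \<equiv> normal_forms X Sig"
abbreviation "N \<equiv> Next X Sig"
abbreviation "eval \<equiv> word_eval X"

text \<open>Left multiplication by a generator touches only the first letter of a normal form: after
  a merger the new letter has the same neighbours as the old one, so nothing further
  reduces.\<close>

definition push :: "'a \<Rightarrow> 'a list \<Rightarrow> 'a list" where
  "push b w = (case w of [] \<Rightarrow> [b] | d # w' \<Rightarrow>
     if b \<otimes> d = \<one> then w' else if b \<otimes> d \<in> Sig then (b \<otimes> d) # w' else b # w)"

lemma push_Nil [simp]: "push b [] = [b]" by (simp add: push_def)

lemma push_Cons: "push b (d # w) = (if b \<otimes> d = \<one> then w else if b \<otimes> d \<in> Sig then (b \<otimes> d) # w else b # d # w)"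
  by (simp add: push_def)

lemma in_carrier [intro, simp]: "a \<in> Sig \<Longrightarrow> a \<in> carrier X"
  using Sig_sub by auto

lemma N_sub: "N a \<subseteq> Sig" by (auto simp: Next_def)

lemma N_fin [simp]: "finite (N a)" using Sig_fin N_sub finite_subset by blast

lemma N_iff: "b \<in> N a \<longleftrightarrow> b \<in> Sig \<and> a \<otimes> b \<noteq> \<one> \<and> a \<otimes> b \<notin> Sig"
  by (auto simp: Next_def)

lemma N_sym: "a \<in> Sig \<Longrightarrow> b \<in> Sig \<Longrightarrow> b \<in> N a \<longleftrightarrow> a \<in> N b"
  using next_sym[of a b] by (auto simp: N_iff)

lemma L_Nil [simp]: "[] \<in> L" by (simp add: normal_forms_def)

lemma L_sub: "w \<in> L \<Longrightarrow> w \<in> lists Sig" by (simp add: normal_forms_def)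

lemma L_Cons: "a # w \<in> L \<longleftrightarrow> a \<in> Sig \<and> w \<in> L \<and> (w = [] \<or> hd w \<in> N a)"
  by (cases w) (auto simp: normal_forms_def N_iff)

lemma L_single [simp]: "[a] \<in> L \<longleftrightarrow> a \<in> Sig" by (simp add: L_Cons)

lemma L_hd: "w \<in> L \<Longrightarrow> w \<noteq> [] \<Longrightarrow> hd w \<in> Sig"
  by (cases w) (auto simp: L_Cons)

lemma L_tl: "w \<in> L \<Longrightarrow> tl w \<in> L"
  by (cases w) (auto simp: L_Cons)

lemma L_append: "u @ v \<in> L \<Longrightarrow> u \<in> L \<and> v \<in> L"
  by (auto simp: normal_forms_def successively_append_iff)

lemma L_butlast: "w \<in> L \<Longrightarrow> butlast w \<in> L"
  using L_append[of "butlast w" "[last w]"] by (cases "w = []") auto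

lemma L_take: "w \<in> L \<Longrightarrow> take n w \<in> L"
  using L_append[of "take n w" "drop n w"] by simp

lemma countable_L: "countable L"
proof -
  have "countable (lists Sig)" using Sig_fin by (intro countable_lists countable_finite)
  then show ?thesis using L_sub by (metis countable_subset subsetI)
qed

lemma N_prod: "b \<in> Sig \<Longrightarrow> d \<in> Sig \<Longrightarrow> b \<otimes> d \<in> Sig \<Longrightarrow> N (b \<otimes> d) = N d"
  using next_prod by blast

lemma push_L:
  assumes b: "b \<in> Sig" and w: "w \<in> L"
  shows "push b w \<in> L"
proof (cases w)
  case (Cons d w')
  show ?thesis
    using b w N_prod[of b d] unfolding Cons push_Cons L_Cons by (auto simp: L_Cons N_iff)
qed (use b in simp)

lemma eval_Nil [simp]: "eval [] = \<one>" and eval_Cons [simp]: "eval (a # w) = a \<otimes> eval w"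
  by (simp_all add: word_eval_def)

lemma eval_closed [simp]: "w \<in> lists Sig \<Longrightarrow> eval w \<in> carrier X"
  by (induction w) auto

lemma eval_closed_L [simp]: "w \<in> L \<Longrightarrow> eval w \<in> carrier X"
  by (rule eval_closed[OF L_sub])

lemma eval_push: "b \<in> Sig \<Longrightarrow> w \<in> L \<Longrightarrow> eval (push b w) = b \<otimes> eval w"
  by (cases w) (auto simp: push_Cons L_Cons m_assoc[symmetric])

lemma pushes_L: "bs \<in> lists Sig \<Longrightarrow> w \<in> L \<Longrightarrow> foldr push bs w \<in> L"
  by (induction bs) (auto intro: push_L)

lemma eval_pushes: "bs \<in> lists Sig \<Longrightarrow> w \<in> L \<Longrightarrow> eval (foldr push bs w) = eval bs \<otimes> eval w"
  by (induction bs) (auto simp: eval_push pushes_L m_assoc)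

lemma pushes_append: "x @ w \<in> L \<Longrightarrow> foldr push x w = x @ w"
proof (induction x)
  case (Cons a x)
  then have IH: "foldr push x w = x @ w" by (simp add: L_Cons)
  show ?case
  proof (cases "x @ w")
    case (Cons d v)
    then show ?thesis using Cons.prems IH unfolding append_Cons Cons by (auto simp: L_Cons push_Cons N_iff)
  qed (use IH in simp)
qed simp

lemma pushes_nf: "x \<in> L \<Longrightarrow> foldr push x [] = x"
  using pushes_append[of x "[]"] by simp

lemma pushes_eq_iff:
  assumes "bs \<in> lists Sig" "w \<in> L" "v \<in> L"
  shows "foldr push bs w = v \<longleftrightarrow> eval bs \<otimes> eval w = eval v"
  using eval_pushes[OF assms(1,2)] eval_inj pushes_L[OF assms(1,2)] assms(3) by (metis inj_onD)

text \<open>The effect of \<open>bs\<close> on \<open>w\<close> depends only on the element that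
  \<open>bs\<close> represents, by injectivity of the evaluation on normal forms.\<close>

lemma pushes_factor:
  assumes bs: "bs \<in> lists Sig" and w: "w \<in> L"
  shows "foldr push bs w = foldr push (foldr push bs []) w"
proof -
  have x: "foldr push bs [] \<in> L" by (rule pushes_L[OF bs L_Nil])
  have "eval (foldr push bs []) = eval bs" using eval_pushes[OF bs L_Nil] bs by simp
  then show ?thesis
    using pushes_eq_iff[OF bs w pushes_L[OF L_sub[OF x] w]] eval_pushes[OF L_sub[OF x] w] by simp
qed

lemma length_push_le: "length (push b w) \<le> Suc (length w)"
  by (cases w) (auto simp: push_Cons)

lemma length_push_ge: "length w \<le> Suc (length (push b w))"
  by (cases w) (auto simp: push_Cons)

lemma length_pushes_le: "length (foldr push bs w) \<le> length bs + length w"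
  by (induction bs) (auto intro: order_trans[OF length_push_le])

lemma length_pushes_ge: "length w \<le> length bs + length (foldr push bs w)"
proof (induction bs)
  case (Cons b bs)
  then show ?case using length_push_ge[of "foldr push bs w" b] by simp
qed simp

lemma length_pushes_subadd:
  assumes "bs \<in> lists Sig" "w \<in> L"
  shows "length (foldr push bs w) \<le> length (foldr push bs []) + length w"
  by (subst pushes_factor[OF assms]) (rule length_pushes_le)

text \<open>Normal forms are geodesic, because pushing a word onto the empty one never yields more
  letters than the word has.\<close>

lemma word_length_eval:
  assumes bs: "bs \<in> lists Sig"
  shows "word_length X Sig (eval bs) = length (foldr push bs [])"
proof -
  have nf: "foldr push bs [] \<in> L" by (rule pushes_L[OF bs L_Nil])
  have ev: "eval (foldr push bs []) = eval bs" using eval_pushes[OF bs L_Nil] bs by simp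
  show ?thesis
    unfolding word_length_def
  proof (rule Least_equality)
    show "\<exists>w\<in>lists Sig. length w = length (foldr push bs []) \<and> eval w = eval bs"
      using L_sub[OF nf] ev by blast
    fix k assume "\<exists>w\<in>lists Sig. length w = k \<and> eval w = eval bs"
    then obtain w where w: "w \<in> lists Sig" "length w = k" "eval w = eval bs" by blast
    have "foldr push w [] = foldr push bs []"
      using w bs by (subst pushes_eq_iff[OF _ L_Nil nf]) (simp_all add: ev)
    then show "length (foldr push bs []) \<le> k" using length_pushes_le[of w "[]"] w by simp
  qed
qed

lemma push_append: "w \<noteq> [] \<Longrightarrow> push b (w @ s) = push b w @ s"
  by (cases w) (auto simp: push_Cons)

lemma pushes_append_suffix: "length bs \<le> length w \<Longrightarrow> foldr push bs (w @ s) = foldr push bs w @ s"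
proof (induction bs)
  case (Cons b bs)
  then have "foldr push bs w \<noteq> []" using length_pushes_ge[of w bs] by (auto simp: Suc_le_eq)
  with Cons show ?case by (simp add: push_append)
qed simp

lemma right_inverse_unique:
  assumes "b \<in> Sig" "d \<in> Sig" "d' \<in> Sig" "b \<otimes> d = \<one>" "b \<otimes> d' = \<one>"
  shows "d = d'"
proof -
  have "d = d \<otimes> (b \<otimes> d')" using assms by simp
  also have "\<dots> = (d \<otimes> b) \<otimes> d'" using assms by (simp add: m_assoc)
  finally show ?thesis using inv_sym[of b d] assms by simp
qed

text \<open>The end of \<open>x\<close> meets the beginning of \<open>w\<close>, which explains
  \<open>rev x\<close>. Letters cancel in pairs \<open>c\<close> times; then either nothing more
  happens or two letters merge, which costs the single letter of the summand 1. After a merger the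
  process stops, since the merged letter may stand wherever its factors could.\<close>

lemma cancellation:
  assumes "x \<in> L" "w \<in> L"
  shows "\<exists>c\<le>length x. c \<le> length w \<and> (\<forall>i<c. rev x ! i \<otimes> w ! i = \<one>) \<and>
    length x + length w \<le> length (foldr push x w) + 2 * c + 1"
  using assms
proof (induction x arbitrary: w rule: rev_induct)
  case (snoc b x)
  have b: "b \<in> Sig" using L_append[OF snoc.prems(1)] by simp
  have x: "x \<in> L" using L_append[OF snoc.prems(1)] by simp
  show ?case
  proof (cases w)
    case Nil
    then show ?thesis using pushes_nf[OF snoc.prems(1)] by (intro exI[of _ 0]) simp
  next
    case (Cons d w')
    have d: "d \<in> Sig" "w' \<in> L" using snoc.prems(2) by (auto simp: Cons L_Cons)
    consider "b \<otimes> d = \<one>" | "b \<otimes> d \<noteq> \<one>" "b \<otimes> d \<in> Sig" | "b \<otimes> d \<noteq> \<one>" "b \<otimes> d \<notin> Sig" by blast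
    then show ?thesis
    proof cases
      case 1
      obtain c where c: "c \<le> length x" "c \<le> length w'" "\<forall>i<c. rev x ! i \<otimes> w' ! i = \<one>"
        "length x + length w' \<le> length (foldr push x w') + 2 * c + 1" using snoc.IH[OF x d(2)] by blast
      then show ?thesis using 1
        by (intro exI[of _ "Suc c"]) (auto simp: Cons push_Cons nth_Cons split: nat.split)
    next
      case 2
      have "x @ (b \<otimes> d) # w' \<in> L"
      proof -
        have "x = [] \<or> b \<in> N (last x)" "(b \<otimes> d) # w' \<in> L"
          using snoc.prems 2 push_L[OF b snoc.prems(2)]
          by (auto simp: normal_forms_def successively_append_iff N_iff Cons push_Cons)
        moreover have "x \<noteq> [] \<Longrightarrow> last x \<in> Sig" using L_sub[OF x] by auto
        ultimately have "x = [] \<or> b \<otimes> d \<in> N (last x)"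
          using N_sym[of "last x" b] N_sym[of "last x" "b \<otimes> d"] next_prod[of b d] 2 b d by auto
        then show ?thesis using x \<open>(b \<otimes> d) # w' \<in> L\<close>
          by (auto simp: normal_forms_def successively_append_iff N_iff)
      qed
      from pushes_append[OF this] show ?thesis using 2
        by (intro exI[of _ 0]) (simp add: Cons push_Cons)
    next
      case 3
      have "x @ b # d # w' \<in> L"
        using snoc.prems 3 b d by (auto simp: normal_forms_def successively_append_iff Cons)
      from pushes_append[OF this] show ?thesis using 3
        by (intro exI[of _ 0]) (simp add: Cons push_Cons)
    qed
  qed
qed auto

lemma generated_nf:
  assumes "generates_monoid X A" "A \<subseteq> Sig"
  shows "carrier X = eval ` L"
proof
  show "carrier X \<subseteq> eval ` L"
  proof
    fix x assume "x \<in> carrier X"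
    then obtain bs where bs: "bs \<in> lists A" "x = eval bs" using assms unfolding generates_monoid_def by blast
    have "bs \<in> lists Sig" using assms bs by auto
    have "x = eval (foldr push bs [])" using eval_pushes[OF \<open>bs \<in> lists Sig\<close> L_Nil] bs \<open>bs \<in> lists Sig\<close> by simp
    then show "x \<in> eval ` L" using pushes_L[OF \<open>bs \<in> lists Sig\<close> L_Nil] by blast
  qed
qed (auto dest: L_sub)

lemma reachable_nf:
  assumes "generates_monoid X A" "A \<subseteq> Sig" "w \<in> L"
  shows "\<exists>bs\<in>lists A. foldr push bs [] = w"
proof -
  have "eval w \<in> carrier X" using L_sub[OF assms(3)] by simp
  then obtain bs where bs: "bs \<in> lists A" "eval bs = eval w" using assms unfolding generates_monoid_def by force
  then have "bs \<in> lists Sig" using assms by auto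
  then have "foldr push bs [] = w" using pushes_eq_iff[of bs "[]" w] bs assms(3) by simp
  then show ?thesis using bs by blast
qed

text \<open>A letter without neighbours clashes with all letters, so by \<open>next_class\<close> no
  letter has a neighbour. Normal forms would have length at most 1 and \<open>X\<close> would be
  finite.\<close>

lemma N_nonempty:
  assumes "infinite (carrier X)" "generates_monoid X A" "A \<subseteq> Sig" "a \<in> Sig"
  shows "N a \<noteq> {}"
proof
  assume e: "N a = {}"
  have all: "N d = {}" if "d \<in> Sig" for d using next_class[of a d] assms(4) that e by auto
  have "L \<subseteq> insert [] ((\<lambda>d. [d]) ` Sig)"
  proof
    fix w assume w: "w \<in> L"
    show "w \<in> insert [] ((\<lambda>d. [d]) ` Sig)"
    proof (cases w)
      case (Cons d v) then show ?thesis using w all[of d] by (auto simp: L_Cons)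
    qed simp
  qed
  then have "finite L" using Sig_fin by (auto intro: finite_subset)
  then show False using generated_nf[OF assms(2,3)] assms(1) by simp
qed

lemma infinite_L:
  assumes "infinite (carrier X)" "generates_monoid X A" "A \<subseteq> Sig"
  shows "infinite L"
  using generated_nf[OF assms(2,3)] assms(1) by auto

section \<open>The integers and the infinite dihedral group\<close>

lemma word_eval_replicate: "a \<in> carrier X \<Longrightarrow> eval (replicate n a) = a [^] n"
  by (induction n) (auto simp: nat_pow_comm[of a 1, simplified] nat_pow_Suc2)

text \<open>Both letters are invertible, so \<open>X\<close> is a group generated by
  \<open>a\<close>. Its positive powers differ from the unit because \<open>replicate n a\<close> is
  a normal form.\<close>

lemma iso_integers:
  assumes gen: "carrier X = eval ` lists Sig" and Sig: "Sig = {a, a'}" and ne: "N a = {a}" and one: "a \<otimes> a' = \<one>"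
  shows "X \<cong> integer_group"
proof -
  have a: "a \<in> Sig" "a' \<in> Sig" and one': "a' \<otimes> a = \<one>" using Sig one inv_sym[of a a'] by auto
  have linv: "\<exists>y\<in>carrier X. y \<otimes> x = \<one>" if xc: "x \<in> carrier X" for x
  proof -
    obtain w where w: "w \<in> lists Sig" "x = eval w" using xc unfolding gen by blast
    have "\<exists>y\<in>carrier X. y \<otimes> eval w = \<one>" using w(1)
    proof (induction w)
      case (Cons b w)
      then obtain y where y: "y \<in> carrier X" "y \<otimes> eval w = \<one>" by auto
      obtain b' where b': "b' \<in> Sig" "b' \<otimes> b = \<one>" using Cons Sig one one' by auto
      have c: "b \<in> carrier X" "eval w \<in> carrier X" "b' \<in> carrier X" using Cons b' by auto
      have "(y \<otimes> b') \<otimes> (b \<otimes> eval w) = y \<otimes> ((b' \<otimes> b) \<otimes> eval w)" using c y by (simp add: m_assoc)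
      then show ?case using b' y c by (intro bexI[of _ "y \<otimes> b'"]) auto
    qed auto
    then show ?thesis using w by simp
  qed
  interpret group X by (rule group_l_invI) (use linv in blast)
  have ac: "a \<in> carrier X" "a' \<in> carrier X" using a by auto
  have a': "a' = inv a" using inv_equality[OF one' ac] by simp
  have pow: "a [^] n \<noteq> \<one>" if "0 < n" for n :: nat
  proof
    assume "a [^] n = \<one>"
    then have "eval (replicate n a) = eval []" using word_eval_replicate[OF ac(1)] by simp
    moreover have "replicate n a \<in> L"
    proof (induction n)
      case (Suc n) then show ?case using ne a by (cases n) (auto simp: L_Cons)
    qed simp
    ultimately have "replicate n a = []" using eval_inj by (metis L_Nil inj_onD)
    with that show False by simp
  qed
  let ?\<psi> = "\<lambda>n :: int. a [^] n"
  have "?\<psi> \<in> iso integer_group X"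
  proof (rule isoI)
    show "?\<psi> \<in> hom integer_group X" using ac by (auto simp: hom_def integer_group_def int_pow_mult)
    show "bij_betw ?\<psi> (carrier integer_group) (carrier X)"
      unfolding bij_betw_def
    proof
      have lt: "a [^] i \<noteq> a [^] j" if "i < j" for i j :: int
      proof
        assume "a [^] i = a [^] j"
        then have "a [^] (j - i) = \<one>" using ac by (simp add: int_pow_diff)
        then have "a [^] nat (j - i) = \<one>" using that int_pow_int[of X a "nat (j - i)"] by simp
        then show False using pow[of "nat (j - i)"] that by simp
      qed
      show "inj_on ?\<psi> (carrier integer_group)"
        by (rule inj_onI) (metis lt linorder_neqE)
      have "\<exists>n :: int. eval w = a [^] n" if "w \<in> lists Sig" for w
        using that
      proof (induction w)
        case Nil then show ?case by (intro exI[of _ 0]) simp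
      next
        case (Cons b w)
        then obtain n :: int where n: "eval w = a [^] n" by auto
        have "a \<otimes> a [^] n = a [^] (1 + n)" "a' \<otimes> a [^] n = a [^] (-1 + n)"
          using ac int_pow_mult[of a 1 n] int_pow_mult[of a "-1" n] by (simp_all add: a' int_pow_neg)
        then show ?case using Cons n Sig by auto
      qed
      then have "carrier X \<subseteq> range ?\<psi>" unfolding gen by blast
      moreover have "range ?\<psi> \<subseteq> carrier X" using ac by auto
      ultimately show "?\<psi> ` carrier integer_group = carrier X" by (simp add: integer_group_def)
    qed
  qed
  then have "integer_group \<cong> X" by (auto simp: is_iso_def)
  then show ?thesis using group.iso_sym[of integer_group X] group_integer_group by blast
qed

text \<open>The only element of \<open>integer_mod_group 2\<close> apart from the unit is 1, so
  reduced words of the free product are alternating words in two symbols, and \<open>l\<close>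
  carries them to the normal forms of \<open>X\<close>.\<close>

lemma iso_infinite_dihedral:
  assumes gen: "carrier X = eval ` lists Sig" and Sig: "Sig = {a, b}" and ab: "a \<noteq> b" and N: "N a = {b}" "N b = {a}"
    and one: "a \<otimes> a = \<one>" "b \<otimes> b = \<one>"
  shows "X \<cong> free_product {0, 1 :: nat} (\<lambda>_. integer_mod_group 2)"
proof -
  let ?F = "\<lambda>_ :: nat. integer_mod_group 2"
  let ?FP = "free_product {0, 1 :: nat} ?F"
  have m2: "carrier (integer_mod_group 2) - {\<one>\<^bsub>integer_mod_group 2\<^esub>} = {1}" "1 \<otimes>\<^bsub>integer_mod_group 2\<^esub> 1 = \<one>\<^bsub>integer_mod_group 2\<^esub>"
    by (auto simp: integer_mod_group_def)
  define l where "l p = (if fst p = 0 then a else b)" for p :: "nat \<times> int"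
  let ?W = "{w \<in> lists {(0, 1), (1, 1)}. successively (\<lambda>x y. fst x \<noteq> fst y) w}"
  have car: "carrier ?FP = ?W"
  proof -
    have "(SIGMA i:{0, 1 :: nat}. carrier (?F i) - {\<one>\<^bsub>?F i\<^esub>}) = {(0, 1), (1, 1)}" using m2 by auto
    then show ?thesis by (simp add: free_product_def)
  qed
  define \<phi> where "\<phi> w = eval (map l w)" for w
  have l: "l p \<in> Sig" for p by (auto simp: l_def Sig)
  have lW: "map l w \<in> L" if "w \<in> ?W" for w
    using that
  proof (induction w)
    case (Cons p w)
    then show ?case using N ab l by (cases w) (auto simp: L_Cons l_def)
  qed simp
  have surjL: "\<exists>w'\<in>?W. map l w' = w" if "w \<in> L" for w
    using that
  proof (induction w)
    case (Cons d w)
    then obtain w' where w': "w' \<in> ?W" "map l w' = w" by (auto simp: L_Cons)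
    let ?p = "(if d = a then 0 else 1 :: nat, 1 :: int)"
    have "d \<in> Sig" using Cons.prems by (simp add: L_Cons)
    then have dab: "d = a \<or> d = b" by (simp add: Sig)
    then have "l ?p = d" by (auto simp: l_def)
    moreover have "?p # w' \<in> ?W"
    proof (cases w')
      case (Cons q v)
      then have "w \<noteq> []" "hd w = l q" using w' by auto
      then have lq: "l q \<in> N d" using \<open>d # w \<in> L\<close> by (simp add: L_Cons)
      have "fst q \<noteq> fst ?p"
        using dab lq N ab by (auto simp: l_def split: if_splits)
      moreover have "?p \<in> {(0, 1), (1, 1)}" by auto
      ultimately show ?thesis using w'(1) unfolding Cons by (simp add: successively_Cons)
    qed simp
    ultimately show ?case using w' by (intro bexI[of _ "?p # w'"]) auto
  qed auto
  have linj: "inj_on l {(0, 1), (1, 1)}" using ab by (auto simp: inj_on_def l_def)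
  have push: "\<phi> (free_product_push ?F p v) = l p \<otimes> \<phi> v" if p: "p \<in> {(0, 1), (1, 1)}" and v: "v \<in> lists {(0, 1), (1, 1)}" for p v
  proof (cases v)
    case Nil
    then show ?thesis using p l by (auto simp: \<phi>_def)
  next
    case (Cons q v')
    have c: "\<phi> v' \<in> carrier X" unfolding \<phi>_def using l by (intro eval_closed) auto
    have q: "q \<in> {(0, 1), (1, 1)}" using v Cons by auto
    have lq: "l q \<in> carrier X" "l p \<in> carrier X" using l by auto
    have s: "l p \<otimes> (l p \<otimes> \<phi> v') = \<phi> v'"
      using one lq c m_assoc[of "l p" "l p" "\<phi> v'"] by (auto simp: l_def)
    show ?thesis using p q s m2(2) unfolding Cons by (auto simp: \<phi>_def)
  qed
  have pushc: "free_product_push ?F p v \<in> lists {(0, 1), (1, 1)}" if "p \<in> {(0, 1), (1, 1)}" "v \<in> lists {(0, 1), (1, 1)}" for p v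
    using that m2(2) by (cases v) auto
  have pc: "foldr (free_product_push ?F) u v \<in> lists {(0, 1), (1, 1)}" if "u \<in> lists {(0, 1), (1, 1)}" "v \<in> lists {(0, 1), (1, 1)}" for u v
    using that(1)
  proof (induction u)
    case (Cons p u)
    then have "p \<in> {(0, 1), (1, 1)}" "foldr (free_product_push ?F) u v \<in> lists {(0, 1), (1, 1)}"
      by (simp_all only: Cons_in_lists_iff)
    then show ?case unfolding foldr.simps comp_apply by (rule pushc)
  qed (use that in simp)
  have cl: "\<phi> v \<in> carrier X" for v unfolding \<phi>_def using l by (intro eval_closed) auto
  have hom: "\<phi> (foldr (free_product_push ?F) u v) = \<phi> u \<otimes> \<phi> v" if "u \<in> lists {(0, 1), (1, 1)}" "v \<in> lists {(0, 1), (1, 1)}" for u v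
    using that
  proof (induction u)
    case Nil then show ?case using cl[of v] by (simp add: \<phi>_def)
  next
    case (Cons p u)
    have "\<phi> (foldr (free_product_push ?F) (p # u) v) = l p \<otimes> \<phi> (foldr (free_product_push ?F) u v)"
    proof -
      have "p \<in> {(0, 1), (1, 1)}" "u \<in> lists {(0, 1), (1, 1)}"
        by (rule Cons.hyps)+
      then show ?thesis unfolding foldr.simps comp_apply by (intro push pc Cons.prems)
    qed
    also have "\<dots> = l p \<otimes> (\<phi> u \<otimes> \<phi> v)"
      using Cons.IH Cons.prems by metis
    also have "\<dots> = (l p \<otimes> \<phi> u) \<otimes> \<phi> v" using l cl by (simp add: m_assoc)
    finally show ?case by (simp add: \<phi>_def)
  qed
  have bij: "bij_betw \<phi> (carrier ?FP) (carrier X)"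
    unfolding bij_betw_def
  proof
    show "inj_on \<phi> (carrier ?FP)"
    proof (rule inj_onI)
      fix u v assume uv: "u \<in> carrier ?FP" "v \<in> carrier ?FP" "\<phi> u = \<phi> v"
      then have "map l u = map l v" using lW eval_inj unfolding car \<phi>_def by (meson inj_onD)
      moreover have "inj_on l (set u \<union> set v)" using uv linj unfolding car by (auto intro: inj_on_subset)
      ultimately show "u = v" by (rule map_inj_on)
    qed
    have "carrier X = eval ` L"
    proof
      show "carrier X \<subseteq> eval ` L"
      proof
        fix x assume "x \<in> carrier X"
        then obtain bs where bs: "bs \<in> lists Sig" "x = eval bs" unfolding gen by blast
        then have "x = eval (foldr push bs [])" using eval_pushes[OF bs(1) L_Nil] by simp
        then show "x \<in> eval ` L" using pushes_L[OF bs(1) L_Nil] by blast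
      qed
    qed auto
    moreover have "L = map l ` ?W" using lW surjL by blast
    ultimately show "\<phi> ` carrier ?FP = carrier X" unfolding car \<phi>_def by (simp add: image_image)
  qed
  have mon: "monoid ?FP" by (rule monoid_free_product) (simp add: group.is_monoid group_integer_mod_group)
  let ?\<psi> = "inv_into (carrier ?FP) \<phi>"
  have "?\<psi> \<in> iso X ?FP"
  proof (rule isoI)
    show "bij_betw ?\<psi> (carrier X) (carrier ?FP)" using bij by (rule bij_betw_inv_into)
    show "?\<psi> \<in> hom X ?FP"
    proof (rule homI)
      fix x assume x: "x \<in> carrier X"
      show cx: "?\<psi> x \<in> carrier ?FP" using bij_betw_apply[OF bij_betw_inv_into[OF bij] x] .
      fix y assume y: "y \<in> carrier X"
      have cy: "?\<psi> y \<in> carrier ?FP" using bij_betw_apply[OF bij_betw_inv_into[OF bij] y] .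
      have e: "\<phi> (?\<psi> x \<otimes>\<^bsub>?FP\<^esub> ?\<psi> y) = x \<otimes> y"
      proof -
        have "?\<psi> x \<in> lists {(0, 1), (1, 1)}" "?\<psi> y \<in> lists {(0, 1), (1, 1)}"
          using cx cy unfolding car by blast+
        from hom[OF this] show ?thesis
          using bij_betw_inv_into_right[OF bij] x y by simp
      qed
      show "?\<psi> (x \<otimes> y) = ?\<psi> x \<otimes>\<^bsub>?FP\<^esub> ?\<psi> y"
        unfolding e[symmetric] by (rule bij_betw_inv_into_left[OF bij monoid.m_closed[OF mon cx cy]])
    qed
  qed
  then show ?thesis by (auto simp: is_iso_def)
qed

text \<open>Here the two excluded groups enter. If \<open>a\<close> may follow itself, its forced
  continuation leaves only \<open>a\<close> and its inverse as letters, which gives the integers.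
  Otherwise \<open>a\<close> clashes with itself, symmetry forces \<open>a\<close> and
  \<open>b\<close> to alternate, and both square to the unit, which gives the infinite dihedral
  group.\<close>

lemma branching:
  assumes gen: "carrier X = eval ` lists Sig" and nZ: "\<not> X \<cong> integer_group"
    and nD: "\<not> X \<cong> free_product {0, 1 :: nat} (\<lambda>_. integer_mod_group 2)"
    and S: "a \<in> Sig" "b \<in> Sig" "c \<in> Sig"
    and inv: "\<exists>x\<in>Sig. x \<otimes> a = \<one>" "\<exists>x\<in>Sig. x \<otimes> b = \<one>"
    and N: "N a = {b}" "N b = {c}"
  shows False
proof (cases "a \<in> N a")
  case True
  then have Na: "N a = {a}" using N by auto
  obtain x where x: "x \<in> Sig" "x \<otimes> a = \<one>" using inv by blast
  then have ax: "a \<otimes> x = \<one>" using inv_sym[of x a] S by simp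
  have "d \<in> {a, x}" if d: "d \<in> Sig" for d
  proof (rule ccontr)
    assume n: "d \<notin> {a, x}"
    then have "d \<notin> N a" using Na by simp
    then have "a \<otimes> d = \<one> \<or> a \<otimes> d \<in> Sig" using d by (auto simp: N_iff)
    then show False
    proof
      assume "a \<otimes> d = \<one>"
      then show False using right_inverse_unique[of a d x] n d x ax S by auto
    next
      assume "a \<otimes> d \<in> Sig"
      then have "N d = {a}" using next_prod[of a d] S d Na by auto
      then show False using N_sym[of a d] S d \<open>d \<notin> N a\<close> by auto
    qed
  qed
  then have "Sig = {a, x}" using S x by auto
  from iso_integers[OF gen this Na ax] nZ show False by simp
next
  case False
  then have ab: "a \<noteq> b" using N by auto
  have "a \<in> N b" using N_sym[of a b] N S by auto
  then have Nb: "N b = {a}" using N by auto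
  have Sig: "d = a \<or> d = b" if d: "d \<in> Sig" for d
  proof (rule ccontr)
    assume n: "\<not> (d = a \<or> d = b)"
    then have "N d = N a" using next_class[of a d] S d False N by auto
    then have "d \<in> N b" using N N_sym[of d b] S d by auto
    then show False using Nb n by simp
  qed
  then have SE: "Sig = {a, b}" using S by auto
  \<comment> \<open>If the square of \<open>u\<close> were \<open>u\<close>, invertibility would
    make \<open>u\<close> the unit; if it were \<open>v\<close>, then \<open>u\<close> and
    \<open>v\<close> would have the same neighbours.\<close>
  have sq: "u \<otimes> u = \<one>" if u: "u \<in> Sig" "v \<in> Sig" "u \<noteq> v" "u \<notin> N u" "\<exists>x\<in>Sig. x \<otimes> u = \<one>" "N u \<noteq> N v" "\<And>d. d \<in> Sig \<Longrightarrow> d = u \<or> d = v" for u v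
  proof (rule ccontr)
    assume n: "u \<otimes> u \<noteq> \<one>"
    then have "u \<otimes> u \<in> Sig" using u by (auto simp: N_iff)
    then consider "u \<otimes> u = u" | "u \<otimes> u = v" using u(7) by blast
    then show False
    proof cases
      case 1
      obtain x where x: "x \<in> Sig" "x \<otimes> u = \<one>" using u by blast
      then have "u = (x \<otimes> u) \<otimes> u" using u by simp
      also have "\<dots> = \<one>" using x u 1 by (subst m_assoc) auto
      finally show False using u one_notin by auto
    next
      case 2
      then show False using next_prod[of u u] u by auto
    qed
  qed
  have "a \<otimes> a = \<one>" "b \<otimes> b = \<one>"
    using sq[of a b] sq[of b a] S ab False N Nb inv Sig by auto
  from iso_infinite_dihedral[OF gen SE ab _ _ this] N Nb nD show False by simp
qed

end

section \<open>The random walk against Markovian words\<close>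

locale plain_walk = plain_structure +
  fixes \<nu> :: "'a pmf"
  assumes supp: "set_pmf \<nu> \<subseteq> Sig" and gen: "generates_monoid X (set_pmf \<nu>)"
    and inf: "infinite (carrier X)" and not_Z: "\<not> X \<cong> integer_group"
    and not_D: "\<not> X \<cong> free_product {0, 1 :: nat} (\<lambda>_. integer_mod_group 2)"
begin

definition Aop :: "('a list \<Rightarrow> real) \<Rightarrow> 'a list \<Rightarrow> real" where
  "Aop f w = (\<Sum>b\<in>Sig. pmf \<nu> b * f (push b w))"

text \<open>Expectation over \<open>j\<close> independent letters of law \<open>\<nu>\<close>, as a
  finite sum, so that no measurability enters the estimates.\<close>

primrec Ex :: "nat \<Rightarrow> ('a list \<Rightarrow> real) \<Rightarrow> real" where
  "Ex 0 F = F []"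
| "Ex (Suc j) F = (\<Sum>b\<in>Sig. pmf \<nu> b * Ex j (\<lambda>bs. F (b # bs)))"

lemma sum_nu [simp]: "sum (pmf \<nu>) Sig = 1"
  using sum_pmf_eq_1[OF Sig_fin supp] .

lemma Ex_const [simp]: "Ex j (\<lambda>_. c) = c"
  by (induction j) (simp_all flip: sum_distrib_right)

lemma Ex_add: "Ex j (\<lambda>bs. F bs + G bs) = Ex j F + Ex j G"
  by (induction j arbitrary: F G) (simp_all add: distrib_left sum.distrib)

lemma Ex_cmult: "Ex j (\<lambda>bs. c * F bs) = c * Ex j F"
  by (induction j arbitrary: F) (simp_all add: sum_distrib_left mult.left_commute)

lemma Ex_minus: "Ex j (\<lambda>bs. F bs - G bs) = Ex j F - Ex j G"
  using Ex_add[of j F "\<lambda>bs. (-1) * G bs"] Ex_cmult[of j "-1" G] by simp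

lemma Ex_sum: "finite I \<Longrightarrow> Ex j (\<lambda>bs. \<Sum>i\<in>I. F i bs) = (\<Sum>i\<in>I. Ex j (F i))"
  by (induction I rule: finite_induct) (simp_all add: Ex_add)

lemma Ex_mono:
  "(\<And>bs. bs \<in> lists Sig \<Longrightarrow> length bs = j \<Longrightarrow> F bs \<le> G bs) \<Longrightarrow> Ex j F \<le> Ex j G"
proof (induction j arbitrary: F G)
  case (Suc j)
  show ?case by (auto intro!: sum_mono mult_left_mono Suc)
qed simp

lemma Ex_nonneg: "(\<And>bs. bs \<in> lists Sig \<Longrightarrow> length bs = j \<Longrightarrow> 0 \<le> F bs) \<Longrightarrow> 0 \<le> Ex j F"
  using Ex_mono[of j "\<lambda>_. 0" F] by simp

lemma Aop_pow: "(Aop ^^ j) f w = Ex j (\<lambda>bs. f (foldr push bs w))"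
proof (induction j arbitrary: f)
  case (Suc j)
  have "(Aop ^^ Suc j) f w = (Aop ^^ j) (Aop f) w" by (simp add: funpow_Suc_right del: funpow.simps)
  also have "\<dots> = Ex j (\<lambda>bs. \<Sum>b\<in>Sig. pmf \<nu> b * f (push b (foldr push bs w)))"
    unfolding Suc Aop_def ..
  also have "\<dots> = Ex (Suc j) (\<lambda>bs. f (foldr push bs w))"
    by (simp add: Ex_sum[OF Sig_fin] Ex_cmult)
  finally show ?case .
qed simp

section \<open>Mean word length and the drift\<close>

definition len :: "'a list \<Rightarrow> real" where "len w = real (length w)"

text \<open>The mean length of the random walk after \<open>j\<close> steps, because
  \<open>foldr push bs []\<close> is the normal form of the product of \<open>bs\<close>.\<close>

definition a :: "nat \<Rightarrow> real" where "a j = (Aop ^^ j) len []"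

lemma Aop_pow_len_le: "w \<in> L \<Longrightarrow> (Aop ^^ j) len w \<le> a j + len w"
  unfolding a_def Aop_pow using length_pushes_subadd[of _ w]
  by (subst Ex_const[symmetric, of "len w" j], subst Ex_add[symmetric], intro Ex_mono) (auto simp: len_def simp flip: of_nat_add simp del: of_nat_add)

lemma Aop_pow_len_bounds:
  "len w - j \<le> (Aop ^^ j) len w" "(Aop ^^ j) len w \<le> len w + j"
proof -
  have "len w - j = Ex j (\<lambda>_. len w - j)" by simp
  also have "\<dots> \<le> Ex j (\<lambda>bs. len (foldr push bs w))"
    using length_pushes_ge[of w] by (intro Ex_mono) (force simp: len_def algebra_simps simp flip: of_nat_add)
  finally show "len w - j \<le> (Aop ^^ j) len w" by (simp add: Aop_pow)
  have "Ex j (\<lambda>bs. len (foldr push bs w)) \<le> Ex j (\<lambda>_. len w + j)"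
    using length_pushes_le[of _ w] by (intro Ex_mono) (force simp: len_def algebra_simps simp flip: of_nat_add)
  then show "(Aop ^^ j) len w \<le> len w + j" by (simp add: Aop_pow)
qed

text \<open>Only finitely many letters occur, but the alphabet type need not be countable;
  \<open>obs j F\<close> is a measurable version of \<open>\<lambda>\<omega>. F (stake j \<omega>)\<close>.\<close>

primrec obs :: "nat \<Rightarrow> ('a list \<Rightarrow> real) \<Rightarrow> 'a stream \<Rightarrow> real" where
  "obs 0 F \<omega> = F []"
| "obs (Suc j) F \<omega> = (\<Sum>b\<in>Sig. indicator {b} (shd \<omega>) * obs j (\<lambda>bs. F (b # bs)) (stl \<omega>))"

lemma obs_measurable [measurable]: "obs j F \<in> borel_measurable (stream_space (measure_pmf \<nu>))"
proof (induction j arbitrary: F)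
  case 0
  have "obs 0 F = (\<lambda>_. F [])" by (simp add: fun_eq_iff)
  then show ?case by simp
next
  case (Suc j)
  have [measurable]: "obs j F \<in> borel_measurable (stream_space (measure_pmf \<nu>))" for F by (rule Suc)
  have [measurable]: "(\<lambda>x. indicator {b} x :: real) \<in> borel_measurable (measure_pmf \<nu>)" for b by simp
  have "obs (Suc j) F = (\<lambda>\<omega>. \<Sum>b\<in>Sig. indicator {b} (shd \<omega>) * obs j (\<lambda>bs. F (b # bs)) (stl \<omega>))"
    by (simp add: fun_eq_iff)
  moreover have "(\<lambda>\<omega>. \<Sum>b\<in>Sig. indicator {b} (shd \<omega>) * obs j (\<lambda>bs. F (b # bs)) (stl \<omega>)) \<in> borel_measurable (stream_space (measure_pmf \<nu>))"
    by measurable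
  ultimately show ?case by simp
qed

lemma obs_stake: "stream_all (\<lambda>x. x \<in> Sig) \<omega> \<Longrightarrow> obs j F \<omega> = F (stake j \<omega>)"
proof (induction j arbitrary: F \<omega>)
  case (Suc j)
  have h: "shd \<omega> \<in> Sig" using Suc.prems by (metis snth.simps(1) stream_all_def)
  have t: "stream_all (\<lambda>x. x \<in> Sig) (stl \<omega>)" using Suc.prems unfolding stream_all_def by (metis snth.simps(2))
  have "obs (Suc j) F \<omega> = (\<Sum>b\<in>Sig. if b = shd \<omega> then F (b # stake j (stl \<omega>)) else 0)"
    unfolding obs.simps using Suc.IH[OF t] by (intro sum.cong) (auto simp: indicator_def)
  then show ?case using h Sig_fin by simp
qed simp

lemma obs_nonneg: "(\<And>bs. 0 \<le> F bs) \<Longrightarrow> 0 \<le> obs j F \<omega>"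
  by (induction j arbitrary: F \<omega>) (auto intro!: sum_nonneg mult_nonneg_nonneg)

lemma nn_integral_obs:
  assumes "\<And>bs. 0 \<le> F bs"
  shows "(\<integral>\<^sup>+\<omega>. ennreal (obs j F \<omega>) \<partial>stream_space (measure_pmf \<nu>)) = ennreal (Ex j F)"
  using assms
proof (induction j arbitrary: F)
  case 0
  interpret S: prob_space "stream_space (measure_pmf \<nu>)" by (rule prob_space.prob_space_stream_space[OF prob_space_measure_pmf])
  show ?case using S.emeasure_space_1 by simp
next
  case (Suc j)
  let ?M = "stream_space (measure_pmf \<nu>)"
  have F: "0 \<le> F (b # bs)" for b bs by (rule Suc.prems)
  have "(\<integral>\<^sup>+\<omega>. ennreal (obs (Suc j) F \<omega>) \<partial>?M) =
    (\<integral>\<^sup>+x. \<integral>\<^sup>+\<omega>. ennreal (obs (Suc j) F (x ## \<omega>)) \<partial>?M \<partial>measure_pmf \<nu>)"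
    by (rule prob_space.nn_integral_stream_space[OF prob_space_measure_pmf]) measurable
  also have "\<dots> = (\<integral>\<^sup>+x. (\<Sum>b\<in>Sig. indicator {b} x * ennreal (Ex j (\<lambda>bs. F (b # bs)))) \<partial>measure_pmf \<nu>)"
  proof (rule nn_integral_cong)
    fix x
    have "ennreal (obs (Suc j) F (x ## \<omega>)) = (\<Sum>b\<in>Sig. indicator {b} x * ennreal (obs j (\<lambda>bs. F (b # bs)) \<omega>))" for \<omega>
    proof -
      have "ennreal (obs (Suc j) F (x ## \<omega>)) = (\<Sum>b\<in>Sig. ennreal (indicator {b} x * obs j (\<lambda>bs. F (b # bs)) \<omega>))"
        unfolding obs.simps stream.sel by (rule sum_ennreal[symmetric]) (auto intro!: mult_nonneg_nonneg obs_nonneg F)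
      also have "\<dots> = (\<Sum>b\<in>Sig. indicator {b} x * ennreal (obs j (\<lambda>bs. F (b # bs)) \<omega>))"
        by (intro sum.cong) (auto simp: indicator_def)
      finally show ?thesis .
    qed
    then have "(\<integral>\<^sup>+\<omega>. ennreal (obs (Suc j) F (x ## \<omega>)) \<partial>?M) =
        (\<integral>\<^sup>+\<omega>. (\<Sum>b\<in>Sig. indicator {b} x * ennreal (obs j (\<lambda>bs. F (b # bs)) \<omega>)) \<partial>?M)" by simp
    also have "\<dots> = (\<Sum>b\<in>Sig. \<integral>\<^sup>+\<omega>. indicator {b} x * ennreal (obs j (\<lambda>bs. F (b # bs)) \<omega>) \<partial>?M)"
      by (rule nn_integral_sum) measurable
    also have "\<dots> = (\<Sum>b\<in>Sig. indicator {b} x * ennreal (Ex j (\<lambda>bs. F (b # bs))))"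
      using Suc.IH[OF F] by (intro sum.cong refl) (subst nn_integral_cmult, auto)
    finally show "(\<integral>\<^sup>+\<omega>. ennreal (obs (Suc j) F (x ## \<omega>)) \<partial>?M) = \<dots>" .
  qed
  also have "\<dots> = (\<Sum>b\<in>Sig. ennreal (pmf \<nu> b) * ennreal (Ex j (\<lambda>bs. F (b # bs))))"
    by (subst nn_integral_sum) (auto simp: nn_integral_multc emeasure_pmf_single intro!: sum.cong)
  also have "\<dots> = (\<Sum>b\<in>Sig. ennreal (pmf \<nu> b * Ex j (\<lambda>bs. F (b # bs))))"
    by (intro sum.cong refl) (simp add: ennreal_mult' Ex_nonneg F)
  also have "\<dots> = ennreal (Ex (Suc j) F)"
    by (simp add: sum_ennreal Ex_nonneg F)
  finally show ?case .
qed

lemma drift_limit: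
  assumes "is_drift X Sig \<nu> \<gamma>"
  shows "(\<lambda>n. a n / n) \<longlonglongrightarrow> \<gamma>"
proof -
  let ?M = "stream_space (measure_pmf \<nu>)"
  interpret S: prob_space ?M by (rule prob_space.prob_space_stream_space[OF prob_space_measure_pmf])
  \<comment> \<open>The cut-off at 1 does nothing on words of length \<open>n\<close> (for
    \<open>n = 0\<close> division by zero gives 0) and provides the constant for dominated
    convergence.\<close>
  define F where "F n bs = min 1 (len (foldr push bs []) / real n)" for n bs
  have F0: "0 \<le> F n bs" and F1: "F n bs \<le> 1" for n bs by (auto simp: F_def len_def)
  have all: "AE \<omega> in ?M. stream_all (\<lambda>x. x \<in> Sig) \<omega>"
    using supp by (intro prob_space.AE_stream_all[OF prob_space_measure_pmf]) (auto simp: AE_measure_pmf_iff)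
  have F_eq: "F n bs = len (foldr push bs []) / real n" if "length bs = n" for n bs
    using length_pushes_le[of bs "[]"] that by (cases "n = 0") (auto simp: F_def len_def min_def field_simps)
  have lim: "(\<lambda>n. \<integral>\<omega>. obs n (F n) \<omega> \<partial>?M) \<longlonglongrightarrow> (\<integral>\<omega>. \<gamma> \<partial>?M)"
  proof (rule integral_dominated_convergence[where w="\<lambda>_. 1"])
    show "AE \<omega> in ?M. (\<lambda>n. obs n (F n) \<omega>) \<longlonglongrightarrow> \<gamma>"
      using all assms[unfolded is_drift_def]
    proof eventually_elim
      case (elim \<omega>)
      have st: "stake n \<omega> \<in> lists Sig" for n
        using elim(1) by (auto simp: stream_all_def in_set_conv_nth)
      have "real (word_length X Sig (eval (stake n \<omega>))) / real n = obs n (F n) \<omega>" for n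
        by (simp add: word_length_eval[OF st] obs_stake[OF elim(1)] F_eq len_def)
      then show ?case using elim(2) by simp
    qed
    show "AE \<omega> in ?M. norm (obs n (F n) \<omega>) \<le> 1" for n
      using all by eventually_elim (simp add: obs_stake F0 F1)
  qed (auto simp: S.emeasure_finite)
  have "(\<integral>\<omega>. obs n (F n) \<omega> \<partial>?M) = a n / n" for n
  proof -
    have "(\<integral>\<omega>. obs n (F n) \<omega> \<partial>?M) = enn2real (\<integral>\<^sup>+\<omega>. ennreal (obs n (F n) \<omega>) \<partial>?M)"
      by (rule integral_eq_nn_integral) (auto intro!: obs_nonneg F0)
    also have "\<dots> = Ex n (F n)" by (simp add: nn_integral_obs[OF F0] Ex_nonneg F0)
    also have "\<dots> = Ex n (\<lambda>bs. 1 / real n * len (foldr push bs []))"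
      by (intro antisym Ex_mono) (auto simp: F_eq)
    also have "\<dots> = a n / n" unfolding Ex_cmult a_def Aop_pow by simp
    finally show ?thesis .
  qed
  with lim show ?thesis using S.prob_space by simp
qed

end

locale weighted_walk = plain_walk +
  fixes r :: "'a \<Rightarrow> real"
  assumes r_pos: "x \<in> Sig \<Longrightarrow> 0 < r x" and r_sum: "sum r Sig = 1"
begin

section \<open>Markovian weights on words\<close>

lemma r_N_pos: "x \<in> N y \<Longrightarrow> 0 < r x"
  using N_sub r_pos by blast

definition rN :: "'a \<Rightarrow> real" where "rN x = sum r (N x)"
definition q :: "'a \<Rightarrow> real" where "q x = r x / rN x"

lemma rN_pos: "x \<in> Sig \<Longrightarrow> 0 < rN x"
  unfolding rN_def using N_nonempty[OF inf gen supp] N_sub r_pos by (intro sum_pos) auto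

lemma rN_le_1: "rN x \<le> 1"
  unfolding rN_def r_sum[symmetric] using N_sub r_pos Sig_fin by (intro sum_mono2) (auto simp: less_imp_le)

lemma q_pos: "x \<in> Sig \<Longrightarrow> 0 < q x"
  by (simp add: q_def r_pos rN_pos)

text \<open>Read from the head, this is the law of a Markov chain with initial law \<open>r\<close>
  that moves from \<open>x\<close> to \<open>y\<close> in \<open>N x\<close> with probability
  \<open>r y / rN x\<close>. So the weights of different lengths are consistent when the last letter
  is removed, which is what a service does.\<close>

fun P :: "'a list \<Rightarrow> real" where
  "P [] = 1"
| "P [x] = r x"
| "P (x # y # w) = q x * P (y # w)"

lemma P_Cons: "w \<noteq> [] \<Longrightarrow> P (x # w) = q x * P w"
  by (cases w) auto

lemma P_eq: "w \<noteq> [] \<Longrightarrow> P w = prod_list (map q (butlast w)) * r (last w)"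
  by (induction w rule: P.induct) auto

lemma P_pos: "w \<in> L \<Longrightarrow> 0 < P w"
  by (induction w rule: P.induct) (auto simp: L_Cons r_pos q_pos)

definition Ln :: "nat \<Rightarrow> 'a list set" where "Ln n = {w \<in> L. length w = n}"

lemma Ln_fin [simp]: "finite (Ln n)"
proof -
  have "Ln n \<subseteq> {w. set w \<subseteq> Sig \<and> length w = n}" using L_sub by (auto simp: Ln_def)
  then show ?thesis using finite_lists_length_eq[OF Sig_fin] finite_subset by blast
qed

lemma Ln_0 [simp]: "Ln 0 = {[]}" by (auto simp: Ln_def)

lemma Ln_1: "Ln (Suc 0) = (\<lambda>x. [x]) ` Sig"
  by (auto simp: Ln_def length_Suc_conv)

lemma Ln_Suc: "Ln (Suc (Suc k)) = (\<Union>w\<in>Ln (Suc k). (\<lambda>x. x # w) ` N (hd w))"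
proof (intro equalityI subsetI)
  fix v assume "v \<in> Ln (Suc (Suc k))"
  then obtain x w where v: "v = x # w" "w \<in> Ln (Suc k)" "x \<in> Sig" "hd w \<in> N x" by (cases v) (auto simp: Ln_def L_Cons)
  then have "x \<in> N (hd w)" using N_sym[of x "hd w"] N_sub[of x] by auto
  with v show "v \<in> (\<Union>w\<in>Ln (Suc k). (\<lambda>x. x # w) ` N (hd w))" by blast
next
  fix v assume "v \<in> (\<Union>w\<in>Ln (Suc k). (\<lambda>x. x # w) ` N (hd w))"
  then obtain x w where v: "v = x # w" "w \<in> Ln (Suc k)" "x \<in> N (hd w)" by blast
  then have "w \<noteq> []" "w \<in> L" by (auto simp: Ln_def)
  then have "hd w \<in> Sig" "x \<in> Sig" using L_hd[of w] v(3) N_sub by auto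
  then have "hd w \<in> N x" using v(3) N_sym by blast
  then show "v \<in> Ln (Suc (Suc k))" using v \<open>x \<in> Sig\<close> by (auto simp: Ln_def L_Cons)
qed

lemma sum_Ln_1: "(\<Sum>v\<in>Ln (Suc 0). F v) = (\<Sum>x\<in>Sig. F [x])"
  unfolding Ln_1 by (subst sum.reindex) (auto simp: inj_on_def)

lemma sum_Ln_Suc: "(\<Sum>v\<in>Ln (Suc (Suc k)). F v) = (\<Sum>w\<in>Ln (Suc k). \<Sum>x\<in>N (hd w). F (x # w))"
  unfolding Ln_Suc
  by (subst sum.UNION_disjoint) (auto intro!: sum.cong sum.reindex_cong[where l="\<lambda>x. x # _"] simp: inj_on_def)

definition En :: "nat \<Rightarrow> ('a list \<Rightarrow> real) \<Rightarrow> real" where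
  "En n f = (\<Sum>w\<in>Ln n. P w * f w)"

lemma En_0 [simp]: "En 0 f = f []" by (simp add: En_def)

lemma En_1: "En (Suc 0) f = (\<Sum>x\<in>Sig. r x * f [x])"
  by (simp add: En_def sum_Ln_1)

lemma En_Suc: "En (Suc (Suc k)) f = En (Suc k) (\<lambda>w. \<Sum>x\<in>N (hd w). q x * f (x # w))"
  unfolding En_def sum_Ln_Suc sum_distrib_left
proof (intro sum.cong refl)
  fix w x assume "w \<in> Ln (Suc k)"
  then have "w \<noteq> []" by (auto simp: Ln_def)
  then show "P (x # w) * f (x # w) = P w * (q x * f (x # w))" by (simp add: P_Cons)
qed

lemma En_cong: "(\<And>w. w \<in> L \<Longrightarrow> length w = n \<Longrightarrow> f w = g w) \<Longrightarrow> En n f = En n g"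
  unfolding En_def by (intro sum.cong) (auto simp: Ln_def)

lemma En_mono: "(\<And>w. w \<in> L \<Longrightarrow> length w = n \<Longrightarrow> f w \<le> g w) \<Longrightarrow> En n f \<le> En n g"
  unfolding En_def by (intro sum_mono mult_left_mono) (auto simp: Ln_def less_imp_le P_pos)

lemma En_add: "En n (\<lambda>w. f w + g w) = En n f + En n g"
  by (simp add: En_def distrib_left sum.distrib)

lemma En_cmult: "En n (\<lambda>w. c * f w) = c * En n f"
  by (simp add: En_def sum_distrib_left mult.left_commute)

lemma En_diff: "En n (\<lambda>w. f w - g w) = En n f - En n g"
  using En_add[of n f "\<lambda>w. (-1) * g w"] En_cmult[of n "-1" g] by simp

lemma En_nonneg: "(\<And>w. w \<in> L \<Longrightarrow> length w = n \<Longrightarrow> 0 \<le> f w) \<Longrightarrow> 0 \<le> En n f"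
  using En_mono[of n "\<lambda>_. 0" f] by (simp add: En_def)

lemma sum_N_swap: "(\<Sum>d\<in>Sig. \<Sum>x\<in>N d. F x d) = (\<Sum>x\<in>Sig. \<Sum>d\<in>N x. F x d)"
proof -
  have "(\<Sum>d\<in>Sig. \<Sum>x\<in>N d. F x d) = (\<Sum>d\<in>Sig. \<Sum>x\<in>Sig. if x \<in> N d then F x d else 0)"
    using N_sub Sig_fin by (intro sum.cong refl sum.mono_neutral_cong_left sum.mono_neutral_cong_right) auto
  also have "\<dots> = (\<Sum>x\<in>Sig. \<Sum>d\<in>Sig. if x \<in> N d then F x d else 0)" by (rule sum.swap)
  also have "\<dots> = (\<Sum>x\<in>Sig. \<Sum>d\<in>Sig. if d \<in> N x then F x d else 0)"
    by (intro sum.cong refl if_cong) (use N_sym in blast)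
  also have "\<dots> = (\<Sum>x\<in>Sig. \<Sum>d\<in>N x. F x d)"
    using N_sub Sig_fin by (intro sum.cong refl sum.mono_neutral_cong_left sum.mono_neutral_cong_right) auto
  finally show ?thesis .
qed

text \<open>For two letters this is \<open>sum r (N x) = rN x\<close>, after exchanging the roles of
  the letters by symmetry of \<open>N\<close>. Longer words reduce to shorter ones, because
  \<open>En_Suc\<close> works at the head and leaves the end alone.\<close>

lemma En_butlast: "En (Suc k) (\<lambda>w. f (butlast w)) = En k f"
proof (induction k arbitrary: f)
  case 0
  show ?case using r_sum by (simp add: En_1 flip: sum_distrib_right)
next
  case (Suc k)
  show ?case
  proof (cases k)
    case 0
    have "En (Suc (Suc 0)) (\<lambda>w. f (butlast w)) = (\<Sum>d\<in>Sig. \<Sum>x\<in>N d. r d * (q x * f [x]))"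
      by (simp add: En_Suc En_1 sum_distrib_left)
    also have "\<dots> = (\<Sum>x\<in>Sig. \<Sum>d\<in>N x. r d * (q x * f [x]))" by (rule sum_N_swap)
    also have "\<dots> = (\<Sum>x\<in>Sig. r x * f [x])"
    proof (intro sum.cong refl)
      fix x assume "x \<in> Sig"
      then show "(\<Sum>d\<in>N x. r d * (q x * f [x])) = r x * f [x]"
        using rN_pos[of x] unfolding sum_distrib_right[symmetric] rN_def[symmetric] q_def by simp
    qed
    finally show ?thesis using 0 by (simp add: En_1)
  next
    case (Suc j)
    let ?f' = "\<lambda>u. \<Sum>x\<in>N (hd u). q x * f (x # u)"
    have "En (Suc (Suc (Suc j))) (\<lambda>w. f (butlast w)) = En (Suc (Suc j)) (\<lambda>w. ?f' (butlast w))"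
      unfolding En_Suc[of "Suc j"]
    proof (rule En_cong)
      fix w :: "'a list" assume "length w = Suc (Suc j)"
      then obtain x y v where "w = x # y # v" by (auto simp: length_Suc_conv)
      then show "(\<Sum>x\<in>N (hd w). q x * f (butlast (x # w))) = ?f' (butlast w)" by simp
    qed
    also have "\<dots> = En (Suc j) ?f'" using Suc.IH[of ?f'] Suc by simp
    also have "\<dots> = En (Suc (Suc j)) f" by (simp add: En_Suc)
    finally show ?thesis using Suc by simp
  qed
qed

lemma En_take: "k \<le> n \<Longrightarrow> En n (\<lambda>w. f (take k w)) = En k f"
proof (induction rule: dec_induct)
  case base
  show ?case by (rule En_cong) simp
next
  case (step n)
  have "En (Suc n) (\<lambda>w. f (take k w)) = En (Suc n) (\<lambda>w. f (take k (butlast w)))"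
    using step.hyps by (intro En_cong) (simp add: take_butlast)
  then show ?case using step.IH En_butlast[of n "\<lambda>w. f (take k w)"] by simp
qed

lemma En_const: "En n (\<lambda>_. c) = c"
  using En_take[of 0 n "\<lambda>_. c"] by simp

lemma En_hd: "En (Suc n) (\<lambda>w. g (hd w)) = (\<Sum>x\<in>Sig. r x * g x)"
  using En_take[of "Suc 0" "Suc n" "\<lambda>w. g (hd w)"] by (simp add: En_1)

section \<open>Decay of the weight of cancelling words\<close>

lemma sum_Ln_gen: "generates_monoid X (set_pmf \<nu>) \<Longrightarrow> carrier X = eval ` lists Sig"
  using supp eval_closed lists_mono[of "set_pmf \<nu>" Sig] unfolding generates_monoid_def by blast

definition invertible :: "'a \<Rightarrow> bool" where "invertible x \<longleftrightarrow> (\<exists>b\<in>Sig. b \<otimes> x = \<one>)"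

text \<open>Both factors are transition probabilities, and both equal 1 only if
  \<open>N x = {y}\<close> and \<open>N y = {z}\<close>, which \<open>branching\<close> excludes.
  One of them may equal 1: in the free product of groups of orders 2 and 3 the letter after one of
  order 3 is forced. Therefore two steps are taken together, and the maximum over finitely many
  triples is below 1.\<close>

lemma branching_bound:
  obtains \<theta> where "0 \<le> \<theta>" "\<theta> < 1"
    "\<And>x y z. x \<in> Sig \<Longrightarrow> y \<in> N x \<Longrightarrow> z \<in> N y \<Longrightarrow> invertible x \<Longrightarrow> invertible y \<Longrightarrow> r y / rN x * (r z / rN y) \<le> \<theta>"
proof -
  have le: "r y / rN x \<le> 1" "r y / rN x = 1 \<Longrightarrow> N x = {y}" if "x \<in> Sig" "y \<in> N x" for x y
  proof -
    have s: "rN x = r y + sum r (N x - {y})" unfolding rN_def using that by (subst sum.remove[of _ y]) auto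
    have 0: "0 \<le> sum r (N x - {y})" using r_N_pos by (intro sum_nonneg) (auto intro: less_imp_le)
    show "r y / rN x \<le> 1" using s 0 rN_pos[OF that(1)] by simp
    assume "r y / rN x = 1"
    then have "sum r (N x - {y}) = 0" using s rN_pos[OF that(1)] by simp
    then have "\<forall>z\<in>N x - {y}. r z = 0" using r_N_pos by (subst (asm) sum_nonneg_eq_0_iff) (auto intro: less_imp_le)
    then have z: "r z = 0" if "z \<in> N x - {y}" for z using that by blast
    have "N x - {y} = {}"
    proof (rule ccontr)
      assume "N x - {y} \<noteq> {}"
      then obtain z where "z \<in> N x - {y}" by blast
      with z[OF this] r_N_pos[of z x] show False by simp
    qed
    then show "N x = {y}" using that by auto
  qed
  let ?T = "{(x, y, z) \<in> Sig \<times> Sig \<times> Sig. y \<in> N x \<and> z \<in> N y \<and> invertible x \<and> invertible y}"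
  let ?f = "\<lambda>(x, y, z). r y / rN x * (r z / rN y)"
  have fin: "finite ?T" using Sig_fin by (auto intro: finite_subset[of _ "Sig \<times> Sig \<times> Sig"])
  define \<theta> where "\<theta> = Max (insert 0 (?f ` ?T))"
  have lt: "?f t < 1" if t: "t \<in> ?T" for t
  proof -
    obtain x y z where t': "t = (x, y, z)" by (cases t)
    have S: "x \<in> Sig" "y \<in> N x" "z \<in> N y" "y \<in> Sig" "z \<in> Sig" "invertible x" "invertible y" using t t' by auto
    have b: "0 < r y / rN x" "0 < r z / rN y" using S r_pos rN_pos by auto
    have "\<not> (r y / rN x = 1 \<and> r z / rN y = 1)"
      using branching[OF sum_Ln_gen[OF gen] not_Z not_D S(1,4,5)] le(2)[OF S(1,2)] le(2)[OF S(4,3)] S(6,7)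
      unfolding invertible_def by blast
    then have "r y / rN x < 1 \<or> r z / rN y < 1" using le(1)[OF S(1,2)] le(1)[OF S(4,3)] by linarith
    then have "r y / rN x * (r z / rN y) < 1"
    proof
      assume "r y / rN x < 1"
      then have "r y / rN x * (r z / rN y) < 1 * (r z / rN y)" using b(2) by (rule mult_strict_right_mono)
      then show ?thesis using le(1)[OF S(4,3)] by linarith
    next
      assume "r z / rN y < 1"
      then have "r y / rN x * (r z / rN y) < r y / rN x * 1" using b(1) by (rule mult_strict_left_mono)
      then show ?thesis using le(1)[OF S(1,2)] by linarith
    qed
    then show ?thesis by (simp add: t')
  qed
  show ?thesis
  proof (rule that[of \<theta>])
    show "0 \<le> \<theta>" unfolding \<theta>_def using fin by (intro Max_ge) auto
    show "\<theta> < 1" unfolding \<theta>_def using fin lt by (subst Max_less_iff) auto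
    fix x y z assume A: "x \<in> Sig" "y \<in> N x" "z \<in> N y" "invertible x" "invertible y"
    then have "(x, y, z) \<in> ?T" using N_sub by auto
    then have "?f (x, y, z) \<in> insert 0 (?f ` ?T)" by blast
    then have "?f (x, y, z) \<le> \<theta>" unfolding \<theta>_def using fin by (intro Max_ge) auto
    then show "r y / rN x * (r z / rN y) \<le> \<theta>" by simp
  qed
qed

text \<open>\<open>P y\<close> is \<open>r (hd y)\<close> times \<open>length y - 1\<close>
  transition probabilities. They are taken in pairs, each pair contributing \<open>\<theta>\<close>;
  a leftover one is at most 1.\<close>

lemma P_invertible_bound:
  assumes \<theta>: "0 \<le> \<theta>" "\<And>x y z. x \<in> Sig \<Longrightarrow> y \<in> N x \<Longrightarrow> z \<in> N y \<Longrightarrow> invertible x \<Longrightarrow> invertible y \<Longrightarrow> r y / rN x * (r z / rN y) \<le> \<theta>"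
  shows "y \<in> L \<Longrightarrow> \<forall>x\<in>set y. invertible x \<Longrightarrow> y \<noteq> [] \<Longrightarrow> P y \<le> \<theta> ^ ((length y - 1) div 2) * r (hd y)"
proof (induction "length y" arbitrary: y rule: less_induct)
  case less
  consider x where "y = [x]" | x z where "y = [x, z]" | x z u v where "y = x # z # u # v"
    using less.prems(3) by (cases y; cases "tl y"; cases "tl (tl y)") auto
  then show ?case
  proof cases
    case (2 x z)
    then have S: "x \<in> Sig" "z \<in> N x" "z \<in> Sig" using less.prems by (auto simp: L_Cons)
    have "r z \<le> rN x" unfolding rN_def using S r_N_pos by (intro member_le_sum) (auto intro: less_imp_le)
    then have "r x / rN x * r z \<le> r x" using rN_pos[OF S(1)] r_pos[OF S(1)] by (simp add: field_simps mult_left_mono)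
    then show ?thesis by (simp add: 2 q_def)
  next
    case (3 x z u v)
    have S: "x \<in> Sig" "z \<in> N x" "u \<in> N z" "z \<in> Sig" "u \<in> Sig" "invertible x" "invertible z" "u # v \<in> L" "\<forall>x\<in>set (u # v). invertible x"
      using less.prems by (auto simp: L_Cons 3)
    have IH: "P (u # v) \<le> \<theta> ^ (length v div 2) * r u" using less.hyps[of "u # v"] S by (simp add: 3)
    have "P y = r x * r z / (rN x * rN z) * P (u # v)" by (simp add: 3 q_def)
    also have "\<dots> \<le> r x * r z / (rN x * rN z) * (\<theta> ^ (length v div 2) * r u)"
      using S r_pos[of x] r_pos[of z] rN_pos[of x] rN_pos[of z] by (intro mult_left_mono IH) auto
    also have "\<dots> = (r z / rN x * (r u / rN z)) * (\<theta> ^ (length v div 2) * r x)" by (simp add: field_simps)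
    also have "\<dots> \<le> \<theta> * (\<theta> ^ (length v div 2) * r x)"
      using \<theta>(1) r_pos[OF S(1)] by (intro mult_right_mono \<theta>(2) S) auto
    finally show ?thesis by (simp add: 3)
  qed (simp)
qed

text \<open>The weight \<open>P\<close> of a cylinder fixed by invertible letters tends to 0 with the length of the cylinder,
  so an independent word of law \<open>P\<close> is unlikely to be cancelled for long.\<close>

lemma cancel_lower_bound:
  "\<exists>c :: nat \<Rightarrow> real. c \<longlonglongrightarrow> 0 \<and> (\<forall>k n j. a j - 2 * real k - 1 - 2 * real j * c k \<le> En n ((Aop ^^ j) len) - real n)"
proof -
  obtain \<theta> where \<theta>: "0 \<le> \<theta>" "\<theta> < 1"
    "\<And>x y z. x \<in> Sig \<Longrightarrow> y \<in> N x \<Longrightarrow> z \<in> N y \<Longrightarrow> invertible x \<Longrightarrow> invertible y \<Longrightarrow> r y / rN x * (r z / rN y) \<le> \<theta>"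
    using branching_bound by blast
  \<comment> \<open>A bound for the weight of a word of \<open>k\<close> invertible letters; the
    empty word has weight 1.\<close>
  define c where "c k = (if k = 0 then 1 else \<theta> ^ ((k - 1) div 2))" for k :: nat
  have c0: "0 \<le> c k" for k using \<theta> by (simp add: c_def)
  have clim: "c \<longlonglongrightarrow> 0"
  proof -
    have "filterlim (\<lambda>k::nat. (k - 1) div 2) at_top sequentially"
      unfolding filterlim_at_top eventually_sequentially by (intro allI, rule_tac x="2 * Z + 1" in exI) auto
    then have "(\<lambda>k. \<theta> ^ ((k - 1) div 2)) \<longlonglongrightarrow> 0"
      using LIMSEQ_realpow_zero[OF \<theta>(1,2)] by (rule filterlim_compose[rotated])
    moreover have "\<forall>\<^sub>F k in sequentially. \<theta> ^ ((k - 1) div 2) = c k"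
      unfolding eventually_sequentially c_def by (intro exI[of _ 1]) auto
    ultimately show ?thesis by (rule Lim_transform_eventually)
  qed
  have "a j - 2 * real k - 1 - 2 * j * c k \<le> En n ((Aop ^^ j) len) - n" for k n j
  proof -
    have pt: "len (foldr push bs []) - 2 * real k - 1 - 2 * j * c k \<le> En n (\<lambda>w. len (foldr push bs w)) - n"
      if bs: "bs \<in> lists Sig" "length bs = j" for bs
    proof -
      define x where "x = foldr push bs []"
      have x: "x \<in> L" "length x \<le> j" using pushes_L[OF bs(1) L_Nil] length_pushes_le[of bs "[]"] bs by (auto simp: x_def)
      \<comment> \<open>The possible first \<open>k\<close> letters of a word that cancels at least
        \<open>k\<close> letters of \<open>x\<close>.\<close>
      define Y where "Y = {y \<in> Ln k. k \<le> length x \<and> (\<forall>i<k. rev x ! i \<otimes> y ! i = \<one>)}"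
      define I where "I w = (if take k w \<in> Y then 1 else 0 :: real)" for w
      have rs: "rev x ! i \<in> Sig" if "i < length x" for i
        using L_sub[OF x(1)] that nth_mem[of i "rev x"] by auto
      \<comment> \<open>With fewer than \<open>k\<close> cancellations at most
        \<open>2 * k + 1\<close> letters are lost. Otherwise \<open>take k w\<close> lies in
        \<open>Y\<close>, and the trivial bound loses at most \<open>2 * j\<close>.\<close>
      have bound: "len x + n - 2 * real k - 1 - 2 * j * I w \<le> len (foldr push bs w)" if w: "w \<in> L" "length w = n" for w
      proof -
        have eq: "foldr push bs w = foldr push x w" unfolding x_def by (rule pushes_factor[OF bs(1) w(1)])
        obtain m where m: "m \<le> length x" "m \<le> length w" "\<forall>i<m. rev x ! i \<otimes> w ! i = \<one>"
          "length x + length w \<le> length (foldr push x w) + 2 * m + 1" using cancellation[OF x(1) w(1)] by blast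
        show ?thesis
        proof (cases "k \<le> m")
          case False
          have "length x + n \<le> length (foldr push bs w) + 2 * m + 1" using m(4) w(2) eq by simp
          then have "real (length x + n) \<le> real (length (foldr push bs w) + 2 * m + 1)" by (simp only: of_nat_le_iff)
          moreover have "0 \<le> 2 * real j * I w" by (simp add: I_def)
          moreover have "real m \<le> real k" using False by simp
          ultimately show ?thesis
            unfolding len_def of_nat_add of_nat_mult of_nat_numeral of_nat_1 by linarith
        next
          case True
          have "take k w \<in> Y" unfolding Y_def Ln_def using True m w L_take[OF w(1)] by auto
          then have "I w = 1" by (simp add: I_def)
          moreover have "n \<le> length x + length (foldr push bs w)" using length_pushes_ge[of w x] w eq by simp
          then have "real n \<le> real (length x + length (foldr push bs w))" by (simp only: of_nat_le_iff)
          ultimately show ?thesis using x(2) by (simp add: len_def)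
        qed
      qed
      \<comment> \<open>Right inverses are unique, so \<open>x\<close> determines the word that
        cancels it, and \<open>Y\<close> is at most one cylinder.\<close>
      have Yone: "y = y'" if "y \<in> Y" "y' \<in> Y" for y y'
      proof (rule nth_equalityI)
        show "length y = length y'" using that by (simp add: Y_def Ln_def)
        fix i assume i: "i < length y"
        have yy: "y \<in> L" "y' \<in> L" "length y = k" "length y' = k" "k \<le> length x"
          "rev x ! i \<otimes> y ! i = \<one>" "rev x ! i \<otimes> y' ! i = \<one>"
          using that i by (simp_all add: Y_def Ln_def)
        have "set y \<subseteq> Sig" "set y' \<subseteq> Sig" using L_sub[OF yy(1)] L_sub[OF yy(2)] by auto
        then have "y ! i \<in> Sig" "y' ! i \<in> Sig" using i yy nth_mem[of i y] nth_mem[of i y'] by auto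
        then show "y ! i = y' ! i" using right_inverse_unique[OF rs[of i] _ _ yy(6,7)] i yy by simp
      qed
      have "En n I \<le> c k"
      proof (cases "k \<le> n")
        case False
        have "En n I = En n (\<lambda>_. 0)" using False by (intro En_cong) (auto simp: I_def Y_def Ln_def)
        then show ?thesis using c0 by (simp add: En_const)
      next
        case True
        have "En n I = En k (\<lambda>y. if y \<in> Y then 1 else 0)" unfolding I_def by (rule En_take[OF True])
        also have "\<dots> \<le> c k"
        proof (cases "Y = {}")
          case True then show ?thesis using c0 by (simp add: En_const)
        next
          case False
          then obtain y where y: "y \<in> Y" by blast
          then have Y: "Y = {y}" using Yone by blast
          have yL: "y \<in> Ln k" using y by (simp add: Y_def)
          have "En k (\<lambda>y. if y \<in> Y then 1 else 0) = (\<Sum>v\<in>Ln k. if v = y then P v else 0)"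
            unfolding En_def Y by (intro sum.cong) auto
          also have "\<dots> = P y" using yL by simp
          also have "\<dots> \<le> c k"
          proof (cases "k = 0")
            case False
            have ne: "y \<noteq> []" "y \<in> L" "length y = k" using False yL by (auto simp: Ln_def)
            have "\<forall>v\<in>set y. invertible v"
            proof
              fix v assume "v \<in> set y"
              then obtain i where i: "i < k" "v = y ! i" using ne(3) unfolding in_set_conv_nth by blast
              then have "rev x ! i \<otimes> v = \<one>" "i < length x" using y by (auto simp: Y_def)
              then show "invertible v" unfolding invertible_def using rs by blast
            qed
            then have "P y \<le> \<theta> ^ ((k - 1) div 2) * r (hd y)" using P_invertible_bound[OF \<theta>(1,3)] ne by auto
            also have "\<dots> \<le> \<theta> ^ ((k - 1) div 2) * 1"
            proof (rule mult_left_mono)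
              have "hd y \<in> Sig" by (rule L_hd[OF ne(2,1)])
              then show "r (hd y) \<le> 1" unfolding r_sum[symmetric] using r_pos Sig_fin by (intro member_le_sum) (auto simp: less_imp_le)
            qed (use \<theta> in simp)
            finally show ?thesis using False by (simp add: c_def)
          qed (use yL in \<open>simp add: c_def\<close>)
          finally show ?thesis .
        qed
        finally show ?thesis .
      qed
      then have "2 * real j * En n I \<le> 2 * real j * c k" by (intro mult_left_mono) auto
      moreover have "En n (\<lambda>w. (len x + n - 2 * real k - 1) - 2 * real j * I w) \<le> En n (\<lambda>w. len (foldr push bs w))"
        using bound by (intro En_mono) (simp add: algebra_simps)
      ultimately show ?thesis unfolding En_diff En_const En_cmult x_def by simp
    qed
    have "Ex j (\<lambda>bs. len (foldr push bs []) - (2 * real k + 1 + 2 * j * c k)) \<le> Ex j (\<lambda>bs. En n (\<lambda>w. len (foldr push bs w)) - n)"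
    proof (rule Ex_mono)
      fix bs assume "bs \<in> lists Sig" "length bs = j"
      from pt[OF this] show "len (foldr push bs []) - (2 * real k + 1 + 2 * j * c k) \<le> En n (\<lambda>w. len (foldr push bs w)) - n" by simp
    qed
    moreover have "Ex j (\<lambda>bs. En n (\<lambda>w. len (foldr push bs w))) = En n ((Aop ^^ j) len)"
      unfolding En_def Aop_pow[abs_def] by (simp add: Ex_sum Ex_cmult)
    ultimately show ?thesis unfolding Ex_minus Ex_const a_def Aop_pow by simp
  qed
  with clim show ?thesis by (intro exI[of _ c] conjI allI) auto
qed

end

context plain_walk
begin

lemma Aop_pow_mono: "(\<And>v. v \<in> L \<Longrightarrow> f v \<le> g v) \<Longrightarrow> w \<in> L \<Longrightarrow> (Aop ^^ j) f w \<le> (Aop ^^ j) g w"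
  unfolding Aop_pow by (rule Ex_mono) (blast intro: pushes_L)

lemma Aop_pow_add: "(Aop ^^ j) (\<lambda>w. f w + g w) w = (Aop ^^ j) f w + (Aop ^^ j) g w"
  unfolding Aop_pow by (rule Ex_add)

lemma Aop_pow_diff: "(Aop ^^ j) (\<lambda>w. f w - g w) w = (Aop ^^ j) f w - (Aop ^^ j) g w"
  unfolding Aop_pow by (rule Ex_minus)

lemma Aop_pow_cmult: "(Aop ^^ j) (\<lambda>w. c * f w) w = c * (Aop ^^ j) f w"
  unfolding Aop_pow by (rule Ex_cmult)

lemma Aop_pow_const: "(Aop ^^ j) (\<lambda>_. c) w = c"
  unfolding Aop_pow by (rule Ex_const)

end

section \<open>Extension of words and the three effects of a letter\<close>

context weighted_walk
begin

text \<open>With \<open>ext\<close> and \<open>scale\<close> the empty word needs no separate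
  treatment: a letter \<open>x\<close> in \<open>ext w\<close>, put in front of \<open>w\<close>,
  multiplies the weight \<open>P\<close> by \<open>r x * scale w x\<close>.\<close>

definition ext :: "'a list \<Rightarrow> 'a set" where "ext w = (if w = [] then Sig else N (hd w))"
definition scale :: "'a list \<Rightarrow> 'a \<Rightarrow> real" where "scale w x = (if w = [] then 1 else 1 / rN x)"

lemma ext_sub: "ext w \<subseteq> Sig" using N_sub by (auto simp: ext_def)
lemma ext_fin [simp]: "finite (ext w)" using ext_sub Sig_fin finite_subset by blast

lemma En_ext: "En (Suc n) f = En n (\<lambda>w. \<Sum>x\<in>ext w. r x * scale w x * f (x # w))"
proof (cases n)
  case 0
  then show ?thesis by (simp add: En_1 ext_def scale_def)
next
  case (Suc k)
  show ?thesis unfolding Suc En_Suc by (intro En_cong sum.cong) (auto simp: ext_def scale_def q_def)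
qed

lemma ext_prod:
  assumes "w \<in> L" "b \<in> Sig" "d \<in> Sig" "b \<otimes> d \<in> Sig"
  shows "b \<otimes> d \<in> ext w \<longleftrightarrow> d \<in> ext w" "scale w (b \<otimes> d) = scale w d"
proof -
  have e: "N (b \<otimes> d) = N d" using N_prod assms by blast
  show "scale w (b \<otimes> d) = scale w d" by (simp add: scale_def rN_def e)
  show "b \<otimes> d \<in> ext w \<longleftrightarrow> d \<in> ext w"
  proof (cases "w = []")
    case False
    then have h: "hd w \<in> Sig" using L_hd assms(1) by blast
    have "b \<otimes> d \<in> N (hd w) \<longleftrightarrow> d \<in> N (hd w)" using N_sym[OF h assms(4)] N_sym[OF h assms(3)] e by blast
    then show ?thesis using False by (simp add: ext_def)
  qed (use assms in \<open>simp add: ext_def\<close>)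
qed

text \<open>On nonempty words \<open>rN x * scale w x = 1\<close>, and this is the part of
  \<open>Aop\<close> that lengthens the word. On the empty word it is the thinned arrival stream of
  the queue, with the factor \<open>r (Next a)\<close> of its generator.\<close>

definition up :: "('a list \<Rightarrow> real) \<Rightarrow> 'a list \<Rightarrow> real" where
  "up f w = (\<Sum>x\<in>ext w. pmf \<nu> x * rN x * scale w x * f (x # w))"
definition same :: "('a list \<Rightarrow> real) \<Rightarrow> 'a list \<Rightarrow> real" where
  "same f w = (\<Sum>b\<in>{b \<in> Sig. b \<otimes> hd w \<in> Sig}. pmf \<nu> b * f ((b \<otimes> hd w) # tl w))"
definition inv_mass :: "'a \<Rightarrow> real" where
  "inv_mass d = (\<Sum>b\<in>{b \<in> Sig. b \<otimes> d = \<one>}. pmf \<nu> b)"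

lemma inv_mass_bounds: "0 \<le> inv_mass d" "inv_mass d \<le> 1"
proof -
  have "inv_mass d \<le> sum (pmf \<nu>) Sig" unfolding inv_mass_def using Sig_fin by (intro sum_mono2) auto
  then show "inv_mass d \<le> 1" by simp
qed (simp add: inv_mass_def sum_nonneg)

lemma up_nonneg: "w \<in> L \<Longrightarrow> (\<And>v. v \<in> L \<Longrightarrow> 0 \<le> f v) \<Longrightarrow> 0 \<le> up f w"
  unfolding up_def
proof (intro sum_nonneg mult_nonneg_nonneg)
  fix x assume w: "w \<in> L" and f: "\<And>v. v \<in> L \<Longrightarrow> 0 \<le> f v" and x: "x \<in> ext w"
  have xS: "x \<in> Sig" using x ext_sub by blast
  show "0 \<le> rN x" "0 \<le> scale w x" using rN_pos[OF xS] by (auto simp: scale_def)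
  have "x # w \<in> L" using x w xS N_sym[of x "hd w"] L_hd[of w] by (auto simp: L_Cons ext_def split: if_splits)
  then show "0 \<le> f (x # w)" by (rule f)
qed simp

lemma up_mono: "w \<in> L \<Longrightarrow> (\<And>v. v \<in> L \<Longrightarrow> f v \<le> g v) \<Longrightarrow> up f w \<le> up g w"
  using up_nonneg[of w "\<lambda>v. g v - f v"] by (simp add: up_def right_diff_distrib sum_subtractf)

lemma Aop_split:
  assumes w: "w \<in> L" "w \<noteq> []"
  shows "Aop f w = up f w + same f w + inv_mass (hd w) * f (tl w)"
proof -
  let ?d = "hd w"
  let ?S = "{b \<in> Sig. b \<otimes> ?d \<in> Sig}" and ?D = "{b \<in> Sig. b \<otimes> ?d = \<one>}"
  have d: "?d \<in> Sig" using L_hd w by blast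
  have wd: "w = ?d # tl w" using w by simp
  have part: "Sig = N ?d \<union> (?S \<union> ?D)" using d N_sym[OF d] by (auto simp: N_iff)
  have dis: "N ?d \<inter> (?S \<union> ?D) = {}" "?S \<inter> ?D = {}" using d N_sym[OF d] N_sub[of ?d] one_notin by (auto simp: N_iff)
  have p1: "push b w = b # w" if "b \<in> N ?d" for b
    using that N_sym[OF d, of b] N_sub[of ?d] wd push_Cons[of b ?d "tl w"] by (auto simp: N_iff)
  have p2: "push b w = (b \<otimes> ?d) # tl w" if "b \<in> ?S" for b
    using that one_notin wd push_Cons[of b ?d "tl w"] by auto
  have p3: "push b w = tl w" if "b \<in> ?D" for b using that wd push_Cons[of b ?d "tl w"] by auto
  have fin: "finite ?S" "finite ?D" using Sig_fin by auto
  have "Aop f w = (\<Sum>b\<in>N ?d. pmf \<nu> b * f (push b w)) + ((\<Sum>b\<in>?S. pmf \<nu> b * f (push b w)) + (\<Sum>b\<in>?D. pmf \<nu> b * f (push b w)))"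
    unfolding Aop_def by (subst part) (use dis fin in \<open>simp add: sum.union_disjoint\<close>)
  also have "(\<Sum>b\<in>N ?d. pmf \<nu> b * f (push b w)) = up f w"
    unfolding up_def
  proof (intro sum.cong)
    fix x assume "x \<in> ext w"
    then have "x \<in> N ?d" "x \<in> Sig" using w N_sub by (auto simp: ext_def)
    then show "pmf \<nu> x * f (push x w) = pmf \<nu> x * rN x * scale w x * f (x # w)"
      using rN_pos[of x] w by (simp add: p1 scale_def)
  qed (use w in \<open>simp add: ext_def\<close>)
  also have "(\<Sum>b\<in>?S. pmf \<nu> b * f (push b w)) = same f w"
    unfolding same_def using p2 by (intro sum.cong) auto
  also have "(\<Sum>b\<in>?D. pmf \<nu> b * f (push b w)) = inv_mass (hd w) * f (tl w)"
    unfolding inv_mass_def sum_distrib_right using p3 by (intro sum.cong) auto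
  finally show ?thesis by simp
qed

text \<open>The pairs of letters are grouped by their product \<open>x\<close>. By
  \<open>ext_prod\<close> a merger changes neither membership in \<open>ext w\<close> nor the scale,
  so both may be expressed by \<open>x\<close> instead of \<open>d\<close>.\<close>

lemma same_ext:
  assumes w: "w \<in> L"
  shows "(\<Sum>d\<in>ext w. r d * scale w d * (\<Sum>b\<in>{b \<in> Sig. b \<otimes> d \<in> Sig}. pmf \<nu> b * f ((b \<otimes> d) # w))) =
    (\<Sum>x\<in>ext w. scale w x * f (x # w) * (\<Sum>(b, d)\<in>{(b, d). b \<in> Sig \<and> d \<in> Sig \<and> b \<otimes> d = x}. pmf \<nu> b * r d))"
proof -
  let ?S = "SIGMA d:ext w. {b \<in> Sig. b \<otimes> d \<in> Sig}"
  let ?h = "\<lambda>(d, b). r d * scale w d * (pmf \<nu> b * f ((b \<otimes> d) # w))"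
  have fin: "finite ?S" using Sig_fin by auto
  have "(\<Sum>d\<in>ext w. r d * scale w d * (\<Sum>b\<in>{b \<in> Sig. b \<otimes> d \<in> Sig}. pmf \<nu> b * f ((b \<otimes> d) # w))) = sum ?h ?S"
    unfolding sum_distrib_left using Sig_fin by (subst sum.Sigma) auto
  also have "\<dots> = (\<Sum>x\<in>ext w. \<Sum>z\<in>{z \<in> ?S. snd z \<otimes> fst z = x}. ?h z)"
  proof (rule sum.group[symmetric])
    show "(\<lambda>z. snd z \<otimes> fst z) ` ?S \<subseteq> ext w"
    proof clarsimp
      fix d b assume "d \<in> ext w" "b \<in> Sig" "b \<otimes> d \<in> Sig"
      then show "b \<otimes> d \<in> ext w" using ext_prod(1)[OF w, of b d] ext_sub by blast
    qed
  qed (use fin in auto)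
  also have "\<dots> = (\<Sum>x\<in>ext w. \<Sum>(b, d)\<in>{(b, d). b \<in> Sig \<and> d \<in> Sig \<and> b \<otimes> d = x}. scale w x * f (x # w) * (pmf \<nu> b * r d))"
  proof (rule sum.cong[OF refl])
    fix x assume x: "x \<in> ext w"
    then have xS: "x \<in> Sig" using ext_sub by blast
    show "sum ?h {z \<in> ?S. snd z \<otimes> fst z = x} = (\<Sum>(b, d)\<in>{(b, d). b \<in> Sig \<and> d \<in> Sig \<and> b \<otimes> d = x}. scale w x * f (x # w) * (pmf \<nu> b * r d))"
    proof (rule sum.reindex_bij_witness[of _ prod.swap prod.swap])
      fix z assume "z \<in> {z \<in> ?S. snd z \<otimes> fst z = x}"
      then obtain d b where z: "z = (d, b)" "d \<in> ext w" "b \<in> Sig" "b \<otimes> d = x" by (cases z) auto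
      then have d: "d \<in> Sig" using ext_sub by blast
      show "prod.swap z \<in> {(b, d). b \<in> Sig \<and> d \<in> Sig \<and> b \<otimes> d = x}" using z d by simp
      have "scale w x = scale w d" using ext_prod(2)[OF w \<open>b \<in> Sig\<close> d] z xS by simp
      then show "(case prod.swap z of (b, d) \<Rightarrow> scale w x * f (x # w) * (pmf \<nu> b * r d)) = ?h z" using z by simp
    next
      fix z assume "z \<in> {(b, d). b \<in> Sig \<and> d \<in> Sig \<and> b \<otimes> d = x}"
      then obtain d b where z: "z = (b, d)" "d \<in> Sig" "b \<in> Sig" "b \<otimes> d = x" by (cases z) auto
      then show "prod.swap z \<in> {z \<in> ?S. snd z \<otimes> fst z = x}" using ext_prod(1)[OF w, of b d] x xS by simp
    qed auto
  qed
  finally show ?thesis by (simp add: sum_distrib_left split_def)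
qed

end

section \<open>Twisted Traffic Equations and the drift\<close>

locale queue = weighted_walk +
  fixes lam mu \<rho> :: real
  assumes lam_pos: "0 < lam" and mu_pos: "0 < mu" and rho_pos: "0 < \<rho>"
    and tte: "twisted_traffic_equations X Sig \<nu> lam mu \<rho> r"
    and adm: "\<rho> = lam * (\<Sum>x\<in>Sig. pmf \<nu> x * sum r (N x)) /
         (mu + lam * (\<Sum>(x, y)\<in>{(x, y). x \<in> Sig \<and> y \<in> Sig \<and> x \<otimes> y = \<one>}. pmf \<nu> x * r y))"
begin

text \<open>Equal to \<open>1 + (mu / lam) * (1 - \<rho>)\<close>. In the Twisted Traffic Equations
  divided by \<open>lam\<close>, this is the coefficient of \<open>\<rho> * r x\<close> once both
  service terms stand on one side.\<close>

definition \<beta> :: real where "\<beta> = (lam + mu - mu * \<rho>) / lam"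
definition A :: real where "A = (\<Sum>x\<in>Sig. pmf \<nu> x * rN x)"
definition C :: real where "C = (\<Sum>x\<in>Sig. r x * inv_mass x)"

lemma inv_sum: "(\<Sum>(b, d)\<in>{(b, d). b \<in> Sig \<and> d \<in> D \<and> b \<otimes> d = \<one>}. F b d) = (\<Sum>d\<in>D. \<Sum>b\<in>{b \<in> Sig. b \<otimes> d = \<one>}. F b d)"
  if "finite D"
proof -
  have "(\<Sum>d\<in>D. \<Sum>b\<in>{b \<in> Sig. b \<otimes> d = \<one>}. F b d) = (\<Sum>(d, b)\<in>(SIGMA d:D. {b \<in> Sig. b \<otimes> d = \<one>}). F b d)"
    using that Sig_fin by (subst sum.Sigma) auto
  also have "\<dots> = (\<Sum>(b, d)\<in>{(b, d). b \<in> Sig \<and> d \<in> D \<and> b \<otimes> d = \<one>}. F b d)"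
    by (rule sum.reindex_bij_witness[of _ prod.swap prod.swap]) auto
  finally show ?thesis ..
qed

lemma adm': "\<rho> * (mu + lam * C) = lam * A" "0 \<le> C"
proof -
  have "C = (\<Sum>(x, y)\<in>{(x, y). x \<in> Sig \<and> y \<in> Sig \<and> x \<otimes> y = \<one>}. pmf \<nu> x * r y)"
    unfolding C_def inv_mass_def sum_distrib_left by (simp add: inv_sum[OF Sig_fin] mult.commute)
  moreover show C0: "0 \<le> C" unfolding C_def by (intro sum_nonneg mult_nonneg_nonneg) (auto simp: r_pos less_imp_le inv_mass_bounds)
  ultimately have "\<rho> = lam * A / (mu + lam * C)" using adm by (simp add: A_def rN_def)
  moreover have "0 < mu + lam * C" using C0 lam_pos mu_pos by (simp add: add_pos_nonneg)
  ultimately show "\<rho> * (mu + lam * C) = lam * A" by simp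
qed

lemma tte': assumes x: "x \<in> Sig"
  shows "\<rho> * \<beta> * r x = pmf \<nu> x * rN x + \<rho> * (\<Sum>(b, d)\<in>{(b, d). b \<in> Sig \<and> d \<in> Sig \<and> b \<otimes> d = x}. pmf \<nu> b * r d)
    + \<rho>\<^sup>2 * (r x * (\<Sum>d\<in>N x. q d * inv_mass d))"
proof -
  let ?S = "\<Sum>(b, d)\<in>{(b, d). b \<in> Sig \<and> d \<in> Sig \<and> b \<otimes> d = x}. pmf \<nu> b * r d"
  let ?D = "\<Sum>d\<in>N x. q d * inv_mass d"
  have "(\<Sum>(b, d)\<in>{(b, d). b \<in> Sig \<and> d \<in> N x \<and> b \<otimes> d = \<one>}. pmf \<nu> b * (r d / sum r (N d)) * r x) = r x * ?D"
    by (subst inv_sum) (simp_all add: inv_mass_def q_def rN_def sum_distrib_left sum_distrib_right mult_ac)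
  then have "\<rho> * (lam + mu) * r x = \<rho>\<^sup>2 * mu * r x + lam * pmf \<nu> x * rN x + \<rho> * lam * ?S + \<rho>\<^sup>2 * lam * (r x * ?D)"
    using tte x unfolding twisted_traffic_equations_def rN_def by simp
  then have "lam * (\<rho> * \<beta> * r x) = lam * (pmf \<nu> x * rN x + \<rho> * ?S + \<rho>\<^sup>2 * (r x * ?D))"
    using lam_pos by (simp add: \<beta>_def field_simps power2_eq_square)
  then show ?thesis using lam_pos by simp
qed

text \<open>\<open>tte'\<close> for the letter \<open>x\<close> is multiplied by
  \<open>scale w x * f (x # w)\<close> and averaged over words \<open>w\<close> of length
  \<open>n\<close>. Its terms are the ways to arrive at \<open>x # w\<close> by one letter: from a
  shorter word, from one of the same length, and from a longer one.\<close>

lemma balance: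
  "En n (up f) + \<rho> * En (Suc n) (same f) + \<rho>\<^sup>2 * En (Suc (Suc n)) (\<lambda>w. inv_mass (hd w) * f (tl w)) = \<rho> * \<beta> * En (Suc n) f"
proof -
  let ?S = "\<lambda>x. \<Sum>(b, d)\<in>{(b, d). b \<in> Sig \<and> d \<in> Sig \<and> b \<otimes> d = x}. pmf \<nu> b * r d"
  let ?D = "\<lambda>x. \<Sum>d\<in>N x. q d * inv_mass d"
  have 1: "En (Suc n) (same f) = En n (\<lambda>w. \<Sum>x\<in>ext w. scale w x * f (x # w) * ?S x)"
    unfolding En_ext[of n] by (rule En_cong) (simp add: same_def same_ext)
  have 2: "En (Suc (Suc n)) (\<lambda>w. inv_mass (hd w) * f (tl w)) = En n (\<lambda>w. \<Sum>x\<in>ext w. r x * scale w x * f (x # w) * ?D x)"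
    unfolding En_Suc En_ext[of n] by (rule En_cong) (simp add: sum_distrib_left sum_distrib_right mult_ac)
  have sum_mult: "c * (\<Sum>x\<in>ext w. h x) = (\<Sum>x\<in>ext w. c * h x)" for c w and h :: "'a \<Rightarrow> real"
    by (rule sum_distrib_left)
  have sum3: "(\<Sum>x\<in>ext w. h1 x) + c * (\<Sum>x\<in>ext w. h2 x) + c' * (\<Sum>x\<in>ext w. h3 x) = (\<Sum>x\<in>ext w. h1 x + c * h2 x + c' * h3 x)"
    for c c' w and h1 h2 h3 :: "'a \<Rightarrow> real" by (simp add: sum.distrib sum_distrib_left)
  show ?thesis unfolding 1 2 unfolding En_ext[of n] En_cmult[symmetric] En_add[symmetric]
  proof (rule En_cong)
    fix w assume "w \<in> L"
    show "up f w + \<rho> * (\<Sum>x\<in>ext w. scale w x * f (x # w) * ?S x) + \<rho>\<^sup>2 * (\<Sum>x\<in>ext w. r x * scale w x * f (x # w) * ?D x)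
      = \<rho> * \<beta> * (\<Sum>x\<in>ext w. r x * scale w x * f (x # w))"
      unfolding up_def sum3 unfolding sum_mult
    proof (rule sum.cong[OF refl])
      fix x assume "x \<in> ext w"
      then have x: "x \<in> Sig" using ext_sub by blast
      have "pmf \<nu> x * rN x * scale w x * f (x # w) + \<rho> * (scale w x * f (x # w) * ?S x) + \<rho>\<^sup>2 * (r x * scale w x * f (x # w) * ?D x)
        = (pmf \<nu> x * rN x + \<rho> * ?S x + \<rho>\<^sup>2 * (r x * ?D x)) * (scale w x * f (x # w))" by (simp add: algebra_simps)
      also have "\<dots> = \<rho> * \<beta> * r x * (scale w x * f (x # w))" by (simp only: tte'[OF x])
      finally show "pmf \<nu> x * rN x * scale w x * f (x # w) + \<rho> * (scale w x * f (x # w) * ?S x) + \<rho>\<^sup>2 * (r x * scale w x * f (x # w) * ?D x)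
        = \<rho> * \<beta> * (r x * scale w x * f (x # w))" by (simp add: mult_ac)
    qed
  qed
qed

lemma En_Aop: "En (Suc n) (Aop f) = En (Suc n) (up f) + En (Suc n) (same f) + En (Suc n) (\<lambda>w. inv_mass (hd w) * f (tl w))"
  unfolding En_add[symmetric] by (rule En_cong) (auto intro: Aop_split)

lemma En_down_1: "En (Suc 0) (\<lambda>w. inv_mass (hd w) * f (tl w)) = C * f []"
  unfolding En_1 C_def sum_distrib_right by (rule sum.cong) auto

lemma A_pos: "0 < A"
proof -
  obtain x where x: "x \<in> set_pmf \<nu>" using set_pmf_not_empty by fast
  have "0 < pmf \<nu> x * rN x" using x supp by (intro mult_pos_pos rN_pos) (auto simp: pmf_positive)
  moreover have "pmf \<nu> x * rN x \<le> A" unfolding A_def using x supp Sig_fin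
    by (intro member_le_sum[of x Sig "\<lambda>x. pmf \<nu> x * rN x"]) (auto intro: mult_nonneg_nonneg less_imp_le[OF rN_pos])
  ultimately show ?thesis by linarith
qed

text \<open>\<open>balance\<close> with \<open>f = 1\<close> and \<open>n = 0\<close> has
  \<open>A > 0\<close> on its left-hand side. Positivity gives sense to
  \<open>ln \<beta>\<close>.\<close>

lemma beta_pos: "0 < \<beta>"
proof -
  have "En 0 (up (\<lambda>_. 1)) = A" by (simp add: up_def ext_def scale_def A_def)
  moreover have s0: "0 \<le> En (Suc 0) (same (\<lambda>_. 1))" by (intro En_nonneg) (auto simp: same_def intro!: sum_nonneg)
  moreover have d0: "0 \<le> En (Suc (Suc 0)) (\<lambda>w. inv_mass (hd w) * 1)" by (intro En_nonneg) (auto simp: inv_mass_bounds)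
  moreover have "0 \<le> \<rho> * En (Suc 0) (same (\<lambda>_. 1))" "0 \<le> \<rho>\<^sup>2 * En (Suc (Suc 0)) (\<lambda>w. inv_mass (hd w) * 1)"
    using s0 d0 rho_pos by simp_all
  ultimately have "0 < \<rho> * \<beta> * 1" using balance[of 0 "\<lambda>_. 1"] A_pos unfolding En_const[of "Suc 0" 1] by linarith
  then show ?thesis using rho_pos by (simp add: zero_less_mult_iff)
qed

text \<open>Truncated, since the full sums may diverge for \<open>\<rho> \<ge> 1\<close>. Length 0
  is left out, because the balance at the empty word has its own form.\<close>

definition Z :: "nat \<Rightarrow> ('a list \<Rightarrow> real) \<Rightarrow> real" where "Z M g = (\<Sum>n<M. \<rho> ^ Suc n * En (Suc n) g)"

lemma Z_add: "Z M (\<lambda>w. f w + g w) = Z M f + Z M g"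
  by (simp add: Z_def En_add distrib_left sum.distrib)
lemma Z_cmult: "Z M (\<lambda>w. c * f w) = c * Z M f"
  by (simp add: Z_def En_cmult sum_distrib_left mult_ac)

text \<open>The instances of \<open>balance\<close> are summed. The cancellation term of length 1,
  which leads to the empty word, belongs to none of them and accounts for
  \<open>\<rho> * C * f []\<close>.\<close>

lemma balance_sum:
  "En 0 (up f) + Z M (up f) + Z (Suc M) (same f) + Z (Suc (Suc M)) (\<lambda>w. inv_mass (hd w) * f (tl w))
   = \<beta> * Z (Suc M) f + \<rho> * C * f []"
proof (induction M)
  case 0
  have "En 0 (up f) + Z 0 (up f) + Z (Suc 0) (same f) + Z (Suc (Suc 0)) (\<lambda>w. inv_mass (hd w) * f (tl w))
    = (En 0 (up f) + \<rho> * En (Suc 0) (same f) + \<rho>\<^sup>2 * En (Suc (Suc 0)) (\<lambda>w. inv_mass (hd w) * f (tl w))) + \<rho> * (C * f [])"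
    by (simp add: Z_def En_down_1 power2_eq_square)
  also have "\<dots> = \<beta> * Z (Suc 0) f + \<rho> * C * f []" unfolding balance by (simp add: Z_def)
  finally show ?case .
next
  case (Suc M)
  define p where "p = \<rho> ^ Suc M"
  have alg: "p * u + p * \<rho> * v + p * \<rho> * \<rho> * d = \<beta> * (p * \<rho> * e)" if "u + \<rho> * v + \<rho>\<^sup>2 * d = \<rho> * \<beta> * e" for u v d e :: real
  proof -
    have "p * u + p * \<rho> * v + p * \<rho> * \<rho> * d = p * (u + \<rho> * v + \<rho>\<^sup>2 * d)" by (simp add: algebra_simps power2_eq_square)
    then show ?thesis by (simp add: that)
  qed
  have "\<rho> ^ Suc M = p" "\<rho> ^ Suc (Suc M) = p * \<rho>" "\<rho> ^ Suc (Suc (Suc M)) = p * \<rho> * \<rho>" by (simp_all add: p_def)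
  then have "\<rho> ^ Suc M * En (Suc M) (up f) + \<rho> ^ Suc (Suc M) * En (Suc (Suc M)) (same f)
      + \<rho> ^ Suc (Suc (Suc M)) * En (Suc (Suc (Suc M))) (\<lambda>w. inv_mass (hd w) * f (tl w))
     = \<beta> * (\<rho> ^ Suc (Suc M) * En (Suc (Suc M)) f)"
    using alg[OF balance[of "Suc M" f]] by (simp only:)
  with Suc show ?case unfolding Z_def sum.lessThan_Suc distrib_left by linarith
qed

text \<open>\<open>balance_sum\<close> truncates the three effects of a letter at different lengths,
  but a nonnegative \<open>g\<close> allows the missing terms to be added.\<close>

lemma Z_Aop_le:
  assumes g: "\<And>w. w \<in> L \<Longrightarrow> 0 \<le> g w"
  shows "Z M (Aop g) \<le> \<beta> * Z (Suc M) g + \<rho> * C * g []"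
proof -
  have same0: "0 \<le> same g w" if w: "w \<in> L" "w \<noteq> []" for w
    unfolding same_def
  proof (intro sum_nonneg mult_nonneg_nonneg)
    fix b assume b: "b \<in> {b \<in> Sig. b \<otimes> hd w \<in> Sig}"
    then have "push b w \<in> L" using push_L w by simp
    moreover have "push b w = (b \<otimes> hd w) # tl w" using b w one_notin by (cases w) (auto simp: push_Cons)
    ultimately show "0 \<le> g ((b \<otimes> hd w) # tl w)" using g by simp
  qed simp
  have "Z M (Aop g) = Z M (up g) + Z M (same g) + Z M (\<lambda>w. inv_mass (hd w) * g (tl w))"
    by (simp add: Z_def En_Aop distrib_left sum.distrib)
  moreover have "Z M (same g) \<le> Z (Suc M) (same g)"
    unfolding Z_def using rho_pos by (auto intro!: mult_nonneg_nonneg En_nonneg same0 simp del: power_Suc)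
  moreover have "Z M (\<lambda>w. inv_mass (hd w) * g (tl w)) \<le> Z (Suc (Suc M)) (\<lambda>w. inv_mass (hd w) * g (tl w))"
    unfolding Z_def using rho_pos
    by (auto intro!: add_nonneg_nonneg mult_nonneg_nonneg En_nonneg g L_tl inv_mass_bounds simp del: power_Suc)
  moreover have "0 \<le> En 0 (up g)" by (auto intro!: up_nonneg g)
  ultimately show ?thesis using balance_sum[of g M] by linarith
qed

text \<open>Each step of the walk costs a factor \<open>\<beta>\<close>, one more length and a
  constant. It matters that \<open>K\<close> does not depend on \<open>M\<close>.\<close>

lemma Z_Aop_pow_le:
  assumes g: "\<And>w. w \<in> L \<Longrightarrow> 0 \<le> g w"
  shows "\<exists>K. \<forall>M. Z M ((Aop ^^ j) g) \<le> \<beta> ^ j * Z (M + j) g + K"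
proof (induction j)
  case 0
  show ?case by (intro exI[of _ 0]) simp
next
  case (Suc j)
  then obtain K where K: "\<And>M. Z M ((Aop ^^ j) g) \<le> \<beta> ^ j * Z (M + j) g + K" by blast
  have g': "0 \<le> (Aop ^^ j) g w" if "w \<in> L" for w using Aop_pow_mono[of "\<lambda>_. 0" g w j] g that by (simp add: Aop_pow_const)
  show ?case
  proof (intro exI[of _ "\<beta> * K + \<rho> * C * (Aop ^^ j) g []"] allI)
    fix M
    have "Z M ((Aop ^^ Suc j) g) \<le> \<beta> * Z (Suc M) ((Aop ^^ j) g) + \<rho> * C * (Aop ^^ j) g []"
      using Z_Aop_le[OF g', where M = M] by simp
    also have "\<beta> * Z (Suc M) ((Aop ^^ j) g) \<le> \<beta> * (\<beta> ^ j * Z (Suc M + j) g + K)"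
      using beta_pos by (intro mult_left_mono K) simp
    finally show "Z M ((Aop ^^ Suc j) g) \<le> \<beta> ^ Suc j * Z (M + Suc j) g + (\<beta> * K + \<rho> * C * (Aop ^^ j) g [])"
      by (simp add: algebra_simps)
  qed
qed

section \<open>Exponential test functions\<close>

lemma level_bound_le:
  assumes "\<And>M. real M * x \<le> (real M + y) * z + K"
  shows "x \<le> z"
proof (rule ccontr)
  assume "\<not> x \<le> z"
  then have p: "0 < x - z" by simp
  obtain M :: nat where "(y * z + K) / (x - z) < real M" using reals_Archimedean2 by blast
  then have "y * z + K < real M * (x - z)" using p by (simp add: pos_divide_less_eq)
  with assms[of M] show False by (simp add: algebra_simps)
qed

text \<open>The reason for this test function: it offsets the weight \<open>\<rho> ^ n\<close>, so
  that all lengths count equally.\<close>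

lemma Z_pow_len:
  assumes "\<rho> \<noteq> 1"
  shows "Z M (\<lambda>w. exp (- ln \<rho> * len w)) = M"
proof -
  have "\<rho> ^ Suc n * En (Suc n) (\<lambda>w. exp (- ln \<rho> * len w)) = 1" for n
  proof -
    have "exp (- ln \<rho> * real (Suc n)) * \<rho> ^ Suc n = 1"
    proof -
      have "\<rho> ^ Suc n = exp (real (Suc n) * ln \<rho>)" using rho_pos by (simp only: exp_of_nat_mult exp_ln)
      then show ?thesis by (simp flip: exp_add)
    qed
    moreover have "En (Suc n) (\<lambda>w. exp (- ln \<rho> * len w)) = En (Suc n) (\<lambda>_. exp (- ln \<rho> * real (Suc n)))"
      by (rule En_cong) (simp add: len_def)
    ultimately show ?thesis by (simp only: En_const mult.commute)
  qed
  then show ?thesis by (simp add: Z_def)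
qed

text \<open>Jensen's inequality for \<open>exp\<close>, under the joint law of a word of length
  \<open>n\<close> and \<open>j\<close> pushed letters. The factor \<open>\<rho> ^ n\<close> turns
  the length in the exponent into its increment.\<close>

lemma En_Aop_pow_exp:
  "exp (- ln \<rho> * (En n ((Aop ^^ j) len) - n)) \<le> \<rho> ^ n * En n ((Aop ^^ j) (\<lambda>w. exp (- ln \<rho> * len w)))"
proof -
  \<comment> \<open>The mean of the exponent; convexity is used through the tangent to
    \<open>exp\<close> at this point.\<close>
  define m where "m = - ln \<rho> * En n ((Aop ^^ j) len)"
  have pt: "exp m * (1 - m) + exp m * (- ln \<rho>) * len w \<le> exp (- ln \<rho> * len w)" for w
  proof -
    have "exp m * (1 + (- ln \<rho> * len w - m)) \<le> exp m * exp (- ln \<rho> * len w - m)"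
      by (intro mult_left_mono exp_ge_add_one_self) simp
    also have "\<dots> = exp (- ln \<rho> * len w)" by (simp flip: exp_add)
    finally show ?thesis by (simp add: algebra_simps)
  qed
  have "exp m * (1 - m) + exp m * (- ln \<rho>) * En n ((Aop ^^ j) len)
    = En n ((Aop ^^ j) (\<lambda>w. exp m * (1 - m) + exp m * (- ln \<rho>) * len w))"
    unfolding Aop_pow_add[abs_def] Aop_pow_cmult[abs_def] Aop_pow_const[abs_def] En_add En_cmult En_const ..
  also have "\<dots> \<le> En n ((Aop ^^ j) (\<lambda>w. exp (- ln \<rho> * len w)))"
    by (intro En_mono Aop_pow_mono pt)
  finally have "exp m \<le> En n ((Aop ^^ j) (\<lambda>w. exp (- ln \<rho> * len w)))" by (simp add: m_def algebra_simps)
  then have "\<rho> ^ n * exp m \<le> \<rho> ^ n * En n ((Aop ^^ j) (\<lambda>w. exp (- ln \<rho> * len w)))"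
    using rho_pos by (intro mult_left_mono) auto
  moreover have "\<rho> ^ n = exp (real n * ln \<rho>)" using rho_pos by (simp only: exp_of_nat_mult exp_ln)
  then have "\<rho> ^ n * exp m = exp (- ln \<rho> * (En n ((Aop ^^ j) len) - n))"
    by (simp add: m_def algebra_simps flip: exp_add)
  ultimately show ?thesis by simp
qed

text \<open>Every length contributes at least \<open>exp (- ln \<rho> * b)\<close> to a sum that is
  at most \<open>\<beta> ^ j\<close> per length, up to \<open>j\<close> extra lengths and a
  constant. Division by \<open>M\<close> removes both.\<close>

lemma growth_le:
  assumes \<rho>: "\<rho> \<noteq> 1" and b: "\<And>n. - ln \<rho> * b \<le> - ln \<rho> * (En n ((Aop ^^ j) len) - n)"
  shows "- ln \<rho> * b \<le> j * ln \<beta>"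
proof -
  let ?g = "\<lambda>w. exp (- ln \<rho> * len w)"
  obtain K where K: "\<And>M. Z M ((Aop ^^ j) ?g) \<le> \<beta> ^ j * Z (M + j) ?g + K" using Z_Aop_pow_le[of ?g j] by auto
  have "exp (- ln \<rho> * b) \<le> \<beta> ^ j"
  proof (rule level_bound_le)
    fix M
    have "real M * exp (- ln \<rho> * b) = (\<Sum>n<M. exp (- ln \<rho> * b))" by simp
    also have "\<dots> \<le> Z M ((Aop ^^ j) ?g)" unfolding Z_def
    proof (rule sum_mono)
      fix n
      have "exp (- ln \<rho> * b) \<le> exp (- ln \<rho> * (En (Suc n) ((Aop ^^ j) len) - Suc n))" using b[of "Suc n"] by (simp del: of_nat_Suc)
      also have "\<dots> \<le> \<rho> ^ Suc n * En (Suc n) ((Aop ^^ j) ?g)" by (rule En_Aop_pow_exp)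
      finally show "exp (- ln \<rho> * b) \<le> \<rho> ^ Suc n * En (Suc n) ((Aop ^^ j) ?g)" .
    qed
    also have "\<dots> \<le> (real M + real j) * \<beta> ^ j + K" using K[of M] Z_pow_len[OF \<rho>, of "M + j"] by (simp add: mult.commute)
    finally show "real M * exp (- ln \<rho> * b) \<le> (real M + real j) * \<beta> ^ j + K" .
  qed
  then have "ln (exp (- ln \<rho> * b)) \<le> ln (\<beta> ^ j)" using beta_pos by (subst ln_le_cancel_iff) auto
  then show ?thesis using beta_pos by (simp add: ln_realpow)
qed

lemma En_pow_len_le: "En n ((Aop ^^ j) len) - n \<le> a j"
proof -
  have "En n ((Aop ^^ j) len) \<le> En n (\<lambda>_. a j + real n)"
  proof (rule En_mono)
    fix w assume "w \<in> L" "length w = n"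
    then show "(Aop ^^ j) len w \<le> a j + real n" using Aop_pow_len_le[of w j] by (simp add: len_def)
  qed
  then show ?thesis by (simp add: En_const)
qed

text \<open>First \<open>j\<close> tends to infinity for fixed \<open>k\<close>, which removes
  \<open>2 * k + 1\<close> and \<open>e\<close> after division by \<open>j\<close>; then
  \<open>k\<close> tends to infinity, which removes \<open>c k\<close>.\<close>

lemma limit_bound_const:
  assumes lim: "(\<lambda>n. a n / n) \<longlonglongrightarrow> \<gamma>" and clim: "c \<longlonglongrightarrow> 0"
    and b: "\<And>j k. t * (a j - 2 * real k - 1 - 2 * real j * c k) \<le> real j * s + e"
  shows "t * \<gamma> \<le> (s :: real)"
proof -
  have "t * (\<gamma> - 2 * c k) \<le> s" for k
  proof (rule LIMSEQ_le_const2)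
    have "(\<lambda>j. t * (a j / j - (2 * real k + 1) / real j - 2 * c k) - e / real j) \<longlonglongrightarrow> t * (\<gamma> - 0 - 2 * c k) - 0"
      by (intro tendsto_intros lim tendsto_divide_0 tendsto_const filterlim_at_top_imp_at_infinity filterlim_real_sequentially)
    then show "(\<lambda>j. t * (a j / j - (2 * real k + 1) / real j - 2 * c k) - e / real j) \<longlonglongrightarrow> t * (\<gamma> - 2 * c k)" by simp
    have "t * (a j / j - (2 * real k + 1) / real j - 2 * c k) - e / real j \<le> s" if "1 \<le> j" for j
    proof -
      have "t * (x / y - z / y - 2 * v) - e / y = (t * (x - z - 2 * y * v) - e) / y" if "0 < y" for x y z v :: real
        using that by (simp add: divide_simps)
      from this[of "real j" "a j" "2 * real k + 1" "c k"]
      have "t * (a j / j - (2 * real k + 1) / real j - 2 * c k) - e / real j = (t * (a j - (2 * real k + 1) - 2 * real j * c k) - e) / j"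
        using that by simp
      also have "\<dots> = (t * (a j - 2 * real k - 1 - 2 * real j * c k) - e) / j"
        by (simp only: diff_diff_eq[symmetric])
      also have "\<dots> \<le> s" using b[of j k] that by (simp add: divide_le_eq mult.commute)
      finally show ?thesis .
    qed
    then show "\<exists>N. \<forall>n\<ge>N. t * (a n / n - (2 * real k + 1) / real n - 2 * c k) - e / real n \<le> s" by blast
  qed
  moreover have "(\<lambda>k. t * (\<gamma> - 2 * c k)) \<longlonglongrightarrow> t * (\<gamma> - 2 * 0)" by (intro tendsto_intros clim)
  ultimately show ?thesis using LIMSEQ_le_const2[of "\<lambda>k. t * (\<gamma> - 2 * c k)" "t * \<gamma>" s] by simp
qed

lemmas limit_bound = limit_bound_const[where e = 0, unfolded add_0_right]

text \<open>The sign of \<open>- ln \<rho>\<close> decides which bound on the mean increments is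
  needed: for \<open>\<rho> < 1\<close> the lower one, where cancellation must be controlled, and
  for \<open>\<rho> > 1\<close> the upper one, which is subadditivity of the length.\<close>

lemma ln_beta_ge:
  assumes lim: "(\<lambda>n. a n / n) \<longlonglongrightarrow> \<gamma>" and \<rho>: "\<rho> \<noteq> 1"
  shows "- ln \<rho> * \<gamma> \<le> ln \<beta>"
proof (cases "\<rho> < 1")
  case True
  then have l: "0 \<le> - ln \<rho>" using rho_pos by simp
  obtain c :: "nat \<Rightarrow> real" where c: "c \<longlonglongrightarrow> 0"
    "\<And>k n j. a j - 2 * real k - 1 - 2 * real j * c k \<le> En n ((Aop ^^ j) len) - real n"
    using cancel_lower_bound by auto
  show ?thesis
    using limit_bound[OF lim c(1) growth_le[OF \<rho> mult_left_mono[OF c(2) l]]] .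
next
  case False
  then have l: "- ln \<rho> \<le> 0" using \<rho> by simp
  show ?thesis
  proof (rule LIMSEQ_le_const2[of "\<lambda>j. - ln \<rho> * (a j / j)"])
    show "(\<lambda>j. - ln \<rho> * (a j / j)) \<longlonglongrightarrow> - ln \<rho> * \<gamma>" by (intro tendsto_intros lim)
    have "- ln \<rho> * (a j / j) \<le> ln \<beta>" if "1 \<le> j" for j
      using growth_le[OF \<rho> mult_left_mono_neg[OF En_pow_len_le l], of j] that
      by (simp add: divide_le_eq field_simps)
    then show "\<exists>N. \<forall>n\<ge>N. - ln \<rho> * (a n / n) \<le> ln \<beta>" by blast
  qed
qed

lemma ln_beta_le: "ln \<beta> \<le> mu / lam * (1 - \<rho>)"
  using ln_le_minus_one[OF beta_pos] lam_pos by (simp add: \<beta>_def field_simps)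

lemma drift_less: "(\<lambda>n. a n / n) \<longlonglongrightarrow> \<gamma> \<Longrightarrow> \<rho> < 1 \<Longrightarrow> lam * \<gamma> < mu"
proof -
  assume lim: "(\<lambda>n. a n / n) \<longlonglongrightarrow> \<gamma>" and r: "\<rho> < 1"
  have 1: "- ln \<rho> * \<gamma> \<le> mu / lam * (1 - \<rho>)" using ln_beta_ge[OF lim] ln_beta_le r by linarith
  have 2: "1 - \<rho> < - ln \<rho>" using ln_le_minus_one[OF rho_pos] ln_eq_minus_one[OF rho_pos] r by fastforce
  show "lam * \<gamma> < mu"
  proof (rule ccontr)
    assume "\<not> lam * \<gamma> < mu"
    then have g: "mu / lam \<le> \<gamma>" using lam_pos by (simp add: field_simps)
    have gp: "0 < mu / lam" using mu_pos lam_pos by simp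
    have "mu / lam * (1 - \<rho>) < mu / lam * (- ln \<rho>)" using 2 gp by (rule mult_strict_left_mono)
    also have "\<dots> \<le> \<gamma> * (- ln \<rho>)" using g 2 r by (intro mult_right_mono) auto
    finally show False using 1 by (simp add: mult.commute)
  qed
qed

lemma drift_greater: "(\<lambda>n. a n / n) \<longlonglongrightarrow> \<gamma> \<Longrightarrow> 1 < \<rho> \<Longrightarrow> mu < lam * \<gamma>"
proof -
  assume lim: "(\<lambda>n. a n / n) \<longlonglongrightarrow> \<gamma>" and r: "1 < \<rho>"
  have 1: "- ln \<rho> * \<gamma> \<le> mu / lam * (1 - \<rho>)" using ln_beta_ge[OF lim] ln_beta_le r by linarith
  have 2: "ln \<rho> < \<rho> - 1" using ln_le_minus_one[OF rho_pos] ln_eq_minus_one[OF rho_pos] r by fastforce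
  show "mu < lam * \<gamma>"
  proof (rule ccontr)
    assume "\<not> mu < lam * \<gamma>"
    then have g: "\<gamma> \<le> mu / lam" using lam_pos by (simp add: field_simps)
    have "\<gamma> * ln \<rho> \<le> mu / lam * ln \<rho>" using g r by (intro mult_right_mono) auto
    also have "\<dots> < mu / lam * (\<rho> - 1)" using 2 mu_pos lam_pos by (intro mult_strict_left_mono) auto
    also have "\<dots> = - (mu / lam * (1 - \<rho>))" by (simp add: right_diff_distrib)
    finally show False using 1 by (simp add: mult.commute)
  qed
qed

section \<open>The critical case\<close>

definition incr :: "'a list \<Rightarrow> real" where "incr w = Aop len w - len w"

lemma incr_bounds: "- 1 \<le> incr w" "incr w \<le> 1"
  using Aop_pow_len_bounds[where j = "Suc 0" and w = w] by (auto simp: incr_def)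

text \<open>\<open>A\<close> is the probability that a letter lengthens a word of law
  \<open>P\<close>, by symmetry of \<open>N\<close>, and \<open>C\<close> the probability that it
  cancels the head. Neither depends on the length, since the head has law \<open>r\<close>.\<close>

lemma En_incr: "En (Suc n) incr = A - C"
proof -
  have "En (Suc n) incr = En (Suc n) (\<lambda>w. sum (pmf \<nu>) (N (hd w)) - inv_mass (hd w))"
  proof (rule En_cong)
    fix w assume w: "w \<in> L" "length w = Suc n"
    then have ne: "w \<noteq> []" by auto
    have "Aop (\<lambda>v. len v - len w) w = incr w"
      by (simp add: Aop_def incr_def right_diff_distrib sum_subtractf flip: sum_distrib_right)
    moreover have "up (\<lambda>v. len v - len w) w = sum (pmf \<nu>) (N (hd w))"
      unfolding up_def
    proof (rule sum.cong)
      fix x assume "x \<in> N (hd w)"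
      then have "0 < rN x" using N_sub rN_pos by blast
      then show "pmf \<nu> x * rN x * scale w x * (len (x # w) - len w) = pmf \<nu> x" using ne by (simp add: scale_def len_def)
    qed (use ne in \<open>simp add: ext_def\<close>)
    moreover have "same (\<lambda>v. len v - len w) w = 0" using ne by (simp add: same_def len_def)
    moreover have "len (tl w) - len w = - 1" using ne by (cases w) (auto simp: len_def)
    ultimately show "incr w = sum (pmf \<nu>) (N (hd w)) - inv_mass (hd w)"
      using Aop_split[OF w(1) ne, of "\<lambda>v. len v - len w"] by simp
  qed
  also have "\<dots> = (\<Sum>y\<in>Sig. \<Sum>x\<in>N y. r y * pmf \<nu> x) - C"
    by (simp add: En_hd[of n "\<lambda>y. sum (pmf \<nu>) (N y) - inv_mass y"] C_def right_diff_distrib sum_subtractf sum_distrib_left)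
  also have "\<dots> = A - C"
    by (subst sum_N_swap) (simp add: A_def rN_def sum_distrib_left mult.commute)
  finally show ?thesis .
qed

text \<open>One step changes the length by at most 1, so \<open>1 + s * incr w\<close> is
  nonnegative for both signs and \<open>Z_Aop_pow_le\<close> applies, with
  \<open>\<beta> = 1\<close>. The two signs together give a two-sided estimate.\<close>

lemma Z_incr_pow_le:
  assumes \<rho>: "\<rho> = 1" and s: "s = 1 \<or> s = - 1"
  shows "\<exists>K. \<forall>M. s * Z M (\<lambda>w. (Aop ^^ j) len w - len w) \<le> M * (j * (s * (A - C))) + K"
proof (induction j)
  case 0
  show ?case by (intro exI[of _ 0]) (simp add: Z_def En_const)
next
  case (Suc j)
  then obtain K where K: "\<And>M. s * Z M (\<lambda>w. (Aop ^^ j) len w - len w) \<le> M * (j * (s * (A - C))) + K" by blast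
  let ?g = "\<lambda>w. 1 + s * incr w"
  have g: "0 \<le> ?g w" for w using incr_bounds[of w] s by auto
  obtain K' where K': "\<And>M. Z M ((Aop ^^ j) ?g) \<le> \<beta> ^ j * Z (M + j) ?g + K'" using Z_Aop_pow_le[of ?g j] g by blast
  have b: "\<beta> = 1" using lam_pos unfolding \<beta>_def unfolding \<rho> by simp
  have Z1: "Z M (\<lambda>_. 1) = M" and Zi: "Z M incr = M * (A - C)" for M unfolding Z_def unfolding \<rho> by (simp_all add: En_const En_incr)
  have Zg: "Z M ?g = M + s * (M * (A - C))" for M by (simp add: Z_add Z_cmult Z1 Zi)
  have "Z M ((Aop ^^ j) ?g) = M + s * Z M ((Aop ^^ j) incr)" for M
    unfolding Aop_pow_add[abs_def] Aop_pow_cmult[abs_def] Aop_pow_const[abs_def] Z_add Z_cmult Z1 ..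
  then have step: "s * Z M ((Aop ^^ j) incr) \<le> M * (s * (A - C)) + (j + j * (s * (A - C)) + K')" for M
    using K'[of M] by (simp add: Zg b algebra_simps)
  show ?case
  proof (intro exI allI)
    fix M
    have "(Aop ^^ Suc j) len w - len w = ((Aop ^^ j) len w - len w) + (Aop ^^ j) incr w" for w
    proof -
      have "(Aop ^^ j) incr w = (Aop ^^ j) (Aop len) w - (Aop ^^ j) len w" unfolding incr_def[abs_def] by (rule Aop_pow_diff)
      then show ?thesis by (simp add: funpow_Suc_right del: funpow.simps)
    qed
    then have "s * Z M (\<lambda>w. (Aop ^^ Suc j) len w - len w) = s * Z M (\<lambda>w. (Aop ^^ j) len w - len w) + s * Z M ((Aop ^^ j) incr)"
      by (simp only: Z_add distrib_left)
    also have "\<dots> \<le> (M * (j * (s * (A - C))) + K) + (M * (s * (A - C)) + (j + j * (s * (A - C)) + K'))"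
      by (intro add_mono K step)
    also have "\<dots> = M * (Suc j * (s * (A - C))) + (K + (j + j * (s * (A - C)) + K'))" by (simp add: algebra_simps)
    finally show "s * Z M (\<lambda>w. (Aop ^^ Suc j) len w - len w) \<le> M * (Suc j * (s * (A - C))) + (K + (j + j * (s * (A - C)) + K'))" .
  qed
qed

lemma drift_critical:
  assumes lim: "(\<lambda>n. a n / n) \<longlonglongrightarrow> \<gamma>" and \<rho>: "\<rho> = 1"
  shows "lam * \<gamma> = mu"
proof -
  have Zl: "Z M (\<lambda>w. (Aop ^^ j) len w - len w) = (\<Sum>n<M. En (Suc n) ((Aop ^^ j) len) - real (Suc n))" for M j
  proof -
    have "En n len = n" for n using En_cong[of n len "\<lambda>_. real n"] by (simp add: len_def En_const)
    then show ?thesis unfolding Z_def En_diff unfolding \<rho> by simp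
  qed
  obtain c :: "nat \<Rightarrow> real" where c: "c \<longlonglongrightarrow> 0"
    "\<And>k n j. a j - 2 * real k - 1 - 2 * real j * c k \<le> En n ((Aop ^^ j) len) - real n"
    using cancel_lower_bound by auto
  have "1 * \<gamma> \<le> A - C"
  proof (rule limit_bound[OF lim c(1)])
    fix j k
    obtain K where K: "\<And>M. 1 * Z M (\<lambda>w. (Aop ^^ j) len w - len w) \<le> M * (j * (1 * (A - C))) + K"
      using Z_incr_pow_le[OF \<rho>, of 1 j] by blast
    show "1 * (a j - 2 * real k - 1 - 2 * real j * c k) \<le> j * (A - C)"
    proof (rule level_bound_le)
      fix M
      have "real M * (1 * (a j - 2 * real k - 1 - 2 * real j * c k)) = (\<Sum>n<M. a j - 2 * real k - 1 - 2 * real j * c k)" by simp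
      also have "\<dots> \<le> Z M (\<lambda>w. (Aop ^^ j) len w - len w)" unfolding Zl by (rule sum_mono) (rule c(2))
      also have "\<dots> \<le> (real M + 0) * (j * (A - C)) + K" using K[of M] by simp
      finally show "real M * (1 * (a j - 2 * real k - 1 - 2 * real j * c k)) \<le> (real M + 0) * (j * (A - C)) + K" .
    qed
  qed
  moreover have "A - C \<le> \<gamma>"
  proof (rule LIMSEQ_le_const[OF lim])
    have "A - C \<le> a j / j" if j: "1 \<le> j" for j
    proof -
      obtain K where K: "\<And>M. - 1 * Z M (\<lambda>w. (Aop ^^ j) len w - len w) \<le> M * (j * (- 1 * (A - C))) + K"
        using Z_incr_pow_le[OF \<rho>, of "- 1" j] by blast
      have "- a j \<le> j * (- 1 * (A - C))"
      proof (rule level_bound_le)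
        fix M
        have "Z M (\<lambda>w. (Aop ^^ j) len w - len w) \<le> (\<Sum>n<M. a j)" unfolding Zl by (rule sum_mono) (rule En_pow_len_le)
        then show "real M * - a j \<le> (real M + 0) * (j * (- 1 * (A - C))) + K" using K[of M] by simp
      qed
      then show ?thesis using j by (simp add: le_divide_eq algebra_simps)
    qed
    then show "\<exists>N. \<forall>n\<ge>N. A - C \<le> a n / n" by blast
  qed
  ultimately have "\<gamma> = A - C" by simp
  \<comment> \<open>Admissibility of \<open>\<rho> = 1\<close>.\<close>
  moreover have "mu = lam * (A - C)" using adm'(1) by (simp add: \<rho> right_diff_distrib)
  ultimately show ?thesis by simp
qed

end

section \<open>The queue-content process\<close>

context queue
begin

section \<open>Generator, rates and irreducibility\<close>

abbreviation Q where "Q \<equiv> queue_generator X Sig \<nu> r lam mu"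
abbreviation K where "K \<equiv> jump_kernel Q"

definition arr :: "('a list \<Rightarrow> real) \<Rightarrow> 'a list \<Rightarrow> real" where
  "arr f u = (if u = [] then up f u else Aop f u)"
definition srv :: "('a list \<Rightarrow> real) \<Rightarrow> 'a list \<Rightarrow> real" where
  "srv f u = (if u = [] then 0 else f (butlast u))"
text \<open>Letters with \<open>b \<otimes> hd u = hd u\<close> are counted too, as moves from
  \<open>u\<close> to \<open>u\<close>. The generator is
  \<open>drv f u - drv (\<lambda>_. 1) u * f u\<close>, where such moves cancel.\<close>

definition drv :: "('a list \<Rightarrow> real) \<Rightarrow> 'a list \<Rightarrow> real" where "drv f u = lam * arr f u + mu * srv f u"

definition targets :: "'a list \<Rightarrow> 'a list set" where
  "targets u = (if u = [] then (\<lambda>x. [x]) ` Sig else insert (butlast u) ((\<lambda>b. push b u) ` Sig))"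

lemma targets_fin [simp]: "finite (targets u)" using Sig_fin by (simp add: targets_def)

lemma targets_L: "u \<in> L \<Longrightarrow> targets u \<subseteq> L"
  using push_L L_butlast by (auto simp: targets_def)

lemma up_Nil: "up f [] = (\<Sum>x\<in>Sig. pmf \<nu> x * rN x * f [x])"
  by (simp add: up_def ext_def scale_def)

lemma drv_cong: "(\<And>v. v \<in> targets u \<Longrightarrow> f v = g v) \<Longrightarrow> drv f u = drv g u"
  by (auto simp: drv_def arr_def srv_def up_Nil Aop_def targets_def intro!: sum.cong)

lemma drv_add: "drv (\<lambda>v. f v + g v) u = drv f u + drv g u"
  by (simp add: drv_def arr_def srv_def up_Nil Aop_def distrib_left sum.distrib)

lemma drv_cmult: "drv (\<lambda>v. c * f v) u = c * drv f u"
  by (simp add: drv_def arr_def srv_def up_Nil Aop_def distrib_left sum_distrib_left mult_ac)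

lemma drv_diff: "drv (\<lambda>v. f v - g v) u = drv f u - drv g u"
  using drv_add[of f "\<lambda>v. (-1) * g v" u] drv_cmult[of "-1" g u] by simp

lemma drv_zero [simp]: "drv (\<lambda>_. 0) u = 0" using drv_cmult[of 0 "\<lambda>_. 0" u] by simp

lemma drv_sum: "finite I \<Longrightarrow> drv (\<lambda>v. \<Sum>i\<in>I. f i v) u = (\<Sum>i\<in>I. drv (f i) u)"
  by (induction I rule: finite_induct) (simp_all add: drv_add)

lemma drv_mono: "(\<And>v. v \<in> targets u \<Longrightarrow> f v \<le> g v) \<Longrightarrow> drv f u \<le> drv g u"
  using lam_pos mu_pos
  by (auto simp: drv_def arr_def srv_def up_Nil Aop_def targets_def less_imp_le[OF rN_pos]
      intro!: sum_mono add_mono mult_left_mono)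

definition pt :: "'a list \<Rightarrow> 'a list \<Rightarrow> real" where "pt v w = of_bool (w = v)"

lemma drv_expand: "drv f u = (\<Sum>v\<in>targets u. drv (pt v) u * f v)"
proof -
  have "drv f u = drv (\<lambda>w. \<Sum>v\<in>targets u. f v * pt v w) u"
    by (rule drv_cong) (simp add: pt_def)
  then show ?thesis by (simp add: drv_sum drv_cmult mult.commute)
qed

lemma drv_pt_nonneg: "0 \<le> drv (pt v) u"
  using drv_mono[of u "\<lambda>_. 0" "pt v"] by (simp add: pt_def)

lemma drv_pt_outside: "v \<notin> targets u \<Longrightarrow> drv (pt v) u = 0"
  using drv_cong[of u "pt v" "\<lambda>_. 0"] by (auto simp: pt_def)

lemma queue_rate_eq:
  assumes u: "u \<in> L" and v: "v \<noteq> u"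
  shows "queue_rate X Sig \<nu> r lam mu u v = drv (pt v) u"
proof (cases "u = []")
  case True
  have "queue_rate X Sig \<nu> r lam mu u v = lam * (\<Sum>x\<in>Sig. pmf \<nu> x * rN x * pt v [x])"
  proof -
    have "lam * (\<Sum>x\<in>Sig. pmf \<nu> x * rN x * pt v [x]) = (\<Sum>x\<in>Sig. lam * (pmf \<nu> x * rN x * pt v [x]))"
      by (rule sum_distrib_left)
    then show ?thesis unfolding queue_rate_def using True by (auto intro!: sum.cong simp: pt_def rN_def)
  qed
  then show ?thesis using True by (simp add: drv_def arr_def srv_def up_Nil)
next
  case False
  let ?d = "hd u"
  have ud: "?d # tl u = u" using False by simp
  have 1: "(\<Sum>b\<in>N ?d. if v = b # u then lam * pmf \<nu> b else 0) = lam * up (pt v) u"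
    unfolding up_def sum_distrib_left
  proof (rule sum.cong)
    fix b assume "b \<in> ext u"
    then have "0 < rN b" using ext_sub rN_pos by blast
    then show "(if v = b # u then lam * pmf \<nu> b else 0) = lam * (pmf \<nu> b * rN b * scale u b * pt v (b # u))"
      using False by (simp add: pt_def scale_def)
  qed (use False in \<open>simp add: ext_def\<close>)
  have 2: "(\<Sum>b\<in>{b \<in> Sig. b \<otimes> ?d \<in> Sig \<and> b \<otimes> ?d \<noteq> ?d}. if v = (b \<otimes> ?d) # tl u then lam * pmf \<nu> b else 0) = lam * same (pt v) u"
    unfolding same_def sum_distrib_left
  proof (rule sum.mono_neutral_cong_left)
    show "\<forall>b\<in>{b \<in> Sig. b \<otimes> ?d \<in> Sig} - {b \<in> Sig. b \<otimes> ?d \<in> Sig \<and> b \<otimes> ?d \<noteq> ?d}. lam * (pmf \<nu> b * pt v ((b \<otimes> ?d) # tl u)) = 0"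
      using v ud by (auto simp: pt_def)
  qed (use Sig_fin in \<open>auto simp: pt_def\<close>)
  have 3: "(\<Sum>b\<in>{b \<in> Sig. b \<otimes> ?d = \<one>}. if v = tl u then lam * pmf \<nu> b else 0) = lam * (inv_mass ?d * pt v (tl u))"
    unfolding inv_mass_def sum_distrib_left sum_distrib_right by (rule sum.cong) (auto simp: pt_def)
  have 4: "(if v = butlast u then mu else 0) = mu * pt v (butlast u)" by (simp add: pt_def)
  show ?thesis
    unfolding queue_rate_def using False
    by (simp only: 1 2 3 4 if_False drv_def arr_def srv_def Aop_split[OF u False] distrib_left)
qed

lemma drv_rate_sum: "(\<Sum>v\<in>targets u - {u}. drv (pt v) u * f v) = drv f u - drv (pt u) u * f u"
proof (cases "u \<in> targets u")
  case True then show ?thesis by (simp add: drv_expand[of f] sum_diff1)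
next
  case False then show ?thesis by (simp add: drv_expand[of f] drv_pt_outside)
qed

lemma exit_rate_eq:
  assumes u: "u \<in> L"
  shows "exit_rate Q u = drv (\<lambda>_. 1) u - drv (pt u) u"
proof -
  have "exit_rate Q u = (\<Sum>\<^sub>\<infinity>w\<in>L - {u}. queue_rate X Sig \<nu> r lam mu u w)"
    by (simp add: exit_rate_def queue_generator_def)
  also have "\<dots> = (\<Sum>\<^sub>\<infinity>w\<in>targets u - {u}. drv (pt w) u)"
    using targets_L[OF u] by (intro infsum_cong_neutral) (auto simp: queue_rate_eq[OF u] drv_pt_outside)
  also have "\<dots> = (\<Sum>w\<in>targets u - {u}. drv (pt w) u * 1)" by simp
  finally show ?thesis using drv_rate_sum[of u "\<lambda>_. 1"] by simp
qed

lemma Nil_notin_targets: "[] \<notin> targets []" by (auto simp: targets_def)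

lemma drv_one: "drv (\<lambda>_. 1) u = (if u = [] then lam * A else lam + mu)"
  by (simp add: drv_def arr_def srv_def up_Nil A_def Aop_def)

lemma A_le_1: "A \<le> 1"
  unfolding A_def sum_nu[symmetric] using rN_le_1 by (intro sum_mono mult_left_le) auto

lemma rate_ge: "u \<in> L \<Longrightarrow> min mu (lam * A) \<le> exit_rate Q u"
proof (cases "u = []")
  case True
  then show ?thesis by (simp add: exit_rate_eq drv_one drv_pt_outside[OF Nil_notin_targets])
next
  case False
  assume u: "u \<in> L"
  have b: "butlast u \<noteq> u" using False by (metis length_butlast diff_less length_greater_0_conv less_not_refl zero_less_one)
  have "mu * pt (butlast u) (butlast u) \<le> drv (pt (butlast u)) u"
    using False lam_pos by (auto simp: drv_def arr_def srv_def Aop_def pt_def intro!: mult_nonneg_nonneg sum_nonneg)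
  then have "mu \<le> drv (pt (butlast u)) u * 1" by (simp add: pt_def)
  also have "\<dots> \<le> (\<Sum>v\<in>targets u - {u}. drv (pt v) u * 1)"
    using b False by (intro member_le_sum[of _ _ "\<lambda>v. drv (pt v) u * 1"]) (auto simp: targets_def drv_pt_nonneg Sig_fin)
  finally show ?thesis unfolding drv_rate_sum exit_rate_eq[OF u] by simp
qed

lemma rate_le: "u \<in> L \<Longrightarrow> exit_rate Q u \<le> lam + mu"
proof -
  assume u: "u \<in> L"
  have "lam * A \<le> lam" using lam_pos A_le_1 by simp
  then have "drv (\<lambda>_. 1) u \<le> lam + mu" using mu_pos by (simp add: drv_one)
  then show ?thesis using drv_pt_nonneg[of u u] exit_rate_eq[OF u] by linarith
qed

lemma c0_pos: "0 < min mu (lam * A)" using A_pos lam_pos mu_pos by simp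

lemma rate_pos: "u \<in> L \<Longrightarrow> 0 < exit_rate Q u"
  using rate_ge[of u] c0_pos by linarith

lemma pmf_K:
  assumes u: "u \<in> L"
  shows "pmf (K u) v = (if v = u then 0 else drv (pt v) u / exit_rate Q u)"
proof -
  let ?f = "\<lambda>v. if v = u then 0 else Q u v / exit_rate Q u"
  have q: "0 < exit_rate Q u" using rate_pos[OF u] by linarith
  have f: "?f v = (if v = u then 0 else drv (pt v) u / exit_rate Q u)" for v
    using queue_rate_eq[OF u] by (simp add: queue_generator_def)
  have nn: "0 \<le> ?f v" for v unfolding f using q drv_pt_nonneg by simp
  have "(\<integral>\<^sup>+v. ennreal (?f v) \<partial>count_space UNIV) = (\<Sum>v\<in>targets u - {u}. ennreal (?f v))"
  proof (rule nn_integral_count_space')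
    fix v assume "v \<notin> targets u - {u}"
    then show "ennreal (?f v) = 0" unfolding f by (auto simp: drv_pt_outside)
  qed auto
  also have "\<dots> = ennreal (\<Sum>v\<in>targets u - {u}. ?f v)" by (rule sum_ennreal) (rule nn)
  also have "(\<Sum>v\<in>targets u - {u}. ?f v) = (\<Sum>v\<in>targets u - {u}. drv (pt v) u * 1) / exit_rate Q u"
    unfolding f sum_divide_distrib by (intro sum.cong) auto
  also have "\<dots> = 1" unfolding drv_rate_sum using q by (simp add: exit_rate_eq[OF u])
  finally have "pmf (embed_pmf ?f) v = ?f v" using nn by (intro pmf_embed_pmf) auto
  then show ?thesis using q f[of v] by (simp add: jump_kernel_def)
qed

lemma K_supp: "u \<in> L \<Longrightarrow> set_pmf (K u) \<subseteq> targets u"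
proof
  fix v assume u: "u \<in> L" and v: "v \<in> set_pmf (K u)"
  then have "drv (pt v) u \<noteq> 0" by (auto simp: set_pmf_iff pmf_K split: if_splits)
  then show "v \<in> targets u" using drv_pt_outside by blast
qed

sublocale fb: finite_bounded_rates Q L "min mu (lam * A)" "lam + mu"
proof
  fix u assume u: "u \<in> L"
  show "set_pmf (K u) \<subseteq> L" using K_supp[OF u] targets_L[OF u] by blast
  show "finite (set_pmf (K u))" by (rule finite_subset[OF K_supp[OF u] targets_fin])
qed (fact rate_ge rate_le c0_pos)+

lemma exit_rate_jump_mean:
  assumes u: "u \<in> L"
  shows "exit_rate Q u * fb.jump_mean f u = drv f u - drv (pt u) u * f u"
proof -
  have q: "exit_rate Q u \<noteq> 0" using rate_pos[OF u] by linarith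
  have "fb.jump_mean f u = (\<Sum>v\<in>targets u - {u}. pmf (K u) v * f v)"
    unfolding fb.jump_mean_def using K_supp[OF u]
    by (intro sum.mono_neutral_left) (auto simp: set_pmf_iff pmf_K[OF u])
  also have "\<dots> = (\<Sum>v\<in>targets u - {u}. drv (pt v) u * f v) / exit_rate Q u"
    unfolding sum_divide_distrib by (intro sum.cong) (auto simp: pmf_K[OF u])
  finally show ?thesis unfolding drv_rate_sum using q by simp
qed

lemma generator_jump_mean: "u \<in> L \<Longrightarrow> exit_rate Q u * (fb.jump_mean f u - f u) = drv f u - drv (\<lambda>_. 1) u * f u"
  unfolding right_diff_distrib exit_rate_jump_mean by (simp add: exit_rate_eq algebra_simps)

lemma pos_iff: "u \<in> L \<Longrightarrow> v \<noteq> u \<Longrightarrow> 0 < pmf (K u) v \<longleftrightarrow> 0 < Q u v"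
  using rate_pos[of u] drv_pt_nonneg[of v u]
  by (auto simp: pmf_K queue_generator_def queue_rate_eq zero_less_divide_iff)

lemma pos_drv: "u \<in> L \<Longrightarrow> v \<noteq> u \<Longrightarrow> 0 < drv (pt v) u \<Longrightarrow> 0 < pmf (K u) v"
  using rate_pos[of u] by (simp add: pmf_K)

text \<open>Services lead from every word to the empty one. From there \<open>v\<close> is reached
  by pushing a word over the support of \<open>\<nu>\<close> that represents it; pushes that change
  nothing are skipped, as they are not jumps.\<close>

lemma irreducible_K: "u \<in> L \<Longrightarrow> v \<in> L \<Longrightarrow> (u, v) \<in> {(x, y). x \<in> L \<and> y \<in> L \<and> 0 < pmf (K x) y}\<^sup>*"
proof -
  let ?R = "{(x, y). x \<in> L \<and> y \<in> L \<and> 0 < pmf (K x) y}"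
  assume u: "u \<in> L" and v: "v \<in> L"
  have down: "(w, []) \<in> ?R\<^sup>*" if "w \<in> L" for w
    using that
  proof (induction w rule: rev_induct)
    case (snoc x w)
    have wL: "w \<in> L" using L_butlast[OF snoc.prems] by simp
    have "mu * pt w w \<le> drv (pt w) (w @ [x])"
      using lam_pos by (auto simp: drv_def arr_def srv_def Aop_def pt_def intro!: mult_nonneg_nonneg sum_nonneg)
    then have "0 < pmf (K (w @ [x])) w" using mu_pos snoc.prems by (intro pos_drv) (auto simp: pt_def)
    then have "(w @ [x], w) \<in> ?R" using wL snoc.prems by simp
    then show ?case using snoc.IH[OF wL] by (rule converse_rtrancl_into_rtrancl)
  qed simp
  have up: "([], foldr push bs []) \<in> ?R\<^sup>*" if "bs \<in> lists (set_pmf \<nu>)" for bs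
    using that
  proof (induction bs)
    case (Cons b bs)
    let ?w = "foldr push bs []"
    have bs: "b \<in> set_pmf \<nu>" "bs \<in> lists (set_pmf \<nu>)" using Cons.hyps by simp_all
    have b: "b \<in> set_pmf \<nu>" "b \<in> Sig" "bs \<in> lists Sig" using bs supp lists_mono[OF supp] by blast+
    have w: "?w \<in> L" by (rule pushes_L[OF b(3) L_Nil])
    have pw: "push b ?w \<in> L" by (rule push_L[OF b(2) w])
    have "(?w, push b ?w) \<in> ?R\<^sup>*"
    proof (cases "push b ?w = ?w")
      case False
      have "0 < drv (pt (push b ?w)) ?w"
      proof (cases "?w = []")
        case True
        have "pmf \<nu> b * rN b * pt [b] [b] \<le> (\<Sum>x\<in>Sig. pmf \<nu> x * rN x * pt [b] [x])"
          using b Sig_fin by (intro member_le_sum[of b Sig "\<lambda>x. pmf \<nu> x * rN x * pt [b] [x]"]) (auto simp: pt_def less_imp_le[OF rN_pos])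
        moreover have "0 < pmf \<nu> b * rN b" using b rN_pos by (simp add: pmf_positive)
        ultimately show ?thesis using True lam_pos by (auto simp: drv_def arr_def srv_def up_Nil pt_def intro!: mult_pos_pos)
      next
        case F: False
        let ?h = "pt (push b ?w)"
        have "pmf \<nu> b * ?h (push b ?w) \<le> (\<Sum>x\<in>Sig. pmf \<nu> x * ?h (push x ?w))"
          using b Sig_fin by (intro member_le_sum[of b Sig "\<lambda>x. pmf \<nu> x * ?h (push x ?w)"]) (auto simp: pt_def)
        moreover have "0 < pmf \<nu> b" using b by (simp add: pmf_positive)
        ultimately have "0 < Aop ?h ?w" by (simp add: Aop_def pt_def)
        moreover have "0 \<le> mu * srv ?h ?w" using mu_pos by (simp add: srv_def pt_def)
        ultimately show ?thesis using F lam_pos by (simp add: drv_def arr_def add_pos_nonneg)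
      qed
      then have "0 < pmf (K ?w) (push b ?w)" using w False by (intro pos_drv) auto
      then show ?thesis using w pw by (intro r_into_rtrancl) simp
    qed simp
    moreover have "([], ?w) \<in> ?R\<^sup>*" using Cons by simp
    ultimately show ?case by simp
  qed simp
  obtain bs where "bs \<in> lists (set_pmf \<nu>)" "foldr push bs [] = v" using reachable_nf[OF gen supp v] by blast
  then have "([], v) \<in> ?R\<^sup>*" using up[of bs] by simp
  then show "(u, v) \<in> ?R\<^sup>*" using down[OF u] by (rule rtrancl_trans[rotated])
qed

lemma irreducible: "irreducible_on L Q"
  unfolding irreducible_on_def
proof (intro ballI)
  fix u v assume "u \<in> L" "v \<in> L"
  then have "(u, v) \<in> {(x, y). x \<in> L \<and> y \<in> L \<and> 0 < pmf (K x) y}\<^sup>*" by (rule irreducible_K)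
  moreover have "{(x, y). x \<in> L \<and> y \<in> L \<and> 0 < pmf (K x) y} \<subseteq> {(x, y). x \<in> L \<and> y \<in> L \<and> x \<noteq> y \<and> 0 < Q x y}"
  proof clarify
    fix x y assume h: "x \<in> L" "y \<in> L" "0 < pmf (K x) y"
    then have "y \<noteq> x" by (auto simp: pmf_K)
    then show "x \<noteq> y \<and> 0 < Q x y" using h pos_iff by blast
  qed
  ultimately show "(u, v) \<in> {(x, y). x \<in> L \<and> y \<in> L \<and> x \<noteq> y \<and> 0 < Q x y}\<^sup>*" using rtrancl_mono by blast
qed

section \<open>The invariant measure\<close>

definition m :: "'a list \<Rightarrow> real" where "m w = (if w \<in> L then \<rho> ^ length w * P w else 0)"

lemma m_pos: "w \<in> L \<Longrightarrow> 0 < m w" using P_pos rho_pos by (simp add: m_def)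
lemma m_nonneg: "0 \<le> m w" using m_pos[of w] by (cases "w \<in> L") (auto simp: m_def)

lemma sum_m_Ln: "(\<Sum>w\<in>Ln n. m w * f w) = \<rho> ^ n * En n f"
  unfolding En_def sum_distrib_left by (rule sum.cong) (auto simp: m_def Ln_def mult_ac)

definition levels :: "nat \<Rightarrow> 'a list set" where "levels M = (\<Union>n\<le>M. Ln n)"

lemma levels_fin [simp]: "finite (levels M)" by (simp add: levels_def)
lemma levels_iff: "w \<in> levels M \<longleftrightarrow> w \<in> L \<and> length w \<le> M" by (auto simp: levels_def Ln_def)

lemma sum_m_levels: "(\<Sum>w\<in>levels M. m w * f w) = (\<Sum>n\<le>M. \<rho> ^ n * En n f)"
  unfolding levels_def sum_m_Ln[symmetric]
proof (rule sum.UNION_disjoint)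
  show "\<forall>i\<in>{..M}. \<forall>j\<in>{..M}. i \<noteq> j \<longrightarrow> Ln i \<inter> Ln j = {}" by (auto simp: Ln_def)
qed simp_all

lemma sum_m_levels_Suc: "(\<Sum>w\<in>levels M. m w * f w) = f [] + Z M f"
  unfolding sum_m_levels lessThan_Suc_atMost[symmetric] sum.lessThan_Suc_shift Z_def by simp

text \<open>Only boundary terms at the truncation level remain, so that \<open>m\<close> is an invariant measure.\<close>

lemma generator_levels:
  "(\<Sum>w\<in>levels (Suc M). m w * (drv f w - drv (\<lambda>_. 1) w * f w)) =
   \<rho> ^ Suc M * (lam * En (Suc M) (up f) - lam * \<rho> * En (Suc (Suc M)) (\<lambda>w. inv_mass (hd w) * f (tl w)) - mu * \<rho> * En (Suc M) f)"
proof -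
  let ?D = "\<lambda>w. inv_mass (hd w) * f (tl w)"
  have E: "En (Suc n) (\<lambda>w. drv f w - drv (\<lambda>_. 1) w * f w)
      = lam * (En (Suc n) (up f) + En (Suc n) (same f) + En (Suc n) ?D) + mu * En n f - (lam + mu) * En (Suc n) f" for n
  proof -
    have "En (Suc n) (\<lambda>w. drv f w - drv (\<lambda>_. 1) w * f w) = En (Suc n) (\<lambda>w. lam * Aop f w + mu * f (butlast w) - (lam + mu) * f w)"
      by (rule En_cong) (auto simp: drv_one, auto simp: drv_def arr_def srv_def)
    then show ?thesis by (simp only: En_diff En_add En_cmult En_Aop En_butlast)
  qed
  have Zs: "(\<Sum>n<Suc M. \<rho> ^ Suc n * En n f) = \<rho> * (f [] + Z (Suc M) f - \<rho> ^ Suc M * En (Suc M) f)"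
  proof -
    have "(\<Sum>n<Suc M. \<rho> ^ Suc n * En n f) = \<rho> * (f [] + Z M f)"
      unfolding sum.lessThan_Suc_shift Z_def by (simp add: sum_distrib_left distrib_left mult_ac)
    then show ?thesis by (simp add: Z_def)
  qed
  have "Z (Suc M) (\<lambda>w. drv f w - drv (\<lambda>_. 1) w * f w) = (\<Sum>n<Suc M. lam * (\<rho> ^ Suc n * En (Suc n) (up f))
      + lam * (\<rho> ^ Suc n * En (Suc n) (same f)) + lam * (\<rho> ^ Suc n * En (Suc n) ?D) + mu * (\<rho> ^ Suc n * En n f) - (lam + mu) * (\<rho> ^ Suc n * En (Suc n) f))"
    unfolding Z_def E by (rule sum.cong) (simp_all add: algebra_simps)
  also have "\<dots> = lam * Z (Suc M) (up f) + lam * Z (Suc M) (same f) + lam * Z (Suc M) ?D + mu * (\<Sum>n<Suc M. \<rho> ^ Suc n * En n f) - (lam + mu) * Z (Suc M) f"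
    unfolding Z_def sum_distrib_left sum.distrib sum_subtractf ..
  finally have 1: "Z (Suc M) (\<lambda>w. drv f w - drv (\<lambda>_. 1) w * f w) = \<dots>" .
  have 2: "Z (Suc M) (up f) = Z M (up f) + \<rho> ^ Suc M * En (Suc M) (up f)"
    and 3: "Z (Suc (Suc M)) ?D = Z (Suc M) ?D + \<rho> * (\<rho> ^ Suc M * En (Suc (Suc M)) ?D)" by (simp_all add: Z_def)
  have 4: "drv f [] - drv (\<lambda>_. 1) [] * f [] = lam * En 0 (up f) - lam * A * f []"
    unfolding drv_one by (simp add: drv_def arr_def srv_def)
  have 5: "lam * \<beta> = lam + mu - mu * \<rho>" using lam_pos by (simp add: \<beta>_def)
  have 6: "lam * (En 0 (up f) + Z M (up f) + Z (Suc M) (same f) + Z (Suc (Suc M)) ?D) = lam * \<beta> * Z (Suc M) f + lam * \<rho> * C * f []"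
    by (simp only: balance_sum distrib_left mult.assoc)
  \<comment> \<open>Balance at the empty word: it is left at rate \<open>lam * A\<close> and entered
    from length 1 by services and by cancellations.\<close>
  have 7: "lam * A * f [] = \<rho> * mu * f [] + lam * \<rho> * C * f []" unfolding adm'(1)[symmetric] by (simp add: algebra_simps)
  show ?thesis unfolding sum_m_levels_Suc 1 4 Zs 2 using 6 7 unfolding 5 3 by (simp add: algebra_simps)
qed

lemma up_one_le: "w \<in> L \<Longrightarrow> w \<noteq> [] \<Longrightarrow> up (\<lambda>_. 1) w \<le> 1"
proof -
  assume w: "w \<in> L" "w \<noteq> []"
  have "0 \<le> same (\<lambda>_. 1) w" by (auto simp: same_def intro!: sum_nonneg)
  moreover have "Aop (\<lambda>_. 1) w = 1" by (simp add: Aop_def)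
  ultimately show ?thesis using Aop_split[OF w, of "\<lambda>_. 1"] inv_mass_bounds(1)[of "hd w"] by simp
qed

lemma generator_levels_bound:
  assumes f: "\<And>w. 0 \<le> f w \<and> f w \<le> 1"
  shows "\<bar>\<Sum>w\<in>levels (Suc M). m w * (drv f w - drv (\<lambda>_. 1) w * f w)\<bar> \<le> \<rho> ^ Suc M * (lam + lam * \<rho> + mu * \<rho>)"
proof -
  have u: "0 \<le> En (Suc M) (up f)" "En (Suc M) (up f) \<le> 1"
  proof -
    show "0 \<le> En (Suc M) (up f)" using f by (intro En_nonneg up_nonneg) auto
    have "En (Suc M) (up f) \<le> En (Suc M) (\<lambda>_. 1)"
    proof (rule En_mono)
      fix w assume w: "w \<in> L" "length w = Suc M"
      have "up f w \<le> up (\<lambda>_. 1) w" using f w by (intro up_mono) auto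
      also have "\<dots> \<le> 1" using w by (intro up_one_le) auto
      finally show "up f w \<le> 1" .
    qed
    then show "En (Suc M) (up f) \<le> 1" by (simp add: En_const)
  qed
  have d: "0 \<le> En n (\<lambda>w. inv_mass (hd w) * f (tl w))" "En n (\<lambda>w. inv_mass (hd w) * f (tl w)) \<le> 1" for n
  proof -
    show "0 \<le> En n (\<lambda>w. inv_mass (hd w) * f (tl w))" using f inv_mass_bounds by (intro En_nonneg mult_nonneg_nonneg) auto
    have "En n (\<lambda>w. inv_mass (hd w) * f (tl w)) \<le> En n (\<lambda>_. 1)" using f inv_mass_bounds by (intro En_mono mult_le_one) auto
    then show "En n (\<lambda>w. inv_mass (hd w) * f (tl w)) \<le> 1" by (simp add: En_const)
  qed
  have e: "0 \<le> En n f" "En n f \<le> 1" for n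
    using En_mono[of n f "\<lambda>_. 1"] En_mono[of n "\<lambda>_. 0" f] f by (auto simp: En_const)
  have "\<bar>lam * x - lam * \<rho> * y - mu * \<rho> * z\<bar> \<le> lam + lam * \<rho> + mu * \<rho>"
    if "0 \<le> x" "x \<le> 1" "0 \<le> y" "y \<le> 1" "0 \<le> z" "z \<le> 1" for x y z :: real
  proof -
    have "0 \<le> lam * x" "lam * x \<le> lam * 1" "0 \<le> lam * \<rho> * y" "lam * \<rho> * y \<le> lam * \<rho> * 1" "0 \<le> mu * \<rho> * z" "mu * \<rho> * z \<le> mu * \<rho> * 1"
      using that lam_pos mu_pos rho_pos by (auto intro!: mult_left_mono mult_nonneg_nonneg)
    then show ?thesis by linarith
  qed
  from this[OF u d[of "Suc (Suc M)"] e[of "Suc M"]] show ?thesis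
    unfolding generator_levels abs_mult using rho_pos by (intro mult_mono) auto
qed

lemma length_targets: "v \<in> targets u \<Longrightarrow> length u \<le> Suc (length v)"
  using length_push_ge[of u] by (auto simp: targets_def split: if_splits)

text \<open>A jump shortens a word by at most one letter, so all predecessors of \<open>v\<close>
  have length at most \<open>Suc (length v)\<close>. For a point function at \<open>v\<close> the
  boundary terms of \<open>generator_levels\<close> at that length vanish.\<close>

lemma m_exit_invariant:
  assumes v: "v \<in> L"
  shows "(\<Sum>u\<in>levels (Suc (length v)). m u * exit_rate Q u * pmf (K u) v) = m v * exit_rate Q v"
proof -
  let ?B = "levels (Suc (length v))"
  have vB: "v \<in> ?B" using v by (simp add: levels_iff)
  have 0: "En (Suc (length v)) (pt v) = 0" "En (Suc (length v)) (up (pt v)) = 0"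
    "En (Suc (Suc (length v))) (\<lambda>w. inv_mass (hd w) * pt v (tl w)) = 0"
  proof -
    have "En (Suc (length v)) (pt v) = En (Suc (length v)) (\<lambda>_. 0)" by (rule En_cong) (auto simp: pt_def)
    then show "En (Suc (length v)) (pt v) = 0" by (simp add: En_const)
    have "En (Suc (length v)) (up (pt v)) = En (Suc (length v)) (\<lambda>_. 0)"
      by (rule En_cong) (auto simp: pt_def up_def intro!: sum.neutral)
    then show "En (Suc (length v)) (up (pt v)) = 0" by (simp add: En_const)
    have "En (Suc (Suc (length v))) (\<lambda>w. inv_mass (hd w) * pt v (tl w)) = En (Suc (Suc (length v))) (\<lambda>_. 0)"
      by (rule En_cong) (auto simp: pt_def)
    then show "En (Suc (Suc (length v))) (\<lambda>w. inv_mass (hd w) * pt v (tl w)) = 0" by (simp add: En_const)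
  qed
  have "(\<Sum>u\<in>?B. m u * (drv (pt v) u - drv (\<lambda>_. 1) u * pt v u)) = 0"
    using generator_levels[where M = "length v" and f = "pt v"] by (simp add: 0)
  moreover have "(\<Sum>u\<in>?B. m u * (drv (pt v) u - drv (\<lambda>_. 1) u * pt v u))
    = (\<Sum>u\<in>?B. m u * exit_rate Q u * pmf (K u) v - (if u = v then m v * exit_rate Q v else 0))"
  proof (rule sum.cong)
    fix u assume "u \<in> ?B"
    then have u: "u \<in> L" by (simp add: levels_iff)
    have q: "exit_rate Q u \<noteq> 0" using rate_pos[OF u] by linarith
    show "m u * (drv (pt v) u - drv (\<lambda>_. 1) u * pt v u) = m u * exit_rate Q u * pmf (K u) v - (if u = v then m v * exit_rate Q v else 0)"
    proof (cases "u = v")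
      case True
      have "drv (pt u) u - drv (\<lambda>_. 1) u * pt u u = - exit_rate Q u" using exit_rate_eq[OF u] by (simp add: pt_def)
      then show ?thesis using pmf_K[OF u, of u] True by simp
    next
      case False
      then show ?thesis using q u by (simp add: pmf_K pt_def)
    qed
  qed simp
  ultimately show ?thesis using vB by (simp add: sum_subtractf)
qed

text \<open>Multiplication by the exit rate turns an invariant measure of the process into one of
  its jump chain.\<close>

definition mJ :: "'a list \<Rightarrow> ennreal" where "mJ u = ennreal (m u * exit_rate Q u)"

lemma mJ_invariant: "occupation mJ (kop K f) = occupation mJ f"
proof -
  have q: "0 \<le> m u * exit_rate Q u" for u
    using rate_pos[of u] m_nonneg[of u] by (cases "u \<in> L") (auto simp: m_def intro!: mult_nonneg_nonneg)
  have pt: "(\<integral>\<^sup>+u. mJ u * ennreal (pmf (K u) v) \<partial>count_space UNIV) = mJ v" for v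
  proof -
    have "(\<integral>\<^sup>+u. mJ u * ennreal (pmf (K u) v) \<partial>count_space UNIV)
      = (\<Sum>u\<in>levels (Suc (length v)). mJ u * ennreal (pmf (K u) v))"
    proof (rule nn_integral_count_space')
      fix u assume u: "u \<notin> levels (Suc (length v))"
      show "mJ u * ennreal (pmf (K u) v) = 0"
      proof (cases "u \<in> L")
        case True
        then have "v \<notin> targets u" using u length_targets[of v u] by (auto simp: levels_iff)
        then have "pmf (K u) v = 0" using True by (simp add: pmf_K drv_pt_outside)
        then show ?thesis by simp
      qed (simp add: mJ_def m_def)
    qed auto
    also have "\<dots> = (\<Sum>u\<in>levels (Suc (length v)). ennreal (m u * exit_rate Q u * pmf (K u) v))"
      using q by (intro sum.cong) (auto simp: mJ_def ennreal_mult')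
    also have "\<dots> = ennreal (\<Sum>u\<in>levels (Suc (length v)). m u * exit_rate Q u * pmf (K u) v)"
      using q by (intro sum_ennreal) simp
    also have "\<dots> = mJ v"
    proof (cases "v \<in> L")
      case True then show ?thesis by (simp add: m_exit_invariant mJ_def)
    next
      case False
      have "pmf (K u) v = 0" if "u \<in> levels (Suc (length v))" for u
        using that False targets_L[of u] K_supp[of u] by (auto simp: levels_iff set_pmf_iff)
      then show ?thesis using False by (simp add: mJ_def m_def)
    qed
    finally show ?thesis .
  qed
  have "occupation mJ (kop K f) = (\<integral>\<^sup>+u. \<integral>\<^sup>+v. mJ u * (ennreal (pmf (K u) v) * f v) \<partial>count_space UNIV \<partial>count_space UNIV)"
    unfolding occupation_def kop_def nn_integral_measure_pmf by (simp add: nn_integral_cmult)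
  also have "\<dots> = (\<integral>\<^sup>+v. \<integral>\<^sup>+u. mJ u * (ennreal (pmf (K u) v) * f v) \<partial>count_space UNIV \<partial>count_space UNIV)"
    using nn_integral_fst_count_space[of "\<lambda>(u, v). mJ u * (ennreal (pmf (K u) v) * f v)"]
      nn_integral_snd_count_space[of "\<lambda>(u, v). mJ u * (ennreal (pmf (K u) v) * f v)"] by simp
  also have "\<dots> = (\<integral>\<^sup>+v. mJ v * f v \<partial>count_space UNIV)"
    by (simp add: nn_integral_multc pt flip: mult.assoc)
  finally show ?thesis by (simp add: occupation_def)
qed

sublocale ic: invariant_chain K L mJ
proof
  fix u v f
  show "u \<in> L \<Longrightarrow> set_pmf (K u) \<subseteq> L" by (rule fb.closed)
  show "u \<in> L \<Longrightarrow> v \<in> L \<Longrightarrow> (u, v) \<in> {(x, y). x \<in> L \<and> y \<in> L \<and> 0 < pmf (K x) y}\<^sup>*" by (rule irreducible_K)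
  show "occupation mJ (kop K f) = occupation mJ f" by (rule mJ_invariant)
  show "mJ u < \<infinity>" by (simp add: mJ_def)
  show "u \<in> L \<Longrightarrow> 0 < mJ u" using m_pos[of u] rate_pos[of u] by (simp add: mJ_def)
  show "u \<notin> L \<Longrightarrow> mJ u = 0" by (simp add: mJ_def m_def)
qed

lemma occupation_levels:
  "occupation mJ f = (\<Sum>n. \<Sum>w\<in>Ln n. mJ w * f w)"
proof -
  have pt: "mJ w * f w = (\<Sum>n. mJ w * f w * indicator (Ln n) w)" for w
  proof (cases "w \<in> L")
    case True
    then have "(\<Sum>n. mJ w * f w * indicator (Ln n) w) = (\<Sum>n\<in>{length w}. mJ w * f w * indicator (Ln n) w)"
      by (intro suminf_finite) (auto simp: Ln_def)
    then show ?thesis using True by (simp add: Ln_def)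
  qed (simp add: mJ_def m_def)
  have "occupation mJ f = (\<integral>\<^sup>+w. (\<Sum>n. mJ w * f w * indicator (Ln n) w) \<partial>count_space UNIV)"
    unfolding occupation_def by (subst pt) (rule refl)
  also have "\<dots> = (\<Sum>n. \<integral>\<^sup>+w. mJ w * f w * indicator (Ln n) w \<partial>count_space UNIV)"
    by (rule nn_integral_suminf) simp
  also have "\<dots> = (\<Sum>n. \<Sum>w\<in>Ln n. mJ w * f w)"
  proof (rule suminf_cong)
    fix n
    have "(\<integral>\<^sup>+w. mJ w * f w * indicator (Ln n) w \<partial>count_space UNIV) = (\<Sum>w\<in>Ln n. mJ w * f w * indicator (Ln n) w)"
      by (rule nn_integral_count_space') auto
    then show "(\<integral>\<^sup>+w. mJ w * f w * indicator (Ln n) w \<partial>count_space UNIV) = (\<Sum>w\<in>Ln n. mJ w * f w)"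
      by simp
  qed
  finally show ?thesis .
qed

lemma occupation_le:
  assumes f: "\<And>w. 0 \<le> f w"
  shows "occupation mJ (\<lambda>w. ennreal (f w)) \<le> (\<Sum>n. ennreal ((lam + mu) * (\<rho> ^ n * En n f)))"
  unfolding occupation_levels
proof (rule suminf_le)
  fix n
  have "(\<Sum>w\<in>Ln n. mJ w * ennreal (f w)) \<le> (\<Sum>w\<in>Ln n. ennreal ((lam + mu) * (m w * f w)))"
  proof (rule sum_mono)
    fix w assume "w \<in> Ln n"
    then have w: "w \<in> L" by (simp add: Ln_def)
    have "m w * exit_rate Q w * f w \<le> m w * (lam + mu) * f w"
      using rate_le[OF w] m_nonneg[of w] f[of w] by (intro mult_right_mono mult_left_mono) auto
    then have "m w * exit_rate Q w * f w \<le> (lam + mu) * (m w * f w)" by (simp add: mult_ac)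
    moreover have "mJ w * ennreal (f w) = ennreal (m w * exit_rate Q w * f w)"
      using f[of w] by (simp add: mJ_def ennreal_mult'')
    ultimately show "mJ w * ennreal (f w) \<le> ennreal ((lam + mu) * (m w * f w))" by (simp add: ennreal_leI)
  qed
  also have "\<dots> = ennreal ((lam + mu) * (\<rho> ^ n * En n f))"
    using f m_nonneg lam_pos mu_pos by (subst sum_ennreal) (auto simp flip: sum_distrib_left simp: sum_m_Ln)
  finally show "(\<Sum>w\<in>Ln n. mJ w * ennreal (f w)) \<le> ennreal ((lam + mu) * (\<rho> ^ n * En n f))" .
qed auto

lemma recurrent_hits: "recurrent_at K u \<Longrightarrow> u \<in> L \<Longrightarrow> v \<in> L \<Longrightarrow> (\<lambda>n. avoid K u n v) \<longlonglongrightarrow> 0"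
  by (rule recurrent_hits_everywhere[of L K u v, OF fb.closed irreducible_K])

section \<open>Recurrence for \<open>\<rho>\<close> at most 1\<close>

lemma ergodic:
  assumes "\<rho> < 1"
  shows "ergodic L Q"
proof -
  have "occupation mJ (\<lambda>_. ennreal 1) \<le> (\<Sum>n. ennreal ((lam + mu) * (\<rho> ^ n * En n (\<lambda>_. 1))))" by (rule occupation_le) simp
  also have "\<dots> = (\<Sum>n. ennreal ((lam + mu) * \<rho> ^ n))" by (simp add: En_const)
  also have "\<dots> = ennreal (\<Sum>n. (lam + mu) * \<rho> ^ n)"
    using assms rho_pos lam_pos mu_pos by (intro suminf_ennreal2) (auto intro!: summable_mult summable_geometric)
  also have "\<dots> < \<infinity>" by simp
  finally have fin: "occupation mJ (\<lambda>_. 1) < \<infinity>" by simp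
  show ?thesis unfolding ergodic_def
    using irreducible ic.finite_mass_imp_recurrent[OF _ fin] ic.finite_mass_imp_finite_return[OF _ fin] recurrent_hits
    by (auto intro!: fb.positive_recurrent_stateI)
qed

text \<open>One step of the walk may change \<open>len\<close> in a way that depends on the word.
  Averaged over \<open>j\<close> steps, the change telescopes to
  \<open>((Aop ^^ j) len w - len w) / j\<close>, which is at most \<open>a j / j\<close> at every
  word, while \<open>V j\<close> stays within \<open>j\<close> of \<open>len\<close>.\<close>

definition V :: "nat \<Rightarrow> 'a list \<Rightarrow> real" where "V j w = (\<Sum>i<j. (Aop ^^ i) len w) / j"

lemma V_nonneg: "0 \<le> V j w"
  unfolding V_def Aop_pow by (auto intro!: divide_nonneg_nonneg sum_nonneg Ex_nonneg simp: len_def)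

lemma V_bounds:
  assumes "1 \<le> j"
  shows "len w - j \<le> V j w" "V j w \<le> len w + j"
proof -
  have "(\<Sum>i<j. len w - j) \<le> (\<Sum>i<j. (Aop ^^ i) len w)"
  proof (rule sum_mono)
    fix i assume "i \<in> {..<j}"
    then have "len w - j \<le> len w - i" by simp
    also have "\<dots> \<le> (Aop ^^ i) len w" by (rule Aop_pow_len_bounds)
    finally show "len w - j \<le> (Aop ^^ i) len w" .
  qed
  then show "len w - j \<le> V j w" using assms by (simp add: V_def le_divide_eq mult.commute)
  have "(\<Sum>i<j. (Aop ^^ i) len w) \<le> (\<Sum>i<j. len w + j)"
  proof (rule sum_mono)
    fix i assume "i \<in> {..<j}"
    then have "len w + i \<le> len w + j" by simp
    with Aop_pow_len_bounds(2)[of i w] show "(Aop ^^ i) len w \<le> len w + j" by linarith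
  qed
  then show "V j w \<le> len w + j" using assms by (simp add: V_def divide_le_eq mult.commute)
qed

lemma Aop_V: assumes j: "1 \<le> j" and w: "w \<in> L" shows "Aop (V j) w - V j w \<le> a j / j"
proof -
  have "Aop (V j) w = (\<Sum>i<j. (Aop ^^ Suc i) len w) / j"
    unfolding V_def[abs_def] Aop_def[of "\<lambda>w. (\<Sum>i<j. (Aop ^^ i) len w) / j"]
    by (simp add: Aop_def[of "(Aop ^^ _) len" w] sum_divide_distrib sum_distrib_left sum.swap[of _ Sig])
  then have "Aop (V j) w - V j w = ((\<Sum>i<j. (Aop ^^ Suc i) len w) - (\<Sum>i<j. (Aop ^^ i) len w)) / j"
    by (simp add: V_def diff_divide_distrib)
  also have "\<dots> = ((Aop ^^ j) len w - len w) / j"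
    by (simp add: sum_subtractf[symmetric] sum_lessThan_telescope[of "\<lambda>i. (Aop ^^ i) len w"] del: funpow.simps(2))
  also have "\<dots> \<le> a j / j" using Aop_pow_len_le[OF w, of j] by (intro divide_right_mono) auto
  finally show ?thesis .
qed

text \<open>Fewer than \<open>j\<close> pushes cannot reach the last letter of a word longer than
  \<open>j\<close>, so a service lowers each of the averaged means by exactly 1.\<close>

lemma V_butlast:
  assumes j: "1 \<le> j" and w: "j < length w"
  shows "V j (butlast w) = V j w - 1"
proof -
  have "(Aop ^^ i) len w = (Aop ^^ i) len (butlast w) + 1" if i: "i < j" for i
  proof -
    have w': "w = butlast w @ [last w]" using w by (intro append_butlast_last_id[symmetric]) auto
    have le: "i \<le> length (butlast w)" using w i by simp
    have e: "len (foldr push bs w) = len (foldr push bs (butlast w)) + 1" if bs: "length bs = i" for bs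
    proof -
      have "foldr push bs w = foldr push bs (butlast w) @ [last w]"
        using pushes_append_suffix[of bs "butlast w" "[last w]"] le bs w' by simp
      then show ?thesis by (simp add: len_def)
    qed
    have "Ex i (\<lambda>bs. len (foldr push bs w)) = Ex i (\<lambda>bs. len (foldr push bs (butlast w)) + 1)"
      by (intro antisym Ex_mono) (auto simp: e)
    then show ?thesis unfolding Aop_pow by (simp add: Ex_add)
  qed
  then have "V j w = (\<Sum>i<j. (Aop ^^ i) len (butlast w) + 1) / j" unfolding V_def by simp
  also have "\<dots> = V j (butlast w) + 1" using j by (simp add: V_def sum.distrib add_divide_distrib)
  finally show ?thesis by simp
qed

text \<open>At \<open>\<rho> = 1\<close> each length has mass at most \<open>lam + mu\<close>, so
  the mass of a ball is linear in its radius. This offsets the factor \<open>1 / M\<close> in the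
  slope of the cut-off function.\<close>

lemma occupation_ball:
  assumes \<rho>: "\<rho> = 1" and c: "0 \<le> c"
  shows "occupation mJ (\<lambda>w. ennreal (c * of_bool (length w \<le> M))) \<le> ennreal ((lam + mu) * c * (real M + 1))"
proof -
  have "En n (\<lambda>w. c * of_bool (length w \<le> M)) = c * of_bool (n \<le> M)" for n
    using En_cong[of n "\<lambda>w. c * of_bool (length w \<le> M)" "\<lambda>_. c * of_bool (n \<le> M)"] by (simp add: En_const)
  then have "occupation mJ (\<lambda>w. ennreal (c * of_bool (length w \<le> M))) \<le> (\<Sum>n. ennreal ((lam + mu) * (c * of_bool (n \<le> M))))"
    using occupation_le[of "\<lambda>w. c * of_bool (length w \<le> M)"] c unfolding \<rho> by simp
  also have "\<dots> = (\<Sum>n\<in>{..M}. ennreal ((lam + mu) * (c * of_bool (n \<le> M))))" by (rule suminf_finite) auto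
  also have "\<dots> = ennreal (\<Sum>n\<in>{..M}. (lam + mu) * c)"
    using c lam_pos mu_pos by (subst sum_ennreal[symmetric]) (auto intro!: sum.cong)
  finally show ?thesis by (simp add: algebra_simps)
qed

text \<open>The function \<open>1 - V j / N\<close>, cut off at 0, is almost superharmonic: the averaging over \<open>j\<close> steps
  makes the upward drift of \<open>V j\<close> close to the drift of the random walk.\<close>

lemma cutoff_generator:
  assumes j: "1 \<le> j" and N: "0 < M" and e: "lam * (a j / j) \<le> mu + \<epsilon>" "0 \<le> \<epsilon>" and u: "u \<in> L"
  defines "f \<equiv> \<lambda>w. max 0 (1 - V j w / M)"
  shows "drv (\<lambda>_. 1) u * f u - drv f u \<le> (\<epsilon> / M) * of_bool (len u \<le> M + j) + ((lam + 2 * mu) * (1 + 2 * real j) / M) * of_bool (length u \<le> j)"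
proof -
  let ?g = "\<lambda>w. 1 - V j w / M"
  have R: "0 \<le> (\<epsilon> / M) * of_bool (len u \<le> M + j) + ((lam + 2 * mu) * (1 + 2 * real j) / M) * of_bool (length u \<le> j)"
    using N e lam_pos mu_pos by (intro add_nonneg_nonneg mult_nonneg_nonneg divide_nonneg_nonneg) auto
  have f0: "0 \<le> f w" and fg: "?g w \<le> f w" for w by (simp_all add: f_def)
  show ?thesis
  proof (cases "?g u \<le> 0")
    case True
    then have "f u = 0" by (simp add: f_def)
    moreover have "0 \<le> drv f u" using drv_mono[of u "\<lambda>_. 0" f] f0 by simp
    ultimately show ?thesis using R by simp
  next
    case False
    then have fu: "f u = ?g u" and Vu: "V j u < M" using N by (auto simp: f_def field_simps)
    have len: "len u \<le> M + j" using V_bounds(1)[OF j, of u] Vu by linarith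
    have "drv (\<lambda>_. 1) u * f u - drv f u \<le> drv (\<lambda>_. 1) u * ?g u - drv ?g u"
      unfolding fu using drv_mono[of u ?g f] fg by simp
    also have "\<dots> = (drv (V j) u - drv (\<lambda>_. 1) u * V j u) / M"
    proof -
      have "drv ?g u = drv (\<lambda>_. 1) u - drv (\<lambda>w. (1 / M) * V j w) u" unfolding drv_diff[symmetric] by simp
      also have "\<dots> = drv (\<lambda>_. 1) u - (1 / M) * drv (V j) u" by (simp only: drv_cmult)
      finally show ?thesis using N by (simp add: field_simps)
    qed
    \<comment> \<open>On words longer than \<open>j\<close> averaged arrivals and service nearly
      balance and leave \<open>\<epsilon>\<close>. On shorter words \<open>V_butlast\<close> does
      not apply, but a crude bound of order \<open>j\<close> is enough, as there are finitely many
      of them.\<close>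
    also have "\<dots> \<le> \<epsilon> / M + ((lam + 2 * mu) * (1 + 2 * real j) / M) * of_bool (length u \<le> j)"
    proof (cases "length u \<le> j")
      case False
      then have ne: "u \<noteq> []" by auto
      have "drv (V j) u - drv (\<lambda>_. 1) u * V j u = lam * (Aop (V j) u - V j u) + mu * (V j (butlast u) - V j u)"
        using ne unfolding drv_one by (simp add: drv_def arr_def srv_def algebra_simps)
      also have "\<dots> \<le> lam * (a j / j) + mu * (- 1)"
        using Aop_V[OF j u] lam_pos mu_pos V_butlast[OF j, of u] False by (intro add_mono mult_left_mono) auto
      also have "\<dots> \<le> \<epsilon>" using e by simp
      finally show ?thesis using N False by (simp add: divide_right_mono)
    next
      case True
      have b: "V j w \<le> 1 + 2 * real j" if w: "w \<in> targets u" for w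
      proof -
        have "length w \<le> Suc (length u)" using w length_push_le[of _ u] by (auto simp: targets_def split: if_splits)
        then have "len w \<le> 1 + j" using True by (simp add: len_def)
        then show ?thesis using V_bounds(2)[OF j, of w] by linarith
      qed
      have "drv (V j) u \<le> drv (\<lambda>_. (1 + 2 * real j) * 1) u" by (rule drv_mono) (use b in simp)
      also have "\<dots> = (1 + 2 * real j) * drv (\<lambda>_. 1) u" by (rule drv_cmult)
      also have "\<dots> \<le> (1 + 2 * real j) * (lam + 2 * mu)"
      proof (rule mult_left_mono)
        have "lam * A \<le> lam" using lam_pos A_le_1 by simp
        then show "drv (\<lambda>_. 1) u \<le> lam + 2 * mu" using mu_pos by (simp add: drv_one)
      qed simp
      finally have "drv (V j) u \<le> (lam + 2 * mu) * (1 + 2 * real j)" by (simp add: mult.commute)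
      moreover have "0 \<le> drv (\<lambda>_. 1) u * V j u"
        using V_nonneg lam_pos mu_pos A_pos by (simp add: drv_one)
      ultimately have "drv (V j) u - drv (\<lambda>_. 1) u * V j u \<le> \<epsilon> + (lam + 2 * mu) * (1 + 2 * real j)" using e by simp
      then have "(drv (V j) u - drv (\<lambda>_. 1) u * V j u) / M \<le> (\<epsilon> + (lam + 2 * mu) * (1 + 2 * real j)) / M"
        using N by (intro divide_right_mono) auto
      then show ?thesis using True by (simp add: add_divide_distrib)
    qed
    finally show ?thesis using len by simp
  qed
qed

lemma critical_recurrent:
  assumes \<rho>: "\<rho> = 1" and lim: "(\<lambda>n. a n / n) \<longlonglongrightarrow> \<gamma>" and x: "x \<in> L"
  shows "recurrent_at K x"
proof (rule ic.lyapunov_recurrent[OF x])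
  fix \<epsilon> :: real assume \<epsilon>: "0 < \<epsilon>"
  define c0 where "c0 = min mu (lam * A)"
  \<comment> \<open>\<open>c0\<close> turns a defect of the generator into one of the jump chain. A
    defect of \<open>\<epsilon>1 / (M * c0)\<close> on a ball of mass at most
    \<open>(lam + mu) * 2 * M\<close> then amounts to at most \<open>\<epsilon> / 2\<close>.\<close>
  define \<epsilon>1 where "\<epsilon>1 = \<epsilon> * c0 / (4 * (lam + mu))"
  have c0: "0 < c0" using c0_pos by (simp add: c0_def)
  have \<epsilon>1: "0 < \<epsilon>1" using \<epsilon> c0 lam_pos mu_pos by (simp add: \<epsilon>1_def)
  have crit: "lam * \<gamma> = mu" by (rule drift_critical[OF lim \<rho>])
  have "(\<lambda>n. lam * (a n / n)) \<longlonglongrightarrow> lam * \<gamma>" by (intro tendsto_intros lim)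
  then have "\<forall>\<^sub>F n in sequentially. lam * (a n / n) < mu + \<epsilon>1" using crit \<epsilon>1 by (intro order_tendstoD(2)) auto
  then have "\<forall>\<^sub>F n in sequentially. lam * (a n / n) < mu + \<epsilon>1 \<and> 1 \<le> n" using eventually_ge_at_top[of 1] by eventually_elim simp
  then obtain j where j: "lam * (a j / j) < mu + \<epsilon>1" "1 \<le> j" unfolding eventually_sequentially by blast
  define C1 where "C1 = (lam + 2 * mu) * (1 + 2 * real j)"
  have C1: "0 \<le> C1" using lam_pos mu_pos by (simp add: C1_def)
  \<comment> \<open>The summands make the cut-off function at least 1/2 at \<open>x\<close>, bound
    \<open>M + j + 1\<close> by \<open>2 * M\<close>, and push the defect on words of length at most
    \<open>j\<close> below \<open>\<epsilon> / 2\<close>.\<close>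
  obtain M :: nat where M: "2 * (len x + real j) + real j + 1 + 2 * (lam + mu) * C1 * (real j + 1) / (c0 * \<epsilon>) < real M"
    using reals_Archimedean2 by blast
  have t0: "0 \<le> 2 * (lam + mu) * C1 * (real j + 1) / (c0 * \<epsilon>)" using C1 lam_pos mu_pos c0 \<epsilon> by simp
  have M0: "0 < real M" "real j + 1 \<le> real M" "2 * (len x + real j) \<le> real M" and M1: "2 * (lam + mu) * C1 * (real j + 1) / (c0 * \<epsilon>) \<le> real M"
    using M t0 by (auto simp: len_def)
  let ?f = "\<lambda>w. max 0 (1 - V j w / real M)"
  let ?\<psi>1 = "\<lambda>w. (\<epsilon>1 / (M * c0)) * of_bool (length w \<le> M + j)"
  let ?\<psi>2 = "\<lambda>w. (C1 / (M * c0)) * of_bool (length w \<le> j)"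
  have p1: "0 \<le> \<epsilon>1 / (M * c0)" and p2: "0 \<le> C1 / (M * c0)" using \<epsilon>1 C1 c0 by auto
  have step: "ennreal (?f u) \<le> kop K (\<lambda>w. ennreal (?f w)) u + (ennreal (?\<psi>1 u) + ennreal (?\<psi>2 u))" if u: "u \<in> L" for u
  proof -
    have q: "c0 \<le> exit_rate Q u" using rate_ge[OF u] by (simp add: c0_def)
    have "exit_rate Q u * (?f u - fb.jump_mean ?f u) = drv (\<lambda>_. 1) u * ?f u - drv ?f u"
      using generator_jump_mean[OF u, of ?f] by (simp add: algebra_simps)
    also have "\<dots> \<le> (\<epsilon>1 / M) * of_bool (len u \<le> real M + j) + ((lam + 2 * mu) * (1 + 2 * real j) / M) * of_bool (length u \<le> j)"
      by (rule cutoff_generator[OF j(2) M0(1) less_imp_le[OF j(1)] less_imp_le[OF \<epsilon>1] u])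
    also have "\<dots> = c0 * (?\<psi>1 u + ?\<psi>2 u)" using c0 by (simp add: len_def C1_def distrib_left flip: of_nat_add)
    also have "\<dots> \<le> exit_rate Q u * (?\<psi>1 u + ?\<psi>2 u)"
      using q p1 p2 by (intro mult_right_mono add_nonneg_nonneg mult_nonneg_nonneg) auto
    finally have "?f u - fb.jump_mean ?f u \<le> ?\<psi>1 u + ?\<psi>2 u" using rate_pos[OF u] by simp
    then have "ennreal (?f u) \<le> ennreal (fb.jump_mean ?f u + (?\<psi>1 u + ?\<psi>2 u))" by (intro ennreal_leI) linarith
    also have "\<dots> = ennreal (fb.jump_mean ?f u) + (ennreal (?\<psi>1 u) + ennreal (?\<psi>2 u))"
    proof -
      have "0 \<le> fb.jump_mean ?f u" unfolding fb.jump_mean_def by (intro sum_nonneg mult_nonneg_nonneg) auto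
      moreover have "0 \<le> ?\<psi>1 u" "0 \<le> ?\<psi>2 u" using p1 p2 by auto
      ultimately show ?thesis by (simp only: ennreal_plus add_nonneg_nonneg)
    qed
    finally show ?thesis by (simp only: fb.kop_ennreal[OF u] max.cobounded1)
  qed
  have fx: "1 / 2 \<le> ?f x"
  proof -
    have "2 * V j x \<le> 2 * (len x + real j)" using V_bounds(2)[OF j(2), of x] by simp
    also have "\<dots> \<le> real M" by (rule M0(3))
    finally have "V j x / real M \<le> 1 / 2" using M0 by (simp add: field_simps)
    then have "1 / 2 \<le> 1 - V j x / real M" by simp
    also have "\<dots> \<le> ?f x" by (rule max.cobounded2)
    finally show ?thesis .
  qed
  have occf: "occupation mJ (\<lambda>w. ennreal (?f w)) < \<infinity>"
  proof -
    have "?f w \<le> 1 * of_bool (length w \<le> M + j)" for w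
    proof (cases "length w \<le> M + j")
      case True then show ?thesis using V_nonneg M0 by simp
    next
      case False
      then have "real M \<le> V j w" using V_bounds(1)[OF j(2), of w] by (simp add: len_def)
      then show ?thesis using M0 by simp
    qed
    then have "occupation mJ (\<lambda>w. ennreal (?f w)) \<le> occupation mJ (\<lambda>w. ennreal (1 * of_bool (length w \<le> M + j)))"
      by (intro occupation_mono ennreal_leI)
    also have "\<dots> \<le> ennreal ((lam + mu) * 1 * (real (M + j) + 1))" by (rule occupation_ball[OF \<rho>]) simp
    also have "\<dots> < \<infinity>" by simp
    finally show ?thesis .
  qed
  have occ\<psi>: "occupation mJ (\<lambda>w. ennreal (?\<psi>1 w) + ennreal (?\<psi>2 w)) \<le> ennreal \<epsilon>"
  proof -
    have "occupation mJ (\<lambda>w. ennreal (?\<psi>1 w) + ennreal (?\<psi>2 w)) \<le>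
        ennreal ((lam + mu) * (\<epsilon>1 / (M * c0)) * (real (M + j) + 1)) + ennreal ((lam + mu) * (C1 / (M * c0)) * (real j + 1))"
      unfolding occupation_add by (intro add_mono occupation_ball[OF \<rho>] p1 p2)
    also have "\<dots> = ennreal ((lam + mu) * (\<epsilon>1 / (M * c0)) * (real (M + j) + 1) + (lam + mu) * (C1 / (M * c0)) * (real j + 1))"
      using p1 p2 lam_pos mu_pos by (intro ennreal_plus[symmetric] mult_nonneg_nonneg) auto
    also have "\<dots> \<le> ennreal \<epsilon>"
    proof (rule ennreal_leI)
      have "(lam + mu) * (\<epsilon>1 / (M * c0)) * (real (M + j) + 1) \<le> (lam + mu) * (\<epsilon>1 / (M * c0)) * (2 * real M)"
      proof (rule mult_left_mono)
        show "0 \<le> (lam + mu) * (\<epsilon>1 / (M * c0))" using p1 lam_pos mu_pos by (intro mult_nonneg_nonneg) auto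
      qed (use M0 in simp)
      also have "\<dots> = \<epsilon> / 2" using M0 c0 lam_pos mu_pos by (simp add: \<epsilon>1_def add_pos_pos divide_simps)
      finally have 1: "(lam + mu) * (\<epsilon>1 / (M * c0)) * (real (M + j) + 1) \<le> \<epsilon> / 2" .
      have "2 * (lam + mu) * C1 * (real j + 1) \<le> real M * (c0 * \<epsilon>)" using M1 c0 \<epsilon> by (simp add: divide_le_eq)
      then have "2 * (lam + mu) * C1 * (real j + 1) / (M * c0) / 2 \<le> real M * (c0 * \<epsilon>) / (M * c0) / 2"
        using M0 c0 by (intro divide_right_mono) auto
      moreover have "real M * (c0 * \<epsilon>) / (M * c0) / 2 = \<epsilon> / 2" using M0 c0 by simp
      moreover have "2 * s * y * z / w / 2 = s * (y / w) * z" for s y z w :: real by simp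
      note this[of "lam + mu" C1 "real j + 1" "M * c0"]
      ultimately have "(lam + mu) * (C1 / (M * c0)) * (real j + 1) \<le> \<epsilon> / 2" by linarith
      with 1 show "(lam + mu) * (\<epsilon>1 / (M * c0)) * (real (M + j) + 1) + (lam + mu) * (C1 / (M * c0)) * (real j + 1) \<le> \<epsilon>" by linarith
    qed
    finally show ?thesis .
  qed
  have "1 / 2 \<le> ennreal (?f x)"
    using ennreal_leI[OF fx] divide_ennreal[of 1 2] by simp
  then show "\<exists>f \<psi>. (\<forall>u\<in>L. f u \<le> kop K f u + \<psi> u) \<and> 1 / 2 \<le> f x \<and> f x < \<infinity> \<and> occupation mJ f < \<infinity> \<and> occupation mJ \<psi> \<le> ennreal \<epsilon>"
    using step occf occ\<psi> by (intro exI[of _ "\<lambda>w. ennreal (?f w)"] exI[of _ "\<lambda>w. ennreal (?\<psi>1 w) + ennreal (?\<psi>2 w)"]) auto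
qed

lemma null_recurrent:
  assumes \<rho>: "\<rho> = 1" and lim: "(\<lambda>n. a n / n) \<longlonglongrightarrow> \<gamma>"
  shows "null_recurrent L Q"
  unfolding null_recurrent_def
proof (intro conjI irreducible ballI)
  fix u assume u: "u \<in> L"
  have rec: "recurrent_at K u" by (rule critical_recurrent[OF \<rho> lim u])
  have "(\<Sum>n. avoid K u n u) = \<infinity>"
  proof (rule ic.infinite_mass_imp_infinite_return[OF rec u])
    fix C' :: real
    \<comment> \<open>At \<open>\<rho> = 1\<close> the words of length at most \<open>M\<close> have
      total weight \<open>M + 1\<close>, and exit rates are at least
      \<open>min mu (lam * A)\<close>.\<close>
    obtain M :: nat where M: "C' / min mu (lam * A) + m u < real M" using reals_Archimedean2 by blast
    have "C' \<le> min mu (lam * A) * (real M - m u)" using M c0_pos by (simp add: divide_less_eq field_simps less_imp_le)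
    also have "\<dots> \<le> min mu (lam * A) * (\<Sum>w\<in>levels M - {u}. m w)"
    proof (rule mult_left_mono)
      have "(\<Sum>w\<in>levels M. m w * 1) = real M + 1" unfolding sum_m_levels by (simp add: \<rho> En_const)
      then show "real M - m u \<le> (\<Sum>w\<in>levels M - {u}. m w)" using m_nonneg[of u] by (simp add: sum_diff1)
    qed (use c0_pos in simp)
    also have "\<dots> \<le> (\<Sum>w\<in>levels M - {u}. m w * exit_rate Q w)"
      unfolding sum_distrib_left mult.commute[of "m _"] using rate_ge m_nonneg by (intro sum_mono mult_right_mono) (auto simp: levels_iff)
    finally have "ennreal C' \<le> ennreal (\<Sum>w\<in>levels M - {u}. m w * exit_rate Q w)" by (rule ennreal_leI)
    also have "\<dots> = (\<Sum>w\<in>levels M - {u}. mJ w)"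
      unfolding mJ_def using m_nonneg rate_pos by (intro sum_ennreal[symmetric] mult_nonneg_nonneg) (auto simp: levels_iff less_imp_le)
    finally show "\<exists>B. finite B \<and> B \<subseteq> L - {u} \<and> ennreal C' \<le> (\<Sum>w\<in>B. mJ w)"
      by (intro exI[of _ "levels M - {u}"]) (auto simp: levels_iff)
  qed
  then show "null_recurrent_state Q u" using recurrent_hits[OF rec u] by (intro fb.null_recurrent_stateI u)
qed

section \<open>Hitting probabilities and transience\<close>

definition hit :: "nat \<Rightarrow> 'a list \<Rightarrow> real" where
  "hit k u = (if u = [] then 1 else 1 - enn2real (avoid K [] k u))"

lemma avoid_real: "ennreal (enn2real (avoid K v k u)) = avoid K v k u" "enn2real (avoid K v k u) \<le> 1"
proof -
  have 1: "avoid K v k u \<le> 1" by (rule avoid_le_1)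
  then show "ennreal (enn2real (avoid K v k u)) = avoid K v k u"
    by (metis ennreal_enn2real ennreal_one_less_top le_less_trans)
  show "enn2real (avoid K v k u) \<le> 1" using enn2real_leI[of 1 "avoid K v k u"] 1 by simp
qed

lemma hit_bounds: "0 \<le> hit k u" "hit k u \<le> 1"
  using avoid_real(2)[of "[]" k u] by (auto simp: hit_def)

lemma jump_mean_hit:
  assumes u: "u \<in> L"
  shows "fb.jump_mean (hit k) u = 1 - enn2real (avoid K [] (Suc k) u)"
proof -
  have "avoid K [] (Suc k) u = kop K (\<lambda>v. ennreal (1 - hit k v)) u"
    unfolding avoid_Suc taboo_def by (rule kop_cong) (simp add: hit_def avoid_real)
  also have "\<dots> = ennreal (fb.jump_mean (\<lambda>v. 1 - hit k v) u)"
    by (rule fb.kop_ennreal[OF u]) (simp add: hit_bounds)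
  finally have "enn2real (avoid K [] (Suc k) u) = fb.jump_mean (\<lambda>v. 1 - hit k v) u"
    unfolding fb.jump_mean_def using hit_bounds by (simp add: sum_nonneg)
  also have "\<dots> = 1 - fb.jump_mean (hit k) u"
    unfolding fb.jump_mean_def using sum_pmf_eq_1[OF fb.finite_succ[OF u] order_refl]
    by (simp add: right_diff_distrib sum_subtractf)
  finally show ?thesis by simp
qed

text \<open>One more jump can only help to reach the empty word, and at a nonempty word
  \<open>hit (Suc k)\<close> is the mean of \<open>hit k\<close> after a jump.\<close>

lemma hit_subharmonic:
  assumes u: "u \<in> L" "u \<noteq> []"
  shows "0 \<le> lam * (Aop (hit k) u - hit k u) + mu * (hit k (butlast u) - hit k u)"
proof -
  have "avoid K [] (Suc k) u \<le> avoid K [] k u" by (rule avoid_decseq)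
  then have "enn2real (avoid K [] (Suc k) u) \<le> enn2real (avoid K [] k u)"
    using avoid_le_1[of K "[]" k u] by (intro enn2real_mono) (auto simp: le_less_trans)
  then have "hit k u \<le> fb.jump_mean (hit k) u" using u by (simp add: jump_mean_hit hit_def)
  then have "0 \<le> exit_rate Q u * (fb.jump_mean (hit k) u - hit k u)" using rate_pos[OF u(1)] by simp
  then show ?thesis unfolding generator_jump_mean[OF u(1)] drv_one
    using u by (simp add: drv_def arr_def srv_def algebra_simps)
qed

text \<open>A jump removes at most one letter. This is the purpose of the finite horizon: prefixes
  longer than \<open>k\<close> contribute nothing, so a sum over prefixes may stop at
  \<open>k\<close>.\<close>

lemma hit_zero: "u \<in> L \<Longrightarrow> k < length u \<Longrightarrow> hit k u = 0"
proof -
  have "avoid K [] k u = 1" if "u \<in> L" "k < length u" for u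
    using that
  proof (induction k arbitrary: u)
    case (Suc k)
    have "avoid K [] (Suc k) u = kop K (\<lambda>_. 1) u"
      unfolding avoid_Suc taboo_def
    proof (rule kop_cong)
      fix v assume "v \<in> set_pmf (K u)"
      then have v: "v \<in> L" "k < length v" using K_supp[OF Suc.prems(1)] targets_L[OF Suc.prems(1)] length_targets[of v u] Suc.prems(2) by auto
      then show "(if v = [] then 0 else avoid K [] k v) = 1" using Suc.IH by auto
    qed
    then show ?case by simp
  qed simp
  then show "u \<in> L \<Longrightarrow> k < length u \<Longrightarrow> hit k u = 0" by (auto simp: hit_def)
qed

text \<open>A push acts at the head, so it commutes with taking a nonempty prefix, up to the change
  of length.\<close>

lemma take_push:
  assumes w: "n < length w" and n: "1 \<le> n"
  shows "push b (take n w) = take (length (push b w) + n - length w) (push b w)"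
proof -
  have ne: "take n w \<noteq> []" using w n by auto
  have eq: "push b w = push b (take n w) @ drop n w" using push_append[OF ne, of b "drop n w"] by simp
  have l: "length (push b w) + n - length w = length (push b (take n w))" using w unfolding eq by simp
  show ?thesis unfolding l unfolding eq by simp
qed

text \<open>Summing the subharmonicity of \<open>hit k\<close> over the prefixes of a long word \<open>w\<close> telescopes the service
  terms. Pushing a letter shifts the prefixes by the change of length of \<open>w\<close>, and if \<open>hit k\<close> is close to 1
  on letters this shift changes the sum by about the same amount. So the mean increase of the length is
  bounded by the service rate, up to a telescoping error in \<open>H k\<close>.\<close>

definition H :: "nat \<Rightarrow> 'a list \<Rightarrow> real" where "H k w = (\<Sum>n\<in>{1..k}. hit k (take n w))"

lemma H_bounds: "0 \<le> H k w" "H k w \<le> k"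
  using sum_bounded_above[of "{1..k}" "\<lambda>n. hit k (take n w)" 1] hit_bounds by (auto simp: H_def intro!: sum_nonneg)

lemma H_push:
  assumes w: "w \<in> L" "Suc k < length w" and b: "b \<in> Sig" and \<eta>: "\<And>x. x \<in> Sig \<Longrightarrow> 1 - \<eta> \<le> hit k [x]" "0 \<le> \<eta>"
  shows "(\<Sum>n\<in>{1..k}. hit k (push b (take n w))) \<le> H k (push b w) - (len (push b w) - len w) + \<eta>"
proof -
  let ?p = "push b w"
  have pL: "?p \<in> L" by (rule push_L[OF b w(1)])
  have e: "(\<Sum>n\<in>{1..k}. hit k (push b (take n w))) = (\<Sum>n\<in>{1..k}. hit k (take (length ?p + n - length w) ?p))"
    using w by (intro sum.cong) (auto simp: take_push)
  have sh: "(\<Sum>n\<in>{1..k}. F (Suc n)) = (\<Sum>n\<in>{1..k}. F n) - F 1 + F (Suc k)" if "1 \<le> k" for F :: "nat \<Rightarrow> real"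
    using that by (induction k rule: dec_induct) auto
  consider "length ?p = length w" | "length ?p = Suc (length w)" | "Suc (length ?p) = length w"
    using length_push_le[of b w] length_push_ge[of w b] by linarith
  then show ?thesis
  proof cases
    case 1
    then show ?thesis unfolding e using \<eta>(2) by (simp add: H_def len_def)
  next
    case 2
    show ?thesis
    proof (cases "1 \<le> k")
      case True
      have "(\<Sum>n\<in>{1..k}. hit k (take (length ?p + n - length w) ?p)) = (\<Sum>n\<in>{1..k}. hit k (take (Suc n) ?p))"
        using 2 by simp
      \<comment> \<open>The shifted sum loses the term of a single letter, which is at least
        \<open>1 - \<eta>\<close>, and gains the term at \<open>Suc k\<close>, which vanishes by
        \<open>hit_zero\<close>.\<close>
      also have "\<dots> = H k ?p - hit k (take 1 ?p) + hit k (take (Suc k) ?p)"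
        unfolding H_def by (rule sh[OF True])
      finally have "(\<Sum>n\<in>{1..k}. hit k (take (length ?p + n - length w) ?p)) = H k ?p - hit k (take 1 ?p) + hit k (take (Suc k) ?p)" .
      moreover have "hit k (take (Suc k) ?p) = 0" using 2 w L_take[OF pL] by (intro hit_zero) auto
      moreover have "1 - \<eta> \<le> hit k (take 1 ?p)"
        using pL 2 \<eta>(1) by (cases ?p) (auto simp: L_Cons)
      moreover have "len ?p - len w = 1" using 2 by (simp add: len_def)
      ultimately show ?thesis unfolding e by linarith
    next
      case False
      \<comment> \<open>For \<open>k = 0\<close> nonempty words have no time to empty, so the
        hypothesis forces \<open>1 \<le> \<eta>\<close>.\<close>
      have "hit k w' = 0" if "w' \<in> L" "w' \<noteq> []" for w' using False hit_zero[of w' k] that by (cases w') auto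
      then have "1 \<le> \<eta>" using \<eta>(1)[OF b] b by fastforce
      then show ?thesis using False 2 by (simp add: H_def len_def)
    qed
  next
    case 3
    \<comment> \<open>The sum now begins with the empty word, where \<open>hit k\<close> is 1; this
      gain matches the letter that was lost.\<close>
    have "(\<Sum>n\<in>{1..k}. hit k (take (length ?p + n - length w) ?p)) = (\<Sum>n\<in>{1..k}. hit k (take (n - 1) ?p))"
      using 3 by (intro sum.cong refl arg_cong[where f="\<lambda>i. hit k (take i ?p)"]) auto
    also have "\<dots> \<le> H k ?p + 1"
    proof (cases "1 \<le> k")
      case True
      from sh[OF True, of "\<lambda>n. hit k (take (n - 1) ?p)"] show ?thesis
        using hit_bounds(1)[of k "take k ?p"] by (simp add: H_def hit_def[of k "[]"])
    qed (use H_bounds(1)[of k ?p] in auto)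
    finally show ?thesis unfolding e using 3 \<eta>(2) by (simp add: len_def)
  qed
qed

lemma Aop_len_H:
  assumes w: "w \<in> L" "Suc k < length w" and \<eta>: "\<And>x. x \<in> Sig \<Longrightarrow> 1 - \<eta> \<le> hit k [x]" "0 \<le> \<eta>"
  shows "lam * (Aop len w - len w) \<le> mu + lam * \<eta> + lam * (Aop (H k) w - H k w)"
proof -
  have "(\<Sum>n\<in>{1..i}. F (n - 1) - F n) = F 0 - F i" for F :: "nat \<Rightarrow> real" and i
    by (induction i) auto
  from this[of "\<lambda>n. hit k (take n w)" k]
  have tele: "(\<Sum>n\<in>{1..k}. hit k (take (n - 1) w) - hit k (take n w)) = hit k [] - hit k (take k w)" by simp
  have "0 \<le> (\<Sum>n\<in>{1..k}. lam * (Aop (hit k) (take n w) - hit k (take n w)) + mu * (hit k (butlast (take n w)) - hit k (take n w)))"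
    using w by (intro sum_nonneg hit_subharmonic L_take) auto
  also have "\<dots> = lam * ((\<Sum>n\<in>{1..k}. Aop (hit k) (take n w)) - H k w) + mu * (\<Sum>n\<in>{1..k}. hit k (butlast (take n w)) - hit k (take n w))"
    unfolding H_def by (simp only: sum.distrib sum_subtractf sum_distrib_left[symmetric])
  also have "(\<Sum>n\<in>{1..k}. hit k (butlast (take n w)) - hit k (take n w)) = hit k [] - hit k (take k w)"
    unfolding tele[symmetric] using w by (intro sum.cong) (auto simp: butlast_take)
  also have "(\<Sum>n\<in>{1..k}. Aop (hit k) (take n w)) = (\<Sum>b\<in>Sig. pmf \<nu> b * (\<Sum>n\<in>{1..k}. hit k (push b (take n w))))"
    unfolding Aop_def sum_distrib_left by (rule sum.swap)
  finally have 1: "0 \<le> lam * ((\<Sum>b\<in>Sig. pmf \<nu> b * (\<Sum>n\<in>{1..k}. hit k (push b (take n w)))) - H k w) + mu * (hit k [] - hit k (take k w))" .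
  have "(\<Sum>b\<in>Sig. pmf \<nu> b * (\<Sum>n\<in>{1..k}. hit k (push b (take n w)))) \<le>
      (\<Sum>b\<in>Sig. pmf \<nu> b * (H k (push b w) - (len (push b w) - len w) + \<eta>))"
    by (intro sum_mono mult_left_mono H_push w \<eta>) auto
  also have "\<dots> = (\<Sum>b\<in>Sig. pmf \<nu> b * H k (push b w) - pmf \<nu> b * len (push b w) + pmf \<nu> b * (len w + \<eta>))"
    by (rule sum.cong) (simp_all add: algebra_simps)
  also have "\<dots> = Aop (H k) w - Aop len w + (len w + \<eta>)"
    by (simp add: sum.distrib sum_subtractf Aop_def flip: sum_distrib_right)
  finally have "lam * ((\<Sum>b\<in>Sig. pmf \<nu> b * (\<Sum>n\<in>{1..k}. hit k (push b (take n w)))) - H k w) \<le> lam * (Aop (H k) w - Aop len w + (len w + \<eta>) - H k w)"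
    using lam_pos by (intro mult_left_mono) auto
  moreover have "mu * (hit k [] - hit k (take k w)) \<le> mu * 1"
    using hit_bounds(1)[of k "take k w"] mu_pos by (intro mult_left_mono) (auto simp: hit_def[of k "[]"])
  ultimately show ?thesis using 1 by (simp add: algebra_simps)
qed

text \<open>The required length leaves room for \<open>T\<close> cancellations, so that
  \<open>Aop_len_H\<close> still applies to the word after each step.\<close>

lemma Aop_pow_len_H:
  assumes w: "w \<in> L" "Suc k + T < length w" and \<eta>: "\<And>x. x \<in> Sig \<Longrightarrow> 1 - \<eta> \<le> hit k [x]" "0 \<le> \<eta>"
  shows "lam * ((Aop ^^ T) len w - len w) \<le> T * (mu + lam * \<eta>) + lam * ((Aop ^^ T) (H k) w - H k w)"
  using w(2)
proof (induction T)
  case (Suc T)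
  have "(Aop ^^ T) (\<lambda>v. lam * (Aop len v - len v)) w \<le> (Aop ^^ T) (\<lambda>v. mu + lam * \<eta> + lam * (Aop (H k) v - H k v)) w"
    unfolding Aop_pow
  proof (rule Ex_mono)
    fix bs assume bs: "bs \<in> lists Sig" "length bs = T"
    have "foldr push bs w \<in> L" by (rule pushes_L[OF bs(1) w(1)])
    moreover have "Suc k < length (foldr push bs w)" using length_pushes_ge[of w bs] bs Suc.prems by simp
    ultimately show "lam * (Aop len (foldr push bs w) - len (foldr push bs w)) \<le>
      mu + lam * \<eta> + lam * (Aop (H k) (foldr push bs w) - H k (foldr push bs w))" by (rule Aop_len_H[OF _ _ \<eta>])
  qed
  then have "lam * ((Aop ^^ Suc T) len w - (Aop ^^ T) len w) \<le> mu + lam * \<eta> + lam * ((Aop ^^ Suc T) (H k) w - (Aop ^^ T) (H k) w)"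
    unfolding Aop_pow_add Aop_pow_cmult Aop_pow_diff Aop_pow_const by (simp add: funpow_Suc_right del: funpow.simps)
  with Suc show ?case by (simp add: algebra_simps del: funpow.simps)
qed simp

text \<open>By recurrence \<open>k\<close> can be fixed such that all single letters are emptied
  within \<open>k\<close> jumps with probability at least \<open>1 - \<eta>\<close>. Then
  \<open>T\<close> grows, and the error \<open>lam * k\<close>, which does not grow with it, is the
  constant \<open>e\<close> of \<open>limit_bound_const\<close>.\<close>

lemma recurrent_imp_drift_le:
  assumes rec: "recurrent_at K []" and lim: "(\<lambda>n. a n / n) \<longlonglongrightarrow> \<gamma>"
  shows "lam * \<gamma> \<le> mu"
proof (rule field_le_epsilon)
  fix e :: real assume e: "0 < e"
  define \<eta> where "\<eta> = e / lam"
  have \<eta>: "0 < \<eta>" using e lam_pos by (simp add: \<eta>_def)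
  have "\<forall>\<^sub>F k in sequentially. \<forall>x\<in>Sig. 1 - \<eta> \<le> hit k [x]"
  proof (rule eventually_ball_finite[OF Sig_fin], rule ballI)
    fix x assume "x \<in> Sig"
    then have "(\<lambda>k. avoid K [] k [x]) \<longlonglongrightarrow> 0" by (intro recurrent_hits rec) auto
    then have "\<forall>\<^sub>F k in sequentially. avoid K [] k [x] < ennreal \<eta>" using \<eta> by (intro order_tendstoD(2)) auto
    then show "\<forall>\<^sub>F k in sequentially. 1 - \<eta> \<le> hit k [x]"
    proof eventually_elim
      case (elim k)
      have "enn2real (avoid K [] k [x]) \<le> \<eta>" using elim \<eta> by (intro enn2real_leI) (auto simp: less_imp_le)
      then show ?case by (simp add: hit_def)
    qed
  qed
  then obtain k where k: "\<And>x. x \<in> Sig \<Longrightarrow> 1 - \<eta> \<le> hit k [x]" unfolding eventually_sequentially by blast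
  obtain c :: "nat \<Rightarrow> real" where c: "c \<longlonglongrightarrow> 0"
    "\<And>k n j. a j - 2 * real k - 1 - 2 * real j * c k \<le> En n ((Aop ^^ j) len) - real n"
    using cancel_lower_bound by auto
  have "lam * \<gamma> \<le> mu + lam * \<eta>"
  proof (rule limit_bound_const[OF lim c(1)])
    fix T i
    let ?n = "Suc (Suc k + T)"
    have "lam * (a T - 2 * real i - 1 - 2 * real T * c i) \<le> lam * (En ?n ((Aop ^^ T) len) - real ?n)"
      using lam_pos by (intro mult_left_mono c(2)) auto
    also have "\<dots> = En ?n (\<lambda>w. lam * ((Aop ^^ T) len w - len w))"
    proof -
      have "En ?n len = ?n" using En_cong[of ?n len "\<lambda>_. real ?n"] by (simp only: len_def En_const)
      then show ?thesis by (simp only: En_cmult En_diff)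
    qed
    also have "\<dots> \<le> En ?n (\<lambda>_. T * (mu + lam * \<eta>) + lam * k)"
    proof (rule En_mono)
      fix w assume w: "w \<in> L" "length w = ?n"
      have "(Aop ^^ T) (H k) w \<le> (Aop ^^ T) (\<lambda>_. real k) w" by (intro Aop_pow_mono H_bounds w)
      then have "(Aop ^^ T) (H k) w - H k w \<le> k" using H_bounds(1)[of k w] by (simp add: Aop_pow_const)
      then have "lam * ((Aop ^^ T) (H k) w - H k w) \<le> lam * k" using lam_pos by (intro mult_left_mono) auto
      moreover have "lam * ((Aop ^^ T) len w - len w) \<le> T * (mu + lam * \<eta>) + lam * ((Aop ^^ T) (H k) w - H k w)"
        using w k \<eta> by (intro Aop_pow_len_H) auto
      ultimately show "lam * ((Aop ^^ T) len w - len w) \<le> T * (mu + lam * \<eta>) + lam * k" by linarith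
    qed
    also have "\<dots> = T * (mu + lam * \<eta>) + lam * k" by (rule En_const)
    finally show "lam * (a T - 2 * real i - 1 - 2 * real T * c i) \<le> real T * (mu + lam * \<eta>) + lam * k" .
  qed
  then show "lam * \<gamma> \<le> mu + e" using lam_pos by (simp add: \<eta>_def)
qed

lemma transient:
  assumes "mu < lam * \<gamma>" and lim: "(\<lambda>n. a n / n) \<longlonglongrightarrow> \<gamma>"
  shows "transient L Q"
  unfolding transient_def
proof (intro conjI irreducible ballI)
  fix u assume u: "u \<in> L"
  have nr: "\<not> recurrent_at K []" using recurrent_imp_drift_le[OF _ lim] assms(1) by auto
  have "green K u u < \<infinity>" by (rule irreducible_green_finite[OF fb.closed irreducible_K L_Nil nr u])
  then show "transient_state Q u" by (rule fb.transient_stateI[OF u])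
qed

section \<open>Disjoint classes and the stationary distribution\<close>

lemma classes_disjoint:
  "\<not> (ergodic L Q \<and> null_recurrent L Q)" "\<not> (ergodic L Q \<and> transient L Q)" "\<not> (null_recurrent L Q \<and> transient L Q)"
  using not_recurrent_and_transient[of Q "[]"] L_Nil
  unfolding ergodic_def null_recurrent_def transient_def null_recurrent_state_def positive_recurrent_state_def by blast+

text \<open>Restricted to words of length at most \<open>Suc M\<close>, the measure is invariant
  under the generator up to boundary terms of order \<open>\<rho> ^ Suc M\<close>, uniformly over
  test functions between 0 and 1. Over a time \<open>t\<close> the error is at most \<open>t\<close>
  times that, and it vanishes as \<open>M\<close> grows.\<close>

lemma stationary_exists:
  assumes \<rho>: "\<rho> < 1"
  shows "\<exists>p. stationary_distribution L Q p \<and> (\<forall>w\<in>L. pmf p w = (1 - \<rho>) * m w)"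
proof -
  let ?f = "\<lambda>w. (1 - \<rho>) * m w"
  have f0: "0 \<le> ?f w" for w using m_nonneg \<rho> by simp
  have level: "(\<Sum>w\<in>Ln n. ?f w) = (1 - \<rho>) * \<rho> ^ n" for n
    using sum_m_Ln[where n = n and f = "\<lambda>_. 1"] by (simp add: En_const flip: sum_distrib_left)
  have "(\<integral>\<^sup>+w. ennreal (?f w) \<partial>count_space UNIV) = 1"
  proof -
    have pt: "ennreal (?f w) = (\<Sum>n. ennreal (?f w) * indicator (Ln n) w)" for w
    proof (cases "w \<in> L")
      case True
      then have "(\<Sum>n. ennreal (?f w) * indicator (Ln n) w) = (\<Sum>n\<in>{length w}. ennreal (?f w) * indicator (Ln n) w)"
        by (intro suminf_finite) (auto simp: Ln_def)
      then show ?thesis using True by (simp add: Ln_def)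
    qed (simp add: m_def)
    have "(\<integral>\<^sup>+w. ennreal (?f w) \<partial>count_space UNIV) = (\<integral>\<^sup>+w. (\<Sum>n. ennreal (?f w) * indicator (Ln n) w) \<partial>count_space UNIV)"
      by (subst pt) (rule refl)
    also have "\<dots> = (\<Sum>n. \<integral>\<^sup>+w. ennreal (?f w) * indicator (Ln n) w \<partial>count_space UNIV)"
      by (rule nn_integral_suminf) simp
    also have "\<dots> = (\<Sum>n. ennreal ((1 - \<rho>) * \<rho> ^ n))"
    proof (rule suminf_cong)
      fix n
      have "(\<integral>\<^sup>+w. ennreal (?f w) * indicator (Ln n) w \<partial>count_space UNIV) = (\<Sum>w\<in>Ln n. ennreal (?f w) * indicator (Ln n) w)"
        by (rule nn_integral_count_space') auto
      also have "\<dots> = (\<Sum>w\<in>Ln n. ennreal (?f w))" by simp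
      also have "\<dots> = ennreal ((1 - \<rho>) * \<rho> ^ n)" unfolding level[symmetric] by (rule sum_ennreal) (rule f0)
      finally show "(\<integral>\<^sup>+w. ennreal (?f w) * indicator (Ln n) w \<partial>count_space UNIV) = ennreal ((1 - \<rho>) * \<rho> ^ n)" .
    qed
    also have "\<dots> = ennreal (\<Sum>n. (1 - \<rho>) * \<rho> ^ n)"
      using \<rho> rho_pos by (intro suminf_ennreal2) (auto intro!: summable_mult summable_geometric)
    also have "(\<Sum>n. (1 - \<rho>) * \<rho> ^ n) = 1"
      using \<rho> rho_pos by (subst suminf_mult) (auto intro!: summable_geometric simp: suminf_geometric)
    finally show ?thesis by simp
  qed
  then have pmf: "pmf (embed_pmf ?f) w = ?f w" for w using f0 by (intro pmf_embed_pmf) auto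
  define p where "p = embed_pmf ?f"
  have p: "pmf p w = (1 - \<rho>) * m w" for w by (simp add: p_def pmf)
  have supp: "set_pmf p \<subseteq> L" by (auto simp: set_pmf_iff p m_def split: if_splits)
  have "measure_pmf.expectation p (\<lambda>u. transition_prob Q t u v) = pmf p v" if t: "0 \<le> t" and v: "v \<in> L" for t v
  proof -
    let ?g = "\<lambda>u. transition_prob Q t u v"
    let ?c = "lam + lam * \<rho> + mu * \<rho>"
    have g: "0 \<le> ?g u" "?g u \<le> 1" for u by (rule transition_prob_bounds)+
    define E where "E = measure_pmf.expectation p ?g"
    have int: "integrable (measure_pmf p) h" if "\<And>u. \<bar>h u\<bar> \<le> 1" for h :: "'a list \<Rightarrow> real"
      by (rule measure_pmf.integrable_const_bound[of _ 1]) (use that in auto)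
    \<comment> \<open>The summand 1 accounts for the words longer than \<open>Suc M\<close>, whose
      mass is \<open>\<rho> ^ Suc (Suc M)\<close>.\<close>
    have bound: "\<bar>E - pmf p v\<bar> \<le> \<rho> ^ Suc M * (?c * t + 1)" if M: "length v \<le> Suc M" for M
    proof -
      let ?B = "levels (Suc M)"
      have vB: "v \<in> ?B" using v M by (simp add: levels_iff)
      have "\<bar>(\<Sum>u\<in>?B. m u * ?g u) - (\<Sum>u\<in>?B. m u * of_bool (u = v))\<bar> \<le> (\<rho> ^ Suc M * ?c) * t"
      proof (rule fb.transition_almost_invariant)
        fix f :: "'a list \<Rightarrow> real" assume f: "\<And>w. 0 \<le> f w \<and> f w \<le> 1"
        have "(\<Sum>u\<in>?B. m u * (exit_rate Q u * (fb.jump_mean f u - f u))) = (\<Sum>u\<in>?B. m u * (drv f u - drv (\<lambda>_. 1) u * f u))"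
          by (rule sum.cong) (simp_all add: generator_jump_mean levels_iff)
        then show "\<bar>\<Sum>u\<in>?B. m u * (exit_rate Q u * (fb.jump_mean f u - f u))\<bar> \<le> \<rho> ^ Suc M * ?c"
          using generator_levels_bound[of f M] f by simp
      qed (use t in \<open>auto simp: levels_iff\<close>)
      moreover have "(\<Sum>u\<in>?B. m u * of_bool (u = v)) = m v" using vB by simp
      ultimately have a1: "\<bar>(\<Sum>u\<in>?B. m u * ?g u) - m v\<bar> \<le> \<rho> ^ Suc M * ?c * t" by simp
      have fin_sum: "measure_pmf.expectation p (\<lambda>u. indicator ?B u * h u) = (1 - \<rho>) * (\<Sum>u\<in>?B. m u * h u)" for h :: "'a list \<Rightarrow> real"
      proof -
        have "measure_pmf.expectation p (\<lambda>u. indicator ?B u * h u) = (\<Sum>u\<in>?B. pmf p u *\<^sub>R (indicator ?B u * h u))"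
          by (rule integral_measure_pmf) (auto simp: indicator_def)
        also have "\<dots> = (1 - \<rho>) * (\<Sum>u\<in>?B. m u * h u)"
          unfolding sum_distrib_left by (rule sum.cong) (simp_all add: p mult_ac)
        finally show ?thesis .
      qed
      have mass: "(1 - \<rho>) * (\<Sum>u\<in>?B. m u * 1) = 1 - \<rho> ^ Suc (Suc M)"
      proof -
        have "(\<Sum>u\<in>?B. m u * 1) = (\<Sum>n<Suc (Suc M). \<rho> ^ n)" unfolding sum_m_levels by (simp add: En_const lessThan_Suc_atMost)
        also have "(1 - \<rho>) * \<dots> = 1 - \<rho> ^ Suc (Suc M)" by (rule one_diff_power_eq[symmetric])
        finally show ?thesis .
      qed
      have le: "E - (1 - \<rho>) * (\<Sum>u\<in>?B. m u * ?g u) \<le> \<rho> ^ Suc (Suc M)" "0 \<le> E - (1 - \<rho>) * (\<Sum>u\<in>?B. m u * ?g u)"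
      proof -
        have d: "E - (1 - \<rho>) * (\<Sum>u\<in>?B. m u * ?g u) = measure_pmf.expectation p (\<lambda>u. ?g u - indicator ?B u * ?g u)"
          unfolding fin_sum[symmetric] E_def
          by (rule Bochner_Integration.integral_diff[symmetric]) (auto intro!: int simp: g abs_of_nonneg indicator_def)
        have "measure_pmf.expectation p (\<lambda>u. ?g u - indicator ?B u * ?g u) \<le> measure_pmf.expectation p (\<lambda>u. 1 - indicator ?B u * 1)"
          by (rule integral_mono) (auto intro!: int simp: g abs_of_nonneg indicator_def)
        also have "\<dots> = 1 - (1 - \<rho>) * (\<Sum>u\<in>?B. m u * 1)"
          unfolding fin_sum[symmetric]
          by (subst Bochner_Integration.integral_diff) (auto intro!: int simp: indicator_def)
        finally show "E - (1 - \<rho>) * (\<Sum>u\<in>?B. m u * ?g u) \<le> \<rho> ^ Suc (Suc M)" unfolding d mass by simp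
        show "0 \<le> E - (1 - \<rho>) * (\<Sum>u\<in>?B. m u * ?g u)" unfolding d
          by (rule integral_nonneg_AE) (auto simp: indicator_def g)
      qed
      have "\<bar>(1 - \<rho>) * ((\<Sum>u\<in>?B. m u * ?g u) - m v)\<bar> \<le> 1 * (\<rho> ^ Suc M * ?c * t)"
        unfolding abs_mult using \<rho> rho_pos by (intro mult_mono a1) auto
      moreover have "\<rho> ^ Suc (Suc M) \<le> \<rho> ^ Suc M" using \<rho> rho_pos by (intro power_decreasing) auto
      moreover have "pmf p v = (1 - \<rho>) * m v" by (rule p)
      moreover have "E - pmf p v = (E - (1 - \<rho>) * (\<Sum>u\<in>?B. m u * ?g u)) + (1 - \<rho>) * ((\<Sum>u\<in>?B. m u * ?g u) - m v)"
        unfolding p by (simp add: algebra_simps)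
      moreover have "\<rho> ^ Suc M * (?c * t + 1) = \<rho> ^ Suc M * ?c * t + \<rho> ^ Suc M" by (subst distrib_left) (simp only: mult.assoc mult_1_right)
      ultimately show ?thesis using le by linarith
    qed
    have "(\<lambda>M. \<rho> ^ Suc M * (?c * t + 1)) \<longlonglongrightarrow> 0 * (?c * t + 1)"
      using \<rho> rho_pos by (intro tendsto_intros LIMSEQ_Suc LIMSEQ_realpow_zero) auto
    then have "\<bar>E - pmf p v\<bar> \<le> 0"
      using LIMSEQ_le_const[of "\<lambda>M. \<rho> ^ Suc M * (?c * t + 1)" 0 "\<bar>E - pmf p v\<bar>"] bound
      by (metis le_SucI mult_zero_left)
    then show ?thesis by (simp add: E_def)
  qed
  then have "stationary_distribution L Q p" using supp unfolding stationary_distribution_def by blast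
  with p show ?thesis by blast
qed

lemma stationary_eq:
  "stationary_distribution L Q p \<Longrightarrow> stationary_distribution L Q p' \<Longrightarrow> p = p'"
  using fb.transition_pos[OF irreducible_K] infinite_L[OF inf gen supp] countable_L
  by (intro stationary_unique) auto

lemma stationary_iff:
  assumes "\<rho> < 1"
  shows "\<exists>!p. stationary_distribution L Q p"
    "stationary_distribution L Q p \<Longrightarrow> w \<in> L \<Longrightarrow> pmf p w = (1 - \<rho>) * \<rho> ^ length w * P w"
proof -
  obtain p0 where p0: "stationary_distribution L Q p0" "\<And>w. w \<in> L \<Longrightarrow> pmf p0 w = (1 - \<rho>) * m w"
    using stationary_exists[OF assms] by blast
  show "\<exists>!p. stationary_distribution L Q p" using p0(1) stationary_eq by blast
  show "pmf p w = (1 - \<rho>) * \<rho> ^ length w * P w" if "stationary_distribution L Q p" "w \<in> L"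
    using stationary_eq[OF p0(1) that(1)] p0(2)[OF that(2)] that(2) by (simp add: m_def)
qed

end

theorem mainTheorem8:
  fixes X :: "('a, 'm) monoid_scheme" and Sig :: "'a set" and \<nu> :: "'a pmf"
    and lam mu \<rho> \<gamma> :: real and r :: "'a \<Rightarrow> real"
  assumes "plain_triple X Sig \<nu>"
    and "0 < lam" and "0 < mu"
    and "admissible_solution X Sig \<nu> lam mu \<rho> r"
    and "is_drift X Sig \<nu> \<gamma>"
  defines "L \<equiv> normal_forms X Sig"
    and "Q \<equiv> queue_generator X Sig \<nu> r lam mu"
    and "q \<equiv> \<lambda>a. r a / sum r (Next X Sig a)"
  shows "(\<rho> < 1 \<longleftrightarrow> lam * \<gamma> < mu) \<and> (lam * \<gamma> < mu \<longleftrightarrow> ergodic L Q) \<and>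
         (\<rho> = 1 \<longleftrightarrow> lam * \<gamma> = mu) \<and> (lam * \<gamma> = mu \<longleftrightarrow> null_recurrent L Q) \<and>
         (\<rho> > 1 \<longleftrightarrow> lam * \<gamma> > mu) \<and> (lam * \<gamma> > mu \<longleftrightarrow> transient L Q) \<and>
         (lam * \<gamma> < mu \<longrightarrow>
            (\<exists>!p. stationary_distribution L Q p) \<and>
            (\<forall>p. stationary_distribution L Q p \<longrightarrow>
               pmf p [] = 1 - \<rho> \<and>
               (\<forall>w\<in>L. w \<noteq> [] \<longrightarrow>
                  pmf p w = (1 - \<rho>) * \<rho> ^ length w * prod_list (map q (butlast w)) * r (last w))))"
proof -
  interpret plain_structure X Sig using assms(1) plain_monoid_structure unfolding plain_triple_def by blast
  interpret queue X Sig \<nu> r lam mu \<rho>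
    by unfold_locales (use assms(1-4)[unfolded plain_triple_def admissible_solution_def] in blast)+
  have lim: "(\<lambda>n. a n / n) \<longlonglongrightarrow> \<gamma>" by (rule drift_limit[OF assms(5)])
  have t: "\<rho> < 1 \<Longrightarrow> lam * \<gamma> < mu" "\<rho> = 1 \<Longrightarrow> lam * \<gamma> = mu" "\<rho> > 1 \<Longrightarrow> lam * \<gamma> > mu"
    using drift_less[OF lim] drift_critical[OF lim] drift_greater[OF lim] by auto
  \<comment> \<open>The cases for \<open>\<rho>\<close> exhaust all possibilities and those for
    \<open>lam * \<gamma>\<close> exclude each other, so the implications reverse.\<close>
  then have iffs: "\<rho> < 1 \<longleftrightarrow> lam * \<gamma> < mu" "\<rho> = 1 \<longleftrightarrow> lam * \<gamma> = mu" "\<rho> > 1 \<longleftrightarrow> lam * \<gamma> > mu"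
    by linarith+
  have cls: "lam * \<gamma> < mu \<Longrightarrow> ergodic L Q" "lam * \<gamma> = mu \<Longrightarrow> null_recurrent L Q" "lam * \<gamma> > mu \<Longrightarrow> transient L Q"
    unfolding L_def Q_def using ergodic null_recurrent[OF _ lim] transient[OF _ lim] iffs by auto
  have trich: "lam * \<gamma> < mu \<or> lam * \<gamma> = mu \<or> lam * \<gamma> > mu" by linarith
  have dis: "\<not> (ergodic L Q \<and> null_recurrent L Q)" "\<not> (ergodic L Q \<and> transient L Q)" "\<not> (null_recurrent L Q \<and> transient L Q)"
    unfolding L_def Q_def by (rule classes_disjoint)+
  have cls_iff: "lam * \<gamma> < mu \<longleftrightarrow> ergodic L Q" "lam * \<gamma> = mu \<longleftrightarrow> null_recurrent L Q" "lam * \<gamma> > mu \<longleftrightarrow> transient L Q"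
    using cls trich dis by blast+
  have stat: "(\<exists>!p. stationary_distribution L Q p) \<and>
            (\<forall>p. stationary_distribution L Q p \<longrightarrow>
               pmf p [] = 1 - \<rho> \<and>
               (\<forall>w\<in>L. w \<noteq> [] \<longrightarrow>
                  pmf p w = (1 - \<rho>) * \<rho> ^ length w * prod_list (map q (butlast w)) * r (last w)))"
    if "lam * \<gamma> < mu"
  proof -
    have \<rho>: "\<rho> < 1" using that iffs by simp
    have q: "weighted_walk.q X Sig r = q" unfolding assms(8) by (simp add: fun_eq_iff q_def rN_def)
    have 1: "\<exists>!p. stationary_distribution L Q p" unfolding L_def Q_def by (rule stationary_iff(1)[OF \<rho>])
    have 2: "pmf p w = (1 - \<rho>) * \<rho> ^ length w * P w" if "stationary_distribution L Q p" "w \<in> L" for p w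
      using stationary_iff(2)[OF \<rho>, of p w] that unfolding L_def Q_def by simp
    show ?thesis
    proof (intro conjI 1 allI impI ballI)
      fix p assume p: "stationary_distribution L Q p"
      show "pmf p [] = 1 - \<rho>" using 2[OF p, of "[]"] by (simp add: L_def)
      fix w assume "w \<in> L" "w \<noteq> []"
      then show "pmf p w = (1 - \<rho>) * \<rho> ^ length w * prod_list (map q (butlast w)) * r (last w)"
        using 2[OF p] P_eq[of w] q by (simp add: mult.assoc)
    qed
  qed
  show ?thesis using iffs cls_iff stat by blast
qed

end
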